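(* Let $X\subset\mathbb{P}^N=\mathbb{P}(\mathbb{C}^{N+1})$ be an irreducible projective variety of dimension $n\le N-1$ and let $Z$ be an irreducible projective subvariety of $X$ of dimension $d$, such that $X$ is ED regular given $Z$. If $\mathcal{PN}_{X,Z}$ is disjoint from the diagonal $\Delta(\mathbb{P}^N)$ of $\mathbb{P}^N\times\mathbb{P}^N$, then $$\mathrm{EDD}(X|Z)\,\deg(\mathrm{DL}_{X|Z})=\sum_{i=0}^d\delta_i(X,Z).$$
   Context: Varieties are reduced. Let $V=\mathbb{C}^{N+1}$ with bilinear form $\langle x,y\rangle=\sum_i x_iy_i$, quadratic form $q(x)=\sum_i x_i^2$, and isotropic quadric $Q=\{q=0\}\subset\mathbb{P}^N$. Projective varieties $Z\subset X\subset\mathbb{P}^N$ are also regarded as affine cones in $V$. For a smooth point $x\neq0$ of the cone $X$, $N_xX=\{y\in V\mid\langle y,v\rangle=0\ \forall v\in T_xX\}$, where $T_xX\subset V$ is the linear tangent space of the cone. For $u\in V$, a point $x\in X_{\rm sm}$ is critical for $d_{X,u}(x)=q(u-x)$ if $u-x\in N_xX$. ED correspondences: $\mathcal{E}_{X|Z}=\overline{\{(x,u)\in V\times V\mid x\in X_{\rm sm}\cap Z,\ u-x\in N_xX\}}$, $\mathcal{E}_X=\mathcal{E}_{X|X}$. The projective ED correspondence $\mathcal{PE}_{X}\subset\mathbb{P}^N\times V$ is the closure of the image of $\mathcal{E}_{X}\cap((V\setminus\{0\})\times V)$ under $(x,u)\mapsto([x],u)$. The ED data locus of $X$ given $Z$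 is $\mathrm{DL}_{X|Z}=\overline{\mathrm{pr}_2(\mathcal{E}_{X|Z})}\subset V$; it is an irreducible affine cone, and $\deg$ denotes its degree (equivalently that of the corresponding projective variety in $\mathbb{P}(V)$). $X$ is ED regular given $Z$ if $Z\not\subset X_{\rm sing}\cup Q$ and $\mathrm{DL}_{X|Z}$ is not contained in the proper subvariety of points $u\in V$ over which the fibre of $\mathcal{PE}_X\to V$ has positive dimension. In this case the conditional ED degree $\mathrm{EDD}(X|Z)$ is the (finite) cardinality of a generic fibre of $\mathrm{pr}_2\colon\mathcal{E}_{X|Z}\to\mathrm{DL}_{X|Z}$. $\mathcal{PN}_{X,Z}\subset\mathbb{P}^N\times\mathbb{P}^N$ is the closure of $\{([x],[y])\mid x\in (X_{\rm sm}\cap Z)\setminus\{0\},\ y\in N_xX\setminus\{0\}\}$; via $y\mapsto\langle y,\cdot\rangle$ it is identified with the relative conormal variety $W_{X,Z}=\overline{\{(x,H)\in\mathbb{P}^N\times(\mathbb{P}^N)^\vee\mid x\in X_{\rm sm}\cap Z,\ H\supset T_xX\}}$ of dimension $N-1-n+d$. With $h,h'$ the pullbacks of the hyperplane classes of the two factors, $\delta_i(X,Z)=\int h^i(h')^{N-1-n+d-i}[W_{X,Z}]$ for $0\le i\le N-1-n+d$. *)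

theory Defs
  imports "HOL-Analysis.Analysis" "HOL-Algebra.Ideal"
begin

no_notation eq_closure_of (\<open>closure'_of\<index>\<close>)

section \<open>Regular functions and the Zariski topology on affine space\<close>

text \<open>
  An affine space is a type with a chosen set of coordinate functions. The instances give
  the standard coordinates on \<open>\<complex>\<close>, on \<open>\<complex>\<^sup>n\<close> and on products such as \<open>V \<times> V\<close>.
\<close>

class affine_space =
  fixes coordinates :: "('a \<Rightarrow> complex) set"

instantiation complex :: affine_space
begin
definition coordinates_complex :: "(complex \<Rightarrow> complex) set"
  where "coordinates_complex = {\<lambda>z. z}"
instance ..
end

instantiation vec :: (affine_space, finite) affine_space
begin
definition coordinates_vec :: "('a ^ 'b \<Rightarrow> complex) set"
  where "coordinates_vec = {\<lambda>x. f (x $ i) | f i. f \<in> coordinates}"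
instance ..
end

instantiation prod :: (affine_space, affine_space) affine_space
begin
definition coordinates_prod :: "('a \<times> 'b \<Rightarrow> complex) set"
  where "coordinates_prod =
    {\<lambda>p. f (fst p) | f. f \<in> coordinates} \<union> {\<lambda>p. g (snd p) | g. g \<in> coordinates}"
instance ..
end

text \<open>Polynomials over the infinite field \<open>\<complex>\<close> are represented by the functions they define.\<close>

inductive polynomial_fun :: "('a::affine_space \<Rightarrow> complex) \<Rightarrow> bool" where
  coord: "f \<in> coordinates \<Longrightarrow> polynomial_fun f"
| const: "polynomial_fun (\<lambda>_. c)"
| add: "polynomial_fun f \<Longrightarrow> polynomial_fun g \<Longrightarrow> polynomial_fun (\<lambda>x. f x + g x)"
| mult: "polynomial_fun f \<Longrightarrow> polynomial_fun g \<Longrightarrow> polynomial_fun (\<lambda>x. f x * g x)"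

definition polynomial_ring :: "('a::affine_space \<Rightarrow> complex) ring" where
  "polynomial_ring = \<lparr>carrier = {f. polynomial_fun f}, mult = (\<lambda>f g x. f x * g x),
     one = (\<lambda>_. 1), zero = (\<lambda>_. 0), add = (\<lambda>f g x. f x + g x)\<rparr>"

definition vanishing_ideal :: "'a::affine_space set \<Rightarrow> ('a \<Rightarrow> complex) set" where
  "vanishing_ideal S = {f. polynomial_fun f \<and> (\<forall>x\<in>S. f x = 0)}"

definition zariski :: "'a::affine_space topology" where
  "zariski = topology (\<lambda>U. \<exists>F\<subseteq>Collect polynomial_fun. U = {x. \<exists>f\<in>F. f x \<noteq> 0})"

text \<open>
  \<open>D\<close> is an open subset of an affine space and \<open>\<pi>\<close> the map from \<open>D\<close> to a (multi)projective
  space given by homogeneous coordinates; the Zariski topology of the target is the quotient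
  topology, i.e. its closed sets are cut out by (multi)homogeneous polynomials.
\<close>

definition zariski_quot :: "'a::affine_space set \<Rightarrow> ('a \<Rightarrow> 'b) \<Rightarrow> 'b topology" where
  "zariski_quot D \<pi> = topology (\<lambda>U. openin zariski {x\<in>D. \<pi> x \<in> U})"


section \<open>Irreducibility and dimension\<close>

definition irreducible_in :: "'a topology \<Rightarrow> 'a set \<Rightarrow> bool" where
  "irreducible_in T S \<longleftrightarrow> S \<subseteq> topspace T \<and> S \<noteq> {} \<and>
     (\<forall>A B. closedin T A \<and> closedin T B \<and> S \<subseteq> A \<union> B \<longrightarrow> S \<subseteq> A \<or> S \<subseteq> B)"

definition irreducible_components :: "'a topology \<Rightarrow> 'a set \<Rightarrow> 'a set set" where
  "irreducible_components T S =
     {C. C \<subseteq> S \<and> irreducible_in T C \<and> (\<forall>C'. C \<subseteq> C' \<and> C' \<subseteq> S \<and> irreducible_in T C' \<longrightarrow> C' = C)}"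

definition chain_length :: "'a set set \<Rightarrow> enat" where
  "chain_length \<F> = Sup {enat k | k. \<exists>c. (\<forall>i\<le>k. c i \<in> \<F>) \<and> (\<forall>i<k. c i \<subset> c (Suc i))}"

definition krull_dim :: "'a topology \<Rightarrow> 'a set \<Rightarrow> enat" where
  "krull_dim T S = chain_length {C. closedin (subtopology T S) C \<and> irreducible_in T C}"


section \<open>Projective space\<close>

typedef 'n pspace = "{L :: (complex ^ 'n::finite) set. \<exists>x. x \<noteq> 0 \<and> L = vec.span {x}}"
proof -
  have "((\<chi> i. 1) :: complex ^ 'n) \<noteq> 0"
    by (simp add: vec_eq_iff)
  then show ?thesis
    by blast
qed

definition point :: "complex ^ 'n::finite \<Rightarrow> 'n pspace" where
  "point x = Abs_pspace (vec.span {x})"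

definition P_dom :: "(complex ^ 'n::finite) set" where
  "P_dom = {x. x \<noteq> 0}"

definition PP_dom :: "((complex ^ 'n::finite) \<times> (complex ^ 'n)) set" where
  "PP_dom = {(x, y). x \<noteq> 0 \<and> y \<noteq> 0}"

definition PV_dom :: "((complex ^ 'n::finite) \<times> (complex ^ 'n)) set" where
  "PV_dom = {(x, u). x \<noteq> 0}"

abbreviation zariski_P :: "'n::finite pspace topology" where
  "zariski_P \<equiv> zariski_quot P_dom point"

abbreviation zariski_PP :: "('n::finite pspace \<times> 'n pspace) topology" where
  "zariski_PP \<equiv> zariski_quot PP_dom (map_prod point point)"

abbreviation zariski_PV :: "('n::finite pspace \<times> (complex ^ 'n)) topology" where
  "zariski_PV \<equiv> zariski_quot PV_dom (map_prod point id)"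

definition projective_variety :: "'n::finite pspace set \<Rightarrow> bool" where
  "projective_variety X \<longleftrightarrow> closedin zariski_P X \<and> irreducible_in zariski_P X"

definition affine_cone :: "'n::finite pspace set \<Rightarrow> (complex ^ 'n) set" where
  "affine_cone X = insert 0 {x. x \<noteq> 0 \<and> point x \<in> X}"

definition projectivization :: "(complex ^ 'n::finite) set \<Rightarrow> 'n pspace set" where
  "projectivization S = point ` (S - {0})"


section \<open>Intersection numbers\<close>

text \<open>
  The multiplicity of a component \<open>C\<close> of \<open>W \<inter> {l = 0}\<close> in the divisor cut out on the
  subvariety \<open>W\<close> by the (multi)homogeneous form \<open>l\<close>, i.e. the length of
  \<open>O\<^bsub>W,C\<^esub> / (l)\<close>. Local rings are taken on the preimages of \<open>W\<close> and \<open>C\<close> under \<open>\<pi>\<close>; as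
  \<open>\<pi>\<close> is a torus bundle this does not change the length. Ideals of the local ring are
  represented by their contractions to the polynomial ring: these are the ideals \<open>I\<close>
  containing the ideal of \<open>W\<close> such that \<open>g f \<in> I\<close> implies \<open>f \<in> I\<close> whenever \<open>g\<close> does not
  vanish identically on \<open>C\<close>.
\<close>

definition div_multiplicity ::
  "'a::affine_space set \<Rightarrow> ('a \<Rightarrow> 'b) \<Rightarrow> 'b set \<Rightarrow> ('a \<Rightarrow> complex) \<Rightarrow> 'b set \<Rightarrow> enat" where
  "div_multiplicity D \<pi> W l C =
     (let IW = vanishing_ideal {x\<in>D. \<pi> x \<in> W}; IC = vanishing_ideal {x\<in>D. \<pi> x \<in> C}
      in chain_length {I. ideal I polynomial_ring \<and> IW \<subseteq> I \<and> l \<in> I \<and>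
           (\<forall>f g. polynomial_fun f \<and> polynomial_fun g \<and> g \<notin> IC \<and> (\<lambda>x. g x * f x) \<in> I
             \<longrightarrow> f \<in> I)})"

definition section_zeros :: "'a set \<Rightarrow> ('a \<Rightarrow> 'b) \<Rightarrow> ('a \<Rightarrow> complex) \<Rightarrow> 'b set" where
  "section_zeros D \<pi> l = \<pi> ` {x\<in>D. l x = 0}"

text \<open>
  \<open>intersection_number D \<pi> [L\<^sub>1, \<dots>, L\<^sub>m] W k\<close> means \<open>\<integral> c\<^sub>1(L\<^sub>m) \<dots> c\<^sub>1(L\<^sub>1) \<inter> [W] = k\<close>, where each
  line bundle is given by the set of its global sections, viewed as forms on \<open>D\<close>.
  As in Fulton's intersection theory, \<open>c\<^sub>1(L) \<inter> [W]\<close> is the class of the divisor on \<open>W\<close> of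
  any section of \<open>L\<close> that does not vanish identically on \<open>W\<close>, and \<open>\<integral>\<close> is the degree of a
  cycle of points. The value does not depend on the sections chosen.
\<close>

inductive intersection_number ::
  "'a::affine_space set \<Rightarrow> ('a \<Rightarrow> 'b) \<Rightarrow> ('a \<Rightarrow> complex) set list \<Rightarrow> 'b set \<Rightarrow> nat \<Rightarrow> bool"
  for D :: "'a::affine_space set" and \<pi> :: "'a \<Rightarrow> 'b" where
  degree_point: "intersection_number D \<pi> [] {p} 1"
| cut: "\<lbrakk>l \<in> L; \<not> W \<subseteq> section_zeros D \<pi> l;
    \<A> = irreducible_components (zariski_quot D \<pi>) (W \<inter> section_zeros D \<pi> l);
    \<forall>C\<in>\<A>. intersection_number D \<pi> Ls C (k C)\<rbrakk>
    \<Longrightarrow> intersection_number D \<pi> (L # Ls) W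
          (\<Sum>C\<in>\<A>. the_enat (div_multiplicity D \<pi> W l C) * k C)"

definition bilin :: "complex ^ 'n::finite \<Rightarrow> complex ^ 'n \<Rightarrow> complex" where
  "bilin x y = (\<Sum>i\<in>UNIV. x $ i * y $ i)"

definition hyperplane_P :: "(complex ^ 'n::finite \<Rightarrow> complex) set" where
  "hyperplane_P = {\<lambda>x. bilin a x | a. True}"

definition hyperplane_fst :: "((complex ^ 'n::finite) \<times> (complex ^ 'n) \<Rightarrow> complex) set" where
  "hyperplane_fst = {\<lambda>p. bilin a (fst p) | a. True}"

definition hyperplane_snd :: "((complex ^ 'n::finite) \<times> (complex ^ 'n) \<Rightarrow> complex) set" where
  "hyperplane_snd = {\<lambda>p. bilin a (snd p) | a. True}"

definition projective_degree :: "'n::finite pspace set \<Rightarrow> nat" where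
  "projective_degree Y = (THE k. intersection_number P_dom point
     (replicate (the_enat (krull_dim zariski_P Y)) hyperplane_P) Y k)"

definition bidegree :: "nat \<Rightarrow> nat \<Rightarrow> ('n::finite pspace \<times> 'n pspace) set \<Rightarrow> nat" where
  "bidegree i j W = (THE k. intersection_number PP_dom (map_prod point point)
     (replicate i hyperplane_fst @ replicate j hyperplane_snd) W k)"


section \<open>Tangent and normal spaces of affine cones\<close>

definition quadric_form :: "complex ^ 'n::finite \<Rightarrow> complex" where
  "quadric_form x = bilin x x"

definition tangent_space :: "(complex ^ 'n::finite) set \<Rightarrow> complex ^ 'n \<Rightarrow> (complex ^ 'n) set" where
  "tangent_space S x = {v. \<forall>f\<in>vanishing_ideal S. deriv (\<lambda>t. f (x + t *s v)) 0 = 0}"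

definition smooth_locus :: "(complex ^ 'n::finite) set \<Rightarrow> (complex ^ 'n) set" where
  "smooth_locus S = {x\<in>S. enat (vec.dim (tangent_space S x)) = krull_dim zariski S}"

definition singular_locus :: "(complex ^ 'n::finite) set \<Rightarrow> (complex ^ 'n) set" where
  "singular_locus S = S - smooth_locus S"

definition normal_space :: "(complex ^ 'n::finite) set \<Rightarrow> complex ^ 'n \<Rightarrow> (complex ^ 'n) set" where
  "normal_space S x = {y. \<forall>v\<in>tangent_space S x. bilin y v = 0}"


section \<open>ED correspondences and conormal varieties\<close>

definition ED_corr ::
  "'n::finite pspace set \<Rightarrow> 'n pspace set \<Rightarrow> ((complex ^ 'n) \<times> (complex ^ 'n)) set" where
  "ED_corr X Z = zariski closure_of
     {(x, u). x \<in> smooth_locus (affine_cone X) \<inter> affine_cone Z \<and>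
              u - x \<in> normal_space (affine_cone X) x}"

definition projective_ED_corr ::
  "'n::finite pspace set \<Rightarrow> ('n pspace \<times> (complex ^ 'n)) set" where
  "projective_ED_corr X =
     zariski_PV closure_of (map_prod point id ` (ED_corr X X \<inter> PV_dom))"

definition ED_data_locus ::
  "'n::finite pspace set \<Rightarrow> 'n pspace set \<Rightarrow> (complex ^ 'n) set" where
  "ED_data_locus X Z = zariski closure_of (snd ` ED_corr X Z)"

definition positive_fibre_locus :: "'n::finite pspace set \<Rightarrow> (complex ^ 'n) set" where
  "positive_fibre_locus X = {u. krull_dim zariski_P {p. (p, u) \<in> projective_ED_corr X} > 0}"

definition ED_regular :: "'n::finite pspace set \<Rightarrow> 'n pspace set \<Rightarrow> bool" where
  "ED_regular X Z \<longleftrightarrow>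
     \<not> affine_cone Z \<subseteq> singular_locus (affine_cone X) \<union> {x. quadric_form x = 0} \<and>
     \<not> ED_data_locus X Z \<subseteq> positive_fibre_locus X"

definition ED_degree :: "'n::finite pspace set \<Rightarrow> 'n pspace set \<Rightarrow> nat" where
  "ED_degree X Z = (THE k. \<exists>U. openin zariski U \<and> U \<inter> ED_data_locus X Z \<noteq> {} \<and>
     (\<forall>u\<in>U \<inter> ED_data_locus X Z.
        finite {x. (x, u) \<in> ED_corr X Z} \<and> card {x. (x, u) \<in> ED_corr X Z} = k))"

text \<open>
  Hyperplanes of \<open>\<P>\<^sup>N\<close> are represented by their coefficient vectors, so that the
  identification \<open>y \<mapsto> \<langle>y, _\<rangle>\<close> of \<open>\<P>\<^sup>N\<close> with its dual is the identity on coordinates and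
  the relative conormal variety is literally this set.
\<close>

definition conormal ::
  "'n::finite pspace set \<Rightarrow> 'n pspace set \<Rightarrow> ('n pspace \<times> 'n pspace) set" where
  "conormal X Z = zariski_PP closure_of
     {(point x, point y) | x y. x \<in> (smooth_locus (affine_cone X) \<inter> affine_cone Z) - {0} \<and>
        y \<in> normal_space (affine_cone X) x - {0}}"

text \<open>\<open>CARD('n) = N + 1\<close>, so the exponent of \<open>h'\<close> is \<open>N - 1 - n + d - i\<close>.\<close>

definition relative_polar_degree :: "nat \<Rightarrow> 'n::finite pspace set \<Rightarrow> 'n pspace set \<Rightarrow> nat" where
  "relative_polar_degree i X Z =
     (let N = CARD('n) - 1; n = the_enat (krull_dim zariski_P X); d = the_enat (krull_dim zariski_P Z)
      in bidegree i (N - 1 - n + d - i) (conormal X Z))"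


section \<open>Basic facts\<close>

lemma istopology_zariski:
  "istopology (\<lambda>U. \<exists>F\<subseteq>Collect polynomial_fun. U = {x::'a::affine_space. \<exists>f\<in>F. f x \<noteq> 0})"
  unfolding istopology_def
proof (intro conjI allI impI)
  fix S T :: "'a set"
  assume S: "\<exists>F\<subseteq>Collect polynomial_fun. S = {x. \<exists>f\<in>F. f x \<noteq> 0}"
    and T: "\<exists>F\<subseteq>Collect polynomial_fun. T = {x. \<exists>f\<in>F. f x \<noteq> 0}"
  from S obtain F where F: "F \<subseteq> Collect polynomial_fun" "S = {x. \<exists>f\<in>F. f x \<noteq> 0}"
    by (elim exE conjE)
  from T obtain G where G: "G \<subseteq> Collect polynomial_fun" "T = {x. \<exists>f\<in>G. f x \<noteq> 0}"
    by (elim exE conjE)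
  let ?H = "\<Union>f\<in>F. (\<lambda>g x. f x * g x) ` G"
  have "?H \<subseteq> Collect polynomial_fun"
    using F(1) G(1) by (auto intro: polynomial_fun.mult)
  moreover have "S \<inter> T = {x. \<exists>h\<in>?H. h x \<noteq> 0}"
  proof (rule Set.set_eqI)
    fix x
    have "x \<in> S \<inter> T \<longleftrightarrow> (\<exists>f\<in>F. \<exists>g\<in>G. f x * g x \<noteq> 0)"
      unfolding F(2) G(2) by simp
    also have "\<dots> \<longleftrightarrow> x \<in> {x. \<exists>h\<in>?H. h x \<noteq> 0}"
      by simp
    finally show "x \<in> S \<inter> T \<longleftrightarrow> x \<in> {x. \<exists>h\<in>?H. h x \<noteq> 0}" .
  qed
  ultimately show "\<exists>H\<subseteq>Collect polynomial_fun. S \<inter> T = {x. \<exists>h\<in>H. h x \<noteq> 0}"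
    by (intro exI[of _ ?H] conjI)
next
  fix K :: "'a set set"
  assume "\<forall>U\<in>K. \<exists>F\<subseteq>Collect polynomial_fun. U = {x. \<exists>f\<in>F. f x \<noteq> 0}"
  then obtain F where F: "\<forall>U\<in>K. F U \<subseteq> Collect polynomial_fun \<and> U = {x. \<exists>f\<in>F U. f x \<noteq> 0}"
    by (rule bchoice[THEN exE])
  have "\<Union>(F ` K) \<subseteq> Collect polynomial_fun"
  proof (rule UN_least)
    show "F U \<subseteq> Collect polynomial_fun" if "U \<in> K" for U
      using bspec[OF F that, THEN conjunct1] .
  qed
  moreover have "\<Union>K = {x. \<exists>f\<in>\<Union>(F ` K). f x \<noteq> 0}"
  proof (rule Set.set_eqI)
    fix x
    have "x \<in> U \<longleftrightarrow> (\<exists>f\<in>F U. f x \<noteq> 0)" if "U \<in> K" for U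
      using bspec[OF F that, THEN conjunct2] by (rule ssubst[where P = "\<lambda>V. x \<in> V \<longleftrightarrow> _"]) simp
    then show "x \<in> \<Union>K \<longleftrightarrow> x \<in> {x. \<exists>f\<in>\<Union>(F ` K). f x \<noteq> 0}"
      by auto
  qed
  ultimately show "\<exists>F\<subseteq>Collect polynomial_fun. \<Union>K = {x. \<exists>f\<in>F. f x \<noteq> 0}"
    by (intro exI[of _ "\<Union>(F ` K)"] conjI)
qed

lemma openin_zariski:
  "openin zariski U \<longleftrightarrow> (\<exists>F\<subseteq>Collect polynomial_fun. U = {x. \<exists>f\<in>F. f x \<noteq> 0})"
  unfolding zariski_def by (simp add: istopology_zariski topology_inverse')

lemma openin_zariski_quot:
  "openin (zariski_quot D \<pi>) U \<longleftrightarrow> openin zariski {x\<in>D. \<pi> x \<in> U}"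
proof -
  have "istopology (\<lambda>U. openin zariski {x\<in>D. \<pi> x \<in> U})"
    unfolding istopology_def
  proof (intro conjI allI impI)
    fix S T
    assume "openin zariski {x\<in>D. \<pi> x \<in> S}" "openin zariski {x\<in>D. \<pi> x \<in> T}"
    then have "openin zariski ({x\<in>D. \<pi> x \<in> S} \<inter> {x\<in>D. \<pi> x \<in> T})"
      by (rule openin_Int)
    moreover have "{x\<in>D. \<pi> x \<in> S} \<inter> {x\<in>D. \<pi> x \<in> T} = {x\<in>D. \<pi> x \<in> S \<inter> T}"
      by blast
    ultimately show "openin zariski {x\<in>D. \<pi> x \<in> S \<inter> T}"
      by simp
  next
    fix K
    assume "\<forall>U\<in>K. openin zariski {x\<in>D. \<pi> x \<in> U}"
    then have "openin zariski (\<Union>U\<in>K. {x\<in>D. \<pi> x \<in> U})"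
      by blast
    moreover have "(\<Union>U\<in>K. {x\<in>D. \<pi> x \<in> U}) = {x\<in>D. \<pi> x \<in> \<Union>K}"
      by blast
    ultimately show "openin zariski {x\<in>D. \<pi> x \<in> \<Union>K}"
      by simp
  qed
  then show ?thesis
    unfolding zariski_quot_def by (simp add: topology_inverse')
qed

lemma cring_polynomial_ring: "cring (polynomial_ring :: ('a::affine_space \<Rightarrow> complex) ring)"
proof (rule cringI)
  show "abelian_group (polynomial_ring :: ('a \<Rightarrow> complex) ring)"
  proof (rule abelian_groupI)
    fix f :: "'a \<Rightarrow> complex" assume "f \<in> carrier polynomial_ring"
    then have "polynomial_fun (\<lambda>x. - 1 * f x)"
      by (intro polynomial_fun.mult polynomial_fun.const) (simp add: polynomial_ring_def)
    then show "\<exists>g\<in>carrier polynomial_ring. g \<oplus>\<^bsub>polynomial_ring\<^esub> f = \<zero>\<^bsub>polynomial_ring\<^esub>"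
      by (intro bexI[of _ "\<lambda>x. - 1 * f x"]) (auto simp: polynomial_ring_def)
  qed (auto simp: polynomial_ring_def algebra_simps intro: polynomial_fun.intros)
  show "Group.comm_monoid (polynomial_ring :: ('a \<Rightarrow> complex) ring)"
    by (rule comm_monoidI)
       (auto simp: polynomial_ring_def algebra_simps intro: polynomial_fun.intros)
qed (auto simp: polynomial_ring_def algebra_simps)

end

theory Submission
  imports Defs "HOL-Library.Function_Algebras" "HOL-Computational_Algebra.Fundamental_Theorem_Algebra"
    "HOL-Computational_Algebra.Primes"
begin

text \<open>Near a smooth point of \<open>X\<close> in \<open>Z\<close> the normal spaces are spanned by \<open>N - n\<close> gradients, so the
  cone \<open>S\<close> of all \<open>(x, y)\<close> with \<open>x\<close> in \<open>X\<^sub>s\<^sub>m \<inter> Z\<close> and \<open>y\<close> normal to \<open>X\<close> at \<open>x\<close> is irreducible of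
  dimension \<open>N - n + d + 1\<close>. Intersection numbers are iterated differences of Hilbert functions.
  Applied to the bigraded Hilbert function of \<open>S\<close> this makes the \<open>\<delta>\<^sub>i\<close> its leading
  coefficients (zero for \<open>i > d\<close>), and summing over the bidegrees of a given total degree shows that
  their sum is the degree of the closure of \<open>S\<close> as an affine cone. Disjointness of the conormal
  variety from the diagonal means that \<open>(x, y) \<mapsto> x + y\<close> has only the origin above the origin. So this
  map is finite on the closure of \<open>S\<close>, and the degree of the closure is the number of points of a
  generic fibre times the degree of the image. Since \<open>u = x + y\<close> amounts to \<open>y = u - x\<close>, the image is the
  ED data locus and the fibres are those of the ED correspondence.\<close>

text \<open>Two grades of precision alternate. Dimensions of affine sets only need crude bounds of
  the form \<open>t ^ k <= K * t ^ m\<close>, which survive substitution of polynomials of bounded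
  degree. Leading coefficients must be exact; they rest on one identity, \<open>H_exact\<close>:
  multiplication by a form \<open>a\<close> splits the Hilbert function of \<open>I\<close> into
  those of \<open>(I : a)\<close> and \<open>I + (a)\<close>. The danger in such identities is
  cancellation in top degree, for in several variables a degree cannot be read off from values on
  one ray. It is excluded by carrying along that leading coefficients are nonnegative
  (\<open>good\<close>). A further obstacle is that a bigraded Hilbert function is polynomial only
  where both degrees are large, while the total one sums over all bidegrees, also those near the
  axes; monotonicity in each variable shows that these strips grow too slowly to matter. The fibre
  count is exact because a basis over the function field of the image restricts to a basis of the
  functions on a general fibre: it spans once a denominator is inverted, and it stays independent
  since in characteristic 0 the coordinates satisfy separable relations, which makes the general
  fibre reduced.\<close>

type_synonym 'n cvec = "complex ^ 'n"
type_synonym 'n cvec2 = "(complex ^ 'n) \<times> (complex ^ 'n)"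

section \<open>Finite-dimensional spaces of functions\<close>

definition fsc :: "complex => ('a => complex) => 'a => complex" where
 "fsc c f = (%x. c * f x)"

lemma fsc_apply [simp]: "fsc c f x = c * f x"
 by (simp add: fsc_def)

interpretation fs: vector_space fsc by standard (auto simp: algebra_simps)

definition flin :: "(('a => complex) => ('b => complex)) => bool" where
 "flin f \<longleftrightarrow> (\<forall>u v. f (u + v) = f u + f v) & (\<forall>c u. f (fsc c u) = fsc c (f u))"

lemma flin_linear: "flin f \<longleftrightarrow> Vector_Spaces.linear fsc fsc f"
 using fs.vector_space_axioms[where 'a='a] fs.vector_space_axioms[where 'a='b]
 unfolding flin_def Vector_Spaces.linear_iff by blast

lemma flinI:
 "(!!u v. f (u + v) = f u + f v) ==> (!!c u. f (fsc c u) = fsc c (f u)) ==> flin f" by (simp add: flin_def)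

lemma flin_add: "flin f ==> f (u + v) = f u + f v"
 by (simp add: flin_def)

lemma flin_scale: "flin f ==> f (fsc c u) = fsc c (f u)"
 by (simp add: flin_def)

lemma flin_0: "flin f ==> f 0 = 0"
 using flin_scale[of f 0 0] by (simp add: fsc_def zero_fun_def)

lemma flin_diff: "flin f ==> f (u - v) = f u - f v"
 using flin_add[of f "u - v" v] by simp

lemma flin_sum: "flin f ==> f (\<Sum>i\<in>A. g i) = (\<Sum>i\<in>A. f (g i))"
 by (induction A rule: infinite_finite_induct) (auto simp: flin_0 flin_add)

lemma flin_comp: "flin f ==> flin g ==> flin (%x. f (g x))"
 by (simp add: flin_def)

lemma sum_fun_apply: "(\<Sum>i\<in>A. f i) x = (\<Sum>i\<in>A. f i x)" for f :: "'i => 'a => 'b::comm_monoid_add"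
 by (induction A rule: infinite_finite_induct) auto

lemma flin_image_span: "flin f ==> f ` fs.span S = fs.span (f ` S)"
 by (metis flin_linear module_hom.span_image Vector_Spaces.linear.axioms(3))

lemma flin_image_subspace: "flin f ==> fs.subspace V ==> fs.subspace (f ` V)"
 by (metis flin_image_span fs.span_eq_iff fs.subspace_span)

text \<open>\<open>fs.dim\<close> is 0 on a space with an infinite basis, as \<open>card\<close> is
  0 on infinite sets; comparisons of dimensions are therefore guarded by
  \<open>findim\<close>.\<close>

definition findim :: "('a => complex) set => bool" where
 "findim V \<longleftrightarrow> (\<exists>T. finite T & V \<subseteq> fs.span T)"

lemma findim_span: "finite T ==> findim (fs.span T)"
 by (auto simp: findim_def)

lemma findim_subset: "findim W ==> V \<subseteq> W ==> findim V"
 by (auto simp: findim_def)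

lemma findim_image: "findim V ==> flin f ==> findim (f ` V)"
 unfolding findim_def by (metis finite_imageI flin_image_span image_mono)

lemma findim_independent_finite:
 assumes "findim V" "B \<subseteq> V" "fs.independent B"
 shows "finite B" "card B <= fs.dim V"
proof -
 obtain T where T: "finite T" "V \<subseteq> fs.span T" using assms(1) findim_def by auto
 show "finite B" using fs.independent_span_bound[of T B] T assms by auto
 obtain C where C: "B \<subseteq> C" "C \<subseteq> V" "fs.independent C" "V \<subseteq> fs.span C"
  using fs.maximal_independent_subset_extend[OF assms(2,3)] by metis
 then have "finite C" using fs.independent_span_bound[of T C] T by auto
 then show "card B <= fs.dim V" using C fs.basis_card_eq_dim[of C V] by (metis card_mono)
qed

lemma findim_basis:
 assumes "findim V"
 obtains B where "finite B" "B \<subseteq> V" "fs.independent B" "V \<subseteq> fs.span B" "card B = fs.dim V"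
 using assms findim_independent_finite(1) by (metis fs.basis_exists)

lemma dim_mono:
 assumes "findim W" "V \<subseteq> W"
 shows "fs.dim V <= fs.dim W"
proof -
 obtain B where "finite B" "B \<subseteq> V" "fs.independent B" "V \<subseteq> fs.span B" "card B = fs.dim V"
  using findim_basis[OF findim_subset[OF assms]] by metis
 then show ?thesis using findim_independent_finite(2)[of W B] assms by auto
qed

lemma fs_dim_0_iff:
 assumes "findim V"
 shows "fs.dim V = 0 \<longleftrightarrow> V \<subseteq> {0}"
proof
 assume "fs.dim V = 0"
 then obtain B where "finite B" "V \<subseteq> fs.span B" "card B = 0" using findim_basis[OF assms] by metis
 then show "V \<subseteq> {0}" by simp
next
 assume "V \<subseteq> {0}"
 then have "V \<subseteq> fs.span {}" by simp
 from fs.dim_le_card[OF this] show "fs.dim V = 0" by simp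
qed

lemma ex_flin_projection:
 assumes "fs.independent C" "A \<subseteq> C"
 obtains f where "flin f" "!!x. x \<in> fs.span A ==> f x = 0" "!!x. x \<in> fs.span (C - A) ==> f x = x"
proof -
 interpret vector_space_pair "fsc :: complex => ('a => complex) => _" "fsc :: complex => ('a => complex) => _"
  by unfold_locales
 obtain f where f: "Vector_Spaces.linear fsc fsc f" "\<forall>x\<in>C. f x = (if x \<in> A then 0 else x)"
  using linear_independent_extend[OF assms(1), of "%x. if x \<in> A then 0 else x"] by auto
 have lf: "flin f" using f flin_linear by auto
 have "f x = 0" if "x \<in> fs.span A" for x using that
 proof (induction rule: fs.span_induct_alt)
  case base
  then show ?case using flin_0[OF lf] by (simp add: zero_fun_def)
 next
  case (step c x y)
  then have "f (fsc c x + y) = fsc c (f x) + f y" "f x = 0" "f y = 0"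
   using f assms(2) by (auto simp: flin_add[OF lf] flin_scale[OF lf])
  then show ?case by (simp only: fs.scale_zero_right add_0)
 qed
 moreover have "f x = x" if "x \<in> fs.span (C - A)" for x using that
 proof (induction rule: fs.span_induct_alt)
  case base
  then show ?case using flin_0[OF lf] by (simp add: zero_fun_def)
 next
  case (step c x y)
  then have "f (fsc c x + y) = fsc c (f x) + f y" "f x = x" "f y = y"
   using f by (auto simp: flin_add[OF lf] flin_scale[OF lf])
  then show ?case by (simp only:)
 qed
 ultimately show ?thesis by (rule that[OF lf])
qed

text \<open>An endomorphism of the whole function space with kernel \<open>I\<close> stands in for
  the passage to the quotient, so that the quotient stays inside the same type.\<close>

lemma ex_quotient_map:
 assumes "fs.subspace I"
 obtains f :: "('a => complex) => 'a => complex" where "flin f" "!!x. f x = 0 \<longleftrightarrow> x \<in> I"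
proof -
 obtain A where A: "A \<subseteq> I" "fs.independent A" "I \<subseteq> fs.span A"
  using fs.maximal_independent_subset by metis
 then have AI: "fs.span A = I" using assms by (metis fs.span_minimal subset_antisym)
 obtain C where C: "A \<subseteq> C" "fs.independent C" "UNIV \<subseteq> fs.span C"
  using fs.maximal_independent_subset_extend[OF subset_UNIV A(2)] by metis
 obtain f where f: "flin f" "!!x. x \<in> fs.span A ==> f x = 0" "!!x. x \<in> fs.span (C - A) ==> f x = x"
  using ex_flin_projection[OF C(2,1)] by metis
 have "f x = 0 \<longleftrightarrow> x \<in> I" for x
 proof
  assume fx: "f x = 0"
  have "x \<in> fs.span (A \<union> (C - A))" using C by (metis Diff_partition UNIV_I subsetD)
  then obtain u v where uv: "x = u + v" "u \<in> fs.span A" "v \<in> fs.span (C - A)" unfolding fs.span_Un by blast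
  then have "v = 0" using fx f(2,3) flin_add[OF f(1), of u v] by simp
  then show "x \<in> I" using uv AI by simp
 qed (use AI f in auto)
 with f(1) show ?thesis by (intro that[of f]) blast+
qed

lemma rank_nullity:
 assumes f: "flin f" and V: "fs.subspace V" "findim V"
 shows "fs.dim V = fs.dim (f ` V) + fs.dim {v\<in>V. f v = 0}"
proof -
 let ?K = "{v\<in>V. f v = 0}"
 obtain A where A: "A \<subseteq> ?K" "fs.independent A" "?K \<subseteq> fs.span A" "card A = fs.dim ?K"
  by (rule fs.basis_exists)
 have "A \<subseteq> V" using A by auto
 from fs.maximal_independent_subset_extend[OF this A(2)]
 obtain B where B: "A \<subseteq> B" "B \<subseteq> V" "fs.independent B" "V \<subseteq> fs.span B" by metis
 have fin: "finite B" using findim_independent_finite V B by auto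
 have sV: "fs.span B = V" using B V by (metis fs.span_minimal subset_antisym)
 \<comment> \<open>\<open>p\<close> vanishes on the kernel and is the identity on the chosen
   complement. A vector in both is therefore 0, which makes \<open>f\<close> injective on the
   complement.\<close>
 obtain p where p: "flin p" "!!x. x \<in> fs.span A ==> p x = 0" "!!x. x \<in> fs.span (B - A) ==> p x = x"
  using ex_flin_projection[OF B(3,1)] by metis
 have inj: "inj_on f (fs.span (B - A))"
 proof (rule inj_onI)
  fix x y assume xy: "x \<in> fs.span (B - A)" "y \<in> fs.span (B - A)" "f x = f y"
  then have d: "x - y \<in> fs.span (B - A)" by (simp add: fs.span_diff)
  moreover have "fs.span (B - A) \<subseteq> V" using sV by (metis Diff_subset fs.span_mono)
  ultimately have "x - y \<in> ?K" using xy flin_diff[OF f, of x y] by auto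
  then have "x - y \<in> fs.span A" using A by blast
  then have "p (x - y) = 0" "p (x - y) = x - y" using p(2,3) d by blast+
  then have "x - y = 0" by (simp only:)
  then show "x = y" by simp
 qed
 have ind: "fs.independent (f ` (B - A))"
  using module_hom.independent_injective_image[of fsc fsc f "B - A"] inj f B(3)
  by (metis Diff_subset flin_linear fs.independent_mono Vector_Spaces.linear.axioms(3))
 have "f ` A \<subseteq> {0}" using A by auto
 then have "fs.span (f ` B) = fs.span (f ` (B - A))"
  by (metis Diff_partition[OF B(1)] fs.span_insert_0 image_Un insert_is_Un subset_singletonD sup_bot_left)
 then have "f ` V = fs.span (f ` (B - A))" using flin_image_span[OF f, of B] sV by simp
 then have "fs.dim (f ` V) = card (f ` (B - A))" using ind by (simp add: fs.dim_eq_card)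
 also have "\<dots> = card (B - A)" using inj by (metis card_image fs.span_superset inj_on_subset)
 finally show ?thesis using A B fin fs.basis_card_eq_dim[of B V] card_mono[OF fin B(1)] finite_subset[OF B(1) fin]
  by (simp add: card_Diff_subset)
qed

lemma dim_image_le: "flin f ==> fs.subspace V ==> findim V ==> fs.dim (f ` V) <= fs.dim V"
 using rank_nullity by fastforce

section \<open>Difference calculus for numerical functions of several variables\<close>

text \<open>\<open>dg m f\<close> says that \<open>f\<close> is a polynomial of degree less than \<open>m\<close> for large arguments; its leading
 coefficients are then given by \<open>coef\<close>, up to factorials.\<close>

definition evc :: "(('k => nat) => int) => int => bool" where
 "evc f v \<longleftrightarrow> (\<exists>c. \<forall>g. (\<forall>k. c <= g k) --> f g = v)"

definition fdiff :: "'k => (('k => nat) => int) => ('k => nat) => int" where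
 "fdiff k f g = f (g(k := Suc (g k))) - f g"

primrec dg :: "nat => (('k::finite => nat) => int) => bool" where
 "dg 0 f \<longleftrightarrow> evc f 0"
| "dg (Suc m) f \<longleftrightarrow> (\<forall>k. dg m (fdiff k f))"

primrec fdiffs :: "'k list => (('k => nat) => int) => ('k => nat) => int" where
 "fdiffs [] f = f"
| "fdiffs (k # ks) f = fdiffs ks (fdiff k f)"

definition coef :: "'k list => (('k => nat) => int) => int" where
 "coef ks f = (THE v. evc (fdiffs ks f) v)"

lemma evc_unique: "evc f v ==> evc f w ==> v = w"
 unfolding evc_def
proof (elim exE)
 fix c d assume "\<forall>g. (\<forall>k. c <= g k) --> f g = v" "\<forall>g. (\<forall>k. d <= g k) --> f g = w"
 then have "f (%_. max c d) = v" "f (%_. max c d) = w"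
  by (metis max.cobounded1, metis max.cobounded2)
 then show "v = w" by simp
qed

lemma evc_add: "evc f v ==> evc g w ==> evc (%x. f x + g x) (v + w)"
 unfolding evc_def by (metis max.bounded_iff)

lemma evc_uminus: "evc f v ==> evc (%x. - f x) (- v)"
 unfolding evc_def by metis

lemma evc_cmult: "evc f v ==> evc (%x. a * f x) (a * v)"
 unfolding evc_def by metis

lemma evc_shift: "evc (%g. f (g + h)) v \<longleftrightarrow> evc f v" for f :: "('k::finite => nat) => int"
proof
 assume "evc (%g. f (g + h)) v"
 then obtain c where c: "!!g. (\<forall>k. c <= g k) ==> f (g + h) = v" by (auto simp: evc_def)
 have "f g = v" if g: "\<forall>k. c + Max (range h) <= g k" for g
 proof -
  have le: "h k <= Max (range h)" for k by (rule Max_ge) auto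
  have ge: "c + h k <= g k" for k using g[rule_format, of k] le[of k] by linarith
  have "c <= g k - h k" for k using ge[of k] by linarith
  then have "f ((%k. g k - h k) + h) = v" by (intro c) auto
  moreover have "(%k. g k - h k) + h = g"
  proof
   fix k show "((%k. g k - h k) + h) k = g k" using ge[of k] by simp
  qed
  ultimately show ?thesis by simp
 qed
 then show "evc f v" by (auto simp: evc_def)
next
 assume "evc f v"
 then obtain c where "!!g. (\<forall>k. c <= g k) ==> f g = v" by (auto simp: evc_def)
 then show "evc (%g. f (g + h)) v" unfolding evc_def by (intro exI[of _ c]) (simp add: trans_le_add1)
qed

lemma fdiff_shift: "fdiff k (%g. f (g + h)) = (%g. fdiff k f (g + h))"
proof
 fix g :: "'a => nat"
 have "g(k := Suc (g k)) + h = (g + h)(k := Suc ((g + h) k))" by (auto simp: fun_eq_iff)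
 then show "fdiff k (%g. f (g + h)) g = fdiff k f (g + h)" by (simp add: fdiff_def)
qed

lemma dg_shift: "dg m (%g. f (g + h)) \<longleftrightarrow> dg m f"
 by (induction m arbitrary: f) (simp_all add: evc_shift fdiff_shift)

lemma fdiff_add: "fdiff k (%x. f x + g x) = (%x. fdiff k f x + fdiff k g x)"
 by (auto simp: fdiff_def)

lemma fdiff_uminus: "fdiff k (%x. - f x) = (%x. - fdiff k f x)"
 by (auto simp: fdiff_def)

lemma fdiff_cmult: "fdiff k (%x. a * f x) = (%x. a * fdiff k f x)"
 by (auto simp: fdiff_def algebra_simps)

lemma dg_add: "dg m f ==> dg m g ==> dg m (%x. f x + g x)"
proof (induction m arbitrary: f g)
 case 0
 then show ?case using evc_add[of f 0 g 0] by simp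
qed (simp add: fdiff_add)

lemma dg_uminus: "dg m f ==> dg m (%x. - f x)"
proof (induction m arbitrary: f)
 case 0
 then show ?case using evc_uminus[of f 0] by simp
qed (simp add: fdiff_uminus)

lemma dg_diff: "dg m f ==> dg m g ==> dg m (%x. f x - g x)"
 using dg_add[of m f "%x. - g x"] dg_uminus by auto

lemma dg_cmult: "dg m f ==> dg m (%x. a * f x)"
proof (induction m arbitrary: f)
 case 0
 then show ?case using evc_cmult[of f 0 a] by simp
qed (simp add: fdiff_cmult)

lemma dg_zero: "dg m (%_. 0)"
proof (induction m)
 case (Suc m)
 have "fdiff k (%_::'a => nat. 0) = (%_. 0)" for k by (auto simp: fdiff_def)
 with Suc show ?case by simp
qed (auto simp: evc_def)

lemma dg_Suc: "dg m f ==> dg (Suc m) f"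
proof (induction m arbitrary: f)
 case 0
 then obtain c where c: "!!g. (\<forall>k. c <= g k) ==> f g = 0" by (auto simp: evc_def)
 have "fdiff k f g = 0" if "\<forall>k. c <= g k" for g k using that by (auto simp: fdiff_def c le_SucI)
 then show ?case by (auto simp: evc_def)
qed simp

lemma dg_mono: "dg m f ==> m <= n ==> dg n f"
 by (induction n) (auto simp: le_Suc_eq dg_Suc simp del: dg.simps)

text \<open>Telescoping: a shift by \<open>h\<close> is made of unit steps, and each of them changes
  \<open>f\<close> by a shifted \<open>fdiff\<close>.\<close>

lemma dg_shift_diff:
 fixes f :: "('k::finite => nat) => int"
 assumes "dg (Suc m) f"
 shows "dg m (%g. f (g + h) - f g)"
proof (induction "\<Sum>k\<in>UNIV. h k" arbitrary: h)
 case 0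
 then have "h = 0" by (auto simp: fun_eq_iff)
 then show ?case by (simp add: dg_zero del: dg.simps)
next
 case (Suc n)
 then have "\<exists>k. h k ~= 0" by (metis sum.neutral Zero_not_Suc)
 then obtain k where k: "h k ~= 0" by auto
 define h' where "h' = h(k := h k - 1)"
 have h: "h = h'(k := Suc (h' k))" using k by (auto simp: h'_def)
 have "(\<Sum>k\<in>UNIV. h k) = Suc (\<Sum>k\<in>UNIV. h' k)" by (subst (1 2) sum.remove[of _ k]) (auto simp: h)
 then have IH: "dg m (%g. f (g + h') - f g)" using Suc by simp
 have "dg m (%g. fdiff k f (g + h'))" using assms by (simp add: dg_shift)
 from dg_add[OF this IH]
 have "dg m (%g. fdiff k f (g + h') + (f (g + h') - f g))" .
 moreover have "(%g. fdiff k f (g + h') + (f (g + h') - f g)) = (%g. f (g + h) - f g)"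
 proof
  fix g :: "'k => nat"
  have "(g + h')(k := Suc ((g + h') k)) = g + h" by (auto simp: h fun_eq_iff)
  then show "fdiff k f (g + h') + (f (g + h') - f g) = f (g + h) - f g" by (simp add: fdiff_def)
 qed
 ultimately show ?case by simp
qed

text \<open>Beyond a common threshold \<open>C\<close> for the finitely many directions no unit step
  changes \<open>f\<close>, so every argument can be walked down to the corner
  \<open>%_. C\<close>.\<close>

lemma dg_1_evc:
 fixes f :: "('k::finite => nat) => int"
 assumes "dg (Suc 0) f"
 obtains v where "evc f v"
proof -
 have "\<forall>k. \<exists>c. \<forall>g. (\<forall>j. c <= g j) --> fdiff k f g = 0"
  using assms by (simp add: evc_def)
 then obtain c where c: "!!k g. (\<forall>j. c k <= g j) ==> fdiff k f g = 0" by metis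
 define C where "C = Max (range c)"
 have C: "c k <= C" for k unfolding C_def by (rule Max_ge) auto
 have "f g = f (%_. C)" if "\<forall>j. C <= g j" for g using that
 proof (induction "\<Sum>k\<in>UNIV. g k - C" arbitrary: g)
  case 0
  then have "g = (%_. C)" by (auto simp: fun_eq_iff le_antisym)
  then show ?case by simp
 next
  case (Suc n)
  then have "\<exists>k. g k - C ~= 0" by (metis sum.neutral Zero_not_Suc)
  then obtain k where k: "g k > C" by (metis diff_is_0_eq not_le)
  define g' where "g' = g(k := g k - 1)"
  have g: "g = g'(k := Suc (g' k))" using k by (auto simp: g'_def)
  have ge: "\<forall>j. C <= g' j" using Suc.prems k by (auto simp: g'_def)
  have "(\<Sum>k\<in>UNIV. g k - C) = Suc (\<Sum>k\<in>UNIV. g' k - C)"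
   using ge by (subst (1 2) sum.remove[of _ k]) (auto simp: g Suc_diff_le)
  then have "f g' = f (%_. C)" using Suc ge by simp
  moreover have "fdiff k f g' = 0" using c C ge by (metis order_trans)
  ultimately show ?case using g by (simp add: fdiff_def)
 qed
 then have "evc f (f (%_. C))" unfolding evc_def by blast
 then show ?thesis by (rule that)
qed

lemma coef_eqI: "evc (fdiffs ks f) v ==> coef ks f = v"
 unfolding coef_def by (rule the_equality) (auto dest: evc_unique)

lemma coef_evc: "dg (Suc (length ks)) f ==> evc (fdiffs ks f) (coef ks f)"
proof (induction ks arbitrary: f)
 case Nil
 then obtain v where "evc f v" by (auto elim: dg_1_evc simp del: dg.simps)
 then show ?case using coef_eqI[of "[]" f v] by simp
next
 case (Cons k ks)
 then have "evc (fdiffs ks (fdiff k f)) (coef ks (fdiff k f))" by simp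
 then show ?case using coef_eqI[of "k # ks"] by simp
qed

lemma coef_Cons: "coef (k # ks) f = coef ks (fdiff k f)"
 by (simp add: coef_def)

lemma coef_0: "dg (length ks) f ==> coef ks f = 0"
proof (induction ks arbitrary: f)
 case Nil
 then show ?case using coef_eqI[of "[]" f 0] by simp
qed (simp add: coef_Cons)

lemma dg_coef_0: "dg (Suc m) f ==> (!!ks. length ks = m ==> coef ks f = 0) ==> dg m f"
proof (induction m arbitrary: f)
 case 0
 then show ?case using coef_evc[of "[]" f] by (simp del: dg.simps(2))
next
 case (Suc m)
 have "dg m (fdiff k f)" for k
 proof (rule Suc.IH)
  show "dg (Suc m) (fdiff k f)" using Suc.prems(1) by simp
  fix ks :: "'a list" assume "length ks = m"
  then show "coef ks (fdiff k f) = 0" using Suc.prems(2)[of "k # ks"] by (simp add: coef_Cons)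
 qed
 then show ?case by simp
qed

lemma fdiffs_add: "fdiffs ks (%x. f x + g x) = (%x. fdiffs ks f x + fdiffs ks g x)"
 by (induction ks arbitrary: f g) (simp_all add: fdiff_add)

lemma fdiffs_shift: "fdiffs ks (%x. f (x + h)) = (%x. fdiffs ks f (x + h))"
 by (induction ks arbitrary: f) (simp_all add: fdiff_shift)

lemma coef_add:
 assumes "dg (Suc (length ks)) f" "dg (Suc (length ks)) g"
 shows "coef ks (%x. f x + g x) = coef ks f + coef ks g" using coef_evc[OF assms(1)] coef_evc[OF assms(2)]
 by (intro coef_eqI) (simp add: fdiffs_add evc_add)

lemma coef_shift: "coef ks (%x. f (x + h)) = coef ks f" for f :: "('k::finite => nat) => int"
 by (simp add: coef_def fdiffs_shift evc_shift)

lemma fdiff_commute: "fdiff j (fdiff k f) = fdiff k (fdiff j f)"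
proof
 fix g
 show "fdiff j (fdiff k f) g = fdiff k (fdiff j f) g"
  by (cases "j = k") (simp_all add: fdiff_def fun_upd_twist[of j k])
qed

lemma fdiffs_cmult: "fdiffs ks (%x. a * f x) = (%x. a * fdiffs ks f x)"
 by (induction ks arbitrary: f) (simp_all add: fdiff_cmult)

lemma coef_cmult: "dg (Suc (length ks)) f ==> coef ks (%x. a * f x) = a * coef ks f"
 by (rule coef_eqI) (simp add: fdiffs_cmult evc_cmult coef_evc del: dg.simps)

subsection \<open>One variable\<close>

definition nd :: "(nat => int) => nat => int" where
 "nd h t = h (Suc t) - h t"

text \<open>This is \<open>dg\<close> for a single weight, with the index type \<open>unit\<close>
  removed. Growth estimates and iterated differences \<open>nd ^^ m\<close> are handled in this form
  and carried over by \<open>ndg_dg\<close> and \<open>dg_unit\<close>.\<close>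

primrec ndg :: "nat => (nat => int) => bool" where
 "ndg 0 h \<longleftrightarrow> (\<exists>c. \<forall>t\<ge>c. h t = 0)"
| "ndg (Suc m) h \<longleftrightarrow> ndg m (nd h)"

lemma nd_diff: "nd (%x. f x - g x) = (%x. nd f x - nd g x)"
 by (auto simp: nd_def)

lemma ndg_dg: "ndg m h \<longleftrightarrow> dg m (%g::unit => nat. h (g ()))"
proof (induction m arbitrary: h)
 case 0
 then show ?case
 proof -
  have "(\<forall>g::unit => nat. (\<forall>k. c <= g k) --> h (g ()) = 0) \<longleftrightarrow> (\<forall>t\<ge>c. h t = 0)" for c
  proof
   assume *: "\<forall>g::unit => nat. (\<forall>k. c <= g k) --> h (g ()) = 0"
   show "\<forall>t\<ge>c. h t = 0" using *[rule_format, of "%_. _"] by auto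
  qed auto
  then show ?thesis by (simp add: evc_def)
 qed
next
 case (Suc m)
 have "fdiff k (%g::unit => nat. h (g ())) = (%g. nd h (g ()))" for k
  by (auto simp: fdiff_def nd_def)
 with Suc show ?case by simp
qed

lemma dg_unit: "dg m f \<longleftrightarrow> ndg m (%t. f (%_::unit. t))"
proof -
 have "(%g::unit => nat. f (%_. g ())) = f" by (rule ext) (metis (full_types) old.unit.exhaust)
 then show ?thesis by (simp add: ndg_dg)
qed

lemma ndg_add: "ndg m f ==> ndg m g ==> ndg m (%x. f x + g x)"
 using dg_add by (auto simp: ndg_dg)

lemma ndg_diff: "ndg m f ==> ndg m g ==> ndg m (%x. f x - g x)"
 using dg_diff by (auto simp: ndg_dg)

lemma ndg_cmult: "ndg m f ==> ndg m (%x. a * f x)"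
 using dg_cmult by (auto simp: ndg_dg)

lemma ndg_mono: "ndg m f ==> m <= n ==> ndg n f"
 using dg_mono by (auto simp: ndg_dg)

lemma ndg_shift: "ndg m (%t. f (t + h)) \<longleftrightarrow> ndg m f"
 using dg_shift[of m "%g. f (g ())" "%_. h"] by (simp add: ndg_dg)

lemma ndg_evc: "ndg (Suc m) h ==> \<exists>v c. \<forall>t\<ge>c. (nd ^^ m) h t = v"
proof (induction m arbitrary: h)
 case 0
 then obtain c where c: "!!t. t >= c ==> h (Suc t) = h t" by (auto simp: nd_def)
 have "h t = h c" if "t >= c" for t using that by (induction rule: dec_induct) (auto simp: c)
 then show ?case by auto
next
 case (Suc m)
 then show ?case by (simp add: funpow_Suc_right del: funpow.simps)
qed

lemma ndg_evc_0: "ndg m h ==> \<exists>c. \<forall>t\<ge>c. (nd ^^ m) h t = 0"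
 by (induction m arbitrary: h) (simp_all add: funpow_Suc_right del: funpow.simps(2))

lemma evc_0_ndg: "\<exists>c. \<forall>t\<ge>c. (nd ^^ m) h t = 0 ==> ndg m h"
 by (induction m arbitrary: h) (simp_all add: funpow_Suc_right del: funpow.simps(2))

text \<open>Each summation of a sequence that is eventually at most -1 tends to minus infinity, so
  the sign propagates from the highest difference down to the function.\<close>

lemma nd_pow_neg: "\<exists>c. \<forall>t\<ge>c. (nd ^^ m) h t <= -1 ==> \<exists>c. \<forall>t\<ge>c. h t <= -1"
proof (induction m arbitrary: h)
 case (Suc m)
 then have "\<exists>c. \<forall>t\<ge>c. nd h t <= -1" by (simp add: funpow_Suc_right del: funpow.simps(2))
 then obtain c where c: "!!t. t >= c ==> h (Suc t) - h t <= - 1" unfolding nd_def by blast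
 have "h (c + s) <= h c - int s" for s
 proof (induction s)
  case (Suc s)
  then show ?case using c[of "c + s"] by simp
 qed simp
 note step = this
 have "h t <= -1" if "t >= c + nat (h c + 1)" for t
 proof -
  have "h t <= h c - int (t - c)" using step[of "t - c"] that by simp
  also have "\<dots> <= - 1" using that by linarith
  finally show ?thesis .
 qed
 then show ?case by blast
qed simp

text \<open>While the order \<open>M\<close> of \<open>p\<close> exceeds \<open>m\<close>, the
  \<open>M\<close>-th difference of \<open>p\<close> is eventually a constant \<open>v\<close> and
  that of \<open>q\<close> is eventually 0. If \<open>v < 0\<close> then \<open>p\<close> becomes
  negative, if \<open>v > 0\<close> then \<open>q - p\<close> does; so \<open>v = 0\<close> and the
  order drops.\<close>

lemma ndg_sandwich:
 assumes "ndg M p" "ndg m q" "\<forall>t\<ge>c. 0 <= p t & p t <= q t"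
 shows "ndg m p" using assms(1)
proof (induction M)
 case 0
 then show ?case using ndg_mono[of 0 p m] by (simp del: ndg.simps)
next
 case (Suc M)
 show ?case
 proof (cases "Suc M <= m")
  case True
  then show ?thesis using ndg_mono[OF Suc.prems] by blast
 next
  case False
  then have "ndg M q" using assms(2) ndg_mono by auto
  then obtain c1 where c1: "!!t. t >= c1 ==> (nd ^^ M) q t = 0" using ndg_evc_0[of M q] by blast
  obtain v c2 where c2: "!!t. t >= c2 ==> (nd ^^ M) p t = v" using ndg_evc[OF Suc.prems] by blast
  have "v >= 0"
  proof (rule ccontr)
   assume "\<not> v >= 0"
   then have "\<forall>t\<ge>c2. (nd ^^ M) p t <= -1" using c2 by auto
   then have "\<exists>c. \<forall>t\<ge>c. (nd ^^ M) p t <= -1" by blast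
   from nd_pow_neg[OF this] obtain d where "\<forall>t\<ge>d. p t <= -1" by auto
   then have "p (max c d) <= -1" "0 <= p (max c d)" using assms(3) by auto
   then show False by simp
  qed
  moreover have "v <= 0"
  proof (rule ccontr)
   assume "\<not> v <= 0"
   have "(nd ^^ M) (%t. q t - p t) = (%t. (nd ^^ M) q t - (nd ^^ M) p t)"
    by (induction M) (simp_all add: nd_diff)
   then have "\<forall>t\<ge>max c1 c2. (nd ^^ M) (%t. q t - p t) t <= -1"
    using c1 c2 \<open>\<not> v <= 0\<close> by auto
   then have "\<exists>c. \<forall>t\<ge>c. (nd ^^ M) (%t. q t - p t) t <= -1" by blast
   from nd_pow_neg[OF this] obtain d where "\<forall>t\<ge>d. q t - p t <= -1" by auto
   then have "q (max c d) - p (max c d) <= -1" "p (max c d) <= q (max c d)" using assms(3) by auto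
   then show False by simp
  qed
  ultimately have "\<forall>t\<ge>c2. (nd ^^ M) p t = 0" using c2 by auto
  then have "ndg M p" by (intro evc_0_ndg) blast
  then show ?thesis using Suc.IH by simp
 qed
qed

lemma ndg_binomial: "ndg (Suc m) (%t. int ((t + m) choose m))"
proof (induction m)
 case 0
 then show ?case by (auto simp: nd_def)
next
 case (Suc m)
 have "nd (%t. int ((t + Suc m) choose Suc m)) = (%t. int ((t + 1 + m) choose m))"
  by (auto simp: nd_def)
 then show ?case using Suc ndg_shift[of "Suc m" "%t. int ((t + m) choose m)" 1] by (simp only: ndg.simps(2))
qed

lemma power_le_binomial: "(t + 1) ^ m <= fact m * ((t + m) choose m)"
proof (induction m)
 case (Suc m)
 have "(t + 1) ^ Suc m <= Suc (t + m) * (fact m * ((t + m) choose m))"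
  using Suc by (simp only: power_Suc) (rule mult_mono, auto)
 also have "\<dots> = fact m * (Suc m * (Suc (t + m) choose Suc m))" by (simp only: Suc_times_binomial ac_simps)
 also have "\<dots> = fact (Suc m) * ((t + Suc m) choose Suc m)" by (simp add: algebra_simps del: binomial_Suc_Suc)
 finally show ?case .
qed simp

text \<open>Turns a growth bound into a degree. The premise with \<open>M\<close>, which may be far
  too large, supplies that \<open>p\<close> is eventually polynomial; growth alone would say nothing
  about differences.\<close>

lemma ndg_bounded:
 assumes "ndg M p" "!!t. 0 <= p t" "!!t. p t <= int K * int (t + 1) ^ m"
 shows "ndg (Suc m) p"
proof (rule ndg_sandwich[OF assms(1), of _ "%t. int (K * fact m) * int ((t + m) choose m)" 0])
 show "ndg (Suc m) (%t. int (K * fact m) * int ((t + m) choose m))" by (rule ndg_cmult[OF ndg_binomial])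
 have "p t <= int (K * fact m) * int ((t + m) choose m)" for t
 proof -
  have "p t <= int (K * (t + 1) ^ m)" using assms(3)[of t] by simp
  also have "\<dots> <= int (K * (fact m * ((t + m) choose m)))"
   using power_le_binomial by (intro of_nat_mono mult_left_mono) auto
  finally show ?thesis by (simp add: mult.assoc)
 qed
 then show "\<forall>t\<ge>0. 0 <= p t & p t <= int (K * fact m) * int ((t + m) choose m)"
  using assms by auto
qed

text \<open>The converse of \<open>ndg_bounded\<close>. \<open>K\<close> also has to absorb the
  finitely many values before \<open>h\<close> becomes polynomial.\<close>

lemma ndg_growth:
 assumes "ndg (Suc m) h"
 shows "\<exists>K::nat. \<forall>t. \<bar>h t\<bar> <= int K * int (t + 1) ^ m" using assms
proof (induction m arbitrary: h)
 case 0
 then obtain v c where c: "\<forall>t\<ge>c. h t = v" using ndg_evc[of 0 h] by auto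
 define K where "K = \<bar>v\<bar> + (\<Sum>t<c. \<bar>h t\<bar>)"
 have "\<bar>h t\<bar> <= K" for t
 proof (cases "t >= c")
  case True
  then show ?thesis using c by (auto simp: K_def intro: sum_nonneg)
 next
  case False
  then have "\<bar>h t\<bar> <= (\<Sum>t<c. \<bar>h t\<bar>)" by (intro member_le_sum) auto
  then show ?thesis by (simp add: K_def)
 qed
 moreover have "0 <= K" by (auto simp: K_def intro: sum_nonneg)
 ultimately show ?case by (intro exI[of _ "nat K"]) auto
next
 case (Suc m)
 then obtain K where K: "!!t. \<bar>nd h t\<bar> <= int K * int (t + 1) ^ m" by auto
 have step: "\<bar>h t\<bar> <= \<bar>h 0\<bar> + int t * (int K * int (t + 1) ^ m)" for t
 proof (induction t)
  case (Suc t)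
  have "\<bar>h (Suc t)\<bar> <= \<bar>h t\<bar> + \<bar>nd h t\<bar>" by (simp add: nd_def)
  also have "\<dots> <= \<bar>h 0\<bar> + int t * (int K * int (t + 1) ^ m) + int K * int (t + 1) ^ m"
   using Suc K[of t] by linarith
  also have "\<dots> = \<bar>h 0\<bar> + int (Suc t) * (int K * int (t + 1) ^ m)" by (simp add: algebra_simps)
  also have "\<dots> <= \<bar>h 0\<bar> + int (Suc t) * (int K * int (Suc t + 1) ^ m)"
   by (intro add_left_mono mult_left_mono power_mono) auto
  finally show ?case .
 qed simp
 have "\<bar>h t\<bar> <= int (nat \<bar>h 0\<bar> + K) * int (t + 1) ^ Suc m" for t
 proof -
  have "int t * (int K * int (t + 1) ^ m) <= int K * int (t + 1) ^ Suc m"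
   using mult_right_mono[of "int t" "int (t + 1)" "int K * int (t + 1) ^ m"] by (simp add: ac_simps)
  moreover have "\<bar>h 0\<bar> * 1 <= \<bar>h 0\<bar> * int (t + 1) ^ Suc m"
   by (intro mult_left_mono) (auto simp: one_le_power simp del: power_Suc)
  moreover have "int (nat \<bar>h 0\<bar> + K) * int (t + 1) ^ Suc m
    = \<bar>h 0\<bar> * int (t + 1) ^ Suc m + int K * int (t + 1) ^ Suc m"
   by (simp add: distrib_right del: power_Suc)
  ultimately show ?thesis using step[of t] by linarith
 qed
 then show ?case by blast
qed

section \<open>Rings of polynomial functions\<close>

abbreviation pol :: "('a::affine_space => complex) => bool" where
 "pol \<equiv> polynomial_fun"

abbreviation \<I> :: "'a::affine_space set => ('a => complex) set" where
 "\<I> \<equiv> vanishing_ideal"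

lemma pol_const: "pol (%_. c)"
 by (rule polynomial_fun.const)

lemma pol_0: "pol 0"
 unfolding zero_fun_def by (rule pol_const)

lemma pol_1: "pol 1"
 unfolding one_fun_def by (rule pol_const)

lemma pol_add: "pol f ==> pol g ==> pol (f + g)"
 unfolding plus_fun_def by (rule polynomial_fun.add)

lemma pol_mult: "pol f ==> pol g ==> pol (f * g)"
 unfolding times_fun_def by (rule polynomial_fun.mult)

lemma fsc_eq_mult: "fsc c f = (%_. c) * f"
 by (simp add: fsc_def times_fun_def)

lemma pol_fsc: "pol f ==> pol (fsc c f)"
 unfolding fsc_eq_mult by (rule pol_mult[OF pol_const])

lemma pol_uminus: "pol f ==> pol (- f)"
 using pol_fsc[of f "-1"] by (simp add: fsc_def fun_Compl_def)

lemma pol_diff: "pol f ==> pol g ==> pol (f - g)"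
 using pol_add[of f "- g"] pol_uminus[of g] by simp

lemma pol_sum: "(!!i. i \<in> A ==> pol (f i)) ==> pol (\<Sum>i\<in>A. f i)"
 by (induction A rule: infinite_finite_induct) (auto intro: pol_0 pol_add)

lemma pol_prod: "(!!i. i \<in> A ==> pol (f i)) ==> pol (\<Prod>i\<in>A. f i)"
 by (induction A rule: infinite_finite_induct) (auto intro: pol_1 pol_mult)

lemma pol_power: "pol f ==> pol (f ^ n)"
 by (induction n) (auto intro: pol_1 pol_mult)

lemma power_fun_apply: "(f ^ n) x = f x ^ n" for f :: "'a => 'b::comm_semiring_1"
 by (induction n) auto

lemma prod_fun_apply: "(\<Prod>i\<in>A. f i) x = (\<Prod>i\<in>A. f i x)" for f :: "'i => 'a => 'b::comm_semiring_1"
 by (induction A rule: infinite_finite_induct) auto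

lemma subspace_pol: "fs.subspace (Collect pol)"
 by (auto simp: fs.subspace_def pol_0 pol_add pol_fsc simp del: fsc_apply)

subsection \<open>Ideals\<close>

text \<open>The same notion as \<open>ideal\<close> in \<open>polynomial_ring\<close>, by
  \<open>pideal_iff_ideal\<close>, but phrased with pointwise operations on functions.\<close>

definition pideal :: "('a::affine_space => complex) set => bool" where
 "pideal I \<longleftrightarrow> I \<subseteq> Collect pol & 0 \<in> I & (\<forall>f\<in>I. \<forall>g\<in>I. f + g \<in> I) &
   (\<forall>f\<in>I. \<forall>g. pol g --> g * f \<in> I)"

text \<open>The ideal quotient \<open>(I : a)\<close>; the next definition is the sum
  \<open>I + (a)\<close>. Together they describe kernel and cokernel of multiplication by
  \<open>a\<close> on the ring modulo \<open>I\<close>.\<close>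

definition colon :: "('a::affine_space => complex) set => ('a => complex) => ('a => complex) set" where
 "colon I a = {f. pol f & a * f \<in> I}"

definition adjoin :: "('a::affine_space => complex) set => ('a => complex) => ('a => complex) set" where
 "adjoin I a = {f + a * g | f g. f \<in> I & pol g}"

definition pprime :: "('a::affine_space => complex) set => bool" where
 "pprime P \<longleftrightarrow> pideal P & 1 ~: P & (\<forall>f g. pol f & pol g & f * g \<in> P --> f \<in> P \<or> g \<in> P)"

lemma pidealD:
 assumes "pideal I"
 shows "f \<in> I ==> pol f" "0 \<in> I" "f \<in> I ==> g \<in> I ==> f + g \<in> I"
  "f \<in> I ==> pol g ==> g * f \<in> I" "f \<in> I ==> pol g ==> f * g \<in> I"
  "f \<in> I ==> fsc c f \<in> I" "f \<in> I ==> - f \<in> I" "f \<in> I ==> g \<in> I ==> f - g \<in> I"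
proof -
 show *: "f \<in> I ==> pol f" "0 \<in> I" "f \<in> I ==> g \<in> I ==> f + g \<in> I"
  and m: "f \<in> I ==> pol g ==> g * f \<in> I" for f g using assms unfolding pideal_def by blast+
 show "f \<in> I ==> pol g ==> f * g \<in> I" using m[of f g] by (simp only: mult.commute)
 show s: "f \<in> I ==> fsc c f \<in> I" for f c unfolding fsc_eq_mult by (rule m[OF _ pol_const])
 show u: "f \<in> I ==> - f \<in> I" for f using s[of f "-1"] by (simp add: fsc_def fun_Compl_def)
 show "f \<in> I ==> g \<in> I ==> f - g \<in> I" using *(3)[of f "- g"] u[of g] by simp
qed

lemma pideal_subspace: "pideal I ==> fs.subspace I"
 unfolding fs.subspace_def using pidealD(2,3,6) by blast

lemma pideal_sum: "pideal I ==> (!!i. i \<in> A ==> f i \<in> I) ==> (\<Sum>i\<in>A. f i) \<in> I"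
 using fs.subspace_sum[OF pideal_subspace] .

lemma pideal_1: "pideal I ==> 1 \<in> I ==> pol f ==> f \<in> I"
 using pidealD(4)[of I 1 f] by simp

lemma pideal_const: "pideal I ==> (%_. c) \<in> I ==> c ~= 0 ==> 1 \<in> I"
 using pidealD(6)[of I "%_. c" "1 / c"] by (simp add: fsc_def one_fun_def)

lemma pideal_colon: "pideal I ==> pideal (colon I a)"
proof -
 assume I: "pideal I"
 show ?thesis unfolding pideal_def
 proof (intro conjI ballI allI impI)
  show "colon I a \<subseteq> Collect pol" by (auto simp: colon_def)
  show "0 \<in> colon I a" unfolding colon_def using pidealD(2)[OF I] pol_0 by simp
  show "f + g \<in> colon I a" if "f \<in> colon I a" "g \<in> colon I a" for f g
   using that pidealD(3)[OF I, of "a * f" "a * g"] pol_add unfolding colon_def mem_Collect_eq distrib_left by blast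
  show "g * f \<in> colon I a" if "f \<in> colon I a" "pol g" for f g
   using that pidealD(4)[OF I, of "a * f" g] pol_mult
   unfolding colon_def mem_Collect_eq mult.left_commute[of a] by blast
 qed
qed

lemma colon_superset: "pideal I ==> pol a ==> I \<subseteq> colon I a"
 unfolding colon_def using pidealD(1,4)[of I] by blast

lemma pideal_adjoin:
 assumes "pideal I" "pol a"
 shows "pideal (adjoin I a)" unfolding pideal_def
proof (intro conjI ballI allI impI)
 show "adjoin I a \<subseteq> Collect pol"
  unfolding adjoin_def using assms pidealD(1) by (auto intro: pol_add pol_mult)
 have "0 = 0 + a * 0" by simp
 then show "0 \<in> adjoin I a" unfolding adjoin_def using pidealD(2)[OF assms(1)] pol_0 by blast
next
 fix u v assume "u \<in> adjoin I a" "v \<in> adjoin I a"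
 then obtain f g f' g' where *: "u = f + a * g" "v = f' + a * g'" "f \<in> I" "f' \<in> I" "pol g" "pol g'"
  unfolding adjoin_def by blast
 then have "u + v = (f + f') + a * (g + g')" by (simp add: algebra_simps)
 then show "u + v \<in> adjoin I a" unfolding adjoin_def using * pidealD(3)[OF assms(1)] pol_add by blast
next
 fix u and h :: "'a => complex" assume "u \<in> adjoin I a" "pol (h :: 'a => complex)"
 then obtain f g where *: "u = f + a * g" "f \<in> I" "pol g" unfolding adjoin_def by blast
 then have "h * u = (h * f) + a * (h * g)" by (simp add: algebra_simps)
 then show "h * u \<in> adjoin I a"
  unfolding adjoin_def using * \<open>pol h\<close> pidealD(4)[OF assms(1)] pol_mult by blast
qed

lemma adjoin_superset: "I \<subseteq> adjoin I a"
proof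
 fix f assume "f \<in> I"
 moreover have "f = f + a * 0" by simp
 ultimately show "f \<in> adjoin I a" unfolding adjoin_def using pol_0 by blast
qed

lemma adjoin_mem: "pideal I ==> a \<in> adjoin I a"
proof -
 assume "pideal I"
 moreover have "a = 0 + a * 1" by simp
 ultimately show "a \<in> adjoin I a" unfolding adjoin_def using pidealD(2) pol_1 by blast
qed

lemma adjoin_minimal: "pideal J ==> I \<subseteq> J ==> a \<in> J ==> adjoin I a \<subseteq> J"
 unfolding adjoin_def using pidealD(3,5) by blast

lemma adjoin_psubset: "pideal I ==> a ~: I ==> I \<subset> adjoin I a"
 using adjoin_superset[of I a] adjoin_mem[of I a] by blast

lemma pprimeD:
 assumes "pprime P"
 shows "pideal P" "1 ~: P" "pol f ==> pol g ==> f * g \<in> P ==> f \<in> P \<or> g \<in> P"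
 using assms unfolding pprime_def by blast+

lemma pprime_const: "pprime P ==> (%_. c) \<in> P ==> c = 0"
 using pideal_const pprimeD(1,2) by blast

lemma pprime_power: "pprime P ==> pol f ==> f ^ n \<in> P ==> f \<in> P"
proof (induction n)
 case 0
 then show ?case using pprimeD(2)[of P] by (simp only: power_0)
next
 case (Suc n)
 then show ?case using pprimeD(3)[of P f "f ^ n"] pol_power[of f n] unfolding power_Suc by blast
qed

lemma pprime_prod:
 assumes "pprime P" "finite A" "!!i. i \<in> A ==> pol (f i)" "(\<Prod>i\<in>A. f i) \<in> P"
 shows "\<exists>i\<in>A. f i \<in> P" using assms(2,3,4)
proof (induction A)
 case empty
 then show ?case using pprimeD(2)[OF assms(1)] by (simp only: prod.empty)
next
 case (insert i A)
 then have "f i * (\<Prod>i\<in>A. f i) \<in> P" by (simp only: prod.insert[OF insert.hyps] simp_thms)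
 then have "f i \<in> P \<or> (\<Prod>i\<in>A. f i) \<in> P"
  using pprimeD(3)[OF assms(1)] pol_prod[of A f] insert by auto
 then show ?case using insert by auto
qed

lemma vanishing_ideal_pideal: "pideal (\<I> S)"
 unfolding pideal_def vanishing_ideal_def by (auto simp: pol_0 pol_add pol_mult)

lemma vanD: "f \<in> \<I> S ==> x \<in> S ==> f x = 0"
 by (simp add: vanishing_ideal_def)

lemma vanishing_ideal_antimono: "S \<subseteq> T ==> \<I> T \<subseteq> \<I> S"
 by (auto simp: vanishing_ideal_def)

definition zset :: "('a => complex) set => 'a set" where
 "zset I = {x. \<forall>f\<in>I. f x = 0}"

lemma subset_zset_vanishing: "S \<subseteq> zset (\<I> S)"
 by (auto simp: zset_def vanishing_ideal_def)

lemma zset_antimono: "I \<subseteq> J ==> zset J \<subseteq> zset I"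
 by (auto simp: zset_def)

subsection \<open>A monomial order\<close>

text \<open>Exponent vectors are ordered by the integers with the corresponding prime factorisation;
 this order is total, multiplicative and well-founded.\<close>

definition primes_of :: "'i::finite => nat" where
 "primes_of = (SOME f. inj f & (\<forall>i. prime (f i)))"

lemma primes_of: "inj (primes_of :: 'i::finite => nat)" "prime (primes_of (i :: 'i))"
proof -
 have "\<exists>B. finite B & card B = card (UNIV :: 'i set) & B \<subseteq> {p::nat. prime p}"
  using infinite_arbitrarily_large[OF primes_infinite] by metis
 then obtain B where B: "finite B" "card B = card (UNIV :: 'i set)" "B \<subseteq> {p::nat. prime p}" by blast
 then obtain f :: "'i => nat" where f: "bij_betw f UNIV B" using finite_same_card_bij[of "UNIV :: 'i set" B] by auto
 then have "inj f" "\<forall>i. prime (f i)" using B(3) by (auto simp: bij_betw_def)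
 then have "\<exists>f :: 'i => nat. inj f & (\<forall>i. prime (f i))" by blast
 from someI_ex[OF this] show "inj (primes_of :: 'i => nat)" "prime (primes_of (i :: 'i))"
  unfolding primes_of_def by blast+
qed

definition nrm :: "('i::finite => nat) => nat" where
 "nrm e = (\<Prod>i\<in>UNIV. primes_of i ^ e i)"

lemma nrm_add: "nrm (e + e') = nrm e * nrm e'"
 by (simp add: nrm_def power_add prod.distrib)

lemma nrm_pos: "nrm e > 0"
 unfolding nrm_def by (intro prod_pos) (simp add: prime_gt_0_nat[OF primes_of(2)])

lemma nrm_inj: "nrm e = nrm e' ==> e = e'"
proof
 fix i assume eq: "nrm e = nrm e'"
 have "multiplicity (primes_of i) (nrm e) = e i" for e :: "'a => nat"
 proof -
  have "nrm e = (\<Prod>p\<in>range (primes_of :: 'a => nat). p ^ e (the_inv primes_of p))"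
   unfolding nrm_def prod.reindex[OF primes_of(1)]
   by (intro prod.cong refl) (simp only: o_apply the_inv_f_f[OF primes_of(1)])
  then have "multiplicity (primes_of i) (nrm e) =
    multiplicity (primes_of i) (\<Prod>p\<in>range (primes_of :: 'a => nat). p ^ e (the_inv primes_of p))" by simp
  also have "\<dots> = e (the_inv primes_of (primes_of i))"
   by (subst multiplicity_prod_prime_powers) (auto simp: primes_of(2))
  finally show ?thesis by (simp add: the_inv_f_f[OF primes_of(1)])
 qed
 then show "e i = e' i" using eq by metis
qed

lemma mono_subseq_nat:
 fixes s :: "nat => nat"
 obtains r :: "nat => nat" where "strict_mono r" "mono (%n. s (r n))"
proof -
 obtain f where f: "strict_mono f" "monoseq (%n. s (f n))" using seq_monosub by blast
 show ?thesis
 proof (cases "incseq (%n. s (f n))")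
  case True
  then show ?thesis using that[of f] f by (simp add: mono_def)
 next
  case False
  then have dec: "!!m n. m <= n ==> s (f n) <= s (f m)"
   using f(2) unfolding monoseq_def incseq_def by blast
  obtain n0 where n0: "!!n. s (f n0) <= s (f n)"
   using ex_has_least_nat[of "%_. True" 0 "%n. s (f n)"] by blast
  have "s (f (n + n0)) = s (f n0)" for n using n0[of "n + n0"] dec[of n0 "n + n0"] by simp
  then have "mono (%n. s (f (n + n0)))" by (simp add: mono_def)
  moreover have "strict_mono (%n. f (n + n0))" using f(1) by (simp add: strict_mono_def)
  ultimately show ?thesis using that by blast
 qed
qed

text \<open>Dickson's lemma: pass to subsequences that are monotone in one coordinate after the
  other.\<close>

lemma dickson:
 fixes e :: "nat => 'i::finite => nat"
 obtains i j where "i < j" "!!k. e i k <= e j k"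
proof -
 have "\<exists>r::nat=>nat. strict_mono r & (\<forall>k\<in>A. mono (%n. e (r n) k))" for A :: "'i set"
 proof (induction A rule: infinite_finite_induct)
  case empty
  show ?case by (intro exI[of _ "%n. n"]) (simp add: strict_mono_def)
 next
  case (insert a A)
  from insert.IH obtain r :: "nat => nat" where r: "strict_mono r" "\<forall>k\<in>A. mono (%n. e (r n) k)"
   by (elim exE conjE)
  obtain q :: "nat => nat" where q: "strict_mono q" "mono (%n. e (r (q n)) a)"
   using mono_subseq_nat[of "%n. e (r n) a"] .
  have "mono (%n. e (r (q n)) k)" if "k \<in> A" for k
   using r(2) that q(1) unfolding mono_def strict_mono_def by (metis le_less)
  moreover have "strict_mono (%n. r (q n))" using r(1) q(1) by (simp add: strict_mono_def)
  ultimately show ?case using q(2) by (intro exI[of _ "%n. r (q n)"]) auto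
 qed simp
 from this[of UNIV] obtain r :: "nat => nat" where r: "strict_mono r" "\<forall>k. mono (%n. e (r n) k)"
  by (auto elim: exE conjE)
 have "r 0 < r 1" using r(1) by (simp add: strict_mono_def)
 moreover have "e (r 0) k <= e (r 1) k" for k using r(2) unfolding mono_def by (metis zero_le)
 ultimately show ?thesis using that by blast
qed

text \<open>For an indexed family a repeated vector is already a dependency, so the case of a
  non-injective \<open>b\<close> gets its own coefficients 1 and -1.\<close>

lemma family_dependent:
 assumes "finite C" "findim V" "fs.dim V < card C" "!!c. c \<in> C ==> b c \<in> V"
 shows "\<exists>\<alpha>. (\<exists>c\<in>C. \<alpha> c ~= 0) & (\<Sum>c\<in>C. fsc (\<alpha> c) (b c)) = 0"
proof (cases "inj_on b C")
 case False
 then obtain c c' where c: "c \<in> C" "c' \<in> C" "c ~= c'" "b c = b c'" unfolding inj_on_def by blast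
 define \<alpha> where "\<alpha> = (%_. 0 :: complex)(c := 1, c' := -1)"
 have "(\<Sum>x\<in>C. fsc (\<alpha> x) (b x)) = (\<Sum>x\<in>{c,c'}. fsc (\<alpha> x) (b x))"
  by (rule sum.mono_neutral_right) (use assms(1) c in \<open>auto simp: \<alpha>_def\<close>)
 also have "\<dots> = 0" using c by (simp add: \<alpha>_def fs.scale_left_imp_eq)
 finally show ?thesis using c by (intro exI[of _ \<alpha>]) (auto simp: \<alpha>_def)
next
 case True
 have "\<not> fs.independent (b ` C)"
 proof
  assume "fs.independent (b ` C)"
  then have "card (b ` C) <= fs.dim V"
   using findim_independent_finite(2)[OF assms(2), of "b ` C"] assms(4) by auto
  then show False using assms(3) True by (simp add: card_image)
 qed
 then obtain u v where u: "(\<Sum>v\<in>b ` C. fsc (u v) v) = 0" "v \<in> b ` C" "u v ~= 0"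
  using fs.independent_if_scalars_zero[of "b ` C"] assms(1) by blast
 then show ?thesis using True by (intro exI[of _ "%c. u (b c)"]) (auto simp: sum.reindex)
qed

section \<open>Multigraded coordinate rings\<close>

text \<open>The coordinate \<open>X i\<close> is given the weight \<open>wt i\<close>, so that multidegrees are functions on
 the set of weights: one weight for \<open>\<P>\<^sup>N\<close> and for affine cones, two for \<open>\<P>\<^sup>N \<times> \<P>\<^sup>N\<close>.\<close>

lemma ex_max_nat:
 fixes f :: "'b => nat"
 assumes "finite S" "S ~= {}"
 shows "\<exists>x\<in>S. \<forall>y\<in>S. f y <= f x"
proof -
 have "Max (f ` S) \<in> f ` S" using assms by (intro Max_in) auto
 then obtain x where "x \<in> S" "Max (f ` S) = f x" by blast
 then show ?thesis using assms(1) by (metis Max_ge finite_imageI imageI)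
qed

locale graded_coords =
 fixes X :: "'i::finite => 'a::affine_space => complex" and wt :: "'i => 'k::finite"
 assumes coordinates_X: "coordinates = range X"
  and X_surj: "\<exists>x. \<forall>i. X i x = v i"
  and X_inj: "(!!i. X i x = X i y) ==> x = y"
begin

definition mon :: "('i => nat) => 'a => complex" where
 "mon e = (%x. \<Prod>i\<in>UNIV. X i x ^ e i)"

definition mdeg :: "('i => nat) => 'k => nat" where
 "mdeg e = (%k. \<Sum>i | wt i = k. e i)"

definition R :: "('k => nat) => ('a => complex) set" where
 "R g = fs.span (mon ` {e. mdeg e = g})"

definition sc :: "('k => complex) => 'a => 'a" where
 "sc s x = (SOME y. \<forall>i. X i y = s (wt i) * X i x)"

text \<open>Multihomogeneity of an ideal, expressed as invariance under the torus that scales the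
  coordinates of each weight separately. \<open>stable_component\<close> recovers the graded
  components from it.\<close>

definition stable :: "('a => complex) set => bool" where
 "stable V \<longleftrightarrow> (\<forall>f\<in>V. \<forall>s. (\<forall>k. s k ~= 0) --> (%x. f (sc s x)) \<in> V)"

definition eg :: "'k => 'k => nat" where
 "eg k = (%j. if j = k then 1 else 0)"

lemma X_sc [simp]: "X i (sc s x) = s (wt i) * X i x"
proof -
 have "\<exists>y. \<forall>i. X i y = s (wt i) * X i x" by (rule X_surj)
 from someI_ex[OF this] show ?thesis unfolding sc_def by blast
qed

lemma pol_X: "pol (X i)"
 using coordinates_X polynomial_fun.coord by blast

lemma mon_add: "mon (e + e') = mon e * mon e'"
 by (auto simp: mon_def power_add prod.distrib times_fun_def)

lemma pol_mon: "pol (mon e)"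
proof -
 have "mon e = (\<Prod>i\<in>UNIV. X i ^ e i)" by (rule ext) (simp only: mon_def prod_fun_apply power_fun_apply)
 then show ?thesis by (simp only:) (intro pol_prod pol_power pol_X)
qed

lemma mon_X: "mon ((%_. 0)(i := Suc 0)) = X i"
proof
 fix x
 have "(\<Prod>j\<in>UNIV. X j x ^ ((%_. 0)(i := Suc 0)) j) = (\<Prod>j\<in>UNIV. if j = i then X j x else 1)"
  by (intro prod.cong) auto
 then show "mon ((%_. 0)(i := Suc 0)) x = X i x" by (simp add: mon_def)
qed

lemma mdeg_add: "mdeg (e + e') = mdeg e + mdeg e'"
 by (auto simp: mdeg_def sum.distrib)

lemma mdeg_0: "mdeg 0 = 0"
 by (auto simp: mdeg_def)

lemma mdeg_X: "mdeg ((%_. 0)(i := Suc 0)) = eg (wt i)"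
proof
 fix k
 have "(\<Sum>j | wt j = k. ((%_. 0)(i := Suc 0)) j) = (\<Sum>j | wt j = k. if j = i then 1 else 0)"
  by (intro sum.cong) auto
 then show "mdeg ((%_. 0)(i := Suc 0)) k = eg (wt i) k" by (simp add: mdeg_def eg_def)
qed

lemma le_mdeg: "e i <= mdeg e (wt i)"
 unfolding mdeg_def by (rule member_le_sum) auto

lemma finite_mdeg: "finite {e. mdeg e = g}"
proof (rule finite_subset)
 show "{e. mdeg e = g} \<subseteq> Pi\<^sub>E UNIV (%i. {..g (wt i)})" using le_mdeg by auto
qed (auto intro: finite_PiE)

lemma findim_R: "findim (R g)"
 unfolding R_def by (intro findim_span finite_imageI finite_mdeg)

lemma subspace_R: "fs.subspace (R g)"
 unfolding R_def by simp

lemma R_pol: "f \<in> R g ==> pol f"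
 unfolding R_def using fs.span_minimal[OF _ subspace_pol, of "mon ` {e. mdeg e = g}"] pol_mon by auto

lemma mon_R: "mon e \<in> R (mdeg e)"
 unfolding R_def by (intro fs.span_base) auto

lemma X_R: "X i \<in> R (eg (wt i))"
 using mon_R[of "(%_. 0)(i := Suc 0)"] by (simp only: mon_X mdeg_X)

lemma const_R: "(%_. c) \<in> R 0"
proof -
 have "fsc c (mon 0) \<in> R 0" using fs.subspace_scale[OF subspace_R mon_R[of 0]] by (simp only: mdeg_0)
 moreover have "fsc c (mon 0) = (%_. c)" by (auto simp: mon_def)
 ultimately show ?thesis by (simp only:)
qed

lemma span_mult:
 assumes "f \<in> fs.span A" "g \<in> fs.span B" "!!a b. a \<in> A ==> b \<in> B ==> a * b \<in> fs.span C"
 shows "f * g \<in> fs.span C" using assms(1)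
proof (induction rule: fs.span_induct_alt)
 case base
 show ?case unfolding mult_zero_left by (rule fs.span_zero)
next
 case (step c a f)
 have "a * g \<in> fs.span C" using assms(2)
 proof (induction rule: fs.span_induct_alt)
  case base
  show ?case unfolding mult_zero_right by (rule fs.span_zero)
 next
  case (step d b g)
  have "a * (fsc d b + g) = fsc d (a * b) + a * g" by (auto simp: algebra_simps)
  then show ?case using step assms(3)[OF \<open>a \<in> A\<close>] fs.span_add fs.span_scale by metis
 qed
 moreover have "(fsc c a + f) * g = fsc c (a * g) + f * g" by (auto simp: algebra_simps)
 ultimately show ?case using step fs.span_add fs.span_scale by metis
qed

lemma R_mult: "f \<in> R g ==> f' \<in> R g' ==> f * f' \<in> R (g + g')"
 unfolding R_def
proof (rule span_mult)
 fix a b assume "a \<in> mon ` {e. mdeg e = g}" "b \<in> mon ` {e. mdeg e = g'}"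
 then obtain e e' where "a = mon e" "b = mon e'" "mdeg e = g" "mdeg e' = g'" by blast
 then have "a * b = mon (e + e')" "mdeg (e + e') = g + g'" by (simp_all only: mon_add mdeg_add)
 then show "a * b \<in> fs.span (mon ` {e. mdeg e = g + g'})" by (intro fs.span_base) blast
qed

lemma pol_span: "pol f \<longleftrightarrow> f \<in> fs.span (range mon)"
proof
 assume "pol f"
 then show "f \<in> fs.span (range mon)"
 proof (induction rule: polynomial_fun.induct)
  case (coord f)
  then obtain i where "f = X i" using coordinates_X by blast
  then have "f = mon ((%_. 0)(i := Suc 0))" by (simp only: mon_X)
  then show ?case by (intro fs.span_base) blast
 next
  case (const c)
  have "(%_. c) = fsc c (mon 0)" by (auto simp: mon_def)
  moreover have "fsc c (mon 0) \<in> fs.span (range mon)" by (intro fs.span_scale fs.span_base) blast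
  ultimately show ?case by (simp only:)
 next
  case (add f g)
  then show ?case using fs.span_add[OF add.IH] by (simp only: plus_fun_def)
 next
  case (mult f g)
  have "f * g \<in> fs.span (range mon)"
   by (rule span_mult[OF mult.IH]) (auto simp only: mon_add[symmetric] intro!: fs.span_base)
  then show ?case by (simp only: times_fun_def)
 qed
next
 show "f \<in> fs.span (range mon) ==> pol f"
  using fs.span_minimal[OF _ subspace_pol, of "range mon"] pol_mon by auto
qed

lemma span_mon_expand:
 assumes "f \<in> fs.span (mon ` A)"
 shows "\<exists>E c. finite E & E \<subseteq> A & f = (\<Sum>e\<in>E. fsc (c e) (mon e))" using assms
proof (induction rule: fs.span_induct_alt)
 case base
 have "finite {} & {} \<subseteq> A & 0 = (\<Sum>e\<in>{}. fsc (undefined e) (mon e))"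
  by (simp only: sum.empty) simp
 then show ?case by blast
next
 case (step c x y)
 obtain e0 where e0: "x = mon e0" "e0 \<in> A" using step(1) by blast
 obtain E d where E: "finite E" "E \<subseteq> A" "y = (\<Sum>e\<in>E. fsc (d e) (mon e))" using step(2) by blast
 define d' where "d' e = (if e = e0 then c else 0) + (if e \<in> E then d e else 0)" for e
 have "(\<Sum>e\<in>insert e0 E. fsc (d' e) (mon e)) =
   (\<Sum>e\<in>insert e0 E. fsc (if e = e0 then c else 0) (mon e)) +
   (\<Sum>e\<in>insert e0 E. fsc (if e \<in> E then d e else 0) (mon e))"
  unfolding d'_def fs.scale_left_distrib by (rule sum.distrib)
 also have "(\<Sum>e\<in>insert e0 E. fsc (if e = e0 then c else 0) (mon e)) = (\<Sum>e\<in>{e0}. fsc c (mon e))"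
  using E(1) by (intro sum.mono_neutral_cong_right) auto
 also have "(\<Sum>e\<in>insert e0 E. fsc (if e \<in> E then d e else 0) (mon e)) = (\<Sum>e\<in>E. fsc (d e) (mon e))"
  using E(1) by (intro sum.mono_neutral_cong_right) auto
 finally have "(\<Sum>e\<in>insert e0 E. fsc (d' e) (mon e)) =
  (\<Sum>e\<in>{e0}. fsc c (mon e)) + (\<Sum>e\<in>E. fsc (d e) (mon e))" .
 moreover have "(\<Sum>e\<in>{e0}. fsc c (mon e)) = fsc c (mon e0)" by (rule ext) (simp add: sum_fun_apply)
 ultimately have "fsc c x + y = (\<Sum>e\<in>insert e0 E. fsc (d' e) (mon e))" unfolding e0(1) E(3) by (simp only:)
 moreover have "finite (insert e0 E)" "insert e0 E \<subseteq> A" using E e0 by auto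
 ultimately show ?case by blast
qed

lemma pol_decomp:
 assumes "pol f"
 obtains G F where "finite G" "!!g. F g \<in> R g" "f = (\<Sum>g\<in>G. F g)"
proof -
 have "f \<in> fs.span (mon ` UNIV)" using assms pol_span by blast
 from span_mon_expand[OF this] obtain E c where E: "finite E" "f = (\<Sum>e\<in>E. fsc (c e) (mon e))" by blast
 define F where "F g = (\<Sum>e | e \<in> E & mdeg e = g. fsc (c e) (mon e))" for g
 have "F g \<in> R g" for g
  unfolding F_def by (intro fs.subspace_sum[OF subspace_R] fs.subspace_scale[OF subspace_R])
   (use mon_R in auto)
 moreover have "f = (\<Sum>g\<in>mdeg ` E. F g)"
  unfolding F_def E(2) by (rule sum.group[symmetric]) (use E(1) in auto)
 ultimately show ?thesis using that E(1) by blast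
qed

lemma mon_sc: "mon e (sc s x) = (\<Prod>k\<in>UNIV. s k ^ mdeg e k) * mon e x"
proof -
 have "(\<Prod>i\<in>UNIV. s (wt i) ^ e i) = (\<Prod>k\<in>UNIV. \<Prod>i | i \<in> UNIV & wt i = k. s (wt i) ^ e i)"
  by (rule prod.group[symmetric]) auto
 also have "\<dots> = (\<Prod>k\<in>UNIV. s k ^ mdeg e k)" unfolding mdeg_def power_sum by (intro prod.cong) auto
 finally show ?thesis by (simp add: mon_def power_mult_distrib prod.distrib)
qed

lemma R_sc: "f \<in> R g ==> f (sc s x) = (\<Prod>k\<in>UNIV. s k ^ g k) * f x"
 unfolding R_def
proof (induction rule: fs.span_induct_alt)
 case (step c u v)
 then show ?case by (auto simp: mon_sc algebra_simps)
qed simp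

lemma pol_sc: "pol f ==> pol (%x. f (sc s x))"
proof (induction rule: polynomial_fun.induct)
 case (coord f)
 then obtain i where i: "f = X i" using coordinates_X by blast
 have "pol (%x. s (wt i) * X i x)" by (intro polynomial_fun.mult polynomial_fun.const pol_X)
 then show ?case using i by simp
qed (auto intro: polynomial_fun.intros)

lemma stableD: "stable V ==> f \<in> V ==> (!!k. s k ~= 0) ==> (%x. f (sc s x)) \<in> V"
 by (simp add: stable_def)

text \<open>Doubling the coordinates of weight \<open>k\<close> multiplies the component of degree
  \<open>h\<close> by \<open>2 ^ h k\<close>. Subtracting \<open>2 ^ g0 k\<close> times the sum
  removes the component \<open>g0\<close>, and it keeps a nonzero multiple of the component
  \<open>g\<close> if \<open>k\<close> is a place where \<open>g0\<close> and \<open>g\<close>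
  differ.\<close>

lemma stable_component:
 assumes "fs.subspace V" "stable V" "finite G" "!!g. g \<in> G ==> F g \<in> R g" "(\<Sum>g\<in>G. F g) \<in> V" "g \<in> G"
 shows "F g \<in> V" using assms(3-6)
proof (induction "card G" arbitrary: G F g)
 case 0
 then show ?case by auto
next
 case (Suc n)
 show ?case
 proof (cases "G = {g}")
  case True
  then show ?thesis using Suc.prems(3) by simp
 next
  case False
  then obtain g0 where g0: "g0 \<in> G" "g0 ~= g" using Suc.prems(4) by blast
  then obtain k where k: "g0 k ~= g k" by blast
  define s :: "'k => complex" where "s = (%_. 1)(k := 2)"
  have sp: "(\<Prod>j\<in>UNIV. s j ^ h j) = 2 ^ h k" for h by (subst prod.remove[of _ k]) (auto simp: s_def)
  have "(%x. (\<Sum>g\<in>G. F g) (sc s x)) \<in> V"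
   by (rule stableD[OF assms(2) Suc.prems(3)]) (simp add: s_def)
  then have "(%x. (\<Sum>g\<in>G. F g) (sc s x)) - fsc (2 ^ g0 k) (\<Sum>g\<in>G. F g) \<in> V"
   using assms(1) Suc.prems(3) by (intro fs.subspace_diff fs.subspace_scale)
  also have "(%x. (\<Sum>g\<in>G. F g) (sc s x)) - fsc (2 ^ g0 k) (\<Sum>g\<in>G. F g) =
    (\<Sum>h\<in>G. fsc (2 ^ h k - 2 ^ g0 k) (F h))"
  proof
   fix x
   have "(\<Sum>g\<in>G. F g) (sc s x) = (\<Sum>h\<in>G. 2 ^ h k * F h x)"
    unfolding sum_fun_apply by (intro sum.cong refl) (simp only: R_sc[OF Suc.prems(2)] sp)
   then show "((%x. (\<Sum>g\<in>G. F g) (sc s x)) - fsc (2 ^ g0 k) (\<Sum>g\<in>G. F g)) x =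
     (\<Sum>h\<in>G. fsc (2 ^ h k - 2 ^ g0 k) (F h)) x"
    by (simp add: sum_fun_apply left_diff_distrib sum_subtractf sum_distrib_left)
  qed
  also have "\<dots> = (\<Sum>h\<in>G - {g0}. fsc (2 ^ h k - 2 ^ g0 k) (F h))"
   using Suc.prems(1) g0(1) by (intro sum.mono_neutral_right) auto
  finally have *: "(\<Sum>h\<in>G - {g0}. fsc (2 ^ h k - 2 ^ g0 k) (F h)) \<in> V" .
  have "fsc (2 ^ g k - 2 ^ g0 k) (F g) \<in> V"
  proof (rule Suc.hyps(1)[of "G - {g0}" "%h. fsc (2 ^ h k - 2 ^ g0 k) (F h)" g])
   show "n = card (G - {g0})" using Suc.hyps(2) Suc.prems(1) g0(1) by simp
   show "fsc (2 ^ h k - 2 ^ g0 k) (F h) \<in> R h" if "h \<in> G - {g0}" for h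
    using that Suc.prems(2) by (intro fs.subspace_scale subspace_R) auto
  qed (use * Suc.prems g0 in auto)
  from fs.subspace_scale[OF assms(1) this, of "1 / (2 ^ g k - 2 ^ g0 k)"]
  have "fsc (1 / (2 ^ g k - 2 ^ g0 k) * (2 ^ g k - 2 ^ g0 k)) (F g) \<in> V" by (simp only: fs.scale_scale)
  moreover have "(2::complex) ^ g k - 2 ^ g0 k ~= 0"
  proof
   assume "(2::complex) ^ g k - 2 ^ g0 k = 0"
   then have "of_nat (2 ^ g k) = (of_nat (2 ^ g0 k) :: complex)" by simp
   then have "(2::nat) ^ g k = 2 ^ g0 k" unfolding of_nat_eq_iff .
   then show False using k by simp
  qed
  ultimately show ?thesis by simp
 qed
qed

lemma stable_vanishing_ideal:
 assumes "!!x s. x \<in> S ==> (!!k. s k ~= 0) ==> sc s x \<in> S"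
 shows "stable (\<I> S)" using assms pol_sc by (auto simp: stable_def vanishing_ideal_def)

lemma stable_colon:
 assumes "pideal I" "stable I" "a \<in> R h"
 shows "stable (colon I a)" unfolding stable_def
proof (intro ballI allI impI)
 fix f and s :: "'k => complex" assume f: "f \<in> colon I a" and s: "\<forall>k. s k ~= 0"
 define c where "c = (\<Prod>k\<in>UNIV. s k ^ h k)"
 have c: "c ~= 0" using s by (simp add: c_def)
 have "a * f \<in> I" using f unfolding colon_def by blast
 then have "(%x. (a * f) (sc s x)) \<in> I" by (rule stableD[OF assms(2)]) (use s in blast)
 also have "(%x. (a * f) (sc s x)) = fsc c (a * (%x. f (sc s x)))"
  using R_sc[OF assms(3), of s] by (auto simp: c_def)
 finally have "fsc (1 / c) (fsc c (a * (%x. f (sc s x)))) \<in> I" by (rule pidealD(6)[OF assms(1)])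
 moreover have "fsc (1 / c) (fsc c u) = u" for u :: "'a => complex" using c by (auto simp: fun_eq_iff)
 ultimately have "a * (%x. f (sc s x)) \<in> I" by metis
 then show "(%x. f (sc s x)) \<in> colon I a" using f pol_sc unfolding colon_def by blast
qed

lemma stable_adjoin:
 assumes "pideal I" "stable I" "a \<in> R h"
 shows "stable (adjoin I a)" unfolding stable_def
proof (intro ballI allI impI)
 fix u and s :: "'k => complex" assume "u \<in> adjoin I a" and s: "\<forall>k. s k ~= 0"
 then obtain f g where fg: "u = f + a * g" "f \<in> I" "pol g" unfolding adjoin_def by blast
 have "(%x. u (sc s x)) = (%x. f (sc s x)) + a * fsc (\<Prod>k\<in>UNIV. s k ^ h k) (%x. g (sc s x))"
  using R_sc[OF assms(3), of s] fg(1) by (auto simp: algebra_simps)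
 moreover have "(%x. f (sc s x)) \<in> I" "pol (fsc (\<Prod>k\<in>UNIV. s k ^ h k) (%x. g (sc s x)))"
  using stableD[OF assms(2) fg(2)] s pol_fsc[OF pol_sc[OF fg(3)]] by blast+
 ultimately show "(%x. u (sc s x)) \<in> adjoin I a" unfolding adjoin_def by blast
qed

lemma homogeneous_witness:
 assumes "pideal I" "pideal J" "stable J" "\<not> J \<subseteq> I"
 obtains a h where "a \<in> R h" "a \<in> J" "a ~: I"
proof -
 obtain f where f: "f \<in> J" "f ~: I" using assms(4) by blast
 obtain G F where G: "finite G" "!!g. F g \<in> R g" "f = (\<Sum>g\<in>G. F g)"
  using pol_decomp[OF pidealD(1)[OF assms(2) f(1)]] by blast
 have *: "F g \<in> J" if "g \<in> G" for g
  by (rule stable_component[OF pideal_subspace[OF assms(2)] assms(3) G(1)]) (use G f that in auto)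
 have "\<exists>g\<in>G. F g ~: I" using f(2) G(3) pideal_sum[OF assms(1), of G F] by blast
 then show ?thesis using that G(2) * by blast
qed

text \<open>Modulo \<open>P\<close>, keep only the components outside \<open>P\<close> and take the
  largest multidegrees \<open>g\<close> and \<open>h\<close> of the two factors in the order by
  \<open>nrm\<close>. As this order is total and multiplicative, \<open>(g, h)\<close> is the only
  pair with sum \<open>g + h\<close>, so the product of the two top components is a component of the
  product.\<close>

lemma homogeneous_prime:
 assumes P: "pideal P" "stable P" "1 ~: P"
  and hom: "!!f f' g g'. f \<in> R g ==> f' \<in> R g' ==> f * f' \<in> P ==> f \<in> P \<or> f' \<in> P"
 shows "pprime P" unfolding pprime_def
proof (intro conjI allI impI P)
 fix f f' assume ff: "pol f & pol f' & f * f' \<in> P"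
 show "f \<in> P \<or> f' \<in> P"
 proof (rule ccontr)
  assume "\<not> (f \<in> P \<or> f' \<in> P)"
  then have nf: "f ~: P" "f' ~: P" by auto
  have top: "\<exists>G F g. finite G & (\<forall>g. F g \<in> R g) & f - (\<Sum>g\<in>G. F g) \<in> P & g \<in> G &
    F g ~: P & (\<forall>g'\<in>G. nrm g' <= nrm g)" if f: "pol f" "f ~: P" for f
  proof -
   obtain G F where G: "finite G" "!!g. F g \<in> R g" "f = (\<Sum>g\<in>G. F g)"
    using pol_decomp[OF f(1)] by blast
   let ?G = "{g\<in>G. F g ~: P}"
   have "f = (\<Sum>g\<in>?G. F g) + (\<Sum>g\<in>G - ?G. F g)"
    unfolding G(3) by (subst sum.subset_diff[of ?G G]) (use G(1) in \<open>auto simp only: add.commute\<close>)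
   then have "f - (\<Sum>g\<in>?G. F g) = (\<Sum>g\<in>G - ?G. F g)" by (simp only: add_diff_cancel_left')
   also have "\<dots> \<in> P" by (rule pideal_sum[OF P(1)]) auto
   finally have 1: "f - (\<Sum>g\<in>?G. F g) \<in> P" .
   have ne: "?G ~= {}"
   proof
    assume "?G = {}"
    then have "f - 0 \<in> P" using 1 by (simp only: sum.empty)
    then show False using f(2) by (simp only: diff_zero)
   qed
   have fin: "finite ?G" using G(1) by simp
   obtain g where "g \<in> ?G" "\<forall>g'\<in>?G. nrm g' <= nrm g"
    using ex_max_nat[OF fin ne, of nrm] by blast
   then show ?thesis using 1 G(2) fin by (intro exI[of _ ?G] exI[of _ F] exI[of _ g]) blast
  qed
  obtain G F g where G: "finite G" "\<forall>g. F g \<in> R g" "f - (\<Sum>g\<in>G. F g) \<in> P" "g \<in> G"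
   "F g ~: P" "\<forall>g'\<in>G. nrm g' <= nrm g" using top[of f] ff nf by blast
  obtain H F' h where H: "finite H" "\<forall>g. F' g \<in> R g" "f' - (\<Sum>g\<in>H. F' g) \<in> P" "h \<in> H"
   "F' h ~: P" "\<forall>g'\<in>H. nrm g' <= nrm h" using top[of f'] ff nf by blast
  let ?f = "\<Sum>g\<in>G. F g" and ?f' = "\<Sum>g\<in>H. F' g"
  have pf: "pol ?f" "pol ?f'" using G(2) H(2) R_pol by (blast intro: pol_sum)+
  have "?f * ?f' = f * f' - (f - ?f) * f' - (f' - ?f') * ?f" by (simp add: algebra_simps)
  moreover have "(f - ?f) * f' \<in> P" "(f' - ?f') * ?f \<in> P"
   using pidealD(5)[OF P(1) G(3)] pidealD(5)[OF P(1) H(3)] ff pf by blast+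
  then have "f * f' - (f - ?f) * f' - (f' - ?f') * ?f \<in> P" using ff pidealD(8)[OF P(1)] by blast
  ultimately have ffP: "?f * ?f' \<in> P" by (simp only:)
  define \<Phi> where "\<Phi> d = (\<Sum>p | p \<in> G \<times> H & fst p + snd p = d. F (fst p) * F' (snd p))" for d
  have "?f * ?f' = (\<Sum>p\<in>G \<times> H. F (fst p) * F' (snd p))"
   by (simp only: sum_product sum.cartesian_product split_def)
  also have "\<dots> = (\<Sum>d\<in>(%p. fst p + snd p) ` (G \<times> H). \<Phi> d)"
   unfolding \<Phi>_def by (rule sum.group[symmetric]) (use G(1) H(1) in auto)
  finally have 1: "(\<Sum>d\<in>(%p. fst p + snd p) ` (G \<times> H). \<Phi> d) \<in> P" using ffP by (simp only:)
  have "\<Phi> (g + h) \<in> P"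
  proof (rule stable_component[OF pideal_subspace[OF P(1)] P(2) _ _ 1])
   show "finite ((%p. fst p + snd p) ` (G \<times> H))" using G(1) H(1) by simp
   show "\<Phi> d \<in> R d" for d
    unfolding \<Phi>_def by (rule fs.subspace_sum[OF subspace_R]) (use G(2) H(2) R_mult in auto)
   show "g + h \<in> (%p. fst p + snd p) ` (G \<times> H)" using G(4) H(4) by force
  qed
  moreover have "{p. p \<in> G \<times> H & fst p + snd p = g + h} = {(g, h)}"
  proof -
   have "g' = g & h' = h" if *: "g' \<in> G" "h' \<in> H" "g' + h' = g + h" for g' h'
   proof -
    have eq: "nrm g' * nrm h' = nrm g * nrm h" using *(3) by (metis nrm_add)
    have le: "nrm g' <= nrm g" "nrm h' <= nrm h" using * G(6) H(6) by auto
    have "nrm g' = nrm g"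
    proof (rule ccontr)
     assume "nrm g' ~= nrm g"
     then have "nrm g' * nrm h' < nrm g * nrm h" using le nrm_pos by (intro mult_less_le_imp_less) auto
     then show False using eq by simp
    qed
    then have "g' = g" by (rule nrm_inj)
    then show ?thesis using *(3) by simp
   qed
   then show ?thesis using G(4) H(4) by auto
  qed
  ultimately have "F g * F' h \<in> P" by (simp add: \<Phi>_def)
  then show False using hom[of "F g" g "F' h" h] G(2,5) H(2,5) by blast
 qed
qed

subsection \<open>Noetherianity\<close>

text \<open>\<open>f\<close> is monic with leading exponent \<open>e\<close> in the order by
  \<open>nrm\<close>.\<close>

definition lead :: "('a => complex) => ('i => nat) => bool" where
 "lead f e \<longleftrightarrow> f - mon e \<in> fs.span (mon ` {e'. nrm e' < nrm e})"

lemma lead_exists: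
 assumes "f \<in> fs.span (mon ` {e. nrm e < N})" "f ~= 0"
 obtains a e where "a ~= 0" "nrm e < N" "lead (fsc a f) e"
proof -
 obtain E c where E: "finite E" "E \<subseteq> {e. nrm e < N}" "f = (\<Sum>e\<in>E. fsc (c e) (mon e))"
  using span_mon_expand[OF assms(1)] by blast
 let ?E = "{e\<in>E. c e ~= 0}"
 have f: "f = (\<Sum>e\<in>?E. fsc (c e) (mon e))" unfolding E(3) using E(1) by (intro sum.mono_neutral_right) auto
 have fin: "finite ?E" using E(1) by simp
 have ne: "?E ~= {}"
 proof
  assume E0: "?E = {}"
  have "f = 0" by (subst f) (simp only: E0 sum.empty)
  then show False using assms(2) by blast
 qed
 obtain e where e: "e \<in> ?E" "\<forall>e'\<in>?E. nrm e' <= nrm e" using ex_max_nat[OF fin ne, of nrm] by blast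
 have f': "f = fsc (c e) (mon e) + (\<Sum>e'\<in>?E - {e}. fsc (c e') (mon e'))"
  unfolding f by (rule sum.remove[OF fin e(1)])
 have fx: "f x = c e * mon e x + (\<Sum>e'\<in>?E - {e}. fsc (c e') (mon e')) x" for x
  using fun_cong[OF f', of x] unfolding plus_fun_apply fsc_apply .
 have "fsc (1 / c e) f - mon e = fsc (1 / c e) (\<Sum>e'\<in>?E - {e}. fsc (c e') (mon e'))"
 proof
  fix x
  show "(fsc (1 / c e) f - mon e) x = fsc (1 / c e) (\<Sum>e'\<in>?E - {e}. fsc (c e') (mon e')) x"
   using fx[of x] e(1) by (simp add: add_divide_distrib)
 qed
 also have "\<dots> \<in> fs.span (mon ` {e'. nrm e' < nrm e})"
 proof (intro fs.span_scale fs.span_sum)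
  fix e' assume e': "e' \<in> ?E - {e}"
  then have "nrm e' < nrm e" using e(2) nrm_inj[of e' e] le_neq_implies_less[of "nrm e'" "nrm e"] by blast
  then show "mon e' \<in> fs.span (mon ` {e'. nrm e' < nrm e})" by (intro fs.span_base) blast
 qed
 finally have "lead (fsc (1 / c e) f) e" unfolding lead_def .
 moreover have "1 / c e ~= 0" "nrm e < N" using e(1) E(2) by auto
 ultimately show ?thesis by (intro that)
qed

lemma lead_mult: "lead f e ==> lead (mon h * f) (h + e)"
proof -
 assume "lead f e"
 then have *: "f - mon e \<in> fs.span (mon ` {e'. nrm e' < nrm e})" by (simp add: lead_def)
 have "mon h * f - mon (h + e) = mon h * (f - mon e)" by (simp only: mon_add right_diff_distrib)
 also have "\<dots> \<in> fs.span (mon ` {e'. nrm e' < nrm (h + e)})"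
 proof (rule span_mult[OF _ *])
  show "mon h \<in> fs.span {mon h}" by (rule fs.span_base) simp
  fix a b assume "a \<in> {mon h}" "b \<in> mon ` {e'. nrm e' < nrm e}"
  then obtain e' where "a * b = mon (h + e')" "nrm e' < nrm e" by (auto simp only: mon_add)
  moreover from this have "nrm (h + e') < nrm (h + e)" using nrm_pos[of h] by (simp add: nrm_add)
  ultimately show "a * b \<in> fs.span (mon ` {e'. nrm e' < nrm (h + e)})" by (intro fs.span_base) blast
 qed
 finally show ?thesis unfolding lead_def .
qed

text \<open>Division with respect to the monomial order: subtracting an element of \<open>I\<close>
  with the same leading exponent lowers the bound \<open>N\<close>, and this stops because
  \<open>N\<close> is a natural number.\<close>

lemma lead_ideal_eq:
 assumes "pideal I" "pideal J" "I \<subseteq> J" and L: "!!f e. f \<in> J ==> lead f e ==> \<exists>g\<in>I. lead g e"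
 shows "I = J"
proof -
 have "f \<in> I" if "f \<in> J" "f \<in> fs.span (mon ` {e. nrm e < N})" for f N using that
 proof (induction N arbitrary: f rule: less_induct)
  case (less N)
  show ?case
  proof (cases "f = 0")
   case True
   then show ?thesis using pidealD(2)[OF assms(1)] by (simp only:)
  next
   case False
   obtain a e where a: "a ~= 0" "nrm e < N" "lead (fsc a f) e" using lead_exists[OF less.prems(2) False] .
   have aJ: "fsc a f \<in> J" using pidealD(6)[OF assms(2) less.prems(1)] .
   obtain g where g: "g \<in> I" "lead g e" using L[OF aJ a(3)] by blast
   have "fsc a f - g = (fsc a f - mon e) - (g - mon e)" by (simp only: diff_diff_eq2 add_diff_cancel_left' diff_add_cancel)
   also have "\<dots> \<in> fs.span (mon ` {e'. nrm e' < nrm e})"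
    using a(3) g(2) unfolding lead_def by (rule fs.span_diff)
   finally have "fsc a f - g \<in> I" using less.IH[OF a(2)] pidealD(8)[OF assms(2) aJ] g(1) assms(3) by blast
   then have "fsc a f - g + g \<in> I" using g(1) pidealD(3)[OF assms(1)] by blast
   then have "fsc a f \<in> I" by (simp only: diff_add_cancel)
   then have "fsc (1 / a) (fsc a f) \<in> I" using pidealD(6)[OF assms(1)] by blast
   then have "fsc (1 / a * a) f \<in> I" by (simp only: fs.scale_scale)
   moreover have "1 / a * a = 1" using a(1) by simp
   ultimately show ?thesis by (simp only: fs.scale_one)
  qed
 qed
 moreover have "\<exists>N. f \<in> fs.span (mon ` {e. nrm e < N})" if "f \<in> J" for f
 proof -
  have "f \<in> fs.span (mon ` UNIV)" using pidealD(1)[OF assms(2) that] pol_span by blast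
  from span_mon_expand[OF this]
  obtain E c where E: "finite E" "f = (\<Sum>e\<in>E. fsc (c e) (mon e))" by blast
  define N where "N = Suc (\<Sum>e\<in>E. nrm e)"
  have "nrm e < N" if "e \<in> E" for e using member_le_sum[of e E nrm] that E(1) by (simp add: N_def)
  then have "f \<in> fs.span (mon ` {e. nrm e < N})"
   unfolding E(2) by (intro fs.span_sum fs.span_scale fs.span_base) blast
  then show ?thesis by blast
 qed
 ultimately show ?thesis using assms(3) by blast
qed

text \<open>Each strict inclusion produces a leading exponent that is new. By \<open>dickson\<close>
  an earlier one divides a later one, and the corresponding monomial multiple, which lies in the
  ideal already reached, makes the later one old.\<close>

lemma no_ascending_ideals:
 fixes I :: "nat => ('a => complex) set"
 assumes I: "!!n. pideal (I n)" "!!n. I n \<subset> I (Suc n)"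
 shows False
proof -
 have mono: "I m \<subseteq> I n" if "m <= n" for m n
  using that by (induction rule: dec_induct) (use I(2) in auto)
 have "\<exists>e. (\<exists>f\<in>I (Suc n). lead f e) & \<not> (\<exists>g\<in>I n. lead g e)" for n
  using lead_ideal_eq[of "I n" "I (Suc n)"] I(1) I(2)[of n] by (metis psubset_imp_subset psubset_eq)
 then obtain e where e: "!!n. \<exists>f\<in>I (Suc n). lead f (e n)" "!!n. \<not> (\<exists>g\<in>I n. lead g (e n))"
  by metis
 obtain i j where ij: "i < j" "!!k. e i k <= e j k" using dickson[of e] by blast
 obtain f where f: "f \<in> I (Suc i)" "lead f (e i)" using e(1) by blast
 have "mon (%k. e j k - e i k) * f \<in> I (Suc i)" using pidealD(4)[OF I(1) f(1) pol_mon] .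
 moreover have "Suc i <= j" using ij(1) by simp
 ultimately have "mon (%k. e j k - e i k) * f \<in> I j" using mono by blast
 moreover have "lead (mon (%k. e j k - e i k) * f) ((%k. e j k - e i k) + e i)"
  by (rule lead_mult[OF f(2)])
 moreover have "(%k. e j k - e i k) + e i = e j" using ij(2) by (auto simp: fun_eq_iff)
 ultimately show False using e(2)[of j] by metis
qed

lemma wf_pideals: "wf {(J, I :: ('a => complex) set). pideal I & pideal J & I \<subset> J}"
 unfolding wf_iff_no_infinite_down_chain
proof
 assume "\<exists>f. \<forall>i. (f (Suc i), f i) \<in> {(J, I :: ('a => complex) set). pideal I & pideal J & I \<subset> J}"
 then obtain f :: "nat => ('a => complex) set"
  where f: "\<forall>i. (f (Suc i), f i) \<in> {(J, I). pideal I & pideal J & I \<subset> J}" ..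
 have "pideal (f n)" "f n \<subset> f (Suc n)" for n using f[rule_format, of n] by auto
 then show False by (rule no_ascending_ideals)
qed

lemma noetherian_induct [consumes 1, case_names step]:
 assumes "pideal (I :: ('a => complex) set)"
  and step: "!!I :: ('a => complex) set. pideal I ==> (!!J. pideal J ==> I \<subset> J ==> Q J) ==> Q I"
 shows "Q I" using assms(1)
proof (induction I rule: wf_induct_rule[OF wf_pideals])
 case (1 I)
 then show ?case using step by blast
qed

lemma maximal_pideal:
 assumes "!!I :: ('a => complex) set. I \<in> \<F> ==> pideal I" "I0 \<in> \<F>"
 obtains M where "M \<in> \<F>" "!!J. J \<in> \<F> ==> M \<subseteq> J ==> J = M"
proof -
 obtain M where M: "M \<in> \<F>" "!!J. (J, M) \<in> {(J, I). pideal I & pideal J & I \<subset> J} ==> J ~: \<F>"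
  by (rule wfE_min[OF wf_pideals assms(2)]) blast
 have "J = M" if "J \<in> \<F>" "M \<subseteq> J" for J using M(2)[of J] assms(1) M(1) that by blast
 then show ?thesis using that M(1) by blast
qed

subsection \<open>The Nullstellensatz\<close>

text \<open>Over the complex numbers the polynomial splits, and a prime ideal contains one of its
  linear factors.\<close>

lemma prime_contains_linear:
 assumes "pprime M" "p ~= 0" "(%x. poly p (X i x)) \<in> M"
 shows "\<exists>r. (%x. X i x - r) \<in> M" using assms(2,3)
proof (induction "degree p" arbitrary: p)
 case 0
 then obtain c where "p = [:c:]" "c ~= 0" by (metis degree_eq_zeroE pCons_0_0)
 then show ?case using 0 pprime_const[OF assms(1)] by auto
next
 case (Suc n)
 then have "\<not> constant (poly p)" by (simp add: constant_degree)
 then obtain r where r: "poly p r = 0" using fundamental_theorem_of_algebra by blast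
 then obtain q where q: "p = [:-r, 1:] * q" by (metis dvdE poly_eq_0_iff_dvd)
 have q0: "q ~= 0" using Suc.prems q by auto
 have "degree p = degree [:-r, 1:] + degree q" unfolding q by (rule degree_mult_eq) (use q0 in auto)
 then have "degree q = n" using Suc.hyps(2) by simp
 have pq: "pol (%x. poly q (X i x))" for q by (induction q) (auto intro!: polynomial_fun.intros(2-) pol_X)
 have "(%x. X i x - r) * (%x. poly q (X i x)) = (%x. poly p (X i x))"
  by (auto simp: q algebra_simps)
 then have "(%x. X i x - r) * (%x. poly q (X i x)) \<in> M" using Suc.prems by (simp only:)
 moreover have "pol (%x. X i x - r)"
  using pol_diff[OF pol_X pol_const[of r], of i] by (simp add: fun_diff_def)
 ultimately have "(%x. X i x - r) \<in> M \<or> (%x. poly q (X i x)) \<in> M"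
  using pprimeD(3)[OF assms(1)] pq by blast
 then show ?case using Suc.hyps(1)[of q] q0 \<open>degree q = n\<close> by auto
qed

lemma uncountable_pigeonhole:
 fixes t :: "complex => 'b::countable"
 obtains v where "infinite {c. t c = v}"
proof (rule ccontr)
 assume "\<not> thesis"
 then have "!!v. finite {c. t c = v}" using that by blast
 then have "countable (\<Union>v. {c. t c = v})" by (intro countable_UN) (auto intro: countable_finite)
 moreover have "(\<Union>v. {c. t c = v}) = UNIV" by auto
 ultimately show False using uncountable_UNIV_complex by simp
qed

text \<open>The cardinality argument for the Nullstellensatz. If no \<open>X i - c\<close> is in
  \<open>M\<close>, then each of the uncountably many \<open>c\<close> has an inverse
  \<open>b c\<close> up to a power of \<open>f\<close>. Countably many finite-dimensional spaces
  contain all \<open>b c\<close>, so infinitely many lie in one of them, with the same exponent, and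
  a linear dependency between these yields a polynomial relation for \<open>X i\<close> modulo
  \<open>M\<close>.\<close>

lemma maximal_contains_linear:
 assumes M: "pprime M" and f: "pol f" "f ~: M"
  and inv: "!!a. pol a ==> a ~: M ==> \<exists>b n. pol b & f ^ n - a * b \<in> M"
 shows "\<exists>r. (%x. X i x - r) \<in> M"
proof (rule ccontr)
 assume no: "\<not> ?thesis"
 let ?l = "%c x. X i x - c"
 note MI = pprimeD(1)[OF M]
 have pl: "pol (?l c)" for c using pol_diff[OF pol_X pol_const[of c], of i] by (simp add: fun_diff_def)
 have "\<forall>c. \<exists>b n. pol b & f ^ n - ?l c * b \<in> M" using inv[OF pl] no by blast
 then obtain b n where b: "!!c. pol (b c)" "!!c. f ^ n c - ?l c * b c \<in> M" by metis
 have "\<exists>N. b c \<in> fs.span (mon ` {e. nrm e < N})" for c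
 proof -
  have "b c \<in> fs.span (mon ` UNIV)" using b(1) pol_span by blast
  from span_mon_expand[OF this]
  obtain E d where E: "finite E" "b c = (\<Sum>e\<in>E. fsc (d e) (mon e))" by blast
  have "nrm e < Suc (\<Sum>e\<in>E. nrm e)" if "e \<in> E" for e using member_le_sum[of e E nrm] that E(1) by simp
  then have "b c \<in> fs.span (mon ` {e. nrm e < Suc (\<Sum>e\<in>E. nrm e)})"
   unfolding E(2) by (intro fs.span_sum fs.span_scale fs.span_base) blast
  then show ?thesis by blast
 qed
 then obtain t where t: "!!c. b c \<in> fs.span (mon ` {e. nrm e < t c})" by metis
 obtain v where v: "infinite {c. (t c, n c) = v}" using uncountable_pigeonhole[of "%c. (t c, n c)"] .
 obtain T m where Tm: "v = (T, m)" by (cases v)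
 define V where "V = fs.span (mon ` {e. nrm e < T})"
 have "inj_on nrm {e :: 'i => nat. nrm e < T}" by (auto intro: inj_onI nrm_inj)
 then have "finite {e :: 'i => nat. nrm e < T}"
  by (rule finite_imageD[rotated]) (auto intro: finite_subset[of _ "{..<T}"])
 then have V: "findim V" unfolding V_def by (intro findim_span finite_imageI)
 obtain C where C: "finite C" "card C = Suc (fs.dim V)" "C \<subseteq> {c. (t c, n c) = v}"
  using infinite_arbitrarily_large[OF v] by metis
 have "\<exists>\<alpha>. (\<exists>c\<in>C. \<alpha> c ~= 0) & (\<Sum>c\<in>C. fsc (\<alpha> c) (b c)) = 0"
 proof (rule family_dependent[OF C(1) V])
  fix c assume "c \<in> C"
  then have "t c = T" using C(3) Tm by auto
  then show "b c \<in> V" using t[of c] by (simp add: V_def)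
 qed (use C(2) in simp)
 then obtain \<alpha> c0 where \<alpha>: "c0 \<in> C" "\<alpha> c0 ~= 0" "(\<Sum>c\<in>C. fsc (\<alpha> c) (b c)) = 0" by blast
 \<comment> \<open>The dependency reads as a sum of terms \<alpha> c / (X i - c); \<open>p\<close>
   is its numerator after multiplication by all \<open>X i - c\<close>. At \<open>c0\<close> only
   the term of \<open>c0\<close> survives, so \<open>p\<close> is not 0.\<close>
 define p where "p = (\<Sum>c\<in>C. smult (\<alpha> c) (\<Prod>c'\<in>C - {c}. [:- c', 1:]))"
 have "poly p c0 = (\<Sum>c\<in>C. \<alpha> c * (\<Prod>c'\<in>C - {c}. c0 - c'))"
  by (simp add: p_def poly_sum poly_prod)
 also have "\<dots> = (\<Sum>c\<in>{c0}. \<alpha> c * (\<Prod>c'\<in>C - {c}. c0 - c'))"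
  using C(1) \<alpha>(1) by (intro sum.mono_neutral_right) auto
 also have "\<dots> ~= 0" using \<alpha>(2) C(1) by auto
 finally have p0: "p ~= 0" by auto
 define q where "q c = (\<Prod>c'\<in>C - {c}. ?l c')" for c
 have pq: "pol (q c)" for c unfolding q_def by (intro pol_prod pl)
 have "(\<Sum>c\<in>C. fsc (\<alpha> c) (q c * (f ^ m - ?l c * b c))) \<in> M"
 proof (intro pideal_sum[OF MI] pidealD(6)[OF MI] pidealD(4)[OF MI] pq)
  fix c assume "c \<in> C"
  then have "n c = m" using C(3) Tm by auto
  then show "f ^ m - ?l c * b c \<in> M" using b(2)[of c] by simp
 qed
 also have "(\<Sum>c\<in>C. fsc (\<alpha> c) (q c * (f ^ m - ?l c * b c))) = f ^ m * (%x. poly p (X i x))"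
 proof
  fix x
  have q: "q c x * (X i x - c) = (\<Prod>c'\<in>C. X i x - c')" if "c \<in> C" for c
   unfolding q_def prod_fun_apply by (subst prod.remove[OF C(1) that]) (simp add: mult.commute)
  have "(\<Sum>c\<in>C. \<alpha> c * (q c x * ((X i x - c) * b c x))) = (\<Sum>c\<in>C. (\<Prod>c'\<in>C. X i x - c') * (\<alpha> c * b c x))"
   by (intro sum.cong refl) (simp only: q[symmetric] ac_simps)
  also have "\<dots> = (\<Prod>c'\<in>C. X i x - c') * (\<Sum>c\<in>C. fsc (\<alpha> c) (b c)) x"
   by (simp add: sum_distrib_left sum_fun_apply)
  also have "\<dots> = 0" unfolding \<alpha>(3) by simp
  finally have 0: "(\<Sum>c\<in>C. \<alpha> c * (q c x * ((X i x - c) * b c x))) = 0" .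
  have "poly p (X i x) = (\<Sum>c\<in>C. \<alpha> c * q c x)"
   by (simp add: p_def poly_sum poly_prod q_def prod_fun_apply)
  then show "(\<Sum>c\<in>C. fsc (\<alpha> c) (q c * (f ^ m - ?l c * b c))) x = (f ^ m * (%x. poly p (X i x))) x"
   using 0 by (simp add: sum_fun_apply power_fun_apply right_diff_distrib sum_subtractf sum_distrib_left ac_simps)
 qed
 finally have "f ^ m * (%x. poly p (X i x)) \<in> M" .
 moreover have "pol (%x. poly p (X i x))" by (induction p) (auto intro!: polynomial_fun.intros(2-) pol_X)
 ultimately have "(%x. poly p (X i x)) \<in> M"
  using pprimeD(3)[OF M pol_power[OF f(1)]] pprime_power[OF M f(1)] f(2) by blast
 then show False using prime_contains_linear[OF M p0] no by blast
qed

text \<open>Take an ideal \<open>M\<close> maximal among those over \<open>J\<close> that avoid all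
  powers of \<open>f\<close>. Working with powers of \<open>f\<close> from the start gives the
  strong form directly: \<open>M\<close> is prime, it contains some \<open>X i - r i\<close> for
  every \<open>i\<close>, and so it is the ideal of a point at which \<open>f\<close> is
  nonzero.\<close>

theorem nullstellensatz:
 assumes J: "pideal (J :: ('a => complex) set)" and f: "pol f" "!!n. f ^ n ~: J"
 obtains x where "x \<in> zset J" "f x ~= 0"
proof -
 let ?F = "{K. pideal K & J \<subseteq> K & (\<forall>n. f ^ n ~: K)}"
 obtain M where M: "M \<in> ?F" "!!K. K \<in> ?F ==> M \<subseteq> K ==> K = M"
  using maximal_pideal[of ?F J] assms by blast
 have MI: "pideal M" and nM: "!!n. f ^ n ~: M" using M(1) by auto
 have inv: "\<exists>b n. pol b & f ^ n - a * b \<in> M" if a: "pol a" "a ~: M" for a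
 proof -
  have "adjoin M a ~: ?F" using M(2)[of "adjoin M a"] adjoin_psubset[OF MI a(2)] by blast
  then obtain n where "f ^ n \<in> adjoin M a" using pideal_adjoin[OF MI a(1)] adjoin_superset[of M a] M(1) by blast
  then obtain m b where "f ^ n = m + a * b" "m \<in> M" "pol b" unfolding adjoin_def by blast
  then have "f ^ n - a * b \<in> M" by (simp only: add_diff_cancel_right')
  then show ?thesis using \<open>pol b\<close> by blast
 qed
 have prime: "pprime M" unfolding pprime_def
 proof (intro conjI allI impI MI)
  show "1 ~: M" using nM[of 0] unfolding power_0 .
  fix a a' assume a: "pol a & pol a' & a * a' \<in> M"
  show "a \<in> M \<or> a' \<in> M"
  proof (rule ccontr)
   assume "\<not> (a \<in> M \<or> a' \<in> M)"
   then obtain b n b' n' where b: "pol b" "f ^ n - a * b \<in> M" "pol b'" "f ^ n' - a' * b' \<in> M"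
    using inv a by blast
   have "f ^ (n + n') = (f ^ n - a * b) * f ^ n' + (f ^ n' - a' * b') * (a * b) + (a * a') * (b * b')"
    by (simp add: power_add algebra_simps)
   also have "\<dots> \<in> M"
   proof (intro pidealD(3)[OF MI])
    show "(f ^ n - a * b) * f ^ n' \<in> M" by (rule pidealD(5)[OF MI b(2) pol_power[OF f(1)]])
    show "(f ^ n' - a' * b') * (a * b) \<in> M" using pidealD(5)[OF MI b(4)] a b(1) pol_mult by blast
    show "(a * a') * (b * b') \<in> M" using pidealD(5)[OF MI] a b(1,3) pol_mult by blast
   qed
   finally show False using nM by blast
  qed
 qed
 have fM: "f ~: M" using nM[of 1] unfolding power_one_right .
 have "\<forall>i. \<exists>r. (%x. X i x - r) \<in> M"
  using maximal_contains_linear[OF prime f(1) fM inv] by blast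
 then obtain r where r: "!!i. (%x. X i x - r i) \<in> M" by metis
 obtain x where x: "!!i. X i x = r i" using X_surj by blast
 have ev: "(%y. g y - g x) \<in> M" if "pol g" for g using that
 proof (induction rule: polynomial_fun.induct)
  case (coord g)
  then obtain i where "g = X i" using coordinates_X by blast
  then show ?case using r x by simp
 next
  case (const c)
  then show ?case using pidealD(2)[OF MI] by (simp add: zero_fun_def)
 next
  case (add g h)
  have "(%y. g y - g x) + (%y. h y - h x) \<in> M" by (rule pidealD(3)[OF MI add.IH])
  then show ?case by (simp add: plus_fun_def algebra_simps)
 next
  case (mult g h)
  have "(%y. g y - g x) * h + fsc (g x) (%y. h y - h x) \<in> M"
   using mult by (intro pidealD(3)[OF MI] pidealD(5)[OF MI] pidealD(6)[OF MI]) auto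
  moreover have "(%y. g y - g x) * h + fsc (g x) (%y. h y - h x) = (%y. g y * h y - g x * h x)"
   by (auto simp: algebra_simps)
  ultimately show ?case by (simp only:)
 qed
 have vanish: "g x = 0 \<longleftrightarrow> g \<in> M" if "pol g" for g
 proof
  assume "g x = 0"
  then show "g \<in> M" using ev[OF that] by simp
 next
  assume "g \<in> M"
  then have "g - (%y. g y - g x) \<in> M" using ev[OF that] by (intro pidealD(8)[OF MI])
  moreover have "g - (%y. g y - g x) = (%_. g x)" by auto
  ultimately have "(%_. g x) \<in> M" by (simp only:)
  then show "g x = 0" by (rule pprime_const[OF prime])
 qed
 have "x \<in> zset J" unfolding zset_def using vanish M(1) pidealD(1)[OF J] by blast
 moreover have "f x ~= 0" using vanish[OF f(1)] fM by blast
 ultimately show ?thesis using that by blast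
qed

end

section \<open>Hilbert functions\<close>

text \<open>Hilbert functions with nonnegative leading coefficients: for these a sum has lower degree
 only if both summands have.\<close>

definition good :: "(('k::finite => nat) => int) => bool" where
 "good f \<longleftrightarrow> (\<exists>M. dg M f) & (\<forall>ks. dg (Suc (length ks)) f --> 0 <= coef ks f)"

text \<open>Start from a common degree bound and descend: in each order above \<open>m\<close> the
  two leading coefficients are nonnegative with sum 0.\<close>

lemma good_split:
 assumes "good f" "good g" "dg m (%x. f x + g x)"
 shows "dg m f" "dg m g"
proof -
 have *: "dg m f & dg m g" if "dg (m + n) f" "dg (m + n) g" for n using that
 proof (induction n)
  case (Suc n)
  have "coef ks f = 0 & coef ks g = 0" if ks: "length ks = m + n" for ks
  proof -
   have d: "dg (Suc (length ks)) f" "dg (Suc (length ks)) g" using Suc.prems ks by (simp_all del: dg.simps)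
   have "dg (length ks) (%x. f x + g x)" using dg_mono[OF assms(3)] ks by simp
   then have "coef ks f + coef ks g = 0" using coef_0 coef_add[OF d] by metis
   moreover have "0 <= coef ks f" "0 <= coef ks g" using assms(1,2) d unfolding good_def by blast+
   ultimately show ?thesis by linarith
  qed
  then have "dg (m + n) f" "dg (m + n) g" using Suc.prems by (auto intro!: dg_coef_0 simp del: dg.simps)
  then show ?case by (rule Suc.IH)
 qed simp
 obtain M N where "dg M f" "dg N g" using assms(1,2) unfolding good_def by blast
 then have "dg (m + (M + N)) f" "dg (m + (M + N)) g" using dg_mono[of M f "m + (M + N)"] dg_mono[of N g "m + (M + N)"] by simp_all
 then show "dg m f" "dg m g" using * by blast+
qed

lemma good_shift: "good (%g. f (g + h)) \<longleftrightarrow> good f"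
 unfolding good_def dg_shift coef_shift ..

lemma good_add: "good f ==> good g ==> good (%x. f x + g x)"
proof -
 assume fg: "good f" "good g"
 then obtain M N where MN: "dg M f" "dg N g" unfolding good_def by blast
 have "dg (M + N) f" "dg (M + N) g" using dg_mono[OF MN(1)] dg_mono[OF MN(2)] by auto
 then have "dg (M + N) (%x. f x + g x)" by (rule dg_add)
 moreover have "0 <= coef ks (%x. f x + g x)" if "dg (Suc (length ks)) (%x. f x + g x)" for ks
 proof -
  have d: "dg (Suc (length ks)) f" "dg (Suc (length ks)) g" using good_split[OF fg that] by blast+
  then have "0 <= coef ks f" "0 <= coef ks g" using fg unfolding good_def by blast+
  then show ?thesis using coef_add[OF d] by simp
 qed
 ultimately show ?thesis unfolding good_def by blast
qed

lemma good_dg_0: "dg 0 f ==> good f"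
 unfolding good_def using coef_0[of _ f] dg_mono[of 0 f] by (metis le0 order_refl)

subsection \<open>Lengths of chains\<close>

definition is_chain :: "'b set set => nat => (nat => 'b set) => bool" where
 "is_chain \<F> k c \<longleftrightarrow> (\<forall>i\<le>k. c i \<in> \<F>) & (\<forall>i<k. c i \<subset> c (Suc i))"

lemma chain_length_le:
 assumes "!!k c. is_chain \<F> k c ==> k <= n"
 shows "chain_length \<F> <= enat n"
 unfolding chain_length_def using assms unfolding is_chain_def by (intro Sup_least) auto

lemma chain_length_ge: "is_chain \<F> k c ==> enat k <= chain_length \<F>"
 unfolding chain_length_def is_chain_def by (intro Sup_upper) auto

lemma chain_length_attained:
 assumes "chain_length \<F> = enat n" "\<F> ~= {}"
 obtains c where "is_chain \<F> n c"
proof -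
 have "\<exists>k c. n <= k & is_chain \<F> k c"
 proof (cases n)
  case 0
  obtain A where "A \<in> \<F>" using assms(2) by blast
  then have "is_chain \<F> 0 (%_. A)" by (simp add: is_chain_def)
  then show ?thesis using 0 by blast
 next
  case (Suc n')
  show ?thesis
  proof (rule ccontr)
   assume no: "\<not> ?thesis"
   have "k <= n'" if "is_chain \<F> k c" for k c using no that Suc by (meson not_less_eq_eq)
   then have "chain_length \<F> <= enat n'" by (rule chain_length_le)
   then show False using assms(1) Suc by simp
  qed
 qed
 then obtain k c where "n <= k" "is_chain \<F> k c" by blast
 then have "is_chain \<F> n c" by (auto simp: is_chain_def)
 then show ?thesis using that by blast
qed

lemma is_chain_mono: "is_chain \<F> k c ==> i <= j ==> j <= k ==> c i \<subseteq> c j"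
proof (induction j)
 case (Suc j)
 show ?case
 proof (cases "i = Suc j")
  case False
  then have "c i \<subseteq> c j" using Suc by simp
  moreover have "c j \<subset> c (Suc j)" using Suc.prems unfolding is_chain_def by simp
  ultimately show ?thesis by blast
 qed simp
qed simp

section \<open>Lengths over local rings, by contracted ideals\<close>

definition saturated :: "('a::affine_space => complex) set => ('a => complex) set => ('a => complex) set set" where
 "saturated P I = {K. pideal K & I \<subseteq> K & (\<forall>f g. pol f & pol g & g ~: P & g * f \<in> K --> f \<in> K)}"

definition saturation :: "('a::affine_space => complex) set => ('a => complex) set => ('a => complex) set" where
 "saturation P I = {f. pol f & (\<exists>g. pol g & g ~: P & g * f \<in> I)}"

text \<open>The members of \<open>saturated P I\<close> are the contractions of the ideals of the
  local ring at \<open>P\<close> that contain \<open>I\<close>, the unit ideal included. As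
  \<open>chain_length\<close> counts inclusions, this is the length of the local ring modulo
  \<open>I\<close>.\<close>

definition local_length :: "('a::affine_space => complex) set => ('a => complex) set => enat" where
 "local_length P I = chain_length (saturated P I)"

lemma saturatedD:
 assumes "K \<in> saturated P I"
 shows "pideal K" "I \<subseteq> K" "pol f ==> pol g ==> g ~: P ==> g * f \<in> K ==> f \<in> K"
 using assms unfolding saturated_def by blast+

lemma saturation_superset: "pprime P ==> pideal I ==> I \<subseteq> saturation P I"
proof
 fix f assume "pprime P" "pideal I" "f \<in> I"
 then have "pol f" "1 * f \<in> I" "1 ~: P" using pidealD(1) pprimeD(2) by (auto simp only: mult_1_left)
 then show "f \<in> saturation P I" unfolding saturation_def using pol_1 by blast
qed

lemma saturation_saturated:
 assumes P: "pprime P" and I: "pideal I"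
 shows "saturation P I \<in> saturated P I"
proof -
 note PI = pprimeD(1)[OF P]
 have "pideal (saturation P I)" unfolding pideal_def
 proof (intro conjI ballI allI impI)
  show "saturation P I \<subseteq> Collect pol" unfolding saturation_def by blast
  show "0 \<in> saturation P I" using saturation_superset[OF P I] pidealD(2)[OF I] by blast
 next
  fix f f' assume "f \<in> saturation P I" "f' \<in> saturation P I"
  then obtain g g' where g: "pol f" "pol f'" "pol g" "g ~: P" "g * f \<in> I" "pol g'" "g' ~: P" "g' * f' \<in> I"
   unfolding saturation_def by blast
  have "g' * (g * f) + g * (g' * f') \<in> I" using g pidealD(3,4)[OF I] by blast
  moreover have "g' * (g * f) + g * (g' * f') = (g * g') * (f + f')" by (simp add: algebra_simps)
  ultimately have "(g * g') * (f + f') \<in> I" by (simp only:)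
  moreover have "g * g' ~: P" using pprimeD(3)[OF P] g by blast
  ultimately show "f + f' \<in> saturation P I"
   unfolding saturation_def using pol_mult[of g g'] pol_add[of f f'] g by blast
 next
  fix f and h :: "'a => complex" assume "f \<in> saturation P I" "pol h"
  then obtain g where g: "pol f" "pol g" "g ~: P" "g * f \<in> I" unfolding saturation_def by blast
  have "h * (g * f) \<in> I" using g pidealD(4)[OF I] \<open>pol h\<close> by blast
  then have "g * (h * f) \<in> I" by (simp only: mult.left_commute)
  then show "h * f \<in> saturation P I" unfolding saturation_def using g \<open>pol h\<close> pol_mult by blast
 qed
 moreover have "f \<in> saturation P I" if fg: "pol f" "pol g" "g ~: P" "g * f \<in> saturation P I" for f g
 proof -
  obtain h where h: "pol h" "h ~: P" "h * (g * f) \<in> I" using fg(4) unfolding saturation_def by blast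
  then have "(h * g) * f \<in> I" by (simp only: mult.assoc)
  moreover have "h * g ~: P" using pprimeD(3)[OF P] h fg by blast
  ultimately show ?thesis unfolding saturation_def using fg h pol_mult by blast
 qed
 ultimately show ?thesis using saturation_superset[OF P I] unfolding saturated_def by blast
qed

lemma saturation_minimal: "K \<in> saturated P I ==> saturation P I \<subseteq> K"
 unfolding saturation_def saturated_def by blast

lemma saturated_antimono: "I \<subseteq> J ==> saturated P J \<subseteq> saturated P I"
 unfolding saturated_def by blast

lemma saturated_adjoin: "pideal I ==> saturated P (adjoin I a) = {K \<in> saturated P I. a \<in> K}"
 unfolding saturated_def using adjoin_minimal[of _ I a] adjoin_superset[of I a] adjoin_mem[of I a] by blast

text \<open>\<open>q\<close> becomes a unit in the local ring at \<open>P\<close>, so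
  \<open>a\<close> is already 0 there modulo \<open>I\<close>.\<close>

lemma local_length_adjoin_eq:
 assumes "pideal I" "pol a" "pol q" "q ~: P" "a * q \<in> I"
 shows "local_length P (adjoin I a) = local_length P I"
proof -
 have "a \<in> K" if "K \<in> saturated P I" for K
 proof -
  have "q * a \<in> K" using assms(5) saturatedD(2)[OF that] by (auto simp only: mult.commute)
  then show ?thesis using saturatedD(3)[OF that assms(2,3,4)] by blast
 qed
 then show ?thesis unfolding local_length_def saturated_adjoin[OF assms(1)]
  by (intro arg_cong[of _ _ chain_length]) blast
qed

lemma local_length_0:
 assumes "pprime P" "pideal I" "\<not> I \<subseteq> P"
 shows "local_length P I = enat 0"
proof -
 obtain i where i: "i \<in> I" "i ~: P" using assms(3) by blast
 have all: "K = Collect pol" if "K \<in> saturated P I" for K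
 proof -
  have "i * 1 \<in> K" using i saturatedD(2)[OF that] by (auto simp only: mult_1_right)
  then have "1 \<in> K" using saturatedD(3)[OF that pol_1, of i] i pidealD(1)[OF assms(2)] by blast
  then show ?thesis using pideal_1[OF saturatedD(1)[OF that]] pidealD(1)[OF saturatedD(1)[OF that]] by blast
 qed
 have "k <= 0" if "is_chain (saturated P I) k c" for k c
 proof (rule ccontr)
  assume "\<not> k <= 0"
  then have "c 0 \<subset> c (Suc 0)" "c 0 \<in> saturated P I" "c (Suc 0) \<in> saturated P I"
   using that unfolding is_chain_def by auto
  then show False using all by blast
 qed
 then have "chain_length (saturated P I) <= enat 0" by (rule chain_length_le)
 then show ?thesis unfolding local_length_def by (simp add: zero_enat_def[symmetric])
qed

text \<open>The module \<open>(I + (a)) / I\<close> is isomorphic to the ring modulo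
  \<open>P\<close>, so localised at \<open>P\<close> it is simple and the length drops by exactly
  one. One inequality puts the saturation of \<open>I\<close> below a chain over
  \<open>I + (a)\<close>; the other shows that a chain over \<open>I\<close> loses at most one
  inclusion when \<open>a\<close> is added.\<close>

lemma local_length_adjoin_Suc:
 assumes P: "pprime P" and I: "pideal I" and a: "pol a" "colon I a = P"
  and n: "local_length P (adjoin I a) = enat n"
 shows "local_length P I = enat (Suc n)"
proof (rule antisym)
 note PI = pprimeD(1)[OF P]
 have aI: "g \<in> P \<longleftrightarrow> a * g \<in> I" if "pol g" for g
  using a(2) that unfolding colon_def by blast
 have ne: "saturated P (adjoin I a) ~= {}" using saturation_saturated[OF P pideal_adjoin[OF I a(1)]] by blast
 obtain c where c: "is_chain (saturated P (adjoin I a)) n c"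
  using chain_length_attained[OF n[unfolded local_length_def] ne] .
 define c' where "c' i = (case i of 0 => saturation P I | Suc j => c j)" for i
 have "a ~: saturation P I"
 proof
  assume "a \<in> saturation P I"
  then obtain g where "pol g" "g ~: P" "g * a \<in> I" unfolding saturation_def by blast
  then show False using aI[of g] by (simp only: mult.commute) 
 qed
 moreover have "c 0 \<in> saturated P (adjoin I a)" using c unfolding is_chain_def by blast
 then have c0: "c 0 \<in> saturated P I" "a \<in> c 0" using saturated_adjoin[OF I] by blast+
 ultimately have "saturation P I \<subset> c 0" using saturation_minimal by blast
 then have "is_chain (saturated P I) (Suc n) c'" using c saturation_saturated[OF P I] saturated_adjoin[OF I, of P a]
  unfolding is_chain_def c'_def by (auto split: nat.split)
 then show "enat (Suc n) <= local_length P I" unfolding local_length_def by (rule chain_length_ge)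
next
 have aI: "g \<in> P \<longleftrightarrow> a * g \<in> I" if "pol g" for g
  using a(2) that unfolding colon_def by blast
 have bound: "k <= n" if "is_chain (saturated P (adjoin I a)) k c" for k c
  using chain_length_ge[OF that] n unfolding local_length_def by simp
 show "local_length P I <= enat (Suc n)" unfolding local_length_def
 proof (rule chain_length_le)
  fix k c assume c: "is_chain (saturated P I) k c"
  have ci: "c i \<in> saturated P I" if "i <= k" for i using c that unfolding is_chain_def by blast
  have cs: "c i \<subset> c (Suc i)" if "i < k" for i using c that unfolding is_chain_def by blast
  \<comment> \<open>A proper inclusion of \<open>c i\<close> in \<open>c (Suc i)\<close> survives
    the adjunction of \<open>a\<close> as long as \<open>a\<close> is outside
    \<open>c (Suc i)\<close>: a multiple \<open>a * r\<close> that turns up in the comparison then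
    has \<open>r\<close> in \<open>P\<close>, hence lies in \<open>I\<close>.\<close>
  define d where "d i = saturation P (adjoin (c i) a)" for i
  have dsat: "d i \<in> saturated P (adjoin I a)" if "i <= k" for i
  proof -
   have "d i \<in> saturated P (adjoin (c i) a)"
    unfolding d_def using saturation_saturated[OF P pideal_adjoin[OF saturatedD(1)[OF ci[OF that]] a(1)]] .
   moreover have "adjoin I a \<subseteq> adjoin (c i) a"
    using saturatedD(2)[OF ci[OF that]] unfolding adjoin_def by blast
   ultimately show ?thesis using saturated_antimono by blast
  qed
  have cd: "c i \<subseteq> d i" if "i <= k" for i
   unfolding d_def using saturation_superset[OF P pideal_adjoin[OF saturatedD(1)[OF ci[OF that]] a(1)]]
    adjoin_superset[of "c i" a] by blast
  have dsub: "d i \<subseteq> K" if "K \<in> saturated P I" "c i \<subseteq> K" "a \<in> K" for i K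
  proof -
   have "K \<in> saturated P (adjoin (c i) a)"
    using that adjoin_minimal[OF saturatedD(1)[OF that(1)] that(2,3)] unfolding saturated_def by blast
   then show ?thesis unfolding d_def by (rule saturation_minimal)
  qed
  have dI: "d i \<in> saturated P I" "a \<in> d i" if "i <= k" for i
   using dsat[OF that] saturated_adjoin[OF I] by blast+
  have dstrict: "d i \<subset> d (Suc i)" if i: "i < k" "a ~: c (Suc i)" for i
  proof
   show "d i \<subseteq> d (Suc i)" using dsub[OF dI(1)] cd[of "Suc i"] cs[OF i(1)] dI(2)[of "Suc i"] i by auto
   show "d i ~= d (Suc i)"
   proof
    assume eq: "d i = d (Suc i)"
    have "c (Suc i) \<subseteq> c i"
    proof
     fix x assume x: "x \<in> c (Suc i)"
     have Ci: "c i \<in> saturated P I" "c (Suc i) \<in> saturated P I" using ci i by auto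
     note J = saturatedD(1)[OF Ci(1)] and J' = saturatedD(1)[OF Ci(2)]
     have px: "pol x" using pidealD(1)[OF J' x] .
     have "x \<in> d i" using eq cd[of "Suc i"] i x by auto
     then obtain g where g: "pol g" "g ~: P" "g * x \<in> adjoin (c i) a"
      unfolding d_def saturation_def by blast
     then obtain y r where y: "g * x = y + a * r" "y \<in> c i" "pol r" unfolding adjoin_def by blast
     have "g * x - y \<in> c (Suc i)" using pidealD(8)[OF J'] pidealD(4)[OF J' x g(1)] y(2) cs[OF i(1)] by blast
     then have ra: "r * a \<in> c (Suc i)" unfolding y(1) by (simp only: add_diff_cancel_left' mult.commute)
     then have "r \<in> P" using saturatedD(3)[OF Ci(2) a(1) y(3)] i(2) by blast
     then have "a * r \<in> c i" using aI[OF y(3)] saturatedD(2)[OF Ci(1)] by blast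
     then have "g * x \<in> c i" unfolding y(1) using pidealD(3)[OF J y(2)] by blast
     then show "x \<in> c i" using saturatedD(3)[OF Ci(1) px g(1,2)] by blast
    qed
    then show False using cs[OF i(1)] by blast
   qed
  qed
  show "k <= Suc n"
  proof (cases "a \<in> c k")
   case False
   have na: "a ~: c i" if "i <= k" for i using is_chain_mono[OF c that] False by blast
   have "is_chain (saturated P (adjoin I a)) k d" unfolding is_chain_def using dsat dstrict na by auto
   then show ?thesis using bound by fastforce
  next
   case True
   define j where "j = (LEAST j. a \<in> c j)"
   have j: "a \<in> c j" "j <= k" unfolding j_def using True by (auto intro: LeastI Least_le)
   have jl: "a ~: c i" if "i < j" for i using that unfolding j_def by (rule not_less_Least)
   have jg: "a \<in> c i" if "j <= i" "i <= k" for i using is_chain_mono[OF c that] j(1) by blast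
   show ?thesis
   proof (cases k)
    case (Suc k')
    \<comment> \<open>\<open>a\<close> enters the chain at index \<open>j\<close>. Members before
      that are enlarged by \<open>a\<close>, those from \<open>j\<close> on are kept, and the member
      just before \<open>j\<close> is dropped (the member at 0 if \<open>j = 0\<close>).\<close>
    define e where "e i = (if Suc i < j then d i else c (Suc i))" for i
    have "is_chain (saturated P (adjoin I a)) k' e" unfolding is_chain_def
    proof (intro conjI allI impI)
     fix i assume i: "i <= k'"
     show "e i \<in> saturated P (adjoin I a)"
     proof (cases "Suc i < j")
      case True
      then show ?thesis using dsat[of i] i Suc by (simp add: e_def)
     next
      case False
      then show ?thesis using ci[of "Suc i"] jg[of "Suc i"] i Suc saturated_adjoin[OF I, of P a]
       by (auto simp: e_def)
     qed
    next
     fix i assume i: "i < k'"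
     show "e i \<subset> e (Suc i)"
     proof (cases "Suc i < j")
      case False
      then show ?thesis using cs[of "Suc i"] i Suc by (simp add: e_def)
     next
      case True
      show ?thesis
      proof (cases "Suc (Suc i) < j")
       case T2: True
       then show ?thesis using dstrict[of i] jl[of "Suc i"] True i Suc by (simp add: e_def)
      next
       case F2: False
       have "d i \<subset> d (Suc i)" using dstrict[of i] jl[OF True] i Suc by simp
       moreover have "d (Suc i) \<subseteq> c (Suc (Suc i))"
        using dsub[OF ci, of "Suc (Suc i)" "Suc i"] cs[of "Suc i"] jg[of "Suc (Suc i)"] F2 i Suc by auto
       ultimately show ?thesis using True F2 by (simp add: e_def)
      qed
     qed
    qed
    then have "k' <= n" by (rule bound)
    then show ?thesis using Suc by simp
   qed simp
  qed
 qed
qed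

section \<open>Hilbert functions of multihomogeneous ideals\<close>

context graded_coords
begin

definition hideal :: "('a => complex) set => bool" where
 "hideal I \<longleftrightarrow> pideal I & stable I"

text \<open>The Hilbert function of the ring modulo \<open>I\<close>, as a codimension inside the
  space of forms. Integers are used so that differences can be taken.\<close>

definition H :: "('a => complex) set => ('k => nat) => int" where
 "H I g = int (fs.dim (R g)) - int (fs.dim (I \<inter> R g))"

text \<open>No weight has all its coordinates in \<open>P\<close>. Among homogeneous primes these
  are the ones that belong to nonempty subsets of the multiprojective space.\<close>

definition relevant :: "('a => complex) set => bool" where
 "relevant P \<longleftrightarrow> (\<forall>k. \<exists>i. wt i = k & X i ~: P)"

lemma hidealD: "hideal I ==> pideal I" "hideal I ==> stable I"
 by (simp_all add: hideal_def)

lemma hideal_colon: "hideal I ==> a \<in> R h ==> hideal (colon I a)"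
 by (simp add: hideal_def pideal_colon stable_colon)

lemma hideal_adjoin: "hideal I ==> a \<in> R h ==> hideal (adjoin I a)"
 by (simp add: hideal_def pideal_adjoin stable_adjoin R_pol)

lemma H_eq_dim_image:
 assumes "flin \<phi>" "!!f. f \<in> R g ==> \<phi> f = 0 \<longleftrightarrow> f \<in> I"
 shows "H I g = int (fs.dim (\<phi> ` R g))"
proof -
 have "{v \<in> R g. \<phi> v = 0} = I \<inter> R g" using assms(2) by blast
 then show ?thesis using rank_nullity[OF assms(1) subspace_R findim_R, of g] by (simp add: H_def)
qed

lemma H_nonneg: "0 <= H I g"
 unfolding H_def using dim_mono[OF findim_R, of "I \<inter> R g" g] by simp

lemma H_antimono: "I \<subseteq> J ==> H J g <= H I g"
 unfolding H_def using dim_mono[OF findim_subset[OF findim_R], of "J \<inter> R g" g "I \<inter> R g"] by auto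

lemma H_eq_0: "R g \<subseteq> I ==> H I g = 0"
 unfolding H_def by (simp add: Int_absorb1)

lemma flin_mult: "flin (%f. a * f)"
 by (rule flinI) (auto simp: algebra_simps)

lemma adjoin_homogeneous_part:
 assumes I: "hideal I" and a: "a \<in> R h" and u: "u \<in> adjoin I a" "u \<in> R (h + g)"
 obtains f where "f \<in> R g" "u - a * f \<in> I"
proof -
 obtain i q where iq: "u = i + a * q" "i \<in> I" "pol q" using u(1) unfolding adjoin_def by blast
 obtain G F where G: "finite G" "!!d. F d \<in> R d" "q = (\<Sum>d\<in>G. F d)" using pol_decomp[OF iq(3)] by blast
 define F' where "F' d = (if d \<in> G then F d else 0)" for d
 have F': "F' d \<in> R d" for d using G(2) fs.subspace_0[OF subspace_R] by (simp add: F'_def)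
 \<comment> \<open>\<open>C e\<close> is the part of \<open>u - a * q\<close> in degree
   \<open>e\<close>. The truncated subtraction \<open>e - h\<close> is exact on the degrees
   \<open>h + d\<close> at which \<open>C\<close> is summed.\<close>
 define C where "C e = (if e = h + g then u else 0) - a * F' (e - h)" for e
 have C: "C (h + d) = (if d = g then u else 0) - a * F' d" for d by (simp add: C_def)
 let ?G = "(%d. h + d) ` (insert g G)"
 have "q = (\<Sum>d\<in>insert g G. F' d)"
  unfolding G(3) F'_def using G(1) by (intro sum.mono_neutral_cong_left) auto
 then have "(\<Sum>d\<in>insert g G. a * F' d) = a * q" by (simp only: sum_distrib_left)
 moreover have "(\<Sum>d\<in>insert g G. (if d = g then u else 0)) = u" using G(1) by (subst sum.delta) auto
 ultimately have "(\<Sum>d\<in>insert g G. C (h + d)) = u - a * q" unfolding C sum_subtractf by (simp only:)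
 then have "(\<Sum>e\<in>?G. C e) = u - a * q" by (subst sum.reindex) (auto simp: inj_on_def simp del: sum.insert)
 then have "(\<Sum>e\<in>?G. C e) \<in> I" using iq(1,2) by (simp only: add_diff_cancel_right')
 then have "C (h + g) \<in> I"
 proof (rule stable_component[OF pideal_subspace[OF hidealD(1)[OF I]] hidealD(2)[OF I], rotated 2])
  show "finite ?G" using G(1) by simp
  show "h + g \<in> ?G" by blast
  fix e assume "e \<in> ?G"
  then obtain d where d: "e = h + d" by blast
  have "(if d = g then u else 0) \<in> R (h + d)" using u(2) fs.subspace_0[OF subspace_R] by simp
  then show "C e \<in> R e" unfolding d C using R_mult[OF a F'] by (intro fs.subspace_diff[OF subspace_R])
 qed
 then have "u - a * F' g \<in> I" unfolding C by simp
 then show ?thesis using that F' by blast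
qed

text \<open>Multiplication by \<open>a\<close> embeds the ring modulo \<open>(I : a)\<close>,
  shifted by \<open>h\<close>, into the ring modulo \<open>I\<close>, with cokernel the ring modulo
  \<open>I + (a)\<close>. This is rank-nullity on one graded piece.\<close>

lemma H_exact:
 assumes I: "hideal I" and a: "a \<in> R h"
 shows "H I (g + h) = H (colon I a) g + H (adjoin I a) (g + h)"
proof -
 note PI = hidealD(1)[OF I]
 obtain \<phi> :: "('a => complex) => 'a => complex" where \<phi>: "flin \<phi>" "!!x. \<phi> x = 0 \<longleftrightarrow> x \<in> I"
  using ex_quotient_map[OF pideal_subspace[OF PI]] by blast
 let ?K = "adjoin I a \<inter> R (g + h)"
 have K: "fs.subspace ?K"
  using pideal_subspace[OF pideal_adjoin[OF PI R_pol[OF a]]] subspace_R by (rule fs.subspace_inter)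
 have fK: "findim ?K" by (rule findim_subset[OF findim_R]) blast
 have kK: "{v \<in> ?K. \<phi> v = 0} = I \<inter> R (g + h)" using \<phi>(2) adjoin_superset by blast
 have 1: "fs.dim ?K = fs.dim (\<phi> ` ?K) + fs.dim (I \<inter> R (g + h))"
  using rank_nullity[OF \<phi>(1) K fK] unfolding kK .
 have eq: "\<phi> ` ?K = (%f. \<phi> (a * f)) ` R g"
 proof
  show "\<phi> ` ?K \<subseteq> (%f. \<phi> (a * f)) ` R g"
  proof
   fix v assume "v \<in> \<phi> ` ?K"
   then obtain u where u: "v = \<phi> u" "u \<in> adjoin I a" "u \<in> R (h + g)" by (auto simp: add.commute)
   obtain f where f: "f \<in> R g" "u - a * f \<in> I" using adjoin_homogeneous_part[OF I a u(2,3)] .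
   then have "\<phi> u - \<phi> (a * f) = 0"
    using \<phi>(2)[of "u - a * f"] unfolding flin_diff[OF \<phi>(1)] by blast
   then have "\<phi> u = \<phi> (a * f)" by (simp only: right_minus_eq)
   then show "v \<in> (%f. \<phi> (a * f)) ` R g" using u(1) f(1) by blast
  qed
  show "(%f. \<phi> (a * f)) ` R g \<subseteq> \<phi> ` ?K"
  proof
   fix v assume "v \<in> (%f. \<phi> (a * f)) ` R g"
   then obtain f where f: "f \<in> R g" "v = \<phi> (a * f)" by blast
   have "a * f \<in> R (g + h)" using R_mult[OF a f(1)] by (simp only: add.commute)
   moreover have "a * f \<in> adjoin I a"
    using pidealD(5)[OF pideal_adjoin[OF PI R_pol[OF a]] adjoin_mem[OF PI]] R_pol[OF f(1)] by blast
   ultimately show "v \<in> \<phi> ` ?K" using f(2) by blast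
  qed
 qed
 have "H (colon I a) g = int (fs.dim ((%f. \<phi> (a * f)) ` R g))"
 proof (rule H_eq_dim_image)
  show "flin (%f. \<phi> (a * f))" using flin_comp[OF \<phi>(1) flin_mult] .
  show "\<phi> (a * f) = 0 \<longleftrightarrow> f \<in> colon I a" if "f \<in> R g" for f
   unfolding colon_def \<phi>(2) using R_pol[OF that] by blast
 qed
 then show ?thesis using 1 unfolding eq H_def by simp
qed

text \<open>The case split for Noetherian induction: an ideal that is neither prime nor the unit
  ideal has a form \<open>a\<close> for which both terms of \<open>H_exact\<close> belong to
  strictly larger ideals.\<close>

lemma hideal_cases:
 assumes I: "hideal I"
 obtains "1 \<in> I" | "pprime I"
 | a h where "a \<in> R h" "a ~: I" "I \<subset> colon I a" "I \<subset> adjoin I a"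
proof (cases "1 \<in> I \<or> pprime I")
 case False
 then obtain f f' g g' where *: "f \<in> R g" "f' \<in> R g'" "f * f' \<in> I" "f ~: I" "f' ~: I"
  using homogeneous_prime[OF hidealD[OF I]] by blast
 note PI = hidealD(1)[OF I]
 have "f' \<in> colon I f" unfolding colon_def using * R_pol by blast
 then have "I \<subset> colon I f" using colon_superset[OF PI R_pol[OF *(1)]] *(5) by blast
 moreover have "I \<subset> adjoin I f" by (rule adjoin_psubset[OF PI *(4)])
 ultimately show ?thesis using that(3) * by blast
qed (use that in blast)

lemma colon_prime: "pprime P ==> pol a ==> a ~: P ==> colon P a = P"
 unfolding colon_def using pprimeD(3)[of P a] pidealD(1,4)[OF pprimeD(1), of P] by blast

text \<open>If all coordinates of weight \<open>k\<close> lie in \<open>P\<close>, so does every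
  monomial of positive degree in that weight.\<close>

lemma not_relevant_dg_0:
 assumes "pideal P" "\<not> relevant P"
 shows "dg 0 (H P)"
proof -
 obtain k where k: "!!i. wt i = k ==> X i \<in> P" using assms(2) unfolding relevant_def by blast
 have "R g \<subseteq> P" if "\<forall>k. 1 <= g k" for g unfolding R_def
 proof (rule fs.span_minimal[OF _ pideal_subspace[OF assms(1)]], rule subsetI)
  fix u assume "u \<in> mon ` {e. mdeg e = g}"
  then obtain e where e: "u = mon e" "mdeg e = g" by blast
  have "mdeg e k ~= 0" using that[rule_format, of k] e(2) by simp
  then obtain i where i: "wt i = k" "e i ~= 0" unfolding mdeg_def by (metis (mono_tags) mem_Collect_eq sum.neutral)
  have "e = e(i := e i - 1) + (%_. 0)(i := Suc 0)" using i(2) by (auto simp: fun_eq_iff)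
  then have "mon e = mon (e(i := e i - 1)) * X i" by (metis mon_add mon_X)
  then show "u \<in> P" unfolding e(1) using pidealD(4)[OF assms(1) k[OF i(1)] pol_mon] by (simp only:)
 qed
 then have "evc (H P) 0" unfolding evc_def using H_eq_0 by blast
 then show ?thesis by simp
qed

lemma upd_eq_add_eg: "g(k := Suc (g k)) = g + eg k"
 by (auto simp: eg_def fun_eq_iff)

text \<open>The algebraic form of a hyperplane section: a linear form outside a prime is no zero
  divisor, so the colon term in \<open>H_exact\<close> is \<open>H P\<close> again and the section
  becomes a difference of the Hilbert function.\<close>

lemma fdiff_H_prime:
 assumes "hideal P" "pprime P" "a \<in> R (eg k)" "a ~: P"
 shows "fdiff k (H P) = (%g. H (adjoin P a) (g + eg k))"
 using H_exact[OF assms(1,3)] colon_prime[OF assms(2) R_pol[OF assms(3)] assms(4)]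
 by (auto simp: fdiff_def upd_eq_add_eg)

lemma H_unit: "1 \<in> I ==> pideal I ==> H I = (%_. 0)"
 using H_eq_0[of _ I] pideal_1[of I] R_pol by blast

text \<open>Noetherian induction. Non-prime ideals reduce to two larger ones by
  \<open>H_exact\<close>. For a relevant prime, each difference is the shifted Hilbert function of a
  larger ideal, so the differences have finite degree and nonnegative leading coefficients; a
  leading coefficient of degree 0 is itself a value of \<open>H\<close>.\<close>

theorem good_H: "hideal I ==> good (H I)"
proof -
 assume "hideal I"
 moreover have "pideal I ==> stable I --> good (H I)"
 proof (induction I rule: noetherian_induct)
  case (step I)
  show ?case
  proof
   assume "stable I"
   then have I: "hideal I" using step.hyps by (simp add: hideal_def)
   have IH: "good (H J)" if "hideal J" "I \<subset> J" for J
    using step.IH[OF hidealD(1)[OF that(1)] that(2)] hidealD(2)[OF that(1)] by blast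
   show "good (H I)"
   proof (rule hideal_cases[OF I])
    assume "1 \<in> I"
    then have "dg 0 (H I)" using H_unit[OF _ step.hyps] dg_zero by metis
    then show ?thesis by (rule good_dg_0)
   next
    fix a h assume a: "a \<in> R h" "a ~: I" "I \<subset> colon I a" "I \<subset> adjoin I a"
    have "good (H (colon I a))" "good (%g. H (adjoin I a) (g + h))"
     using IH[OF hideal_colon[OF I a(1)] a(3)] IH[OF hideal_adjoin[OF I a(1)] a(4)]
     by (simp_all only: good_shift)
    from good_add[OF this] have "good (%g. H I (g + h))" unfolding H_exact[OF I a(1)] .
    then show ?thesis unfolding good_shift .
   next
    assume P: "pprime I"
    show ?thesis
    proof (cases "relevant I")
     case False
     then show ?thesis using good_dg_0 not_relevant_dg_0[OF step.hyps] by blast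
    next
     case True
     have "\<exists>i. wt i = k & X i ~: I" for k using True unfolding relevant_def by blast
     then obtain i where i: "!!k. wt (i k) = k" "!!k. X (i k) ~: I" by metis
     have Xk: "X (i k) \<in> R (eg k)" for k using X_R[of "i k"] by (simp only: i(1))
     let ?J = "%k. adjoin I (X (i k))"
     have fd: "fdiff k (H I) = (%g. H (?J k) (g + eg k))" for k by (rule fdiff_H_prime[OF I P Xk i(2)])
     have gJ: "good (H (?J k))" for k by (rule IH[OF hideal_adjoin[OF I Xk] adjoin_psubset[OF step.hyps i(2)]])
     have "\<forall>k. \<exists>M. dg M (H (?J k))" using gJ unfolding good_def by blast
     then obtain M where M: "!!k. dg (M k) (H (?J k))" by metis
     have "dg (Max (range M)) (fdiff k (H I))" for k
      unfolding fd dg_shift by (rule dg_mono[OF M]) (rule Max_ge, auto)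
     then have 1: "dg (Suc (Max (range M))) (H I)" by simp
     have "0 <= coef ks (H I)" if ks: "dg (Suc (length ks)) (H I)" for ks
     proof (cases ks)
      case Nil
      then have "evc (H I) (coef [] (H I))" using coef_evc[of "[]" "H I"] ks by simp
      then obtain c where "!!g. (\<forall>k. c <= g k) ==> H I g = coef [] (H I)" unfolding evc_def by blast
      from this[of "%_. c"] show ?thesis using Nil H_nonneg[of I "%_. c"] by simp
     next
      case (Cons k ks')
      have "dg (Suc (length ks')) (H (?J k))"
      proof -
       have "dg (length ks) (fdiff k (H I))" using ks by simp
       then show ?thesis unfolding Cons length_Cons fd dg_shift .
      qed
      then have "0 <= coef ks' (H (?J k))" using gJ unfolding good_def by blast
      then show ?thesis unfolding Cons coef_Cons fd coef_shift .
     qed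
     then show ?thesis using 1 unfolding good_def by blast
    qed
   qed
  qed
 qed
 ultimately show ?thesis by (simp add: hideal_def)
qed

text \<open>The pointwise inequality \<open>H J <= H I\<close> does not by itself bound a degree.
  Instead \<open>J\<close> is approached from \<open>I\<close> by adjoining forms: both summands in
  \<open>H_exact\<close> are \<open>good\<close>, so neither can exceed the degree of their
  sum.\<close>

lemma H_dg_mono:
 assumes "hideal I" "hideal J" "I \<subseteq> J" "dg m (H I)"
 shows "dg m (H J)"
proof -
 let ?F = "{K. hideal K & I \<subseteq> K & K \<subseteq> J & dg m (H K)}"
 obtain K where K: "K \<in> ?F" "!!L. L \<in> ?F ==> K \<subseteq> L ==> L = K"
  using maximal_pideal[of ?F I] assms hidealD(1) by blast
 then have hK: "hideal K" and dK: "dg m (H K)" and KJ: "K \<subseteq> J" "I \<subseteq> K" by auto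
 have "J \<subseteq> K"
 proof (rule ccontr)
  assume "\<not> J \<subseteq> K"
  then obtain a h where a: "a \<in> R h" "a \<in> J" "a ~: K"
   using homogeneous_witness[OF hidealD(1)[OF hK] hidealD[OF assms(2)]] by blast
  have "dg m (%g. H (colon K a) g + H (adjoin K a) (g + h))"
   using dK dg_shift[of m "H K" h] unfolding H_exact[OF hK a(1)] by blast
  moreover have "good (H (colon K a))" "good (%g. H (adjoin K a) (g + h))"
   using good_H[OF hideal_colon[OF hK a(1)]] good_H[OF hideal_adjoin[OF hK a(1)]] by (simp_all only: good_shift)
  ultimately have "dg m (%g. H (adjoin K a) (g + h))" using good_split(2) by blast
  then have "dg m (H (adjoin K a))" unfolding dg_shift .
  moreover have "adjoin K a \<subseteq> J" using adjoin_minimal[OF hidealD(1)[OF assms(2)] KJ(1) a(2)] .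
  ultimately have "adjoin K a \<in> ?F" using hideal_adjoin[OF hK a(1)] KJ(2) adjoin_superset[of K a] by blast
  then have "adjoin K a = K" using K(2) adjoin_superset by blast
  then show False using adjoin_mem[OF hidealD(1)[OF hK], of a] a(3) by blast
 qed
 then show ?thesis using dK KJ by (metis subset_antisym)
qed

text \<open>A form \<open>a\<close> in \<open>Q\<close> outside \<open>P\<close> is no zero divisor
  modulo \<open>P\<close>, so the Hilbert function of \<open>P + (a)\<close> is a shift difference
  of \<open>H P\<close> and has smaller degree; \<open>Q\<close> contains
  \<open>P + (a)\<close>.\<close>

lemma H_strict:
 assumes P: "hideal P" "pprime P" and Q: "hideal Q" "P \<subset> Q" and "dg (Suc m) (H P)"
 shows "dg m (H Q)"
proof -
 obtain a h where a: "a \<in> R h" "a \<in> Q" "a ~: P"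
  using homogeneous_witness[OF hidealD(1)[OF P(1)] hidealD[OF Q(1)]] Q(2) by blast
 have "H (adjoin P a) (g + h) = H P (g + h) - H P g" for g
  using H_exact[OF P(1) a(1), of g] colon_prime[OF P(2) R_pol[OF a(1)] a(3)] by simp
 then have "dg m (%g. H (adjoin P a) (g + h))" using dg_shift_diff[OF assms(5), of h] by presburger
 then have "dg m (H (adjoin P a))" unfolding dg_shift .
 moreover have "adjoin P a \<subseteq> Q"
  using adjoin_minimal[OF hidealD(1)[OF Q(1)] psubset_imp_subset[OF Q(2)] a(2)] .
 ultimately show ?thesis using H_dg_mono[OF hideal_adjoin[OF P(1) a(1)] Q(1)] by blast
qed

text \<open>Existence of an associated prime: a colon ideal that is maximal among those by forms
  outside \<open>I\<close> is prime.\<close>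

lemma ex_prime_colon:
 assumes I: "hideal I" "1 ~: I"
 obtains a h where "a \<in> R h" "a ~: I" "pprime (colon I a)"
proof -
 note PI = hidealD(1)[OF I(1)]
 let ?F = "{colon I a | a h. a \<in> R h & a ~: I}"
 have one: "1 \<in> R 0" using const_R[of 1] by (simp add: one_fun_def)
 have "colon I 1 \<in> ?F" using one I(2) by blast
 moreover have "!!J. J \<in> ?F ==> pideal J" using pideal_colon[OF PI] by blast
 ultimately obtain M where M: "M \<in> ?F" "!!J. J \<in> ?F ==> M \<subseteq> J ==> J = M"
  using maximal_pideal[of ?F "colon I 1"] by blast
 then obtain a h where a: "M = colon I a" "a \<in> R h" "a ~: I" by blast
 have "pprime (colon I a)"
 proof (rule homogeneous_prime)
  show "pideal (colon I a)" "stable (colon I a)" using hidealD[OF hideal_colon[OF I(1) a(2)]] by blast+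
  show "1 ~: colon I a"
  proof
   assume "1 \<in> colon I a"
   then have "a * 1 \<in> I" unfolding colon_def by blast
   then show False using a(3) unfolding mult_1_right by blast
  qed
  fix f f' g g' assume f: "f \<in> R g" "f' \<in> R g'" "f * f' \<in> colon I a"
  have "f' \<in> colon I a" if nf: "f ~: colon I a"
  proof -
   have af: "a * f ~: I" using nf unfolding colon_def using R_pol[OF f(1)] by blast
   have "colon I a \<subseteq> colon I (a * f)"
   proof
    fix q assume "q \<in> colon I a"
    then have q: "pol q" "a * q \<in> I" unfolding colon_def by blast+
    then have "f * (a * q) \<in> I" using pidealD(4)[OF PI] R_pol[OF f(1)] by blast
    moreover have "f * (a * q) = a * f * q" by (simp only: ac_simps)
    ultimately have "a * f * q \<in> I" by (simp only:)
    then show "q \<in> colon I (a * f)" unfolding colon_def using q(1) by blast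
   qed
   moreover have "colon I (a * f) \<in> ?F" using R_mult[OF a(2) f(1)] af by blast
   ultimately have "colon I (a * f) = colon I a" using M(2) a(1) by blast
   moreover have "f' \<in> colon I (a * f)"
    using f(3) R_pol[OF f(2)] unfolding colon_def by (simp only: mem_Collect_eq mult.assoc)
   ultimately show "f' \<in> colon I a" by blast
  qed
  then show "f \<in> colon I a \<or> f' \<in> colon I a" by blast
 qed
 then show ?thesis using that a by blast
qed

text \<open>The leading coefficient is additive over top-dimensional primes, weighted by length.
  Adjoining an \<open>a\<close> with \<open>(I : a)\<close> prime peels off one copy of the ring
  modulo this prime. If the prime is in \<open>\<P>\<close>, its length and the coefficient both
  grow accordingly by one copy; otherwise the copy has too small a degree to be seen by
  \<open>coef ks\<close>, and no length in \<open>\<P>\<close> changes.\<close>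

theorem coef_local_length:
 assumes fin: "finite \<P>"
  and \<P>: "!!P. P \<in> \<P> ==> hideal P & pprime P & \<not> dg (length ks) (H P)"
  and "hideal I" "dg (Suc (length ks)) (H I)"
  and "!!P. hideal P ==> pprime P ==> I \<subseteq> P ==> \<not> dg (length ks) (H P) ==> P \<in> \<P>"
 shows "(\<forall>P\<in>\<P>. \<exists>n. local_length P I = enat n) &
  coef ks (H I) = (\<Sum>P\<in>\<P>. int (the_enat (local_length P I)) * coef ks (H P))"
proof -
 let ?Q = "%I. (\<forall>P\<in>\<P>. \<exists>n. local_length P I = enat n) &
  coef ks (H I) = (\<Sum>P\<in>\<P>. int (the_enat (local_length P I)) * coef ks (H P))"
 have "pideal I ==> hideal I --> dg (Suc (length ks)) (H I) -->
  (\<forall>P. hideal P & pprime P & I \<subseteq> P & \<not> dg (length ks) (H P) --> P \<in> \<P>) --> ?Q I"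
 proof (induction I rule: noetherian_induct)
  case (step I)
  show ?case
  proof (intro impI)
   assume I: "hideal I" and d: "dg (Suc (length ks)) (H I)"
    and all: "\<forall>P. hideal P & pprime P & I \<subseteq> P & \<not> dg (length ks) (H P) --> P \<in> \<P>"
   show "?Q I"
   proof (cases "1 \<in> I")
    case True
    have l0: "local_length P I = enat 0" if "P \<in> \<P>" for P
     using local_length_0[of P I] \<P>[OF that] pprimeD(2)[of P] True step.hyps by blast
    have "coef ks (H I) = 0" unfolding H_unit[OF True step.hyps] by (rule coef_0[OF dg_zero])
    moreover have "(\<Sum>P\<in>\<P>. int (the_enat (local_length P I)) * coef ks (H P)) = 0"
     by (rule sum.neutral) (simp add: l0)
    ultimately show ?thesis using l0 by auto
   next
    case False
    obtain a h where a: "a \<in> R h" "a ~: I" "pprime (colon I a)"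
     using ex_prime_colon[OF I False] by blast
    let ?C = "colon I a" and ?J = "adjoin I a"
    note pa = R_pol[OF a(1)]
    have hC: "hideal ?C" by (rule hideal_colon[OF I a(1)])
    have hJ: "hideal ?J" by (rule hideal_adjoin[OF I a(1)])
    have IC: "I \<subseteq> ?C" by (rule colon_superset[OF step.hyps pa])
    have dC: "dg (Suc (length ks)) (H ?C)" by (rule H_dg_mono[OF I hC IC d])
    have dJ: "dg (Suc (length ks)) (H ?J)" by (rule H_dg_mono[OF I hJ adjoin_superset d])
    have IH: "?Q ?J" using step.IH[OF hidealD(1)[OF hJ] adjoin_psubset[OF step.hyps a(2)]] hJ dJ all
      adjoin_superset[of I a] by blast
    have "coef ks (%g. H I (g + h)) = coef ks (H ?C) + coef ks (%g. H ?J (g + h))"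
     unfolding H_exact[OF I a(1)] by (rule coef_add[OF dC]) (use dJ in \<open>simp only: dg_shift\<close>)
    then have ce: "coef ks (H I) = coef ks (H ?C) + coef ks (H ?J)" unfolding coef_shift .
    \<comment> \<open>A different top-dimensional \<open>P\<close> cannot contain \<open>?C\<close>,
      by \<open>H_strict\<close>, so some element outside \<open>P\<close> multiplies
      \<open>a\<close> into \<open>I\<close>.\<close>
    have other: "local_length P I = local_length P ?J" if P: "P \<in> \<P>" "P ~= ?C" for P
    proof -
     have "\<not> ?C \<subseteq> P"
     proof
      assume "?C \<subseteq> P"
      then have "dg (length ks) (H P)" using H_strict[OF hC a(3) _ _ dC] \<P>[OF P(1)] P(2) by blast
      then show False using \<P>[OF P(1)] by blast
     qed
     then obtain q where q: "pol q" "a * q \<in> I" "q ~: P" unfolding colon_def by blast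
     show ?thesis using local_length_adjoin_eq[OF step.hyps pa q(1,3,2)] by simp
    qed
    show ?thesis
    proof (cases "?C \<in> \<P>")
     case True
     obtain n where n: "local_length ?C ?J = enat n" using IH True by blast
     have S: "local_length ?C I = enat (Suc n)" by (rule local_length_adjoin_Suc[OF a(3) step.hyps pa refl n])
     have rest: "(\<Sum>P\<in>\<P> - {?C}. int (the_enat (local_length P I)) * coef ks (H P)) =
       (\<Sum>P\<in>\<P> - {?C}. int (the_enat (local_length P ?J)) * coef ks (H P))"
      by (rule sum.cong) (use other in auto)
     have "coef ks (H I) = coef ks (H ?C) + (int n * coef ks (H ?C) +
       (\<Sum>P\<in>\<P> - {?C}. int (the_enat (local_length P ?J)) * coef ks (H P)))"
      using ce IH sum.remove[OF fin True, of "%P. int (the_enat (local_length P ?J)) * coef ks (H P)"] n by simp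
     also have "\<dots> = (\<Sum>P\<in>\<P>. int (the_enat (local_length P I)) * coef ks (H P))"
      using sum.remove[OF fin True, of "%P. int (the_enat (local_length P I)) * coef ks (H P)"] S rest
      by (simp add: algebra_simps)
     finally show ?thesis using IH S other by metis
    next
     case False
     then have "dg (length ks) (H ?C)" using all hC a(3) IC by blast
     then have "coef ks (H ?C) = 0" by (rule coef_0)
     moreover have "(\<Sum>P\<in>\<P>. int (the_enat (local_length P I)) * coef ks (H P)) =
       (\<Sum>P\<in>\<P>. int (the_enat (local_length P ?J)) * coef ks (H P))"
      by (rule sum.cong[OF refl]) (use other False in metis)
     moreover have "\<forall>P\<in>\<P>. \<exists>n. local_length P I = enat n" using IH other False by metis
     ultimately show ?thesis using ce IH by simp
    qed
   qed
  qed
 qed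
 then show ?thesis using assms(3-5) hidealD(1)[OF assms(3)] by blast
qed

end

section \<open>Closed subsets of multiprojective spaces\<close>

lemma topspace_zariski: "topspace (zariski :: 'a::affine_space topology) = UNIV"
proof -
 have "openin (zariski :: 'a topology) UNIV"
  unfolding openin_zariski using pol_const[of 1] by (intro exI[of _ "{%_. 1}"]) auto
 then show ?thesis using openin_subset by blast
qed

lemma closedin_zariski_zset: "F \<subseteq> Collect pol ==> closedin zariski (zset F)"
 unfolding closedin_def topspace_zariski openin_zariski zset_def by (intro conjI exI[of _ F]) auto

lemma closedin_zariski_iff: "closedin zariski A \<longleftrightarrow> zset (\<I> A) = A"
proof
 assume "closedin zariski A"
 then obtain F where F: "F \<subseteq> Collect pol" "- A = {x. \<exists>f\<in>F. f x ~= 0}"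
  unfolding closedin_def topspace_zariski openin_zariski by (auto simp: Compl_eq_Diff_UNIV)
 have "F \<subseteq> \<I> A" using F unfolding vanishing_ideal_def by blast
 then have "zset (\<I> A) \<subseteq> A" using F(2) unfolding zset_def by blast
 then show "zset (\<I> A) = A" using subset_zset_vanishing by blast
next
 assume "zset (\<I> A) = A"
 then show "closedin zariski A" using closedin_zariski_zset[of "\<I> A"] by (auto simp: vanishing_ideal_def)
qed

lemma zariski_closure: "zariski closure_of S = zset (\<I> S)"
proof (rule closure_of_unique)
 show "S \<subseteq> zset (\<I> S)" by (rule subset_zset_vanishing)
 show "closedin zariski (zset (\<I> S))" by (rule closedin_zariski_zset) (auto simp: vanishing_ideal_def)
 fix T assume "S \<subseteq> T" "closedin zariski T"
 then show "zset (\<I> S) \<subseteq> T" using closedin_zariski_iff zset_antimono vanishing_ideal_antimono by metis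
qed

lemma irreducible_zariski_prime:
 assumes "irreducible_in zariski S"
 shows "pprime (\<I> S)" unfolding pprime_def
proof (intro conjI allI impI vanishing_ideal_pideal)
 obtain x where "x \<in> S" using assms unfolding irreducible_in_def by blast
 then show "1 ~: \<I> S" by (auto simp: vanishing_ideal_def)
 fix f g assume fg: "pol f & pol g & f * g \<in> \<I> S"
 have "S \<subseteq> zset {f} \<union> zset {g}" using fg by (auto simp: zset_def vanishing_ideal_def)
 moreover have "closedin zariski (zset {f})" "closedin zariski (zset {g})"
  using fg by (auto intro: closedin_zariski_zset)
 ultimately have "S \<subseteq> zset {f} \<or> S \<subseteq> zset {g}" using assms unfolding irreducible_in_def by blast
 then show "f \<in> \<I> S \<or> g \<in> \<I> S" using fg by (auto simp: zset_def vanishing_ideal_def)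
qed

lemma prime_irreducible_zariski:
 assumes "pprime (\<I> S)"
 shows "irreducible_in zariski S" unfolding irreducible_in_def topspace_zariski
proof (intro conjI allI impI)
 show "S ~= {}"
 proof
  assume "S = {}"
  then have "1 \<in> \<I> S" using pol_1 by (simp add: vanishing_ideal_def)
  then show False using pprimeD(2)[OF assms] by blast
 qed
 fix A B assume *: "closedin zariski A & closedin zariski B & S \<subseteq> A \<union> B"
 show "S \<subseteq> A \<or> S \<subseteq> B"
 proof (rule ccontr)
  assume no: "\<not> (S \<subseteq> A \<or> S \<subseteq> B)"
  have ex: "\<exists>f\<in>\<I> A. f ~: \<I> S" if A: "closedin zariski A" "\<not> S \<subseteq> A" for A
  proof (rule ccontr)
   assume "\<not> ?thesis"
   then have "zset (\<I> S) \<subseteq> zset (\<I> A)" by (intro zset_antimono) blast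
   then show False using A(2) subset_zset_vanishing[of S] A(1)[unfolded closedin_zariski_iff] by blast
  qed
  obtain f g where fg: "f \<in> \<I> A" "f ~: \<I> S"
   "g \<in> \<I> B" "g ~: \<I> S" using ex[of A] ex[of B] no * by blast
  then have "f * g \<in> \<I> S" using * by (auto simp: vanishing_ideal_def intro: pol_mult)
  then show False using pprimeD(3)[OF assms] fg by (auto simp: vanishing_ideal_def)
 qed
qed simp

lemma pideal_iff_ideal: "ideal I polynomial_ring \<longleftrightarrow> pideal I" for I :: "('a::affine_space => complex) set"
proof
 interpret PR: cring "polynomial_ring :: ('a => complex) ring" by (rule cring_polynomial_ring)
 {
  assume "ideal I polynomial_ring"
  then interpret ideal I polynomial_ring .
  show "pideal I" unfolding pideal_def
  proof (intro conjI ballI allI impI)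
   show "I \<subseteq> Collect pol" using a_subset by (simp add: polynomial_ring_def)
   show "0 \<in> I" using zero_closed by (simp add: polynomial_ring_def zero_fun_def)
   show "f + g \<in> I" if "f \<in> I" "g \<in> I" for f g
    using a_closed[OF that] by (simp add: polynomial_ring_def plus_fun_def)
   show "g * f \<in> I" if "f \<in> I" "pol g" for f g
    using I_l_closed[OF that(1), of g] that(2) by (simp add: polynomial_ring_def times_fun_def)
  qed
 next
  assume I: "pideal I"
  show "ideal I polynomial_ring"
  proof (rule idealI)
   show "ring (polynomial_ring :: ('a => complex) ring)" by (rule PR.ring_axioms)
   show "subgroup I (add_monoid polynomial_ring)"
   proof (rule group.subgroupI[OF PR.a_group])
    show "I \<subseteq> carrier (add_monoid polynomial_ring)"
     using pidealD(1)[OF I] by (auto simp: polynomial_ring_def)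
    show "I ~= {}" using pidealD(2)[OF I] by blast
    fix a assume a: "a \<in> I"
    have "- a \<oplus>\<^bsub>polynomial_ring\<^esub> a = \<zero>\<^bsub>polynomial_ring\<^esub>"
     by (auto simp: polynomial_ring_def)
    then have "\<ominus>\<^bsub>polynomial_ring\<^esub> a = - a"
     using PR.minus_equality[of "- a" a] pidealD(1)[OF I] pidealD(7)[OF I a] a by (simp add: polynomial_ring_def)
    then show "inv\<^bsub>add_monoid polynomial_ring\<^esub> a \<in> I"
     using pidealD(7)[OF I a] by (simp add: a_inv_def)
    fix b assume "b \<in> I"
    then show "a \<otimes>\<^bsub>add_monoid polynomial_ring\<^esub> b \<in> I"
     using pidealD(3)[OF I a] by (simp add: polynomial_ring_def plus_fun_def)
   qed
   show "x \<otimes>\<^bsub>polynomial_ring\<^esub> a \<in> I" if "a \<in> I" "x \<in> carrier polynomial_ring" for a x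
    using pidealD(4)[OF I that(1), of x] that(2) by (simp add: polynomial_ring_def times_fun_def)
   show "a \<otimes>\<^bsub>polynomial_ring\<^esub> x \<in> I" if "a \<in> I" "x \<in> carrier polynomial_ring" for a x
    using pidealD(5)[OF I that(1), of x] that(2) by (simp add: polynomial_ring_def times_fun_def)
  qed
 }
qed

lemma irreducible_subset_Union:
 assumes "irreducible_in T C" "finite \<C>" "!!Y. Y \<in> \<C> ==> closedin T Y" "C \<subseteq> \<Union>\<C>"
 shows "\<exists>Y\<in>\<C>. C \<subseteq> Y" using assms(2,3,4)
proof (induction \<C>)
 case empty
 then show ?case using assms(1) unfolding irreducible_in_def by blast
next
 case (insert Y \<C>)
 have "closedin T (\<Union>\<C>)" using insert by (intro closedin_Union) auto
 then have "C \<subseteq> Y \<or> C \<subseteq> \<Union>\<C>"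
  using assms(1) insert.prems unfolding irreducible_in_def by auto
 then show ?case using insert by auto
qed

lemma irreducible_components_finite_union:
 assumes "finite \<C>" "!!Y. Y \<in> \<C> ==> closedin T Y & irreducible_in T Y" "Y = \<Union>\<C>"
 shows "irreducible_components T Y \<subseteq> \<C>"
  and "!!C. irreducible_in T C ==> C \<subseteq> Y ==> \<exists>C'\<in>irreducible_components T Y. C \<subseteq> C'"
proof -
 have cover: "\<exists>Z\<in>\<C>. C \<subseteq> Z" if "irreducible_in T C" "C \<subseteq> Y" for C
  by (rule irreducible_subset_Union[OF that(1) assms(1)]) (use assms(2,3) that(2) in auto)
 show "irreducible_components T Y \<subseteq> \<C>"
 proof
  fix C assume "C \<in> irreducible_components T Y"
  then have C: "C \<subseteq> Y" "irreducible_in T C" "!!C'. C \<subseteq> C' ==> C' \<subseteq> Y ==> irreducible_in T C' ==> C' = C"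
   unfolding irreducible_components_def by blast+
  obtain Z where "Z \<in> \<C>" "C \<subseteq> Z" using cover[OF C(2,1)] by blast
  then have "Z = C" using C(3)[of Z] assms(2,3) by blast
  then show "C \<in> \<C>" using \<open>Z \<in> \<C>\<close> by simp
 qed
 fix C assume C: "irreducible_in T C" "C \<subseteq> Y"
 let ?S = "{Z\<in>\<C>. C \<subseteq> Z}"
 have "?S ~= {}" using cover[OF C] by blast
 moreover have "finite ?S" using assms(1) by simp
 ultimately have "\<exists>M\<in>?S. \<forall>Z\<in>?S. M \<subseteq> Z --> M = Z"
  using finite_has_maximal[of ?S] by metis
 then obtain M where M: "M \<in> ?S" "!!Z. Z \<in> ?S ==> M \<subseteq> Z ==> M = Z" by (elim bexE) blast
 have "M \<in> irreducible_components T Y" unfolding irreducible_components_def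
 proof (intro CollectI conjI allI impI)
  show "M \<subseteq> Y" "irreducible_in T M" using M(1) assms(2,3) by blast+
  fix C' assume C': "M \<subseteq> C' & C' \<subseteq> Y & irreducible_in T C'"
  then obtain Z where Z: "Z \<in> \<C>" "C' \<subseteq> Z" using cover[of C'] by blast
  have "M = Z" by (rule M(2)) (use M(1) Z C' in auto)
  then show "C' = M" using C' Z(2) by auto
 qed
 then show "\<exists>C'\<in>irreducible_components T Y. C \<subseteq> C'" using M(1) by blast
qed

text \<open>Common setting for projective space and for its product with itself. \<open>D\<close>
  leaves out the points at which all coordinates of some weight vanish, the fibres of
  \<open>\<pi>\<close> on \<open>D\<close> are the torus orbits, and \<open>L k\<close> consists of
  the sections of the hyperplane bundle of weight \<open>k\<close>.\<close>

locale multiprojective = graded_coords X wt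
 for X :: "'i::finite => 'a::affine_space => complex" and wt :: "'i => 'k::finite" +
 fixes D :: "'a set" and \<pi> :: "'a => 'b" and L :: "'k => ('a => complex) set"
 assumes D_eq: "D = {x. \<forall>k. \<exists>i. wt i = k & X i x ~= 0}"
  and \<pi>_eq: "x \<in> D ==> y \<in> D ==> \<pi> x = \<pi> y \<longleftrightarrow> (\<exists>s. (\<forall>k. s k ~= 0) & y = sc s x)"
  and \<pi>_surj: "\<pi> ` D = UNIV"
  and L_R: "l \<in> L k ==> l \<in> R (eg k)"
  and X_L: "X i \<in> L (wt i)"
begin

abbreviation "T \<equiv> zariski_quot D \<pi>"

definition pre :: "'b set => 'a set" where
 "pre W = {x\<in>D. \<pi> x \<in> W}"

definition IW :: "'b set => ('a => complex) set" where
 "IW W = \<I> (pre W)"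

definition Vp :: "('a => complex) set => 'b set" where
 "Vp I = \<pi> ` (D \<inter> zset I)"

lemma D_sc: "x \<in> D ==> (!!k. s k ~= 0) ==> sc s x \<in> D"
 by (simp add: D_eq)

lemma \<pi>_sc: "x \<in> D ==> (!!k. s k ~= 0) ==> \<pi> (sc s x) = \<pi> x"
 using \<pi>_eq[of x "sc s x"] D_sc by metis

lemma open_D: "openin zariski D"
proof -
 let ?F = "{(\<Prod>k\<in>UNIV. X (c k)) | c. \<forall>k. wt (c k) = k}"
 have "?F \<subseteq> Collect pol" by (auto intro: pol_prod pol_X)
 moreover have "D = {x. \<exists>f\<in>?F. f x ~= 0}"
 proof (intro Set.set_eqI iffI)
  fix x assume "x \<in> D"
  then have "\<forall>k. \<exists>i. wt i = k & X i x ~= 0" by (simp add: D_eq)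
  then obtain c where c: "\<forall>k. wt (c k) = k & X (c k) x ~= 0" by metis
  then have "(\<Prod>k\<in>UNIV. X (c k)) x ~= 0" by (simp add: prod_fun_apply)
  then show "x \<in> {x. \<exists>f\<in>?F. f x ~= 0}" using c by blast
 next
  fix x assume "x \<in> {x. \<exists>f\<in>?F. f x ~= 0}"
  then obtain c where c: "\<forall>k. wt (c k) = k" "(\<Prod>k\<in>UNIV. X (c k)) x ~= 0" by blast
  then have "X (c k) x ~= 0" for k by (simp add: prod_fun_apply)
  then show "x \<in> D" using c(1) by (auto simp: D_eq)
 qed
 ultimately show ?thesis unfolding openin_zariski by blast
qed

lemma topspace_T: "topspace T = UNIV"
proof -
 have "openin T UNIV" using open_D by (simp add: openin_zariski_quot)
 then show ?thesis using openin_subset by blast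
qed

lemma pre_subset_D: "pre W \<subseteq> D"
 by (auto simp: pre_def)

lemma image_pre: "\<pi> ` pre W = W"
proof -
 have "p \<in> \<pi> ` pre W" if "p \<in> W" for p
 proof -
  obtain x where "x \<in> D" "p = \<pi> x" using \<pi>_surj by blast
  then show ?thesis using that by (auto simp: pre_def)
 qed
 then show ?thesis by (auto simp: pre_def)
qed

lemma hideal_IW: "hideal (IW W)"
 unfolding hideal_def IW_def
 by (intro conjI vanishing_ideal_pideal stable_vanishing_ideal) (auto simp: pre_def D_sc \<pi>_sc)

lemma closedin_T: "closedin T W \<longleftrightarrow> pre W = D \<inter> zset (IW W)"
proof
 assume "closedin T W"
 then have "openin zariski {x\<in>D. \<pi> x \<in> UNIV - W}"
  unfolding closedin_def topspace_T openin_zariski_quot by blast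
 then obtain F where F: "F \<subseteq> Collect pol" "{x\<in>D. \<pi> x \<in> UNIV - W} = {x. \<exists>f\<in>F. f x ~= 0}"
  unfolding openin_zariski by blast
 have "F \<subseteq> IW W" unfolding IW_def vanishing_ideal_def pre_def using F by blast
 then have "D \<inter> zset (IW W) \<subseteq> pre W" unfolding pre_def zset_def using F(2) by blast
 moreover have "pre W \<subseteq> D \<inter> zset (IW W)"
  unfolding IW_def using subset_zset_vanishing pre_subset_D by blast
 ultimately show "pre W = D \<inter> zset (IW W)" by blast
next
 assume eq: "pre W = D \<inter> zset (IW W)"
 have "openin zariski {x. \<exists>f\<in>IW W. f x ~= 0}" unfolding openin_zariski
  by (intro exI[of _ "IW W"] conjI refl) (auto simp: IW_def vanishing_ideal_def)
 then have "openin zariski (D \<inter> {x. \<exists>f\<in>IW W. f x ~= 0})" using open_D by (rule openin_Int[rotated])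
 moreover have "D \<inter> {x. \<exists>f\<in>IW W. f x ~= 0} = {x\<in>D. \<pi> x \<in> UNIV - W}"
  using eq unfolding pre_def zset_def by blast
 ultimately show "closedin T W" unfolding closedin_def topspace_T openin_zariski_quot by simp
qed

lemma pre_Vp:
 assumes "stable I"
 shows "pre (Vp I) = D \<inter> zset I"
proof
 show "D \<inter> zset I \<subseteq> pre (Vp I)" by (auto simp: pre_def Vp_def)
 show "pre (Vp I) \<subseteq> D \<inter> zset I"
 proof
  fix y assume "y \<in> pre (Vp I)"
  then obtain x where x: "y \<in> D" "x \<in> D" "x \<in> zset I" "\<pi> x = \<pi> y" unfolding pre_def Vp_def by auto
  then obtain s where s: "\<forall>k. s k ~= 0" "y = sc s x" using \<pi>_eq by blast
  have "f y = 0" if "f \<in> I" for f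
  proof -
   have "(%x. f (sc s x)) \<in> I" using stableD[OF assms that, of s] s(1) by blast
   then show ?thesis using x(3) s(2) by (auto simp: zset_def)
  qed
  then show "y \<in> D \<inter> zset I" using x(1) by (simp add: zset_def)
 qed
qed

lemma closed_Vp:
 assumes "hideal I"
 shows "closedin T (Vp I)"
proof -
 have "I \<subseteq> IW (Vp I)" unfolding IW_def pre_Vp[OF hidealD(2)[OF assms]] vanishing_ideal_def zset_def
  using pidealD(1)[OF hidealD(1)[OF assms]] by blast
 then have "D \<inter> zset (IW (Vp I)) \<subseteq> pre (Vp I)"
  unfolding pre_Vp[OF hidealD(2)[OF assms]] using zset_antimono by blast
 moreover have "pre (Vp I) \<subseteq> D \<inter> zset (IW (Vp I))"
  unfolding IW_def using subset_zset_vanishing pre_subset_D by blast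
 ultimately show ?thesis unfolding closedin_T by blast
qed

lemma IW_antimono: "W \<subseteq> W' ==> IW W' \<subseteq> IW W"
 unfolding IW_def by (rule vanishing_ideal_antimono) (auto simp: pre_def)

lemma closed_subset_iff:
 assumes "closedin T W'"
 shows "W \<subseteq> W' \<longleftrightarrow> IW W' \<subseteq> IW W"
proof
 assume "IW W' \<subseteq> IW W"
 then have "D \<inter> zset (IW W) \<subseteq> D \<inter> zset (IW W')" using zset_antimono by blast
 moreover have "pre W \<subseteq> D \<inter> zset (IW W)"
  unfolding IW_def using subset_zset_vanishing pre_subset_D by blast
 ultimately have "pre W \<subseteq> pre W'" using assms unfolding closedin_T by blast
 then show "W \<subseteq> W'" using image_pre by (metis image_mono)
qed (rule IW_antimono)

lemma IW_inj: "closedin T W ==> closedin T W' ==> IW W = IW W' ==> W = W'"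
 using closed_subset_iff by blast

lemma IW_strict: "closedin T W ==> closedin T W' ==> W \<subset> W' ==> IW W' \<subset> IW W"
 using closed_subset_iff by blast

lemma relevant_IW: "W ~= {} ==> relevant (IW W)"
proof -
 assume "W ~= {}"
 then obtain x where x: "x \<in> pre W" using image_pre[of W] by blast
 then have "x \<in> D" using pre_subset_D by blast
 then have "\<forall>k. \<exists>i. wt i = k & X i x ~= 0" using D_eq by blast
 then show ?thesis unfolding relevant_def IW_def using vanD[OF _ x] by blast
qed

text \<open>The multiprojective Nullstellensatz. To an \<open>f\<close> outside \<open>P\<close>
  multiply one coordinate of each weight that is outside \<open>P\<close>; a zero of
  \<open>P\<close> at which this product is nonzero automatically lies in \<open>D\<close>.\<close>

lemma IW_Vp:
 assumes "hideal P" "pprime P" "relevant P"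
 shows "IW (Vp P) = P"
proof
 show "P \<subseteq> IW (Vp P)" unfolding IW_def pre_Vp[OF hidealD(2)[OF assms(1)]] vanishing_ideal_def zset_def
  using pidealD(1)[OF hidealD(1)[OF assms(1)]] by blast
 show "IW (Vp P) \<subseteq> P"
 proof
  fix f assume f: "f \<in> IW (Vp P)"
  then have pf: "pol f" by (simp add: IW_def vanishing_ideal_def)
  show "f \<in> P"
  proof (rule ccontr)
   assume nf: "f ~: P"
   have "\<forall>k. \<exists>i. wt i = k & X i ~: P" using assms(3) unfolding relevant_def .
   then obtain c where c: "!!k. wt (c k) = k" "!!k. X (c k) ~: P" by metis
   let ?u = "f * (\<Prod>k\<in>UNIV. X (c k))"
   have pu: "pol ?u" using pf by (intro pol_mult pol_prod pol_X)
   have "(\<Prod>k\<in>UNIV. X (c k)) ~: P"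
    using pprime_prod[OF assms(2), where f = "%k. X (c k)" and A = UNIV] pol_X c(2) finite by blast
   then have "?u ~: P" using pprimeD(3)[OF assms(2) pf] nf pol_prod[of UNIV "%k. X (c k)"] pol_X by blast
   then have "?u ^ n ~: P" for n using pprime_power[OF assms(2) pu] by blast
   then obtain x where x: "x \<in> zset P" "?u x ~= 0"
    using nullstellensatz[OF pprimeD(1)[OF assms(2)] pu] by blast
   then have "f x ~= 0" "!!k. X (c k) x ~= 0" by (auto simp: prod_fun_apply)
   then have "x \<in> D" using c(1) by (auto simp: D_eq)
   then have "x \<in> pre (Vp P)" using x(1) pre_Vp[OF hidealD(2)[OF assms(1)]] by blast
   then show False using f \<open>f x ~= 0\<close> unfolding IW_def using vanD by blast
  qed
 qed
qed

lemma Vp_adjoin: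
 assumes "closedin T W" "l \<in> R h"
 shows "Vp (adjoin (IW W) l) = W \<inter> section_zeros D \<pi> l"
  and "W \<subseteq> section_zeros D \<pi> l \<longleftrightarrow> l \<in> IW W"
proof -
 have pl: "pol l" by (rule R_pol[OF assms(2)])
 have sz: "\<pi> x \<in> section_zeros D \<pi> l \<longleftrightarrow> l x = 0" if xD: "x \<in> D" for x
 proof
  assume "\<pi> x \<in> section_zeros D \<pi> l"
  then obtain y where y: "y \<in> D" "l y = 0" "\<pi> y = \<pi> x" unfolding section_zeros_def by auto
  then obtain s where "x = sc s y" using \<pi>_eq[OF y(1) xD] by blast
  then show "l x = 0" using R_sc[OF assms(2)] y(2) by simp
 qed (use xD in \<open>auto simp: section_zeros_def\<close>)
 have "zset (adjoin (IW W) l) = zset (IW W) \<inter> {x. l x = 0}"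
 proof -
  have "adjoin (IW W) l \<supseteq> insert l (IW W)"
   using adjoin_superset[of "IW W" l] adjoin_mem[OF hidealD(1)[OF hideal_IW[of W]], of l] by blast
  moreover have "x \<in> zset (adjoin (IW W) l)" if "x \<in> zset (IW W)" "l x = 0" for x
   using that unfolding zset_def adjoin_def by auto
  ultimately show ?thesis unfolding zset_def by blast
 qed
 then have "D \<inter> zset (adjoin (IW W) l) = {x\<in>pre W. l x = 0}" using assms(1) unfolding closedin_T by blast
 then have "Vp (adjoin (IW W) l) = \<pi> ` {x\<in>pre W. l x = 0}" unfolding Vp_def by simp
 also have "\<dots> = W \<inter> section_zeros D \<pi> l"
 proof
  show "\<pi> ` {x\<in>pre W. l x = 0} \<subseteq> W \<inter> section_zeros D \<pi> l"
   using sz unfolding pre_def by blast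
  show "W \<inter> section_zeros D \<pi> l \<subseteq> \<pi> ` {x\<in>pre W. l x = 0}"
  proof
   fix p assume p: "p \<in> W \<inter> section_zeros D \<pi> l"
   then obtain x where x: "x \<in> pre W" "p = \<pi> x" using image_pre by blast
   then have "l x = 0" using sz[of x] p pre_subset_D by blast
   then show "p \<in> \<pi> ` {x\<in>pre W. l x = 0}" using x by blast
  qed
 qed
 finally show "Vp (adjoin (IW W) l) = W \<inter> section_zeros D \<pi> l" .
 show "W \<subseteq> section_zeros D \<pi> l \<longleftrightarrow> l \<in> IW W"
 proof
  assume "W \<subseteq> section_zeros D \<pi> l"
  then show "l \<in> IW W" unfolding IW_def vanishing_ideal_def pre_def using sz pl by blast
 next
  assume l: "l \<in> IW W"
  show "W \<subseteq> section_zeros D \<pi> l"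
  proof
   fix p assume "p \<in> W"
   then obtain x where x: "x \<in> pre W" "p = \<pi> x" using image_pre by blast
   then have "l x = 0" using l vanD unfolding IW_def by blast
   then show "p \<in> section_zeros D \<pi> l" using sz[of x] x pre_subset_D by blast
  qed
 qed
qed

lemma irreducible_iff_prime:
 assumes W: "closedin T W"
 shows "irreducible_in T W \<longleftrightarrow> pprime (IW W)"
proof
 assume irr: "irreducible_in T W"
 show "pprime (IW W)"
 proof (rule homogeneous_prime[OF hidealD[OF hideal_IW]])
  have "W ~= {}" using irr unfolding irreducible_in_def by blast
  then obtain x where "x \<in> pre W" using image_pre[of W] by blast
  then show "1 ~: IW W" unfolding IW_def vanishing_ideal_def by auto
  fix f f' g g' assume f: "f \<in> R g" "f' \<in> R g'" "f * f' \<in> IW W"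
  have "W \<subseteq> Vp (adjoin (IW W) f) \<union> Vp (adjoin (IW W) f')"
  proof
   fix p assume "p \<in> W"
   then obtain x where x: "x \<in> pre W" "p = \<pi> x" using image_pre by blast
   have "(f * f') x = 0" using f(3) x(1) vanD unfolding IW_def by blast
   then have "f x = 0 \<or> f' x = 0" by simp
   moreover have "\<pi> x \<in> section_zeros D \<pi> l" if "l x = 0" for l
    using that x(1) pre_subset_D unfolding section_zeros_def by blast
   ultimately show "p \<in> Vp (adjoin (IW W) f) \<union> Vp (adjoin (IW W) f')"
    unfolding Vp_adjoin(1)[OF W f(1)] Vp_adjoin(1)[OF W f(2)] using \<open>p \<in> W\<close> x(2) by blast
  qed
  moreover have "closedin T (Vp (adjoin (IW W) f))" "closedin T (Vp (adjoin (IW W) f'))"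
   using closed_Vp[OF hideal_adjoin[OF hideal_IW]] f by blast+
  ultimately have "W \<subseteq> Vp (adjoin (IW W) f) \<or> W \<subseteq> Vp (adjoin (IW W) f')"
   using irr unfolding irreducible_in_def by blast
  then show "f \<in> IW W \<or> f' \<in> IW W" unfolding Vp_adjoin(1)[OF W f(1)] Vp_adjoin(1)[OF W f(2)]
   using Vp_adjoin(2)[OF W f(1)] Vp_adjoin(2)[OF W f(2)] by blast
 qed
next
 assume P: "pprime (IW W)"
 show "irreducible_in T W" unfolding irreducible_in_def topspace_T
 proof (intro conjI allI impI)
  show "W ~= {}"
  proof
   assume "W = {}"
   then have "1 \<in> IW W" using pol_1 unfolding IW_def pre_def vanishing_ideal_def by simp
   then show False using pprimeD(2)[OF P] by blast
  qed
  fix A B assume AB: "closedin T A & closedin T B & W \<subseteq> A \<union> B"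
  show "W \<subseteq> A \<or> W \<subseteq> B"
  proof (rule ccontr)
   assume "\<not> (W \<subseteq> A \<or> W \<subseteq> B)"
   then have "\<not> IW A \<subseteq> IW W" "\<not> IW B \<subseteq> IW W"
    using closed_subset_iff[of A W] closed_subset_iff[of B W] AB by blast+
   then obtain f g where fg: "f \<in> IW A" "f ~: IW W" "g \<in> IW B" "g ~: IW W" by blast
   have pp: "pol f" "pol g" using fg unfolding IW_def vanishing_ideal_def by blast+
   have "(f * g) x = 0" if "x \<in> pre W" for x
   proof -
    have "x \<in> pre A \<or> x \<in> pre B" using that AB unfolding pre_def by blast
    then show ?thesis using fg unfolding IW_def vanishing_ideal_def by auto
   qed
   then have "f * g \<in> IW W" unfolding IW_def vanishing_ideal_def using pol_mult[OF pp] by blast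
   then show False using pprimeD(3)[OF P pp] fg by blast
  qed
 qed simp
qed

lemma finite_irreducible_decomposition:
 "closedin T Y ==> \<exists>\<C>. finite \<C> & (\<forall>C\<in>\<C>. closedin T C & irreducible_in T C) & Y = \<Union>\<C>"
proof -
 have "pideal I ==> \<forall>Y. closedin T Y & IW Y = I -->
  (\<exists>\<C>. finite \<C> & (\<forall>C\<in>\<C>. closedin T C & irreducible_in T C) & Y = \<Union>\<C>)" for I
 proof (induction I rule: noetherian_induct)
  case (step I)
  show ?case
  proof (intro allI impI)
   fix Y assume Y: "closedin T Y & IW Y = I"
   have IH: "\<exists>\<C>. finite \<C> & (\<forall>C\<in>\<C>. closedin T C & irreducible_in T C) & Y' = \<Union>\<C>"
    if "closedin T Y'" "Y' \<subset> Y" for Y'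
   proof -
    have "I \<subset> IW Y'" using IW_strict[OF that(1) _ that(2)] Y by blast
    then show ?thesis using step.IH[OF hidealD(1)[OF hideal_IW[of Y']]] that(1) by blast
   qed
   show "\<exists>\<C>. finite \<C> & (\<forall>C\<in>\<C>. closedin T C & irreducible_in T C) & Y = \<Union>\<C>"
   proof (cases "Y = {} \<or> irreducible_in T Y")
    case True
    then show ?thesis
    proof
     assume "Y = {}"
     then show ?thesis by (intro exI[of _ "{}"]) simp
    next
     assume "irreducible_in T Y"
     then show ?thesis using Y by (intro exI[of _ "{Y}"]) simp
    qed
   next
    case False
    then obtain A B where AB: "closedin T A" "closedin T B" "Y \<subseteq> A \<union> B" "\<not> Y \<subseteq> A" "\<not> Y \<subseteq> B"
     unfolding irreducible_in_def topspace_T by blast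
    have cl: "closedin T (Y \<inter> A)" "closedin T (Y \<inter> B)" using AB Y by (auto intro: closedin_Int)
    have "Y \<inter> A \<subset> Y" "Y \<inter> B \<subset> Y" using AB by blast+
    note IH' = IH[OF cl(1) this(1)] IH[OF cl(2) this(2)]
    from IH'(1) obtain \<C> where C: "finite \<C>" "\<forall>C\<in>\<C>. closedin T C & irreducible_in T C" "Y \<inter> A = \<Union>\<C>"
     by (elim exE conjE)
    from IH'(2) obtain \<C>' where C': "finite \<C>'" "\<forall>C\<in>\<C>'. closedin T C & irreducible_in T C" "Y \<inter> B = \<Union>\<C>'"
     by (elim exE conjE)
    show ?thesis
    proof (intro exI[of _ "\<C> \<union> \<C>'"] conjI)
     show "finite (\<C> \<union> \<C>')" using C(1) C'(1) by simp
     show "\<forall>C\<in>\<C> \<union> \<C>'. closedin T C & irreducible_in T C" using C(2) C'(2) by (simp add: ball_Un)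
     have "Y = (Y \<inter> A) \<union> (Y \<inter> B)" using AB(3) by blast
     then show "Y = \<Union>(\<C> \<union> \<C>')" by (simp only: C(3) C'(3) Union_Un_distrib)
    qed
   qed
  qed
 qed
 then show "closedin T Y ==> ?thesis" using hidealD(1)[OF hideal_IW] by blast
qed

lemma irreducible_components_T:
 assumes "closedin T Y"
 shows "finite (irreducible_components T Y)"
  and "C \<in> irreducible_components T Y ==> closedin T C & irreducible_in T C & C \<subseteq> Y"
  and "irreducible_in T C ==> C \<subseteq> Y ==> \<exists>C'\<in>irreducible_components T Y. C \<subseteq> C'"
proof -
 obtain \<C> where C: "finite \<C>" "\<forall>C\<in>\<C>. closedin T C & irreducible_in T C" "Y = \<Union>\<C>"
  using finite_irreducible_decomposition[OF assms] by blast
 note * = irreducible_components_finite_union[OF C(1) _ C(3), of T]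
 have sub: "irreducible_components T Y \<subseteq> \<C>" using *(1) C(2) by blast
 then show "finite (irreducible_components T Y)" using C(1) finite_subset by blast
 show "C \<in> irreducible_components T Y ==> closedin T C & irreducible_in T C & C \<subseteq> Y"
  using sub C(2,3) by blast
 show "irreducible_in T C ==> C \<subseteq> Y ==> \<exists>C'\<in>irreducible_components T Y. C \<subseteq> C'"
  using *(2) C(2) by blast
qed

lemma IW_superset:
 assumes J: "hideal J" and C: "C \<subseteq> Vp J"
 shows "J \<subseteq> IW C"
proof
 fix f assume f: "f \<in> J"
 have "f x = 0" if "x \<in> pre C" for x
 proof -
  have "x \<in> pre (Vp J)" using that C by (auto simp: pre_def)
  then show ?thesis using f pre_Vp[OF hidealD(2)[OF J]] by (auto simp: zset_def)
 qed
 then show "f \<in> IW C" using pidealD(1)[OF hidealD(1)[OF J] f] by (simp add: IW_def vanishing_ideal_def)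
qed

section \<open>Intersection numbers as leading coefficients\<close>

lemma div_multiplicity_eq: "div_multiplicity D \<pi> W l C = local_length (IW C) (adjoin (IW W) l)"
proof -
 have "{I. ideal I polynomial_ring & IW W \<subseteq> I & l \<in> I &
   (\<forall>f g. pol f & pol g & g ~: IW C & (%x. g x * f x) \<in> I --> f \<in> I)} =
   saturated (IW C) (adjoin (IW W) l)" unfolding saturated_adjoin[OF hidealD(1)[OF hideal_IW]]
  unfolding pideal_iff_ideal saturated_def times_fun_def by blast
 then show ?thesis
  unfolding div_multiplicity_def local_length_def Let_def IW_def[symmetric] pre_def[symmetric] by simp
qed

lemma H_point: "H (IW {p}) g = 1"
proof -
 obtain x where x: "x \<in> D" "\<pi> x = p" using \<pi>_surj by (metis UNIV_I imageE)
 have "\<forall>k. \<exists>i. wt i = k & X i x ~= 0" using x(1) by (simp add: D_eq)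
 then obtain c where c: "!!k. wt (c k) = k" "!!k. X (c k) x ~= 0" by metis
 \<comment> \<open>A monomial of multidegree \<open>g\<close> in coordinates that are nonzero at
   \<open>x\<close>. It shows that evaluation at \<open>x\<close> is not 0 on \<open>R g\<close>, so
   its image has dimension exactly 1.\<close>
 define e where "e i = (if i = c (wt i) then g (wt i) else 0)" for i
 have "mdeg e k = g k" for k
 proof -
  have "(\<Sum>i | wt i = k. e i) = (\<Sum>i\<in>{c k}. g k)"
   by (rule sum.mono_neutral_cong_right) (auto simp: e_def c)
  then show ?thesis by (simp add: mdeg_def)
 qed
 then have "mon e \<in> R g" using mon_R[of e] by (metis ext)
 moreover have "X i x ^ e i ~= 0" for i using c(2)[of "wt i"] by (cases "i = c (wt i)") (auto simp: e_def)
 then have "mon e x ~= 0" by (simp add: mon_def)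
 ultimately obtain f0 where f0: "f0 \<in> R g" "f0 x ~= 0" by blast
 define \<phi> :: "('a => complex) => 'a => complex" where "\<phi> f = (%_. f x)" for f
 have l: "flin \<phi>" by (rule flinI) (auto simp: \<phi>_def)
 have "H (IW {p}) g = int (fs.dim (\<phi> ` R g))"
 proof (rule H_eq_dim_image[OF l])
  fix f assume f: "f \<in> R g"
  have "f x = 0 \<longleftrightarrow> f \<in> IW {p}"
  proof
   assume "f x = 0"
   then have "f y = 0" if "y \<in> pre {p}" for y using that x \<pi>_eq[of x y] R_sc[OF f] by (auto simp: pre_def)
   then show "f \<in> IW {p}" using R_pol[OF f] by (simp add: IW_def vanishing_ideal_def)
  next
   assume "f \<in> IW {p}"
   then show "f x = 0" using x by (simp add: IW_def vanishing_ideal_def pre_def)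
  qed
  then show "\<phi> f = 0 \<longleftrightarrow> f \<in> IW {p}" by (auto simp: \<phi>_def fun_eq_iff)
 qed
 also have "\<phi> ` R g = fs.span {%_. 1}"
 proof
  have "\<phi> f = fsc (f x) (%_. 1)" for f by (auto simp: \<phi>_def)
  moreover have "fsc c (%_. 1) \<in> fs.span {%_. 1}" for c :: complex
   by (intro fs.span_scale fs.span_base) simp
  ultimately show "\<phi> ` R g \<subseteq> fs.span {%_. 1}" by (metis image_subsetI)
  have "(%_. 1) = fsc (1 / f0 x) (\<phi> f0)" using f0 by (auto simp: \<phi>_def)
  moreover have "fsc (1 / f0 x) (\<phi> f0) \<in> \<phi> ` R g"
   using flin_image_subspace[OF l subspace_R] f0(1) by (intro fs.subspace_scale) auto
  ultimately have "(%_. 1) \<in> \<phi> ` R g" by (simp only:)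
  then show "fs.span {%_. 1} \<subseteq> \<phi> ` R g"
   by (intro fs.span_minimal flin_image_subspace[OF l subspace_R]) blast
 qed
 also have "fs.dim (fs.span {%_::'a. 1 :: complex}) = 1"
 proof -
  have "fs.independent {%_::'a. 1 :: complex}" by (simp add: fs.independent_insert fun_eq_iff)
  then have "fs.dim {%_::'a. 1 :: complex} = card {%_::'a. 1 :: complex}"
   by (rule fs.dim_eq_card_independent)
  then show ?thesis unfolding fs.dim_span by simp
 qed
 finally show ?thesis by simp
qed

lemma not_dg_0_IW: "W ~= {} ==> \<not> dg 0 (H (IW W))"
proof
 assume "W ~= {}" "dg 0 (H (IW W))"
 then obtain p c where p: "p \<in> W" and c: "!!g. (\<forall>k. c <= g k) ==> H (IW W) g = 0"
  unfolding dg.simps evc_def by blast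
 have "H (IW {p}) (%_. c) <= H (IW W) (%_. c)"
  by (rule H_antimono[OF IW_antimono]) (use p in blast)
 then show False using c[of "%_. c"] H_point by simp
qed

lemma closed_point: "closedin T {p}"
 unfolding closedin_T
proof
 show "pre {p} \<subseteq> D \<inter> zset (IW {p})"
  unfolding IW_def using subset_zset_vanishing pre_subset_D by blast
 show "D \<inter> zset (IW {p}) \<subseteq> pre {p}"
 proof
  fix y assume y: "y \<in> D \<inter> zset (IW {p})"
  obtain x where x: "x \<in> D" "\<pi> x = p" using \<pi>_surj by (metis UNIV_I imageE)
  have "\<forall>k. \<exists>i. wt i = k & X i x ~= 0" using x(1) by (simp add: D_eq)
  then obtain c where c: "!!k. wt (c k) = k" "!!k. X (c k) x ~= 0" by metis
  \<comment> \<open>The only candidate for the scaling from \<open>x\<close> to \<open>y\<close>.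
    That it works for every coordinate follows from the two-by-two minors, which vanish on the orbit
    of \<open>x\<close>.\<close>
  define s where "s k = X (c k) y / X (c k) x" for k
  have Xj: "X j y = s (wt j) * X j x" for j
  proof -
   let ?f = "fsc (X j x) (X (c (wt j))) - fsc (X (c (wt j)) x) (X j)"
   have "?f z = 0" if z: "z \<in> pre {p}" for z
   proof -
    have "z \<in> D" "\<pi> x = \<pi> z" using z x(2) by (auto simp: pre_def)
    then obtain t where "z = sc t x" using \<pi>_eq[OF x(1)] by blast
    then show ?thesis by (simp add: c)
   qed
   then have "?f \<in> IW {p}"
    unfolding IW_def vanishing_ideal_def using pol_diff[OF pol_fsc[OF pol_X] pol_fsc[OF pol_X]] by blast
   then have "?f y = 0" using y unfolding zset_def by blast
   then show ?thesis using c(2) by (simp add: s_def field_simps)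
  qed
  have "s k ~= 0" for k
  proof -
   have "\<exists>i. wt i = k & X i y ~= 0" using y by (auto simp: D_eq)
   then show ?thesis using Xj by auto
  qed
  moreover have "y = sc s x" by (rule X_inj) (simp add: Xj)
  ultimately have "\<pi> y = p" using \<pi>_sc[OF x(1)] x(2) by simp
  then show "y \<in> pre {p}" using y by (simp add: pre_def)
 qed
qed

text \<open>If the ideal of a point of \<open>W\<close> were strictly larger than that of
  \<open>W\<close>, its Hilbert function would be eventually 0 by \<open>H_strict\<close>, whereas
  it is constantly 1.\<close>

lemma dim_0_is_point:
 assumes W: "closedin T W" "irreducible_in T W" and "dg (Suc 0) (H (IW W))"
 shows "\<exists>p. W = {p}"
proof -
 obtain p where p: "p \<in> W" using W(2) unfolding irreducible_in_def by blast
 have sub: "IW W \<subseteq> IW {p}" by (rule IW_antimono) (use p in blast)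
 have P: "pprime (IW W)" using irreducible_iff_prime[OF W(1)] W(2) by blast
 have "\<not> IW W \<subset> IW {p}"
  using H_strict[OF hideal_IW P hideal_IW _ assms(3), of "{p}"] not_dg_0_IW[of "{p}"] by blast
 then have "IW W = IW {p}" using sub by blast
 then show ?thesis using IW_inj[OF W(1) closed_point] by blast
qed

text \<open>Induction along the defining cuts: \<open>fdiff_H_prime\<close> turns a cut into a
  difference, and \<open>coef_local_length\<close> distributes the leading coefficient of
  \<open>IW W + (l)\<close> over the components with the multiplicities of the definition as
  weights. In particular the number does not depend on the sections chosen.\<close>

theorem intersection_number_coef:
 assumes "intersection_number D \<pi> Ls W k" "Ls = map L ks"
  "closedin T W" "irreducible_in T W" "dg (Suc (length ks)) (H (IW W))"
 shows "int k = coef ks (H (IW W))" using assms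
proof (induction arbitrary: ks rule: intersection_number.induct)
 case (degree_point p)
 then have "ks = []" by simp
 have "coef [] (H (IW {p})) = 1" by (rule coef_eqI) (simp add: evc_def H_point)
 then show ?case using \<open>ks = []\<close> by simp
next
 case (cut l L' W \<A> Ls k)
 obtain k0 ks' where ks: "ks = k0 # ks'" "L' = L k0" "Ls = map L ks'" using cut.prems(1) by auto
 have W: "closedin T W" by fact
 have P: "pprime (IW W)" using irreducible_iff_prime[OF W] cut.prems(3) by blast
 have lR: "l \<in> R (eg k0)" using L_R cut.hyps(1) ks(2) by blast
 have nl: "l ~: IW W" using Vp_adjoin(2)[OF W lR] cut.hyps(2) by blast
 let ?J = "adjoin (IW W) l"
 have hJ: "hideal ?J" by (rule hideal_adjoin[OF hideal_IW lR])
 have fd: "fdiff k0 (H (IW W)) = (%g. H ?J (g + eg k0))" by (rule fdiff_H_prime[OF hideal_IW P lR nl])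
 have "dg (Suc (length ks')) (fdiff k0 (H (IW W)))"
 proof -
  have "dg (length ks) (fdiff k0 (H (IW W)))" using cut.prems(4) by simp
  then show ?thesis unfolding ks(1) length_Cons .
 qed
 then have dJ: "dg (Suc (length ks')) (H ?J)" unfolding fd dg_shift .
 have Y: "closedin T (Vp ?J)" by (rule closed_Vp[OF hJ])
 have A: "\<A> = irreducible_components T (Vp ?J)" using cut.hyps(3) Vp_adjoin(1)[OF W lR] by simp
 have fin: "finite \<A>" unfolding A by (rule irreducible_components_T(1)[OF Y])
 have comp: "closedin T C" "irreducible_in T C" "C \<subseteq> Vp ?J" if "C \<in> \<A>" for C
  using irreducible_components_T(2)[OF Y] that unfolding A by blast+
 have JIW: "?J \<subseteq> IW C" if "C \<subseteq> Vp ?J" for C by (rule IW_superset[OF hJ that])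
 have dC: "dg (Suc (length ks')) (H (IW C))" if "C \<in> \<A>" for C
  by (rule H_dg_mono[OF hJ hideal_IW JIW[OF comp(3)[OF that]] dJ])
 have kC: "int (k C) = coef ks' (H (IW C))" if "C \<in> \<A>" for C
  using cut.IH that ks(3) comp[OF that] dC[OF that] by blast
 \<comment> \<open>Only components of full dimension are primes counted by
   \<open>coef_local_length\<close>; the others enter the defining sum with coefficient 0.\<close>
 let ?B = "{C\<in>\<A>. \<not> dg (length ks') (H (IW C))}"
 have inj: "inj_on IW ?B" by (rule inj_onI, rule IW_inj) (use comp in auto)
 have "(\<forall>P\<in>IW ` ?B. \<exists>n. local_length P ?J = enat n) &
  coef ks' (H ?J) = (\<Sum>P\<in>IW ` ?B. int (the_enat (local_length P ?J)) * coef ks' (H P))"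
 proof (rule coef_local_length[OF _ _ hJ dJ])
  show "finite (IW ` ?B)" using fin by simp
  show "hideal P & pprime P & \<not> dg (length ks') (H P)" if "P \<in> IW ` ?B" for P
   using that hideal_IW irreducible_iff_prime comp by blast
  fix P assume P: "hideal P" "pprime P" "?J \<subseteq> P" "\<not> dg (length ks') (H P)"
  have rel: "relevant P" using not_relevant_dg_0[OF hidealD(1)[OF P(1)]] dg_mono[of 0] P(4) by blast
  note IV = IW_Vp[OF P(1,2) rel]
  have cV: "closedin T (Vp P)" by (rule closed_Vp[OF P(1)])
  have iV: "irreducible_in T (Vp P)" using irreducible_iff_prime[OF cV] IV P(2) by simp
  have "Vp P \<subseteq> Vp ?J" unfolding Vp_def using zset_antimono[OF P(3)] by blast
  then obtain C where C: "C \<in> \<A>" "Vp P \<subseteq> C" using irreducible_components_T(3)[OF Y iV] A by blast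
  have "IW C \<subseteq> P" using IW_antimono[OF C(2)] IV by simp
  moreover have "\<not> IW C \<subset> P"
  proof
   assume "IW C \<subset> P"
   moreover have "pprime (IW C)" using irreducible_iff_prime comp[OF C(1)] by blast
   ultimately have "dg (length ks') (H P)" using H_strict[OF hideal_IW _ P(1) _ dC[OF C(1)]] by blast
   then show False using P(4) by blast
  qed
  ultimately have "IW C = P" by blast
  then show "P \<in> IW ` ?B" using C(1) P(4) by blast
 qed
 then have "coef ks' (H ?J) = (\<Sum>C\<in>?B. int (the_enat (local_length (IW C) ?J)) * coef ks' (H (IW C)))"
  by (simp add: sum.reindex[OF inj])
 also have "\<dots> = (\<Sum>C\<in>\<A>. int (the_enat (local_length (IW C) ?J)) * coef ks' (H (IW C)))"
  by (rule sum.mono_neutral_left[OF fin]) (auto simp: coef_0)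
 also have "\<dots> = int (\<Sum>C\<in>\<A>. the_enat (div_multiplicity D \<pi> W l C) * k C)"
  unfolding div_multiplicity_eq of_nat_sum of_nat_mult by (rule sum.cong[OF refl]) (simp add: kC)
 finally show ?case unfolding ks(1) coef_Cons fd coef_shift by simp
qed

text \<open>The degrees are definite descriptions, so a derivation has to be exhibited. A cut is
  always possible, since \<open>W\<close> is nonempty and hence some coordinate of weight
  \<open>k0\<close> is not identically 0 on it.\<close>

theorem intersection_number_exists:
 assumes "closedin T W" "irreducible_in T W" "dg (Suc (length ks)) (H (IW W))"
 shows "\<exists>k. intersection_number D \<pi> (map L ks) W k" using assms
proof (induction ks arbitrary: W)
 case Nil
 then obtain p where "W = {p}" using dim_0_is_point[of W] by auto
 then show ?case using intersection_number.degree_point by fastforce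
next
 case (Cons k0 ks)
 have W: "closedin T W" by fact
 have P: "pprime (IW W)" using irreducible_iff_prime[OF W] Cons.prems(2) by blast
 have "W ~= {}" using Cons.prems(2) unfolding irreducible_in_def by blast
 then obtain i where i: "wt i = k0" "X i ~: IW W" using relevant_IW unfolding relevant_def by blast
 have lR: "X i \<in> R (eg k0)" using X_R[of i] i(1) by simp
 let ?J = "adjoin (IW W) (X i)"
 have hJ: "hideal ?J" by (rule hideal_adjoin[OF hideal_IW lR])
 have fd: "fdiff k0 (H (IW W)) = (%g. H ?J (g + eg k0))" by (rule fdiff_H_prime[OF hideal_IW P lR i(2)])
 have "dg (Suc (length ks)) (fdiff k0 (H (IW W)))"
 proof -
  have "dg (length (k0 # ks)) (fdiff k0 (H (IW W)))" using Cons.prems(3) by simp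
  then show ?thesis unfolding length_Cons .
 qed
 then have dJ: "dg (Suc (length ks)) (H ?J)" unfolding fd dg_shift .
 have Y: "closedin T (Vp ?J)" by (rule closed_Vp[OF hJ])
 let ?A = "irreducible_components T (Vp ?J)"
 have "\<exists>k. intersection_number D \<pi> (map L ks) C k" if "C \<in> ?A" for C
 proof (rule Cons.IH)
  show "closedin T C" "irreducible_in T C" using irreducible_components_T(2)[OF Y that] by blast+
  have "?J \<subseteq> IW C" using IW_superset[OF hJ] irreducible_components_T(2)[OF Y that] by blast
  then show "dg (Suc (length ks)) (H (IW C))" by (rule H_dg_mono[OF hJ hideal_IW _ dJ])
 qed
 then obtain k where k: "\<forall>C\<in>?A. intersection_number D \<pi> (map L ks) C (k C)" by metis
 have "intersection_number D \<pi> (L k0 # map L ks) W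
  (\<Sum>C\<in>?A. the_enat (div_multiplicity D \<pi> W (X i) C) * k C)"
 proof (rule intersection_number.cut)
  show "X i \<in> L k0" using X_L[of i] i(1) by simp
  show "\<not> W \<subseteq> section_zeros D \<pi> (X i)" using Vp_adjoin(2)[OF W lR] i(2) by blast
  show "?A = irreducible_components T (W \<inter> section_zeros D \<pi> (X i))" using Vp_adjoin(1)[OF W lR] by simp
 qed (rule k)
 then show ?case by auto
qed

lemma the_intersection_number:
 assumes "closedin T W" "irreducible_in T W" "dg (Suc (length ks)) (H (IW W))"
 shows "int (THE k. intersection_number D \<pi> (map L ks) W k) = coef ks (H (IW W))"
proof -
 obtain k where k: "intersection_number D \<pi> (map L ks) W k" using intersection_number_exists[OF assms] by blast
 have eq: "int k' = coef ks (H (IW W))" if "intersection_number D \<pi> (map L ks) W k'" for k'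
  by (rule intersection_number_coef[OF that refl assms])
 have "(THE k. intersection_number D \<pi> (map L ks) W k) = k"
 proof (rule the_equality)
  show "intersection_number D \<pi> (map L ks) W k" by (rule k)
  fix k' assume "intersection_number D \<pi> (map L ks) W k'"
  then show "k' = k" using eq eq[OF k] by (metis of_nat_eq_iff)
 qed
 then show ?thesis using eq[OF k] by simp
qed

section \<open>Krull dimension as the degree of the Hilbert function\<close>

lemma ex_prime_not_dg:
 assumes "hideal I" "\<not> dg m (H I)"
 obtains P where "hideal P" "pprime P" "I \<subseteq> P" "\<not> dg m (H P)"
proof -
 let ?F = "{J. hideal J & I \<subseteq> J & \<not> dg m (H J)}"
 obtain P where P: "P \<in> ?F" "!!L. L \<in> ?F ==> P \<subseteq> L ==> L = P"
  using maximal_pideal[of ?F I] assms hidealD(1) by blast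
 then have hP: "hideal P" and nP: "\<not> dg m (H P)" and IP: "I \<subseteq> P" by auto
 have "pprime P"
 proof (rule hideal_cases[OF hP])
  assume "1 \<in> P"
  then have "H P = (%_. 0)" by (rule H_unit[OF _ hidealD(1)[OF hP]])
  then show ?thesis using nP dg_zero by metis
 next
  fix a h assume a: "a \<in> R h" "a ~: P" "P \<subset> colon P a" "P \<subset> adjoin P a"
  have "dg m (H (colon P a))" "dg m (H (adjoin P a))"
   using P(2)[of "colon P a"] P(2)[of "adjoin P a"] hideal_colon[OF hP a(1)] hideal_adjoin[OF hP a(1)] a IP
   by blast+
  then have "dg m (%g. H (colon P a) g + H (adjoin P a) (g + h))"
   by (intro dg_add) (simp_all only: dg_shift)
  then have "dg m (%g. H P (g + h))" unfolding H_exact[OF hP a(1)] .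
  then show ?thesis using nP unfolding dg_shift by blast
 qed
 then show ?thesis using that hP IP nP by blast
qed

text \<open>Cut by a coordinate in a direction whose difference still has large degree, and pick a
  prime over the cut that keeps this degree. It is the ideal of a closed irreducible set strictly
  inside \<open>W\<close>.\<close>

lemma chain_below:
 assumes "closedin T W" "irreducible_in T W" "\<not> dg m (H (IW W))"
 shows "\<exists>c. is_chain {C. closedin T C & irreducible_in T C} m c & c m = W" using assms
proof (induction m arbitrary: W)
 case 0
 then show ?case by (intro exI[of _ "%_. W"]) (simp add: is_chain_def)
next
 case (Suc m)
 have W: "closedin T W" by fact
 have P: "pprime (IW W)" using irreducible_iff_prime[OF W] Suc.prems(2) by blast
 obtain k where k: "\<not> dg m (fdiff k (H (IW W)))" using Suc.prems(3) by auto
 have "W ~= {}" using Suc.prems(2) unfolding irreducible_in_def by blast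
 then obtain i where i: "wt i = k" "X i ~: IW W" using relevant_IW unfolding relevant_def by blast
 have lR: "X i \<in> R (eg k)" using X_R[of i] i(1) by simp
 let ?J = "adjoin (IW W) (X i)"
 have hJ: "hideal ?J" by (rule hideal_adjoin[OF hideal_IW lR])
 have "\<not> dg m (H ?J)" using k unfolding fdiff_H_prime[OF hideal_IW P lR i(2)] dg_shift .
 then obtain Q where Q: "hideal Q" "pprime Q" "?J \<subseteq> Q" "\<not> dg m (H Q)"
  using ex_prime_not_dg[OF hJ] by blast
 have rel: "relevant Q" using not_relevant_dg_0[OF hidealD(1)[OF Q(1)]] dg_mono[of 0] Q(4) by blast
 note IV = IW_Vp[OF Q(1,2) rel]
 have cV: "closedin T (Vp Q)" by (rule closed_Vp[OF Q(1)])
 have iV: "irreducible_in T (Vp Q)" using irreducible_iff_prime[OF cV] IV Q(2) by simp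
 obtain c where c: "is_chain {C. closedin T C & irreducible_in T C} m c" "c m = Vp Q"
  using Suc.IH[OF cV iV] IV Q(4) by auto
 have "X i \<in> Q" using adjoin_mem[OF hidealD(1)[OF hideal_IW]] Q(3) by blast
 then have "IW W \<subset> IW (Vp Q)" using adjoin_superset Q(3) i(2) unfolding IV by blast
 then have "Vp Q \<subset> W" using closed_subset_iff[OF W] IW_antimono by blast
 then have "is_chain {C. closedin T C & irreducible_in T C} (Suc m) (c(Suc m := W))"
  using c W Suc.prems(2) unfolding is_chain_def by (auto simp: less_Suc_eq le_Suc_eq)
 then show ?case by (intro exI[of _ "c(Suc m := W)"] conjI) (assumption, simp)
qed

text \<open>By \<open>H_strict\<close> every proper inclusion raises the degree of the Hilbert
  function by at least one.\<close>

lemma chain_not_dg: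
 assumes "is_chain {C. closedin T C & irreducible_in T C} k c" "j <= k"
 shows "\<not> dg j (H (IW (c j)))" using assms(2)
proof (induction j)
 case 0
 then have "irreducible_in T (c 0)" using assms(1) unfolding is_chain_def by blast
 then show ?case using not_dg_0_IW unfolding irreducible_in_def by blast
next
 case (Suc j)
 have c: "closedin T (c j)" "closedin T (c (Suc j))" "irreducible_in T (c (Suc j))" "c j \<subset> c (Suc j)"
  using assms(1) Suc.prems unfolding is_chain_def by auto
 show ?case
 proof
  assume "dg (Suc j) (H (IW (c (Suc j))))"
  then have "dg j (H (IW (c j)))"
   using H_strict[OF hideal_IW _ hideal_IW IW_strict[OF c(1,2,4)]] irreducible_iff_prime[OF c(2)] c(3) by blast
  then show False using Suc by simp
 qed
qed

theorem krull_dim_T: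
 assumes W: "closedin T W" "irreducible_in T W" and m: "dg (Suc m) (H (IW W))" "\<not> dg m (H (IW W))"
 shows "krull_dim T W = enat m"
proof -
 let ?F = "{C. closedin T C & irreducible_in T C}"
 have F: "{C. closedin (subtopology T W) C & irreducible_in T C} = {C\<in>?F. C \<subseteq> W}"
  using closedin_closed_subtopology[OF W(1)] by blast
 show ?thesis unfolding krull_dim_def F
 proof (rule antisym)
  show "chain_length {C\<in>?F. C \<subseteq> W} <= enat m"
  proof (rule chain_length_le, rule ccontr)
   fix k c assume c: "is_chain {C\<in>?F. C \<subseteq> W} k c" "\<not> k <= m"
   then have "is_chain ?F k c" unfolding is_chain_def by blast
   then have "\<not> dg k (H (IW (c k)))" using chain_not_dg by blast
   moreover have "c k \<subseteq> W" using c(1) unfolding is_chain_def by blast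
   then have "dg k (H (IW (c k)))"
    using H_dg_mono[OF hideal_IW hideal_IW IW_antimono dg_mono[OF m(1)]] c(2) by auto
   ultimately show False by blast
  qed
  obtain c where c: "is_chain ?F m c" "c m = W" using chain_below[OF W m(2)] by blast
  have "c i \<subseteq> W" if "i <= m" for i using is_chain_mono[OF c(1) that] c(2) by blast
  then have "is_chain {C\<in>?F. C \<subseteq> W} m c" using c(1) unfolding is_chain_def by auto
  then show "enat m <= chain_length {C\<in>?F. C \<subseteq> W}" by (rule chain_length_ge)
 qed
qed

lemma ex_dim:
 assumes "closedin T W" "irreducible_in T W"
 obtains m where "dg (Suc m) (H (IW W))" "\<not> dg m (H (IW W))" "krull_dim T W = enat m"
proof -
 have ex: "\<exists>M. dg M (H (IW W))" using good_H[OF hideal_IW] unfolding good_def by blast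
 define M where "M = (LEAST M. dg M (H (IW W)))"
 have M: "dg M (H (IW W))" unfolding M_def using ex by (rule LeastI_ex)
 have "M ~= 0" using M not_dg_0_IW[of W] assms(2) unfolding irreducible_in_def by metis
 then obtain m where m: "M = Suc m" by (cases M) auto
 have "\<not> dg m (H (IW W))" using not_less_Least[of m "%M. dg M (H (IW W))"] m M_def by simp
 then show ?thesis using that M m krull_dim_T[OF assms] by blast
qed

lemma dim_iff:
 assumes "closedin T W" "irreducible_in T W" "krull_dim T W = enat m"
 shows "dg (Suc m) (H (IW W))" "\<not> dg m (H (IW W))" using ex_dim[OF assms(1,2)] assms(3) by (metis enat.inject)+

lemma closure_of_image:
 assumes S: "S \<subseteq> D" "!!x s. x \<in> S ==> (!!k. s k ~= 0) ==> sc s x \<in> S"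
 shows "T closure_of (\<pi> ` S) = Vp (\<I> S)"
  and "IW (T closure_of (\<pi> ` S)) = \<I> S"
proof -
 have h: "hideal (\<I> S)" unfolding hideal_def by (intro conjI vanishing_ideal_pideal stable_vanishing_ideal S(2))
 show *: "T closure_of (\<pi> ` S) = Vp (\<I> S)"
 proof (rule closure_of_unique)
  show "\<pi> ` S \<subseteq> Vp (\<I> S)" unfolding Vp_def using S(1) subset_zset_vanishing by blast
  show "closedin T (Vp (\<I> S))" by (rule closed_Vp[OF h])
  fix W assume W: "\<pi> ` S \<subseteq> W" "closedin T W"
  have "S \<subseteq> pre W" using W(1) S(1) by (auto simp: pre_def)
  then have "IW W \<subseteq> \<I> S" unfolding IW_def by (rule vanishing_ideal_antimono)
  then have "D \<inter> zset (\<I> S) \<subseteq> pre W" using W(2) zset_antimono unfolding closedin_T by blast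
  then show "Vp (\<I> S) \<subseteq> W" unfolding Vp_def pre_def by blast
 qed
 have "S \<subseteq> D \<inter> zset (\<I> S)" using S(1) subset_zset_vanishing by blast
 then have "\<I> (D \<inter> zset (\<I> S)) \<subseteq> \<I> S" by (rule vanishing_ideal_antimono)
 moreover have "\<I> S \<subseteq> \<I> (D \<inter> zset (\<I> S))" unfolding vanishing_ideal_def zset_def by blast
 ultimately show "IW (T closure_of (\<pi> ` S)) = \<I> S" unfolding * IW_def pre_Vp[OF hidealD(2)[OF h]] by blast
qed

end

section \<open>Growth of coordinate rings of affine sets\<close>

lemma dim_direct_sum:
 assumes "fs.subspace A" "fs.subspace B" "findim A" "findim B" "A \<inter> B \<subseteq> {0}"
 shows "fs.dim {a + b | a b. a \<in> A & b \<in> B} = fs.dim A + fs.dim B"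
proof -
 let ?S = "{a + b | a b. a \<in> A & b \<in> B}"
 obtain \<phi> :: "('a => complex) => 'a => complex" where \<phi>: "flin \<phi>" "!!x. \<phi> x = 0 \<longleftrightarrow> x \<in> A"
  using ex_quotient_map[OF assms(1)] by blast
 obtain TA TB where TA: "finite TA" "A \<subseteq> fs.span TA" and TB: "finite TB" "B \<subseteq> fs.span TB"
  using assms(3,4) unfolding findim_def by blast
 have "findim ?S" unfolding findim_def
 proof (intro exI[of _ "TA \<union> TB"] conjI subsetI)
  show "finite (TA \<union> TB)" using TA TB by simp
  fix u assume "u \<in> ?S"
  then obtain a b where ab: "u = a + b" "a \<in> A" "b \<in> B" by blast
  have "a \<in> fs.span (TA \<union> TB)" "b \<in> fs.span (TA \<union> TB)"
   using ab(2,3) TA(2) TB(2) fs.span_mono[of TA "TA \<union> TB"] fs.span_mono[of TB "TA \<union> TB"] by blast+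
  then show "u \<in> fs.span (TA \<union> TB)" unfolding ab(1) by (rule fs.span_add)
 qed
 moreover have "fs.subspace ?S" by (rule fs.subspace_sums[OF assms(1,2)])
 ultimately have 1: "fs.dim ?S = fs.dim (\<phi> ` ?S) + fs.dim {v \<in> ?S. \<phi> v = 0}"
  by (intro rank_nullity[OF \<phi>(1)])
 have A0: "0 \<in> A" and B0: "0 \<in> B" using assms(1,2) by (simp_all add: fs.subspace_0)
 have "{v \<in> ?S. \<phi> v = 0} = A"
 proof
  show "{v \<in> ?S. \<phi> v = 0} \<subseteq> A" using \<phi>(2) by blast
  show "A \<subseteq> {v \<in> ?S. \<phi> v = 0}"
  proof
   fix a assume a: "a \<in> A"
   have "a = a + 0" by simp
   then show "a \<in> {v \<in> ?S. \<phi> v = 0}" using a B0 \<phi>(2) by blast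
  qed
 qed
 moreover have "\<phi> ` ?S = \<phi> ` B"
 proof
  show "\<phi> ` ?S \<subseteq> \<phi> ` B"
  proof
   fix u assume "u \<in> \<phi> ` ?S"
   then obtain a b where ab: "u = \<phi> (a + b)" "a \<in> A" "b \<in> B" by blast
   have "\<phi> a = 0" using \<phi>(2) ab(2) by blast
   then have "u = \<phi> b" using ab(1) flin_add[OF \<phi>(1), of a b] by simp
   then show "u \<in> \<phi> ` B" using ab(3) by blast
  qed
  show "\<phi> ` B \<subseteq> \<phi> ` ?S"
  proof
   fix u assume "u \<in> \<phi> ` B"
   then obtain b where b: "u = \<phi> b" "b \<in> B" by blast
   have "b = 0 + b" by simp
   then show "u \<in> \<phi> ` ?S" using b A0 by blast
  qed
 qed
 moreover have "fs.dim B = fs.dim (\<phi> ` B) + fs.dim {v \<in> B. \<phi> v = 0}"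
  by (rule rank_nullity[OF \<phi>(1) assms(2,4)])
 moreover have "{v \<in> B. \<phi> v = 0} \<subseteq> {0}" using \<phi>(2) assms(5) by blast
 then have "fs.dim {v \<in> B. \<phi> v = 0} = 0"
  using fs_dim_0_iff[of "{v \<in> B. \<phi> v = 0}"] findim_subset[OF assms(4)] by blast
 ultimately show ?thesis using 1 by simp
qed

text \<open>The device by which dimension inequalities are drawn from growth bounds; a single
  \<open>t\<close> larger than \<open>t0\<close> and \<open>K\<close> refutes
  \<open>k > m\<close>.\<close>

lemma power_growth_compare:
 fixes K k m t0 :: nat
 assumes "!!t. t >= t0 ==> t ^ k <= K * t ^ m"
 shows "k <= m"
proof (rule ccontr)
 assume "\<not> k <= m"
 define t where "t = Suc (t0 + K)"
 have "t ^ m * t = t ^ Suc m" by simp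
 also have "\<dots> <= t ^ k" using \<open>\<not> k <= m\<close> by (intro power_increasing) (auto simp: t_def)
 also have "\<dots> <= t ^ m * K" using assms[of t] by (simp add: t_def mult.commute)
 finally have "t ^ m * t <= t ^ m * K" .
 moreover have "0 < t ^ m" by (simp add: t_def)
 ultimately have "t <= K" unfolding mult_le_cancel1 by blast
 then show False by (simp add: t_def)
qed

lemma power_le_binomial': "k <= t ==> t ^ k <= k ^ k * (t choose k)"
proof -
 assume kt: "k <= t"
 have "(real t / real k) ^ k <= real (t choose k)" using binomial_ge_n_over_k_pow_k[OF kt] by simp
 then have "real t ^ k <= real k ^ k * real (t choose k)"
  by (cases "k = 0") (simp_all add: power_divide field_simps)
 then have "real (t ^ k) <= real (k ^ k * (t choose k))" by simp
 then show ?thesis by (simp only: of_nat_le_iff)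
qed

text \<open>Restriction to \<open>Y\<close>, extended by 0 so that the coordinate ring of
  \<open>Y\<close> remains a space of functions on the same type. By \<open>restr_eq_0\<close> its
  kernel on polynomials is \<open>\<I> Y\<close>.\<close>

definition restr :: "'a set => ('a => complex) => 'a => complex" where
 "restr Y f = (%x. if x \<in> Y then f x else 0)"

lemma flin_restr: "flin (restr Y)"
 by (rule flinI) (auto simp: restr_def)

lemma restr_eq_0: "pol f ==> restr Y f = 0 \<longleftrightarrow> f \<in> \<I> Y"
 by (auto simp: restr_def vanishing_ideal_def fun_eq_iff)

locale affine_coords = graded_coords X "%_::'i. ()" for X :: "'i::finite => 'a::affine_space => complex"
begin

definition Rle :: "nat => ('a => complex) set" where
 "Rle t = fs.span (mon ` {e. (\<Sum>i\<in>UNIV. e i) <= t})"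

text \<open>The affine Hilbert function. It makes sense for arbitrary sets, not only for cones, and
  therefore controls chains of arbitrary closed sets and images under polynomial maps.\<close>

definition Fn :: "'a set => nat => nat" where
 "Fn Y t = fs.dim (restr Y ` Rle t)"

lemma mdeg_unit: "mdeg e = (%_. \<Sum>i\<in>UNIV. e i)"
 by (simp add: mdeg_def)

lemma subspace_Rle: "fs.subspace (Rle t)"
 unfolding Rle_def by simp

lemma findim_Rle: "findim (Rle t)"
 unfolding Rle_def
proof (intro findim_span finite_imageI)
 have "{e :: 'i => nat. (\<Sum>i\<in>UNIV. e i) <= t} \<subseteq> Pi\<^sub>E UNIV (%i. {..t})"
 proof
  fix e :: "'i => nat" assume "e \<in> {e. (\<Sum>i\<in>UNIV. e i) <= t}"
  moreover have "e i <= (\<Sum>i\<in>UNIV. e i)" for i by (rule member_le_sum) auto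
  ultimately have "e i <= t" for i using order_trans by blast
  then show "e \<in> Pi\<^sub>E UNIV (%i. {..t})" by auto
 qed
 then show "finite {e :: 'i => nat. (\<Sum>i\<in>UNIV. e i) <= t}"
  by (rule finite_subset) (auto intro: finite_PiE)
qed

lemma Rle_pol: "f \<in> Rle t ==> pol f"
 unfolding Rle_def using fs.span_minimal[OF _ subspace_pol, of "mon ` {e. (\<Sum>i\<in>UNIV. e i) <= t}"] pol_mon by auto

lemma Rle_mono: "s <= t ==> Rle s \<subseteq> Rle t"
 unfolding Rle_def by (intro fs.span_mono) auto

lemma R_Rle: "R (%_. t) \<subseteq> Rle t"
 unfolding R_def Rle_def by (intro fs.span_mono) (auto simp: mdeg_unit fun_eq_iff)

lemma Rle_mult: "f \<in> Rle s ==> g \<in> Rle t ==> f * g \<in> Rle (s + t)"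
 unfolding Rle_def
proof (rule span_mult)
 fix a b assume "a \<in> mon ` {e. (\<Sum>i\<in>UNIV. e i) <= s}" "b \<in> mon ` {e. (\<Sum>i\<in>UNIV. e i) <= t}"
 then obtain e e' where e: "a = mon e" "b = mon e'" "(\<Sum>i\<in>UNIV. e i) <= s" "(\<Sum>i\<in>UNIV. e' i) <= t" by blast
 then have "a * b = mon (e + e')" "(\<Sum>i\<in>UNIV. (e + e') i) <= s + t"
  by (simp_all only: mon_add plus_fun_apply sum.distrib add_mono)
 then show "a * b \<in> fs.span (mon ` {e. (\<Sum>i\<in>UNIV. e i) <= s + t})" by (intro fs.span_base) blast
qed

lemma const_Rle: "(%_. c) \<in> Rle t"
 using const_R[of c] R_Rle[of 0] Rle_mono[of 0 t] by (auto simp: zero_fun_def)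

lemma X_Rle: "X i \<in> Rle (Suc 0)"
proof -
 have "eg () = (%_. Suc 0)" by (auto simp: eg_def)
 then show ?thesis using X_R[of i] R_Rle[of "Suc 0"] by auto
qed

lemma pol_Rle:
 assumes "pol f"
 obtains t where "f \<in> Rle t"
proof -
 obtain G F where G: "finite G" "!!g. F g \<in> R g" "f = (\<Sum>g\<in>G. F g)" using pol_decomp[OF assms] by blast
 define t where "t = (\<Sum>g\<in>G. g ())"
 have "F g \<in> Rle t" if "g \<in> G" for g
 proof -
  have "g = (%_. g ())" by auto
  then have "F g \<in> Rle (g ())" using G(2)[of g] R_Rle[of "g ()"] by (metis subsetD)
  moreover have "g () <= t" unfolding t_def using member_le_sum[of g G "%g. g ()"] that G(1) by simp
  ultimately show ?thesis using Rle_mono by blast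
 qed
 then have "f \<in> Rle t" unfolding G(3) by (intro fs.subspace_sum[OF subspace_Rle])
 then show ?thesis by (rule that)
qed

lemma Rle_decomp:
 assumes "f \<in> Rle t"
 obtains F where "!!s. F s \<in> R (%_. s)" "f = (\<Sum>s\<le>t. F s)"
proof -
 obtain E c where E: "finite E" "E \<subseteq> {e. (\<Sum>i\<in>UNIV. e i) <= t}" "f = (\<Sum>e\<in>E. fsc (c e) (mon e))"
  using span_mon_expand[OF assms[unfolded Rle_def]] by blast
 define F where "F s = (\<Sum>e | e \<in> E & (\<Sum>i\<in>UNIV. e i) = s. fsc (c e) (mon e))" for s
 have "F s \<in> R (%_. s)" for s unfolding F_def
 proof (intro fs.subspace_sum[OF subspace_R] fs.subspace_scale[OF subspace_R])
  fix e assume "e \<in> {e. e \<in> E & (\<Sum>i\<in>UNIV. e i) = s}"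
  then have "mdeg e = (%_. s)" by (simp add: mdeg_unit)
  then show "mon e \<in> R (%_. s)" using mon_R[of e] by simp
 qed
 moreover have "f = (\<Sum>s\<le>t. F s)" unfolding F_def E(3) by (rule sum.group[symmetric]) (use E(1,2) in auto)
 ultimately show ?thesis using that by blast
qed

lemma Rle_Suc: "Rle (Suc t) = {a + b | a b. a \<in> Rle t & b \<in> R (%_. Suc t)}"
proof
 show "Rle (Suc t) \<subseteq> {a + b | a b. a \<in> Rle t & b \<in> R (%_. Suc t)}"
 proof
  fix f assume f: "f \<in> Rle (Suc t)"
  obtain F where F: "!!s. F s \<in> R (%_. s)" "f = (\<Sum>s\<le>Suc t. F s)" using Rle_decomp[OF f] by blast
  have "(\<Sum>s\<le>t. F s) \<in> Rle t"
   by (rule fs.subspace_sum[OF subspace_Rle]) (use F(1) R_Rle Rle_mono in \<open>simp, blast\<close>)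
  moreover have "f = (\<Sum>s\<le>t. F s) + F (Suc t)" unfolding F(2) by (rule sum.atMost_Suc)
  ultimately show "f \<in> {a + b | a b. a \<in> Rle t & b \<in> R (%_. Suc t)}" using F(1) by blast
 qed
 show "{a + b | a b. a \<in> Rle t & b \<in> R (%_. Suc t)} \<subseteq> Rle (Suc t)"
 proof
  fix u assume "u \<in> {a + b | a b. a \<in> Rle t & b \<in> R (%_. Suc t)}"
  then obtain a b where ab: "u = a + b" "a \<in> Rle t" "b \<in> R (%_. Suc t)" by blast
  have "a \<in> Rle (Suc t)" "b \<in> Rle (Suc t)" using ab Rle_mono[of t "Suc t"] R_Rle[of "Suc t"] by auto
  then show "u \<in> Rle (Suc t)" unfolding ab(1) by (rule fs.subspace_add[OF subspace_Rle])
 qed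
qed

lemma H_vanishing: "H (\<I> Y) g = int (fs.dim (restr Y ` R g))"
 by (rule H_eq_dim_image[OF flin_restr]) (simp add: restr_eq_0 R_pol)

text \<open>On a cone the restrictions of polynomials of degree at most \<open>t\<close> and of
  forms of degree \<open>Suc t\<close> meet only in 0: a common element gives a vanishing
  polynomial, and its homogeneous components then vanish too.\<close>

lemma Fn_Suc:
 assumes "stable (\<I> Y)"
 shows "int (Fn Y (Suc t)) = int (Fn Y t) + H (\<I> Y) (%_. Suc t)"
proof -
 let ?A = "restr Y ` Rle t" and ?B = "restr Y ` R (%_. Suc t)"
 have eq: "restr Y ` Rle (Suc t) = {a + b | a b. a \<in> ?A & b \<in> ?B}"
  unfolding Rle_Suc using flin_add[OF flin_restr, of Y] by (auto simp: image_iff; metis)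
 have disj: "?A \<inter> ?B \<subseteq> {0}"
 proof
  fix u assume "u \<in> ?A \<inter> ?B"
  then obtain f h where f: "f \<in> Rle t" "h \<in> R (%_. Suc t)" "u = restr Y f" "u = restr Y h" by blast
  obtain F where F: "!!s. F s \<in> R (%_. s)" "f = (\<Sum>s\<le>t. F s)" using Rle_decomp[OF f(1)] by blast
  define C where "C g = (if g () = Suc t then - h else F (g ()))" for g :: "unit => nat"
  let ?G = "(%s. %_::unit. s) ` {..Suc t}"
  have "inj_on (%s. %_::unit. s) {..Suc t}" by (auto simp: inj_on_def fun_eq_iff)
  then have "(\<Sum>g\<in>?G. C g) = (\<Sum>s\<le>Suc t. C (%_. s))" by (simp only: sum.reindex o_def)
  also have "\<dots> = (\<Sum>s\<le>t. C (%_. s)) + C (%_. Suc t)" by (rule sum.atMost_Suc)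
  also have "(\<Sum>s\<le>t. C (%_. s)) = f" unfolding F(2) by (rule sum.cong) (auto simp: C_def)
  finally have "(\<Sum>g\<in>?G. C g) = f + C (%_. Suc t)" .
  moreover have "C (%_. Suc t) = - h" by (simp add: C_def)
  ultimately have sum: "(\<Sum>g\<in>?G. C g) = f - h" by (simp only: diff_conv_add_uminus)
  have "restr Y (f - h) = 0" using f(3,4) by (simp add: flin_diff[OF flin_restr])
  then have "f - h \<in> \<I> Y" using restr_eq_0[OF pol_diff[OF Rle_pol[OF f(1)] R_pol[OF f(2)]]] by blast
  then have V: "(\<Sum>g\<in>?G. C g) \<in> \<I> Y" unfolding sum .
  have "C (%_. Suc t) \<in> \<I> Y"
  proof (rule stable_component[OF pideal_subspace[OF vanishing_ideal_pideal] assms _ _ V])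
   show "C g \<in> R g" if "g \<in> ?G" for g
    using that F(1) fs.subspace_neg[OF subspace_R f(2)] by (auto simp: C_def)
  qed auto
  then have "h \<in> \<I> Y" using pidealD(7)[OF vanishing_ideal_pideal, of "- h" Y] by (simp add: C_def)
  then show "u \<in> {0}" using restr_eq_0[OF R_pol[OF f(2)]] f(4) by simp
 qed
 have "fs.dim (restr Y ` Rle (Suc t)) = fs.dim ?A + fs.dim ?B"
  unfolding eq by (rule dim_direct_sum[OF flin_image_subspace[OF flin_restr subspace_Rle]
    flin_image_subspace[OF flin_restr subspace_R]
    findim_image[OF findim_Rle flin_restr] findim_image[OF findim_R flin_restr] disj])
 then show ?thesis unfolding Fn_def H_vanishing by simp
qed

lemma Fn_ndg:
 assumes "stable (\<I> Y)"
 shows "ndg (Suc m) (%t. int (Fn Y t)) \<longleftrightarrow> dg m (H (\<I> Y))"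
proof -
 have "nd (%t. int (Fn Y t)) = (%t. H (\<I> Y) (%_. t + 1))"
  using Fn_Suc[OF assms] by (auto simp: nd_def)
 then show ?thesis using ndg_shift[of m "%t. H (\<I> Y) (%_. t)" 1] by (simp add: dg_unit)
qed

lemma restr_restr: "Y' \<subseteq> Y ==> restr Y' (restr Y f) = restr Y' f"
 by (auto simp: restr_def fun_eq_iff)

lemma Fn_mono_set: "Y' \<subseteq> Y ==> Fn Y' t <= Fn Y t"
proof -
 assume *: "Y' \<subseteq> Y"
 have "restr Y' ` Rle t = restr Y' ` (restr Y ` Rle t)" by (simp add: image_image restr_restr[OF *])
 then show ?thesis unfolding Fn_def using dim_image_le[OF flin_restr flin_image_subspace[OF flin_restr subspace_Rle]
   findim_image[OF findim_Rle flin_restr]] by metis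
qed

lemma Fn_mono: "s <= t ==> Fn Y s <= Fn Y t"
 unfolding Fn_def by (intro dim_mono findim_image[OF findim_Rle flin_restr] image_mono Rle_mono)

text \<open>Multiplication by \<open>a\<close> is injective on the coordinate ring of
  \<open>Y\<close> and lands in the functions that vanish on \<open>Y'\<close>, that is, in the
  kernel of restriction from \<open>Y\<close> to \<open>Y'\<close>.\<close>

lemma Fn_step:
 assumes "Y' \<subseteq> Y" "pprime (\<I> Y)" "a \<in> \<I> Y'" "a ~: \<I> Y" "a \<in> Rle h"
 shows "Fn Y t + Fn Y' (t + h) <= Fn Y (t + h)"
proof -
 let ?V = "restr Y ` Rle (t + h)" and ?W = "restr Y ` Rle t"
 have pa: "pol a" by (rule Rle_pol[OF assms(5)])
 have fl: "flin (%u. a * u)" by (rule flin_mult)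
 have sW: "fs.subspace ?W" "findim ?W"
  using flin_image_subspace[OF flin_restr subspace_Rle] findim_image[OF findim_Rle flin_restr] by blast+
 have sV: "fs.subspace ?V" "findim ?V"
  using flin_image_subspace[OF flin_restr subspace_Rle] findim_image[OF findim_Rle flin_restr] by blast+
 have am: "a * restr Y f = restr Y (a * f)" for f by (auto simp: restr_def)
 have "fs.dim ?W = fs.dim ((%u. a * u) ` ?W) + fs.dim {u \<in> ?W. a * u = 0}"
  by (rule rank_nullity[OF fl sW])
 moreover have "{u \<in> ?W. a * u = 0} \<subseteq> {0}"
 proof
  fix u assume "u \<in> {u \<in> ?W. a * u = 0}"
  then obtain f where f: "f \<in> Rle t" "u = restr Y f" "restr Y (a * f) = 0" using am by auto
  have pf: "pol f" by (rule Rle_pol[OF f(1)])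
  have "a * f \<in> \<I> Y" using restr_eq_0[OF pol_mult[OF pa pf]] f(3) by blast
  then have "f \<in> \<I> Y" using pprimeD(3)[OF assms(2) pa pf] assms(4) by blast
  then show "u \<in> {0}" using restr_eq_0[OF pf] f(2) by blast
 qed
 then have "fs.dim {u \<in> ?W. a * u = 0} = 0"
  using fs_dim_0_iff[OF findim_subset[OF sW(2)], of "{u \<in> ?W. a * u = 0}"] by blast
 ultimately have 1: "Fn Y t = fs.dim ((%u. a * u) ` ?W)" unfolding Fn_def by simp
 have "(%u. a * u) ` ?W \<subseteq> {v \<in> ?V. restr Y' v = 0}"
 proof
  fix v assume "v \<in> (%u. a * u) ` ?W"
  then obtain f where f: "f \<in> Rle t" "v = restr Y (a * f)" using am by auto
  have "a * f \<in> Rle (t + h)" using Rle_mult[OF assms(5) f(1)] by (simp only: add.commute)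
  moreover have "restr Y' v = 0"
   using assms(3) unfolding f(2) restr_restr[OF assms(1)] by (auto simp: restr_def vanishing_ideal_def)
  ultimately show "v \<in> {v \<in> ?V. restr Y' v = 0}" using f(2) by blast
 qed
 then have 2: "Fn Y t <= fs.dim {v \<in> ?V. restr Y' v = 0}"
  unfolding 1 by (intro dim_mono findim_subset[OF sV(2)]) auto
 have "fs.dim ?V = fs.dim (restr Y' ` ?V) + fs.dim {v \<in> ?V. restr Y' v = 0}"
  by (rule rank_nullity[OF flin_restr sV])
 moreover have "restr Y' ` ?V = restr Y' ` Rle (t + h)" by (simp add: image_image restr_restr[OF assms(1)])
 ultimately show ?thesis using 2 unfolding Fn_def by simp
qed

lemma Fn_pos: "Y ~= {} ==> 1 <= Fn Y t"
proof -
 assume "Y ~= {}"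
 then have "restr Y (%_. 1) ~= 0" by (auto simp: restr_def fun_eq_iff)
 moreover have "restr Y (%_. 1) \<in> restr Y ` Rle t" using const_Rle by blast
 ultimately have "\<not> restr Y ` Rle t \<subseteq> {0}" by blast
 then have "Fn Y t ~= 0" unfolding Fn_def using fs_dim_0_iff[OF findim_image[OF findim_Rle flin_restr]] by blast
 then show ?thesis by simp
qed

text \<open>Pascal's rule. With \<open>a\<close> vanishing on \<open>c j\<close> but not on
  \<open>c (Suc j)\<close>, \<open>Fn_step\<close> makes \<open>Fn (c (Suc j))\<close> grow over
  each interval of length \<open>h'\<close> by at least a value of \<open>Fn (c j)\<close>; summing
  turns binomials of order \<open>j\<close> into binomials of order \<open>Suc j\<close>.\<close>

lemma Fn_chain:
 assumes "is_chain {C. closedin zariski C & irreducible_in zariski C} k c"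
 shows "\<exists>h. \<forall>t. (t choose k) <= Fn (c k) (t * h)"
proof -
 have "j <= k ==> \<exists>h. \<forall>t. (t choose j) <= Fn (c j) (t * h)" for j
 proof (induction j)
  case 0
  have "irreducible_in zariski (c 0)" using assms unfolding is_chain_def by blast
  then have "c 0 ~= {}" unfolding irreducible_in_def by blast
  then show ?case using Fn_pos[of "c 0"] by simp
 next
  case (Suc j)
  then obtain h where h: "!!t. (t choose j) <= Fn (c j) (t * h)" by auto
  have c: "closedin zariski (c j)" "closedin zariski (c (Suc j))" "irreducible_in zariski (c (Suc j))" "c j \<subset> c (Suc j)"
   using assms Suc.prems unfolding is_chain_def by auto
  have "\<not> \<I> (c j) \<subseteq> \<I> (c (Suc j))"
  proof
   assume "\<I> (c j) \<subseteq> \<I> (c (Suc j))"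
   then have "zset (\<I> (c (Suc j))) \<subseteq> zset (\<I> (c j))" by (rule zset_antimono)
   then show False using c(1,2,4) unfolding closedin_zariski_iff by blast
  qed
  then obtain a where a: "a \<in> \<I> (c j)" "a ~: \<I> (c (Suc j))" by blast
  then have "pol a" by (simp add: vanishing_ideal_def)
  then obtain d where d: "a \<in> Rle d" by (rule pol_Rle)
  define h' where "h' = max h d"
  have a': "a \<in> Rle h'" using d Rle_mono[of d h'] by (auto simp: h'_def)
  have h'': "(t choose j) <= Fn (c j) (t * h')" for t
   using h[of t] Fn_mono[of "t * h" "t * h'" "c j"] by (auto simp: h'_def)
  have "(t choose Suc j) <= Fn (c (Suc j)) (t * h')" for t
  proof (induction t)
   case (Suc t)
   have "(Suc t choose Suc j) = (t choose j) + (t choose Suc j)" by simp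
   also have "(t choose j) <= (Suc t choose j)" by (cases j) auto
   also have "(Suc t choose j) + (t choose Suc j) <= Fn (c j) (Suc t * h') + Fn (c (Suc j)) (t * h')"
    by (rule add_mono[OF h'' Suc])
   also have "\<dots> <= Fn (c (Suc j)) (Suc t * h')"
    using Fn_step[OF psubset_imp_subset[OF c(4)] irreducible_zariski_prime[OF c(3)] a a', of "t * h'"]
    by (simp add: add.commute)
   finally show ?case by simp
  qed simp
  then show ?case by blast
 qed
 then show ?thesis by blast
qed

lemma chain_lower_bound:
 assumes "is_chain {C. closedin zariski C & irreducible_in zariski C} k c"
 shows "\<exists>h>0. \<forall>t\<ge>k. t ^ k <= k ^ k * Fn (c k) (t * h)"
proof -
 obtain h where h: "!!t. (t choose k) <= Fn (c k) (t * h)" using Fn_chain[OF assms] by blast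
 have "t ^ k <= k ^ k * Fn (c k) (t * Suc h)" if "k <= t" for t
 proof -
  have "t ^ k <= k ^ k * (t choose k)" by (rule power_le_binomial'[OF that])
  also have "\<dots> <= k ^ k * Fn (c k) (t * Suc h)"
   using h[of t] Fn_mono[of "t * h" "t * Suc h" "c k"] by (intro mult_left_mono) auto
  finally show ?thesis .
 qed
 then show ?thesis by blast
qed

lemma Fn_upper_bound:
 assumes "stable (\<I> Y)" "dg m (H (\<I> Y))"
 shows "\<exists>K. \<forall>t. Fn Y t <= K * (t + 1) ^ m"
proof -
 obtain K where K: "!!t. \<bar>int (Fn Y t)\<bar> <= int K * int (t + 1) ^ m"
  using ndg_growth Fn_ndg[OF assms(1)] assms(2) by blast
 have "Fn Y t <= K * (t + 1) ^ m" for t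
 proof -
  have "int (Fn Y t) <= int (K * (t + 1) ^ m)" using K[of t] by simp
  then show ?thesis by (simp only: of_nat_le_iff)
 qed
 then show ?thesis by blast
qed

lemma chain_bound:
 assumes "is_chain {C. closedin zariski C & irreducible_in zariski C} k c" "c k \<subseteq> Y"
  and "stable (\<I> Y)" "dg m (H (\<I> Y))"
 shows "k <= m"
proof -
 obtain h where h: "!!t. t >= k ==> t ^ k <= k ^ k * Fn (c k) (t * h)"
  using chain_lower_bound[OF assms(1)] by blast
 obtain K where K: "!!t. Fn Y t <= K * (t + 1) ^ m" using Fn_upper_bound[OF assms(3,4)] by blast
 show ?thesis
 proof (rule power_growth_compare)
  fix t assume t: "t >= max k 1"
  have "t ^ k <= k ^ k * Fn (c k) (t * h)" using h t by simp
  also have "\<dots> <= k ^ k * (K * (t * h + 1) ^ m)"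
   using Fn_mono_set[OF assms(2), of "t * h"] K[of "t * h"] by (intro mult_left_mono) auto
  also have "\<dots> <= k ^ k * (K * (t * (h + 1)) ^ m)" using t by (intro mult_left_mono power_mono) auto
  also have "\<dots> = (k ^ k * K * (h + 1) ^ m) * t ^ m" by (simp only: power_mult_distrib ac_simps)
  finally show "t ^ k <= (k ^ k * K * (h + 1) ^ m) * t ^ m" .
 qed
qed

end

section \<open>Affine cones of projective varieties\<close>

lemma point_eq_iff:
 fixes x y :: "'n::finite cvec"
 assumes "x ~= 0" "y ~= 0"
 shows "point x = point y \<longleftrightarrow> (\<exists>c. c ~= 0 & y = c *s x)"
proof -
 have "point x = point y \<longleftrightarrow> vec.span {x} = vec.span {y}"
  unfolding point_def using assms by (subst Abs_pspace_inject) auto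
 also have "\<dots> \<longleftrightarrow> (\<exists>c. c ~= 0 & y = c *s x)"
 proof
  assume "vec.span {x} = vec.span {y}"
  then have "y \<in> vec.span {x}" using vec.span_base[of y "{y}"] by simp
  then obtain c where "y = c *s x" by (auto simp: vec.span_singleton)
  then show "\<exists>c. c ~= 0 & y = c *s x" using assms(2) by (intro exI[of _ c]) auto
 next
  assume "\<exists>c. c ~= 0 & y = c *s x"
  then obtain c where c: "c ~= 0" "y = c *s x" by blast
  then have "x = (1 / c) *s y" by (simp add: vec_eq_iff)
  then have "x \<in> vec.span {y}" "y \<in> vec.span {x}" using c(2) unfolding vec.span_singleton by blast+
  then have "vec.span {x} \<subseteq> vec.span {y}" "vec.span {y} \<subseteq> vec.span {x}"
   by (simp_all add: vec.span_minimal vec.subspace_span)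
  then show "vec.span {x} = vec.span {y}" by blast
 qed
 finally show ?thesis .
qed

lemma point_surj: "\<exists>x. x ~= 0 & p = point x"
proof -
 obtain x where x: "x ~= 0" "Rep_pspace p = vec.span {x}" using Rep_pspace[of p] by blast
 then have "p = point x" unfolding point_def using Rep_pspace_inverse[of p] by simp
 then show ?thesis using x(1) by blast
qed

interpretation V: affine_coords "%(i::'n::finite) (x :: 'n cvec). x $ i"
proof
 show "coordinates = range (%(i::'n) (x :: 'n cvec). x $ i)"
  by (auto simp: coordinates_vec_def coordinates_complex_def)
 show "\<exists>x :: 'n cvec. \<forall>i. x $ i = v i" for v by (intro exI[of _ "\<chi> i. v i"]) simp
qed (simp add: vec_eq_iff)

lemma V_sc: "V.sc s x = s () *s x" for x :: "'n::finite cvec"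
 by (simp add: vec_eq_iff)

lemma bilin_R: "(%x. bilin a x) \<in> V.R (V.eg ())" for a :: "'n::finite cvec"
proof -
 have "(%x. bilin a x) = (\<Sum>i\<in>UNIV. fsc (a $ i) (%x. x $ i))"
  by (auto simp: bilin_def sum_fun_apply)
 also have "\<dots> \<in> V.R (V.eg ())"
  using V.X_R by (intro fs.subspace_sum[OF V.subspace_R] fs.subspace_scale[OF V.subspace_R]) auto
 finally show ?thesis .
qed

lemma bilin_axis: "bilin (axis i 1) x = x $ i"
proof -
 have "bilin (axis i 1) x = (\<Sum>j\<in>UNIV. if j = i then x $ j else 0)"
  unfolding bilin_def by (intro sum.cong) (auto simp: axis_def)
 then show ?thesis by simp
qed

interpretation P: multiprojective "%(i::'n::finite) (x :: 'n cvec). x $ i" "%_. ()" P_dom point "%_. hyperplane_P"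
proof
 show "P_dom = {x :: 'n cvec. \<forall>k::unit. \<exists>i. () = k & x $ i ~= 0}"
  by (auto simp: P_dom_def vec_eq_iff)
 fix x y :: "'n cvec" assume xy: "x \<in> P_dom" "y \<in> P_dom"
 have "(\<exists>c. c ~= 0 & y = c *s x) \<longleftrightarrow> (\<exists>s. (\<forall>k::unit. s k ~= 0) & y = V.sc s x)"
 proof
  assume "\<exists>c. c ~= 0 & y = c *s x"
  then obtain c where "c ~= 0" "y = c *s x" by blast
  then show "\<exists>s. (\<forall>k::unit. s k ~= 0) & y = V.sc s x"
   by (intro exI[of _ "%_. c"]) (simp add: V_sc)
 next
  assume "\<exists>s. (\<forall>k::unit. s k ~= 0) & y = V.sc s x"
  then obtain s where "\<forall>k::unit. s k ~= 0" "y = V.sc s x" by blast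
  then show "\<exists>c. c ~= 0 & y = c *s x" by (intro exI[of _ "s ()"]) (simp add: V_sc)
 qed
 then show "point x = point y \<longleftrightarrow> (\<exists>s. (\<forall>k::unit. s k ~= 0) & y = V.sc s x)"
  using point_eq_iff[of x y] xy by (simp add: P_dom_def)
next
 show "point ` P_dom = (UNIV :: 'n pspace set)" using point_surj by (auto simp: P_dom_def)
 show "l \<in> V.R (V.eg k)" if "l \<in> hyperplane_P" for l :: "'n cvec => complex" and k
  using that bilin_R by (auto simp: hyperplane_P_def)
 show "(%x :: 'n cvec. x $ i) \<in> hyperplane_P" for i
  unfolding hyperplane_P_def using bilin_axis[of i] by (intro CollectI exI[of _ "axis i 1"]) auto
qed

lemma P_pre_iff: "x \<in> P.pre W \<longleftrightarrow> x ~= 0 & point x \<in> W"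
 unfolding P.pre_def by (simp add: P_dom_def)

lemma affine_cone_pre: "affine_cone W = insert 0 (P.pre W)"
 by (auto simp: affine_cone_def P_pre_iff)

lemma stable_vanish_0:
 assumes "V.stable (\<I> S)" "S ~= {}" "f \<in> \<I> S"
 shows "f (0 :: 'n::finite cvec) = 0"
proof -
 have pf: "pol f" using assms(3) by (simp add: vanishing_ideal_def)
 obtain G F where G: "finite G" "!!g. F g \<in> V.R g" "f = (\<Sum>g\<in>G. F g)" using V.pol_decomp[OF pf] by blast
 obtain x where x: "x \<in> S" using assms(2) by blast
 have "F g 0 = 0" if g: "g \<in> G" for g
 proof -
  have "F g \<in> \<I> S" by (rule V.stable_component[OF pideal_subspace[OF vanishing_ideal_pideal] assms(1) G(1)])
    (use G assms(3) g in auto)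
  then have "F g x = 0" using x vanD by blast
  \<comment> \<open>Scaling by 0 sends \<open>x\<close> to the origin. This also covers degree 0,
    where the factor is 1, because \<open>F g x\<close> is already 0.\<close>
  then have "F g (V.sc (%_. 0) x) = 0" using V.R_sc[OF G(2), of g "%_. 0" x] by simp
  moreover have "V.sc (%_. 0) x = 0" by (simp add: V_sc)
  ultimately show ?thesis by simp
 qed
 then show ?thesis unfolding G(3) by (simp add: sum_fun_apply)
qed

lemma vanishing_ideal_cone: "W ~= {} ==> \<I> (affine_cone W) = P.IW W"
proof -
 assume "W ~= {}"
 then have "P.pre W ~= {}" using P.image_pre[of W] by blast
 then have "f 0 = 0" if "f \<in> P.IW W" for f
  using stable_vanish_0[of "P.pre W" f] V.hidealD(2)[OF P.hideal_IW[of W]] that unfolding P.IW_def by blast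
 then show ?thesis unfolding affine_cone_pre P.IW_def vanishing_ideal_def by auto
qed

lemma closed_cone: "closedin zariski_P W ==> W ~= {} ==> closedin zariski (affine_cone W)"
proof -
 assume W: "closedin zariski_P W" "W ~= {}"
 have "zset (P.IW W) \<subseteq> affine_cone W"
 proof
  fix x assume x: "x \<in> zset (P.IW W)"
  show "x \<in> affine_cone W"
  proof (cases "x = 0")
   case False
   then have "x \<in> P_dom \<inter> zset (P.IW W)" using x by (simp add: P_dom_def)
   then show ?thesis using W(1) unfolding P.closedin_T affine_cone_pre by blast
  qed (simp add: affine_cone_def)
 qed
 then show ?thesis unfolding closedin_zariski_iff vanishing_ideal_cone[OF W(2)]
  using subset_zset_vanishing[of "affine_cone W"] vanishing_ideal_cone[OF W(2)] by auto
qed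

lemma irreducible_cone:
 assumes "closedin zariski_P W" "irreducible_in zariski_P W"
 shows "pprime (\<I> (affine_cone W))" "irreducible_in zariski (affine_cone W)"
proof -
 have "W ~= {}" using assms(2) unfolding irreducible_in_def by blast
 then show *: "pprime (\<I> (affine_cone W))"
  using P.irreducible_iff_prime[OF assms(1)] assms(2) vanishing_ideal_cone by metis
 then show "irreducible_in zariski (affine_cone W)" by (rule prime_irreducible_zariski)
qed

lemma cone_subset_iff: "affine_cone W \<subseteq> affine_cone W' \<longleftrightarrow> W \<subseteq> W'"
proof
 assume "affine_cone W \<subseteq> affine_cone W'"
 then have "P.pre W \<subseteq> P.pre W'" by (auto simp: affine_cone_pre P_pre_iff)
 then show "W \<subseteq> W'" using P.image_pre by (metis image_mono)
qed (auto simp: affine_cone_def)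

section \<open>Dimension of affine cones\<close>

lemma origin_irreducible:
 "closedin zariski {0 :: 'n::finite cvec}" "irreducible_in zariski {0 :: 'n cvec}"
proof -
 have "zset (range (%i (x :: 'n cvec). x $ i)) = {0}" by (auto simp: zset_def vec_eq_iff)
 then show "closedin zariski {0 :: 'n cvec}"
  using closedin_zariski_zset[of "range (%i (x :: 'n cvec). x $ i)"] V.pol_X by auto
 show "irreducible_in zariski {0 :: 'n cvec}"
 proof (rule prime_irreducible_zariski)
  show "pprime (\<I> {0 :: 'n cvec})" unfolding pprime_def
   by (intro conjI allI impI vanishing_ideal_pideal) (auto simp: vanishing_ideal_def)
 qed
qed

text \<open>The origin is put below the cones over a projective chain and accounts for the extra
  dimension.\<close>

lemma cone_chain:
 assumes W: "closedin zariski_P W" "irreducible_in zariski_P W" "krull_dim zariski_P W = enat m"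
 shows "\<exists>c. is_chain {C. closedin zariski C & irreducible_in zariski C} (Suc m) c & c (Suc m) = affine_cone W"
proof -
 obtain c where c: "is_chain {C. closedin zariski_P C & irreducible_in zariski_P C} m c" "c m = W"
  using P.chain_below[OF W(1,2) P.dim_iff(2)[OF W]] by blast
 define c' where "c' i = (case i of 0 => {0} | Suc j => affine_cone (c j))" for i
 have ne: "c i ~= {}" if "i <= m" for i using c(1) that unfolding is_chain_def irreducible_in_def by blast
 have "is_chain {C. closedin zariski C & irreducible_in zariski C} (Suc m) c'" unfolding is_chain_def
 proof (intro conjI allI impI)
  fix i assume i: "i <= Suc m"
  show "c' i \<in> {C. closedin zariski C & irreducible_in zariski C}"
  proof (cases i)
   case 0
   then show ?thesis using origin_irreducible by (simp add: c'_def)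
  next
   case (Suc j)
   then have j: "closedin zariski_P (c j)" "irreducible_in zariski_P (c j)" "c j ~= {}"
    using c(1) i ne unfolding is_chain_def by auto
   show ?thesis using closed_cone[OF j(1,3)] irreducible_cone(2)[OF j(1,2)] Suc by (simp add: c'_def)
  qed
 next
  fix i assume i: "i < Suc m"
  show "c' i \<subset> c' (Suc i)"
  proof (cases i)
   case 0
   obtain p where "p \<in> c 0" using ne[of 0] by blast
   then obtain x where "x \<in> P.pre (c 0)" using P.image_pre[of "c 0"] by blast
   then show ?thesis using 0 by (auto simp: c'_def affine_cone_pre P_pre_iff)
  next
   case (Suc j)
   then have "c j \<subset> c (Suc j)" using c(1) i unfolding is_chain_def by auto
   then show ?thesis using Suc cone_subset_iff by (auto simp: c'_def psubset_eq)
  qed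
 qed
 then show ?thesis using c(2) by (intro exI[of _ c']) (simp add: c'_def)
qed

text \<open>Chains of closed subsets of a cone need not consist of cones, so the upper bound is
  obtained from the growth of \<open>Fn\<close> rather than from projective chains.\<close>

theorem krull_dim_affine_cone:
 assumes W: "closedin zariski_P W" "irreducible_in zariski_P W" "krull_dim zariski_P W = enat m"
 shows "krull_dim zariski (affine_cone W) = enat (Suc m)"
proof -
 have ne: "W ~= {}" using W(2) unfolding irreducible_in_def by blast
 have cl: "closedin zariski (affine_cone W)" by (rule closed_cone[OF W(1) ne])
 let ?F = "{C. closedin zariski C & irreducible_in zariski C}"
 have F: "{C. closedin (subtopology zariski (affine_cone W)) C & irreducible_in zariski C} =
   {C\<in>?F. C \<subseteq> affine_cone W}" using closedin_closed_subtopology[OF cl] by blast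
 note vc = vanishing_ideal_cone[OF ne]
 show ?thesis unfolding krull_dim_def F
 proof (rule antisym)
  show "chain_length {C\<in>?F. C \<subseteq> affine_cone W} <= enat (Suc m)"
  proof (rule chain_length_le)
   fix k c assume c: "is_chain {C\<in>?F. C \<subseteq> affine_cone W} k c"
   then have c': "is_chain ?F k c" "c k \<subseteq> affine_cone W" unfolding is_chain_def by blast+
   show "k <= Suc m" by (rule V.chain_bound[OF c'])
     (use V.hidealD(2)[OF P.hideal_IW] P.dim_iff(1)[OF W] in \<open>simp_all only: vc\<close>)
  qed
  obtain c where c: "is_chain ?F (Suc m) c" "c (Suc m) = affine_cone W" using cone_chain[OF W] by blast
  have "c i \<subseteq> affine_cone W" if "i <= Suc m" for i using is_chain_mono[OF c(1) that] c(2) by blast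
  then have "is_chain {C\<in>?F. C \<subseteq> affine_cone W} (Suc m) c" using c(1) unfolding is_chain_def by auto
  then show "enat (Suc m) <= chain_length {C\<in>?F. C \<subseteq> affine_cone W}" by (rule chain_length_ge)
 qed
qed

section \<open>Ideals generated by several elements\<close>

lemma (in graded_coords) pol_comp:
 assumes "!!i. pol (%y. X i (h y))" "pol f"
 shows "pol (%y. f (h y))" using assms(2)
proof (induction rule: polynomial_fun.induct)
 case (coord f)
 then obtain i where "f = X i" using coordinates_X by blast
 then show ?case using assms(1) by simp
qed (auto intro: polynomial_fun.intros)

lemma (in graded_coords) evaluation_mod_ideal:
 assumes K: "pideal K" and h: "!!i. (%y. X i (h y) - X i u) \<in> K" "!!i. pol (%y. X i (h y))" and f: "pol f"
 shows "(%y. f (h y) - f u) \<in> K" using f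
proof (induction rule: polynomial_fun.induct)
 case (coord f)
 then obtain i where "f = X i" using coordinates_X by blast
 then show ?case using h(1) by simp
next
 case (const c)
 then show ?case using pidealD(2)[OF K] by (simp add: zero_fun_def)
next
 case (add f g)
 have "(%y. f (h y) - f u) + (%y. g (h y) - g u) \<in> K" by (rule pidealD(3)[OF K add.IH])
 then show ?case by (simp add: plus_fun_def algebra_simps)
next
 case (mult f g)
 have pg: "pol (%y. g (h y))" by (rule pol_comp[OF h(2) mult.hyps(2)])
 have "(%y. f (h y) - f u) * (%y. g (h y)) + fsc (f u) (%y. g (h y) - g u) \<in> K"
  using pidealD(5)[OF K mult.IH(1) pg] pidealD(6)[OF K mult.IH(2)] by (rule pidealD(3)[OF K])
 moreover have "(%y. f (h y) - f u) * (%y. g (h y)) + fsc (f u) (%y. g (h y) - g u) =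
   (%y. f (h y) * g (h y) - f u * g u)" by (auto simp: algebra_simps)
 ultimately show ?case by (simp only:)
qed

lemma (in graded_coords) separating_polynomial:
 assumes "finite (C :: 'a set)" "x0 ~: C"
 shows "\<exists>f. pol f & f x0 ~= 0 & (\<forall>x\<in>C. f x = 0)"
proof -
 have "\<forall>x\<in>C. \<exists>i. X i x ~= X i x0" using X_inj assms(2) by metis
 then obtain i where i: "!!x. x \<in> C ==> X (i x) x ~= X (i x) x0" by metis
 let ?f = "\<Prod>x\<in>C. X (i x) - (%_. X (i x) x)"
 have "pol ?f" by (intro pol_prod pol_diff pol_X pol_const)
 moreover have "?f x0 ~= 0" using i assms(1) by (auto simp: prod_fun_apply) (metis i)
 moreover have "?f x = 0" if "x \<in> C" for x using that assms(1) by (auto simp: prod_fun_apply)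
 ultimately show ?thesis by blast
qed

lemma dim_supported_le:
 assumes "finite S"
 shows "findim {f :: 'b => complex. \<forall>x. x ~: S --> f x = 0}"
  and "fs.dim {f :: 'b => complex. \<forall>x. x ~: S --> f x = 0} <= card S"
proof -
 let ?d = "%s x :: 'b. if x = s then 1 else 0 :: complex"
 have sub: "{f :: 'b => complex. \<forall>x. x ~: S --> f x = 0} \<subseteq> fs.span (?d ` S)"
 proof
  fix f :: "'b => complex" assume f: "f \<in> {f. \<forall>x. x ~: S --> f x = 0}"
  have "f = (\<Sum>s\<in>S. fsc (f s) (?d s))"
  proof
   fix x
   have "(\<Sum>s\<in>S. f s * ?d s x) = (\<Sum>s\<in>S. if x = s then f s else 0)" by (intro sum.cong) auto
   then show "f x = (\<Sum>s\<in>S. fsc (f s) (?d s)) x" using f assms by (auto simp: sum_fun_apply)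
  qed
  also have "\<dots> \<in> fs.span (?d ` S)" by (intro fs.span_sum fs.span_scale fs.span_base) blast
  finally show "f \<in> fs.span (?d ` S)" .
 qed
 have fin: "finite (?d ` S)" using assms by simp
 show "findim {f :: 'b => complex. \<forall>x. x ~: S --> f x = 0}" unfolding findim_def using sub fin by blast
 show "fs.dim {f :: 'b => complex. \<forall>x. x ~: S --> f x = 0} <= card S"
  using fs.dim_le_card[OF sub fin] card_image_le[OF assms, of ?d] by simp
qed

primrec adjoins :: "('a::affine_space => complex) set => ('a => complex) list => ('a => complex) set" where
 "adjoins I [] = I"
| "adjoins I (a # as) = adjoin (adjoins I as) a"

lemma adjoins:
 assumes "pideal I" "!!a. a \<in> set as ==> pol a"
 shows "pideal (adjoins I as)" "I \<subseteq> adjoins I as" "set as \<subseteq> adjoins I as"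
  "zset (adjoins I as) = {x \<in> zset I. \<forall>a\<in>set as. a x = 0}"
proof -
 have "pideal (adjoins I as) & I \<subseteq> adjoins I as & set as \<subseteq> adjoins I as &
  zset (adjoins I as) = {x \<in> zset I. \<forall>a\<in>set as. a x = 0}" using assms(2)
 proof (induction as)
  case (Cons a as)
  have z: "zset (adjoin J a) = {x \<in> zset J. a x = 0}" if "pideal J" for J
  proof
   show "zset (adjoin J a) \<subseteq> {x \<in> zset J. a x = 0}"
    using adjoin_superset[of J a] adjoin_mem[OF that, of a] unfolding zset_def by blast
   show "{x \<in> zset J. a x = 0} \<subseteq> zset (adjoin J a)" unfolding zset_def adjoin_def by auto
  qed
  have IH: "pideal (adjoins I as)" "I \<subseteq> adjoins I as" "set as \<subseteq> adjoins I as"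
   "zset (adjoins I as) = {x \<in> zset I. \<forall>a\<in>set as. a x = 0}" using Cons by auto
  have "pol a" using Cons.prems by simp
  then show ?case using pideal_adjoin[OF IH(1)] adjoin_superset[of "adjoins I as" a] adjoin_mem[OF IH(1), of a] IH
    z[OF IH(1)] by auto
 qed (use assms(1) in auto)
 then show "pideal (adjoins I as)" "I \<subseteq> adjoins I as" "set as \<subseteq> adjoins I as"
  "zset (adjoins I as) = {x \<in> zset I. \<forall>a\<in>set as. a x = 0}" by blast+
qed

lemma adjoins_mem:
 assumes "u \<in> adjoins I (map y js)" "distinct js"
 shows "\<exists>h. (\<forall>j. pol (h j)) & u - (\<Sum>j\<in>set js. y j * h j) \<in> I" using assms
proof (induction js arbitrary: u)
 case Nil
 then have "u - (\<Sum>j\<in>set []. y j * (%_. 0) j) \<in> I" by (simp add: fun_diff_def)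
 then show ?case using pol_const by (intro exI[of _ "%_ _. 0"]) auto
next
 case (Cons j js)
 then obtain f g where fg: "u = f + y j * g" "f \<in> adjoins I (map y js)" "pol g"
  by (auto simp only: list.map adjoins.simps adjoin_def)
 have "distinct js" using Cons.prems(2) by simp
 from Cons.IH[OF fg(2) this] obtain h where h: "\<forall>j. pol (h j)" "f - (\<Sum>j\<in>set js. y j * h j) \<in> I" by blast
 have "(\<Sum>j'\<in>set (j # js). y j' * (h(j := g)) j') = y j * g + (\<Sum>j'\<in>set js. y j' * (h(j := g)) j')"
  using Cons.prems(2) by (simp add: fun_eq_iff sum_fun_apply)
 also have "(\<Sum>j'\<in>set js. y j' * (h(j := g)) j') = (\<Sum>j'\<in>set js. y j' * h j')"
  using Cons.prems(2) by (intro sum.cong) auto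
 finally have eq: "(\<Sum>j'\<in>set (j # js). y j' * (h(j := g)) j') = y j * g + (\<Sum>j\<in>set js. y j * h j)" .
 have "u - (\<Sum>j'\<in>set (j # js). y j' * (h(j := g)) j') = f - (\<Sum>j\<in>set js. y j * h j)"
  unfolding fg(1) eq by (rule ext) simp
 then have "u - (\<Sum>j'\<in>set (j # js). y j' * (h(j := g)) j') \<in> I" using h(2) by (simp only:)
 moreover have "\<forall>j'. pol ((h(j := g)) j')" using h(1) fg(3) by simp
 ultimately show ?case by blast
qed

lemma (in graded_coords) adjoins_homogeneous_part:
 assumes "hideal I" "!!j. j \<in> set js ==> y j \<in> R h" "u \<in> adjoins I (map y js)" "u \<in> R (h + g)" "distinct js"
 shows "\<exists>c. (\<forall>j. c j \<in> R g) & u - (\<Sum>j\<in>set js. y j * c j) \<in> I" using assms(2-5)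
proof (induction js arbitrary: u)
 case Nil
 then have "u - (\<Sum>j\<in>set []. y j * (%_. 0) j) \<in> I" by (simp add: fun_diff_def)
 moreover have "(%_. 0) \<in> R g" using fs.subspace_0[OF subspace_R, of g] by (simp add: zero_fun_def)
 ultimately show ?case by (intro exI[of _ "%_ _. 0"]) auto
next
 case (Cons j js)
 have "hideal (adjoins I as)" if "!!a. a \<in> set as ==> a \<in> R h" for as
  using that by (induction as) (auto intro!: hideal_adjoin[where h = h] simp: assms(1))
 from this[of "map y js"] have hI: "hideal (adjoins I (map y js))" using Cons.prems(1) by auto
 have "u \<in> adjoin (adjoins I (map y js)) (y j)" using Cons.prems(2) by simp
 then obtain f where f: "f \<in> R g" "u - y j * f \<in> adjoins I (map y js)"
  using adjoin_homogeneous_part[OF hI _ _ Cons.prems(3)] Cons.prems(1)[of j] by auto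
 have uR: "u - y j * f \<in> R (h + g)"
  by (rule fs.subspace_diff[OF subspace_R Cons.prems(3) R_mult[OF Cons.prems(1)[of j] f(1)]]) simp
 have yh: "y j' \<in> R h" if "j' \<in> set js" for j' using Cons.prems(1) that by simp
 have dj: "distinct js" using Cons.prems(4) by simp
 have "\<exists>c. (\<forall>j. c j \<in> R g) & (u - y j * f) - (\<Sum>j\<in>set js. y j * c j) \<in> I"
  by (rule Cons.IH[OF _ f(2) uR dj]) (rule yh)
 then obtain c where c: "\<forall>j. c j \<in> R g" "(u - y j * f) - (\<Sum>j\<in>set js. y j * c j) \<in> I"
  by (elim exE conjE)
 have "(\<Sum>j'\<in>set (j # js). y j' * (c(j := f)) j') = y j * f + (\<Sum>j'\<in>set js. y j' * (c(j := f)) j')"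
  using Cons.prems(4) by (simp add: fun_eq_iff sum_fun_apply)
 also have "(\<Sum>j'\<in>set js. y j' * (c(j := f)) j') = (\<Sum>j'\<in>set js. y j' * c j')"
  using Cons.prems(4) by (intro sum.cong) auto
 finally have eq: "(\<Sum>j'\<in>set (j # js). y j' * (c(j := f)) j') = y j * f + (\<Sum>j\<in>set js. y j * c j)" .
 have "u - (\<Sum>j'\<in>set (j # js). y j' * (c(j := f)) j') = (u - y j * f) - (\<Sum>j\<in>set js. y j * c j)"
  unfolding eq by (rule ext) simp
 then have "u - (\<Sum>j'\<in>set (j # js). y j' * (c(j := f)) j') \<in> I" using c(2) by (simp only:)
 moreover have "\<forall>j'. (c(j := f)) j' \<in> R g" using c(1) f(1) by simp
 ultimately show ?case by blast
qed

lemma (in affine_coords) dim_mult_restr: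
 assumes "pprime (\<I> W)" "pol a" "a ~: \<I> W"
 shows "fs.dim ((%f. restr W (a * f)) ` Rle t) = Fn W t"
proof -
 have am: "a * restr W f = restr W (a * f)" for f by (auto simp: restr_def)
 let ?V = "restr W ` Rle t"
 have sV: "fs.subspace ?V" "findim ?V"
  using flin_image_subspace[OF flin_restr subspace_Rle] findim_image[OF findim_Rle flin_restr] by blast+
 have "fs.dim ?V = fs.dim ((%u. a * u) ` ?V) + fs.dim {u \<in> ?V. a * u = 0}"
  by (rule rank_nullity[OF flin_mult sV])
 moreover have "{u \<in> ?V. a * u = 0} \<subseteq> {0}"
 proof
  fix u assume "u \<in> {u \<in> ?V. a * u = 0}"
  then obtain f where f: "f \<in> Rle t" "u = restr W f" "restr W (a * f) = 0" using am by auto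
  have pf: "pol f" by (rule Rle_pol[OF f(1)])
  have "a * f \<in> \<I> W" using restr_eq_0[OF pol_mult[OF assms(2) pf]] f(3) by blast
  then have "f \<in> \<I> W" using pprimeD(3)[OF assms(1,2) pf] assms(3) by blast
  then show "u \<in> {0}" using restr_eq_0[OF pf] f(2) by blast
 qed
 then have "fs.dim {u \<in> ?V. a * u = 0} = 0"
  using fs_dim_0_iff[OF findim_subset[OF sV(2)], of "{u \<in> ?V. a * u = 0}"] by blast
 moreover have "(%u. a * u) ` ?V = (%f. restr W (a * f)) ` Rle t" by (simp add: image_image am)
 ultimately show ?thesis unfolding Fn_def by simp
qed

section \<open>Counting independent families\<close>

text \<open>A polynomial that vanishes everywhere has zero coefficients, one variable at a time. It
  is used to separate the monomials in normal directions.\<close>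

lemma box_identity:
 fixes c :: "('c => nat) => complex"
 assumes "finite C" "!!z. (\<Sum>\<beta>\<in>Pi\<^sub>E C (%_. {..t::nat}). c \<beta> * (\<Prod>i\<in>C. z i ^ \<beta> i)) = 0" "\<beta> \<in> Pi\<^sub>E C (%_. {..t})"
 shows "c \<beta> = 0" using assms
proof (induction C arbitrary: c \<beta>)
 case (insert k C)
 let ?P = "Pi\<^sub>E C (%_. {..t})"
 have exp: "(\<Sum>\<beta>\<in>Pi\<^sub>E (insert k C) (%_. {..t}). c \<beta> * (\<Prod>i\<in>insert k C. z i ^ \<beta> i)) =
   (\<Sum>y\<le>t. (\<Sum>g\<in>?P. c (g(k := y)) * (\<Prod>i\<in>C. z i ^ g i)) * z k ^ y)" for z
 proof -
  have "(\<Sum>\<beta>\<in>Pi\<^sub>E (insert k C) (%_. {..t}). c \<beta> * (\<Prod>i\<in>insert k C. z i ^ \<beta> i)) =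
    (\<Sum>p\<in>{..t} \<times> ?P. c ((snd p)(k := fst p)) * (\<Prod>i\<in>insert k C. z i ^ ((snd p)(k := fst p)) i))"
   unfolding PiE_insert_eq
   by (subst sum.reindex[OF inj_combinator[OF insert.hyps(2)]]) (simp add: case_prod_beta' comp_def)
  also have "\<dots> = (\<Sum>p\<in>{..t} \<times> ?P. c ((snd p)(k := fst p)) * (\<Prod>i\<in>C. z i ^ snd p i) * z k ^ fst p)"
  proof (rule sum.cong[OF refl])
   fix p
   have "(\<Prod>i\<in>C. z i ^ ((snd p)(k := fst p)) i) = (\<Prod>i\<in>C. z i ^ snd p i)"
    using insert.hyps(2) by (intro prod.cong) auto
   then show "c ((snd p)(k := fst p)) * (\<Prod>i\<in>insert k C. z i ^ ((snd p)(k := fst p)) i) =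
     c ((snd p)(k := fst p)) * (\<Prod>i\<in>C. z i ^ snd p i) * z k ^ fst p" using insert.hyps by simp
  qed
  also have "\<dots> = (\<Sum>y\<le>t. \<Sum>g\<in>?P. c (g(k := y)) * (\<Prod>i\<in>C. z i ^ g i) * z k ^ y)"
   by (simp add: sum.cartesian_product case_prod_beta')
  finally show ?thesis by (simp only: sum_distrib_right)
 qed
 have zero: "(\<Sum>g\<in>?P. c (g(k := y)) * (\<Prod>i\<in>C. z i ^ g i)) = 0" if y: "y <= t" for y z
 proof -
  have "(\<Sum>y\<le>t. (\<Sum>g\<in>?P. c (g(k := y)) * (\<Prod>i\<in>C. z i ^ g i)) * s ^ y) = 0" for s
  proof -
   have "(\<Prod>i\<in>C. (z(k := s)) i ^ g i) = (\<Prod>i\<in>C. z i ^ g i)" for g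
    using insert.hyps(2) by (intro prod.cong) auto
   then show ?thesis using insert.prems(1)[of "z(k := s)"] unfolding exp by simp
  qed
  then show ?thesis
   using polyfun_eq_0[of "%y. \<Sum>g\<in>?P. c (g(k := y)) * (\<Prod>i\<in>C. z i ^ g i)" t] y by blast
 qed
 obtain y g where yg: "y <= t" "g \<in> ?P" "\<beta> = g(k := y)" using insert.prems(2) unfolding PiE_insert_eq by auto
 have "c (g(k := y)) = 0" by (rule insert.IH[of "%g. c (g(k := y))", OF zero[OF yg(1)] yg(2)])
 then show ?case unfolding yg(3) .
qed auto

lemma finite_degree:
 fixes s :: nat
 shows "{e :: 'c::finite => nat. (\<Sum>i\<in>UNIV. e i) <= s} \<subseteq> Pi\<^sub>E UNIV (%_. {..s})"
  and "finite {e :: 'c::finite => nat. (\<Sum>i\<in>UNIV. e i) <= s}"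
proof -
 have "e i <= (\<Sum>i\<in>UNIV. e i)" for e :: "'c => nat" and i by (rule member_le_sum) auto
 then show "{e :: 'c => nat. (\<Sum>i\<in>UNIV. e i) <= s} \<subseteq> Pi\<^sub>E UNIV (%_. {..s})"
  by (auto intro: order_trans)
 then show "finite {e :: 'c => nat. (\<Sum>i\<in>UNIV. e i) <= s}"
  by (rule finite_subset) (auto intro: finite_PiE)
qed

lemma card_box: "finite C ==> card (Pi\<^sub>E C (%_. {..t::nat})) = (t + 1) ^ card C"
 by (simp add: card_PiE)

section \<open>Bases modulo vanishing ideals\<close>

context affine_coords
begin

text \<open>Polynomial representatives of a basis of the restrictions to \<open>Y\<close>.
  Independence and spanning are stated as membership in \<open>\<I> Y\<close>, the form in which
  they combine with other ideals.\<close>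

lemma basis_lift:
 obtains Bs where "finite Bs" "Bs \<subseteq> Rle t" "card Bs = Fn Y t"
  "!!\<alpha>. (\<Sum>b\<in>Bs. fsc (\<alpha> b) b) \<in> \<I> Y ==> \<forall>b\<in>Bs. \<alpha> b = 0"
  "!!f. f \<in> Rle t ==> \<exists>\<alpha>. f - (\<Sum>b\<in>Bs. fsc (\<alpha> b) b) \<in> \<I> Y"
proof -
 obtain B where B: "finite B" "B \<subseteq> restr Y ` Rle t" "fs.independent B" "restr Y ` Rle t \<subseteq> fs.span B" "card B = Fn Y t"
  using findim_basis[OF findim_image[OF findim_Rle flin_restr], of Y t] unfolding Fn_def by metis
 have "\<forall>v\<in>B. \<exists>b. b \<in> Rle t & v = restr Y b" using B(2) by blast
 from bchoice[OF this] obtain r where r: "\<forall>v\<in>B. r v \<in> Rle t & v = restr Y (r v)" by (elim exE)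
 have inj: "inj_on r B"
 proof (rule inj_onI)
  fix u v assume uv: "u \<in> B" "v \<in> B" "r u = r v"
  have "u = restr Y (r u)" "v = restr Y (r v)" using r uv by blast+
  then show "u = v" unfolding uv(3) by (simp only:)
 qed
 have sum: "restr Y (\<Sum>b\<in>r ` B. fsc (\<alpha> b) b) = (\<Sum>v\<in>B. fsc (\<alpha> (r v)) v)" for \<alpha>
  unfolding sum.reindex[OF inj] flin_sum[OF flin_restr] comp_def flin_scale[OF flin_restr]
  by (rule sum.cong) (use r in auto)
 have pol: "pol (\<Sum>b\<in>r ` B. fsc (\<alpha> b) b)" for \<alpha>
  using r Rle_pol by (intro pol_sum pol_fsc) blast
 show ?thesis
 proof (rule that[of "r ` B"])
  show "finite (r ` B)" "r ` B \<subseteq> Rle t" "card (r ` B) = Fn Y t"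
   using B(1,5) r inj by (auto simp: card_image)
  fix \<alpha> assume "(\<Sum>b\<in>r ` B. fsc (\<alpha> b) b) \<in> \<I> Y"
  with restr_eq_0[OF pol[of \<alpha>]] have "restr Y (\<Sum>b\<in>r ` B. fsc (\<alpha> b) b) = 0" by (rule iffD2)
  then have "(\<Sum>v\<in>B. fsc (\<alpha> (r v)) v) = 0" unfolding sum .
  then have "\<alpha> (r v) = 0" if "v \<in> B" for v
   using fs.independentD[OF B(3,1) subset_refl, where u = "%v. \<alpha> (r v)"] that by blast
  then show "\<forall>b\<in>r ` B. \<alpha> b = 0" by blast
 next
  fix f assume f: "f \<in> Rle t"
  then have "restr Y f \<in> fs.span B" using B(4) by blast
  then obtain u where u: "restr Y f = (\<Sum>v\<in>B. fsc (u v) v)" unfolding fs.span_finite[OF B(1)] by blast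
  let ?\<alpha> = "%b. u (restr Y b)"
  have "restr Y (\<Sum>b\<in>r ` B. fsc (?\<alpha> b) b) = restr Y f"
   unfolding sum u by (rule sum.cong) (use r in auto)
  then have "restr Y (f - (\<Sum>b\<in>r ` B. fsc (?\<alpha> b) b)) = 0" by (simp only: flin_diff[OF flin_restr] diff_self)
  then have "f - (\<Sum>b\<in>r ` B. fsc (?\<alpha> b) b) \<in> \<I> Y"
   using restr_eq_0[OF pol_diff[OF Rle_pol[OF f] pol[of ?\<alpha>]]] by blast
  then show "\<exists>\<alpha>. f - (\<Sum>b\<in>r ` B. fsc (\<alpha> b) b) \<in> \<I> Y" by (intro exI[of _ ?\<alpha>])
 qed
qed

lemma family_count:
 assumes "finite P" "!!p. p \<in> P ==> g p \<in> Rle s"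
  and ind: "!!\<alpha>. (\<Sum>p\<in>P. fsc (\<alpha> p) (g p)) \<in> \<I> Y ==> \<forall>p\<in>P. \<alpha> p = 0"
 shows "card P <= Fn Y s"
proof (rule ccontr)
 assume neg: "\<not> ?thesis"
 have "\<exists>\<alpha>. (\<exists>p\<in>P. \<alpha> p ~= 0) & (\<Sum>p\<in>P. fsc (\<alpha> p) (restr Y (g p))) = 0"
  by (rule family_dependent[OF assms(1) findim_image[OF findim_Rle flin_restr], of Y s])
   (use neg assms(2) in \<open>auto simp: Fn_def\<close>)
 then obtain \<alpha> where \<alpha>: "\<exists>p\<in>P. \<alpha> p ~= 0" "(\<Sum>p\<in>P. fsc (\<alpha> p) (restr Y (g p))) = 0" by (elim exE conjE)
 have "restr Y (\<Sum>p\<in>P. fsc (\<alpha> p) (g p)) = 0"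
  using \<alpha>(2) by (simp only: flin_sum[OF flin_restr] flin_scale[OF flin_restr])
 moreover have "pol (\<Sum>p\<in>P. fsc (\<alpha> p) (g p))" using assms(2) Rle_pol by (intro pol_sum pol_fsc) blast
 ultimately have "(\<Sum>p\<in>P. fsc (\<alpha> p) (g p)) \<in> \<I> Y" using restr_eq_0 by blast
 then show False using ind[of \<alpha>] \<alpha>(1) by blast
qed

lemma Fn_box: "Fn Y s <= (s + 1) ^ CARD('i)"
proof -
 let ?B = "Pi\<^sub>E UNIV (%_::'i. {..s})"
 have "restr Y ` Rle s = fs.span (restr Y ` mon ` {e. (\<Sum>i\<in>UNIV. e i) <= s})"
  unfolding Rle_def by (rule flin_image_span[OF flin_restr])
 also have "{e :: 'i => nat. (\<Sum>i\<in>UNIV. e i) <= s} \<subseteq> ?B" by (rule finite_degree(1))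
 finally have sub: "restr Y ` Rle s \<subseteq> fs.span (restr Y ` mon ` ?B)" by (meson fs.span_mono image_mono subset_trans order_refl)
 have fin: "finite ?B" by (intro finite_PiE) auto
 have "Fn Y s <= card (restr Y ` mon ` ?B)" unfolding Fn_def by (rule fs.dim_le_card[OF sub]) (use fin in simp)
 also have "\<dots> <= card ?B" using card_image_le[OF fin, of "%e. restr Y (mon e)"] by (simp add: image_image)
 finally show ?thesis using card_box[of "UNIV :: 'i set" s] by simp
qed

text \<open>For sets \<open>Y'\<close> that lie only in the Zariski closure of \<open>Y\<close>,
  where \<open>Fn_mono_set\<close> does not apply.\<close>

lemma Fn_ideal_mono: "\<I> Y \<subseteq> \<I> Y' ==> Fn Y' s <= Fn Y s"
proof -
 assume sub: "\<I> Y \<subseteq> \<I> Y'"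
 obtain Bs where Bs: "finite Bs" "Bs \<subseteq> Rle s" "card Bs = Fn Y' s"
  "!!\<alpha>. (\<Sum>b\<in>Bs. fsc (\<alpha> b) b) \<in> \<I> Y' ==> \<forall>b\<in>Bs. \<alpha> b = 0" by (rule basis_lift[of s Y']) blast
 have "card Bs <= Fn Y s" by (rule family_count[of Bs "%b. b"]) (use Bs sub in auto)
 then show ?thesis using Bs(3) by simp
qed

lemma Rle_power: "f \<in> Rle s ==> f ^ n \<in> Rle (n * s)"
proof (induction n)
 case 0
 then show ?case using const_Rle[of 1 0] by (simp only: power_0 one_fun_def mult_0)
next
 case (Suc n)
 then show ?case using Rle_mult[of f s "f ^ n" "n * s"] by (simp only: power_Suc mult_Suc)
qed

lemma Rle_prod:
 assumes "finite A" "!!j. j \<in> A ==> f j \<in> Rle (s j)"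
 shows "(\<Prod>j\<in>A. f j) \<in> Rle (\<Sum>j\<in>A. s j)" using assms
proof (induction A)
 case empty
 then show ?case using const_Rle[of 1 0] by (simp only: prod.empty sum.empty one_fun_def)
next
 case (insert j A)
 have "f j * prod f A \<in> Rle (s j + sum s A)" by (rule Rle_mult) (use insert in auto)
 then show ?case using insert.hyps by (simp only: prod.insert sum.insert simp_thms)
qed

end

locale affine_map = S: affine_coords X + T: affine_coords Y
 for X :: "'i::finite => 'a::affine_space => complex" and Y :: "'j::finite => 'b::affine_space => complex" +
 fixes \<phi> :: "'a => 'b" and \<kappa> :: nat
 assumes comp: "(%x. Y j (\<phi> x)) \<in> S.Rle \<kappa>"
begin

lemma comp_Rle: "b \<in> T.Rle t ==> (%x. b (\<phi> x)) \<in> S.Rle (t * \<kappa>)"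
 unfolding T.Rle_def
proof (induction rule: fs.span_induct_alt)
 case base
 then show ?case using S.const_Rle[of 0] by (simp add: zero_fun_def)
next
 case (step c u v)
 then obtain e where e: "u = T.mon e" "(\<Sum>i\<in>UNIV. e i) <= t" by blast
 have "(%x. T.mon e (\<phi> x)) = (\<Prod>j\<in>UNIV. (%x. Y j (\<phi> x)) ^ e j)"
  by (rule ext) (simp add: T.mon_def prod_fun_apply power_fun_apply)
 moreover have p: "(\<Prod>j\<in>UNIV. (%x. Y j (\<phi> x)) ^ e j) \<in> S.Rle (\<Sum>j\<in>UNIV. e j * \<kappa>)"
  by (intro S.Rle_prod S.Rle_power comp finite)
 have le: "(\<Sum>j\<in>UNIV. e j * \<kappa>) <= t * \<kappa>" using e(2) by (simp add: sum_distrib_right[symmetric])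
 have "(\<Prod>j\<in>UNIV. (%x. Y j (\<phi> x)) ^ e j) \<in> S.Rle (t * \<kappa>)" by (rule subsetD[OF S.Rle_mono[OF le] p])
 ultimately have "(%x. u (\<phi> x)) \<in> S.Rle (t * \<kappa>)" unfolding e(1) by (simp only:)
 then have "fsc c (%x. u (\<phi> x)) + (%x. v (\<phi> x)) \<in> S.Rle (t * \<kappa>)"
  using step.IH by (intro fs.subspace_add[OF S.subspace_Rle] fs.subspace_scale[OF S.subspace_Rle])
 then show ?case by (simp add: plus_fun_def)
qed

lemma pol_map: "pol b ==> pol (%x. b (\<phi> x))"
 using T.pol_comp[of \<phi> b] S.Rle_pol[OF comp] by blast

lemma Fn_image: "T.Fn (\<phi> ` Y0) s <= S.Fn Y0 (s * \<kappa>)"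
proof -
 obtain Bs where Bs: "finite Bs" "Bs \<subseteq> T.Rle s" "card Bs = T.Fn (\<phi> ` Y0) s"
  "!!\<alpha>. (\<Sum>b\<in>Bs. fsc (\<alpha> b) b) \<in> \<I> (\<phi> ` Y0) ==> \<forall>b\<in>Bs. \<alpha> b = 0"
  by (rule T.basis_lift[of s "\<phi> ` Y0"]) blast
 have "card Bs <= S.Fn Y0 (s * \<kappa>)"
 proof (rule S.family_count[of Bs "%b x. b (\<phi> x)"])
  show "(%x. b (\<phi> x)) \<in> S.Rle (s * \<kappa>)" if "b \<in> Bs" for b using comp_Rle Bs(2) that by blast
  fix \<alpha> assume z: "(\<Sum>b\<in>Bs. fsc (\<alpha> b) (%x. b (\<phi> x))) \<in> \<I> Y0"
  have "pol (\<Sum>b\<in>Bs. fsc (\<alpha> b) b)" using Bs(2) T.Rle_pol by (intro pol_sum pol_fsc) blast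
  moreover have "(\<Sum>b\<in>Bs. fsc (\<alpha> b) b) (\<phi> x) = 0" if "x \<in> Y0" for x
   using vanD[OF z that] by (simp add: sum_fun_apply)
  ultimately have "(\<Sum>b\<in>Bs. fsc (\<alpha> b) b) \<in> \<I> (\<phi> ` Y0)" by (auto simp: vanishing_ideal_def)
  then show "\<forall>b\<in>Bs. \<alpha> b = 0" by (rule Bs(4))
 qed (rule Bs(1))
 then show ?thesis using Bs(3) by simp
qed

end

section \<open>Finite projections\<close>

text \<open>\<open>proper\<close> says that the linear map \<open>lam\<close> has nothing but the
  origin of the cone \<open>W\<close> above the origin, so that projectively the centre of
  projection is avoided. This forces the coordinate ring of \<open>W\<close> to be a finite module
  over that of the image; \<open>PB\<close> is the contraction of \<open>I\<close> along the
  pullback \<open>pb\<close>.\<close>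

locale finite_projection = S: affine_coords X + T: affine_coords Y
 for X :: "'i::finite => 'a::affine_space => complex" and Y :: "'j::finite => 'b::affine_space => complex" +
 fixes lam :: "'a => 'b" and W :: "'a set"
 assumes lin: "(%x. Y j (lam x)) \<in> S.R (S.eg ())"
  and prime: "pprime (\<I> W)"
  and stab: "S.stable (\<I> W)"
  and closed: "zset (\<I> W) = W"
  and proper: "x \<in> W ==> (!!j. Y j (lam x) = 0) ==> X i x = 0"
begin

abbreviation "I \<equiv> \<I> W"
abbreviation "PB \<equiv> \<I> (lam ` W)"

definition pb :: "('b => complex) => 'a => complex" where
 "pb b = (%x. b (lam x))"

lemma I_pideal: "pideal I" by (rule vanishing_ideal_pideal)
lemma PB_pideal: "pideal PB" by (rule vanishing_ideal_pideal)

lemma pb_ring: "pb (f + g) = pb f + pb g" "pb (f * g) = pb f * pb g" "pb (fsc c f) = fsc c (pb f)"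
 "pb (f - g) = pb f - pb g" "pb (- f) = - pb f" "pb (%_. c) = (%_. c)" "pb 0 = 0" "pb 1 = 1"
 by (auto simp: pb_def)

lemma pol_pbY: "pol (%x. Y j (lam x))" by (rule S.R_pol[OF lin])

lemma pol_pb: "pol b ==> pol (pb b)"
 unfolding pb_def by (rule T.pol_comp[OF pol_pbY])

lemma pb_mem: "pol b ==> pb b \<in> I \<longleftrightarrow> b \<in> PB"
 using pol_pb by (auto simp: vanishing_ideal_def pb_def)

lemma PB_prime: "pprime PB"
 unfolding pprime_def
proof (intro conjI allI impI PB_pideal)
 show "1 ~: PB"
 proof
  assume "1 \<in> PB"
  then have "pb 1 \<in> I" using pb_mem[OF pol_1] by blast
  then show False using pprimeD(2)[OF prime] unfolding pb_ring by blast
 qed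
 fix f g assume fg: "pol f & pol g & f * g \<in> PB"
 then have "pb f * pb g \<in> I" using pb_mem[OF pol_mult, of f g] by (simp only: pb_ring)
 then show "f \<in> PB \<or> g \<in> PB" using pprimeD(3)[OF prime pol_pb pol_pb] fg pb_mem by blast
qed

lemma lam_sc: "lam (S.sc s x) = T.sc s (lam x)"
proof (rule T.X_inj)
 fix j
 have "(\<Prod>k\<in>UNIV. s k ^ S.eg () k) = s ()" by (simp add: S.eg_def UNIV_unit)
 then show "Y j (lam (S.sc s x)) = Y j (T.sc s (lam x))" using S.R_sc[OF lin, of j s x] by simp
qed

lemma PB_stable: "T.stable PB"
 unfolding T.stable_def
proof (intro ballI allI impI)
 fix b and s :: "unit => complex" assume b: "b \<in> PB" and s: "\<forall>k. s k ~= 0"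
 have pb: "pol b" using b by (simp add: vanishing_ideal_def)
 have "(%x. pb b (S.sc s x)) \<in> I" using S.stableD[OF stab, of "pb b" s] pb_mem[OF pb] b s by blast
 then have "pb (%y. b (T.sc s y)) \<in> I" by (simp add: pb_def lam_sc)
 then show "(%y. b (T.sc s y)) \<in> PB" using pb_mem[OF T.pol_sc[OF pb]] by blast
qed

lemma T_hideal: "T.hideal PB" using PB_pideal PB_stable by (simp add: T.hideal_def)
lemma S_hideal: "S.hideal I" using I_pideal stab by (simp add: S.hideal_def)

lemma pb_Rle: "b \<in> T.Rle t ==> pb b \<in> S.Rle t"
proof -
 interpret M: affine_map X Y lam "Suc 0"
 proof unfold_locales
  have "S.eg () = (%_. Suc 0)" by (auto simp: S.eg_def)
  then show "(%x. Y j (lam x)) \<in> S.Rle (Suc 0)" for j using lin[of j] S.R_Rle[of "Suc 0"] by auto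
 qed
 show "b \<in> T.Rle t ==> pb b \<in> S.Rle t" unfolding pb_def using M.comp_Rle[of b t] by simp
qed

text \<open>Linear independence of the classes of \<open>a s\<close> modulo \<open>I\<close> over
  the coordinate ring of the image.\<close>

definition Bindep :: "'c set => ('c => 'a => complex) => bool" where
 "Bindep S a \<longleftrightarrow> (\<forall>b. (\<forall>s\<in>S. pol (b s)) & (\<Sum>s\<in>S. pb (b s) * a s) \<in> I --> (\<forall>s\<in>S. b s \<in> PB))"

lemma Bindep_count:
 assumes S: "finite S" "Bindep S a" "!!s. s \<in> S ==> a s \<in> S.Rle d"
 shows "card S * T.Fn (lam ` W) t <= S.Fn W (t + d)"
proof -
 obtain Bs where Bs: "finite Bs" "Bs \<subseteq> T.Rle t" "card Bs = T.Fn (lam ` W) t"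
  "!!\<alpha>. (\<Sum>b\<in>Bs. fsc (\<alpha> b) b) \<in> PB ==> \<forall>b\<in>Bs. \<alpha> b = 0"
  by (rule T.basis_lift[of t "lam ` W"]) blast
 let ?g = "%p. pb (snd p) * a (fst p)"
 have "card (S \<times> Bs) <= S.Fn W (t + d)"
 proof (rule S.family_count[of _ ?g])
  show "finite (S \<times> Bs)" using S(1) Bs(1) by simp
  show "?g p \<in> S.Rle (t + d)" if "p \<in> S \<times> Bs" for p
   using S(3) Bs(2) pb_Rle that by (intro S.Rle_mult) auto
  fix \<alpha> assume z: "(\<Sum>p\<in>S \<times> Bs. fsc (\<alpha> p) (?g p)) \<in> I"
  define b where "b s = (\<Sum>v\<in>Bs. fsc (\<alpha> (s, v)) v)" for s
  have pbs: "pol (b s)" for s unfolding b_def using Bs(2) T.Rle_pol by (intro pol_sum pol_fsc) blast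
  have "(\<Sum>s\<in>S. pb (b s) * a s) = (\<Sum>p\<in>S \<times> Bs. fsc (\<alpha> p) (?g p))"
  proof
   fix x
   show "(\<Sum>s\<in>S. pb (b s) * a s) x = (\<Sum>p\<in>S \<times> Bs. fsc (\<alpha> p) (?g p)) x"
    by (simp add: sum_fun_apply b_def pb_def sum_distrib_right sum_distrib_left sum.cartesian_product split_def ac_simps)
  qed
  then have "(\<Sum>s\<in>S. pb (b s) * a s) \<in> I" using z by (simp only:)
  then have "b s \<in> PB" if "s \<in> S" for s using S(2) pbs that unfolding Bindep_def by blast
  then have "\<forall>v\<in>Bs. \<alpha> (s, v) = 0" if "s \<in> S" for s
   using Bs(4)[of "%v. \<alpha> (s, v)"] that unfolding b_def by blast
  then show "\<forall>p\<in>S \<times> Bs. \<alpha> p = 0" by auto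
 qed
 then show ?thesis using Bs(3) by (simp add: card_cartesian_product)
qed

text \<open>Graded Nakayama. By \<open>proper\<close> the pulled-back coordinates have only the
  origin as a common zero on \<open>W\<close>, so by the Nullstellensatz the ideal they generate
  with \<open>I\<close> contains a power of each \<open>X i\<close> and hence all forms of large
  degree. Such forms are reduced to lower degree step by step, and the coefficients never exceed the
  degree of \<open>f\<close>.\<close>

lemma finite_generation:
 obtains B0 where "B0 > 0" "!!f t. f \<in> S.Rle t ==>
  \<exists>b. (\<forall>e. b e \<in> T.Rle t) & f - (\<Sum>e | (\<Sum>i\<in>UNIV. e i) < B0. pb (b e) * S.mon e) \<in> I"
proof -
 obtain js :: "'j list" where js: "set js = UNIV" "distinct js"
  using finite_distinct_list[OF finite, of "UNIV :: 'j set"] by blast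
 let ?y = "%j. pb (Y j)"
 let ?J = "adjoins I (map ?y js)"
 have py: "pol a" if "a \<in> set (map ?y js)" for a using that pol_pbY by (auto simp: pb_def)
 have J: "pideal ?J" "I \<subseteq> ?J" "zset ?J = {x \<in> zset I. \<forall>a\<in>set (map ?y js). a x = 0}"
  using adjoins[of I "map ?y js"] I_pideal py by blast+
 have "\<exists>n. X i ^ n \<in> ?J" for i
 proof (rule ccontr)
  assume "\<nexists>n. X i ^ n \<in> ?J"
  then obtain x where x: "x \<in> zset ?J" "X i x ~= 0"
   using S.nullstellensatz[OF J(1) S.pol_X, of i] by blast
  then have "x \<in> W" "!!j. Y j (lam x) = 0" using J(3) closed js(1) by (auto simp: pb_def)
  then show False using proper x(2) by blast
 qed
 then obtain n where n: "!!i. X i ^ n i \<in> ?J" by metis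
 \<comment> \<open>An exponent vector of at least this total degree has some entry
   \<open>e i >= n i\<close>, so its monomial is divisible by \<open>X i ^ n i\<close>.\<close>
 define B0 where "B0 = Suc (\<Sum>i\<in>UNIV. n i)"
 have monJ: "S.mon e \<in> ?J" if "(\<Sum>i\<in>UNIV. e i) >= B0" for e
 proof -
  have "\<exists>i. n i <= e i"
  proof (rule ccontr)
   assume "\<nexists>i. n i <= e i"
   then have "(\<Sum>i\<in>UNIV. e i) <= (\<Sum>i\<in>UNIV. n i)" by (intro sum_mono) (auto simp: not_le less_imp_le)
   then show False using that by (simp add: B0_def)
  qed
  then obtain i where i: "n i <= e i" by blast
  have "S.mon e = (\<Prod>j\<in>UNIV - {i}. X j ^ e j) * X i ^ (e i - n i) * X i ^ n i"
  proof
   fix x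
   show "S.mon e x = ((\<Prod>j\<in>UNIV - {i}. X j ^ e j) * X i ^ (e i - n i) * X i ^ n i) x"
    unfolding S.mon_def using i
    by (subst prod.remove[of _ i]) (simp_all add: prod_fun_apply power_fun_apply power_add[symmetric])
  qed
  moreover have "pol ((\<Prod>j\<in>UNIV - {i}. X j ^ e j) * X i ^ (e i - n i))"
   by (intro pol_mult pol_prod pol_power S.pol_X)
  ultimately show ?thesis using pidealD(4)[OF J(1) n[of i]] by (simp only:)
 qed
 have RJ: "S.R (%_. t) \<subseteq> ?J" if "t >= B0" for t unfolding S.R_def
 proof (rule fs.span_minimal[OF _ pideal_subspace[OF J(1)]])
  show "S.mon ` {e. S.mdeg e = (%_. t)} \<subseteq> ?J"
   using monJ that by (auto simp: S.mdeg_unit fun_eq_iff)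
 qed
 let ?M = "{e :: 'i => nat. (\<Sum>i\<in>UNIV. e i) < B0}"
 have finM: "finite ?M" by (rule finite_subset[OF _ finite_degree(2)[of B0]]) auto
 let ?G = "%t f. \<exists>b. (\<forall>e. b e \<in> T.Rle t) & f - (\<Sum>e\<in>?M. pb (b e) * S.mon e) \<in> I"
 have Gmon: "?G s f ==> s <= t ==> ?G t f" for s t f using T.Rle_mono by blast
 have Gadd: "?G t (f + g)" if Gf: "?G t f" and Gg: "?G t g" for t f g
 proof -
  obtain b where b: "\<forall>e. b e \<in> T.Rle t" "f - (\<Sum>e\<in>?M. pb (b e) * S.mon e) \<in> I" using Gf by (elim exE conjE)
  obtain b' where b': "\<forall>e. b' e \<in> T.Rle t" "g - (\<Sum>e\<in>?M. pb (b' e) * S.mon e) \<in> I" using Gg by (elim exE conjE)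
  have "(f - (\<Sum>e\<in>?M. pb (b e) * S.mon e)) + (g - (\<Sum>e\<in>?M. pb (b' e) * S.mon e)) \<in> I"
   by (rule pidealD(3)[OF I_pideal b(2) b'(2)])
  also have "(f - (\<Sum>e\<in>?M. pb (b e) * S.mon e)) + (g - (\<Sum>e\<in>?M. pb (b' e) * S.mon e)) =
    f + g - (\<Sum>e\<in>?M. pb (b e + b' e) * S.mon e)"
   by (simp add: fun_eq_iff sum_fun_apply pb_ring distrib_right sum.distrib)
  finally have *: "f + g - (\<Sum>e\<in>?M. pb (b e + b' e) * S.mon e) \<in> I" .
  show ?thesis
   by (rule exI[of _ "%e. b e + b' e"]) (use b(1) b'(1) fs.subspace_add[OF T.subspace_Rle] * in blast)
 qed
 have Gscale: "?G t (fsc c f)" if Gf: "?G t f" for t c f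
 proof -
  obtain b where b: "\<forall>e. b e \<in> T.Rle t" "f - (\<Sum>e\<in>?M. pb (b e) * S.mon e) \<in> I" using Gf by (elim exE conjE)
  have "fsc c (f - (\<Sum>e\<in>?M. pb (b e) * S.mon e)) \<in> I" by (rule pidealD(6)[OF I_pideal b(2)])
  also have "fsc c (f - (\<Sum>e\<in>?M. pb (b e) * S.mon e)) = fsc c f - (\<Sum>e\<in>?M. pb (fsc c (b e)) * S.mon e)"
   by (simp add: fun_eq_iff sum_fun_apply pb_ring right_diff_distrib sum_distrib_left ac_simps)
  finally have *: "fsc c f - (\<Sum>e\<in>?M. pb (fsc c (b e)) * S.mon e) \<in> I" .
  show ?thesis
   by (rule exI[of _ "%e. fsc c (b e)"]) (use b(1) fs.subspace_scale[OF T.subspace_Rle] * in blast)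
 qed
 have GI: "?G t f" if "f \<in> I" for t f
 proof -
  have "f - (\<Sum>e\<in>?M. pb 0 * S.mon e) = f" by (simp add: fun_eq_iff sum_fun_apply pb_ring)
  then have "f - (\<Sum>e\<in>?M. pb 0 * S.mon e) \<in> I" using that by simp
  then show ?thesis using fs.subspace_0[OF T.subspace_Rle] by (intro exI[of _ "%_. 0"]) auto
 qed
 have GY: "?G (Suc t) (?y j * f)" if Gf: "?G t f" for t j f
 proof -
  obtain b where b: "\<forall>e. b e \<in> T.Rle t" "f - (\<Sum>e\<in>?M. pb (b e) * S.mon e) \<in> I" using Gf by (elim exE conjE)
  have "?y j * (f - (\<Sum>e\<in>?M. pb (b e) * S.mon e)) \<in> I"
   using pidealD(4)[OF I_pideal b(2)] pol_pbY[of j] by (simp add: pb_def)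
  also have "?y j * (f - (\<Sum>e\<in>?M. pb (b e) * S.mon e)) = ?y j * f - (\<Sum>e\<in>?M. pb (Y j * b e) * S.mon e)"
   by (simp add: fun_eq_iff sum_fun_apply pb_ring right_diff_distrib sum_distrib_left ac_simps)
  finally have *: "?y j * f - (\<Sum>e\<in>?M. pb (Y j * b e) * S.mon e) \<in> I" .
  have "Y j * b e \<in> T.Rle (Suc t)" for e using T.Rle_mult[OF T.X_Rle, of "b e" t j] b(1) by simp
  then show ?thesis using * by (intro exI[of _ "%e. Y j * b e"]) blast
 qed
 have Gsum: "?G t (\<Sum>j\<in>A. f j)" if "finite A" "!!j. j \<in> A ==> ?G t (f j)" for t A and f :: "'j => 'a => complex"
  using that
 proof (induction A)
  case empty
  then show ?case using GI[OF pidealD(2)[OF I_pideal]] by (simp only: sum.empty)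
 next
  case (insert j A)
  have "?G t (f j + (\<Sum>j\<in>A. f j))" by (rule Gadd[OF insert.prems[OF insertI1] insert.IH[OF insert.prems[OF insertI2]]])
  then show ?case unfolding sum.insert[OF insert.hyps] .
 qed
 have Gm: "?G t (S.mon e)" if "e \<in> ?M" for t e
 proof -
  have "S.mon e - (\<Sum>e'\<in>?M. pb (%_. if e' = e then 1 else 0) * S.mon e') = 0"
  proof
   fix x
   have "(\<Sum>e'\<in>?M. (if e' = e then 1 else 0) * S.mon e' x) = (\<Sum>e'\<in>?M. if e' = e then S.mon e' x else 0)"
    by (intro sum.cong) auto
   then show "(S.mon e - (\<Sum>e'\<in>?M. pb (%_. if e' = e then 1 else 0) * S.mon e')) x = 0 x"
    using finM that by (simp add: sum_fun_apply pb_ring)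
  qed
  then have "S.mon e - (\<Sum>e'\<in>?M. pb (%_. if e' = e then 1 else 0) * S.mon e') \<in> I"
   using pidealD(2)[OF I_pideal] by (simp only:)
  then show ?thesis using T.const_Rle by (intro exI[of _ "%e' _. if e' = e then 1 else 0"]) auto
 qed
 have GR: "f \<in> S.R (%_. t) ==> ?G t f" for f t
 proof (induction t arbitrary: f rule: less_induct)
  case (less t)
  show ?case
  proof (cases "t < B0")
   case True
   from less.prems show ?thesis unfolding S.R_def
   proof (induction rule: fs.span_induct_alt)
    case base
    then show ?case by (rule GI[OF pidealD(2)[OF I_pideal]])
   next
    case (step c u v)
    then obtain e where e: "u = S.mon e" "S.mdeg e = (%_. t)" by blast
    then have "e \<in> ?M" using True by (auto simp: S.mdeg_unit dest: fun_cong)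
    from Gm[OF this, of t] have "?G t u" unfolding e(1) .
    then show ?case using Gadd[OF Gscale step.IH] by blast
   qed
  next
   case False
   then obtain t' where t': "t = Suc t'" by (cases t) (auto simp: B0_def)
   have eg: "(%_. t) = S.eg () + (%_. t')" by (auto simp: t' S.eg_def)
   have fJ: "f \<in> ?J" using RJ[of t] False less.prems by auto
   \<comment> \<open>Modulo \<open>I\<close>, a form of degree \<open>t >= B0\<close> is a
     combination of pulled-back coordinates with forms of degree \<open>t - 1\<close>, to which the
     induction hypothesis applies.\<close>
   obtain c where c: "\<forall>j. c j \<in> S.R (%_. t')" "f - (\<Sum>j\<in>set js. ?y j * c j) \<in> I"
    using S.adjoins_homogeneous_part[OF S_hideal _ fJ less.prems[unfolded eg] js(2)] lin by (auto simp: pb_def)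
   have "?G t (\<Sum>j\<in>set js. ?y j * c j)" using GY[OF less.IH[of t']] c(1) unfolding t' by (intro Gsum) auto
   then have "?G t ((f - (\<Sum>j\<in>set js. ?y j * c j)) + (\<Sum>j\<in>set js. ?y j * c j))"
    by (rule Gadd[OF GI[OF c(2)]])
   then show ?thesis by (simp only: diff_add_cancel)
  qed
 qed
 have "?G t f" if "f \<in> S.Rle t" for f t using that
 proof (induction t arbitrary: f)
  case 0
  then have "f \<in> S.R (%_. 0)" unfolding S.Rle_def S.R_def by (simp add: S.mdeg_unit fun_eq_iff)
  then show ?case by (rule GR)
 next
  case (Suc t)
  then obtain a b where ab: "f = a + b" "a \<in> S.Rle t" "b \<in> S.R (%_. Suc t)" unfolding S.Rle_Suc by blast
  have "?G (Suc t) a" by (rule Gmon[OF Suc.IH[OF ab(2)]]) simp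
  then show ?case unfolding ab(1) using GR[OF ab(3)] by (rule Gadd)
 qed
 then show ?thesis using that[of B0] by (simp add: B0_def)
qed

end

lemma ndg_shift_diff: "ndg (Suc m) f ==> ndg m (%t. f (t + h) - f t)"
 using dg_shift_diff[of m "%g::unit => nat. f (g ())" "%_. h"] unfolding ndg_dg by simp

section \<open>Generic rank and the comparison of leading coefficients\<close>

context finite_projection
begin

lemma bounded_degree:
 assumes "finite A" "!!p. p \<in> A ==> pol (g p)"
 shows "\<exists>h. \<forall>p\<in>A. g p \<in> T.Rle h" using assms
proof (induction A)
 case (insert p A)
 then obtain h where h: "\<forall>p\<in>A. g p \<in> T.Rle h" by auto
 obtain t where t: "g p \<in> T.Rle t" using T.pol_Rle[of "g p"] insert.prems by auto
 have "\<forall>q\<in>insert p A. g q \<in> T.Rle (max h t)"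
  using h t T.Rle_mono[of h "max h t"] T.Rle_mono[of t "max h t"] by auto
 then show ?case by blast
qed simp

text \<open>A maximal independent set \<open>S\<close> of the generating monomials is a basis over
  the fraction field of the image, and \<Delta> is a common denominator for expressing all
  polynomials. The shift \<open>h\<close> of degrees is uniform because only finitely many
  coefficients \<open>C e s\<close> occur.\<close>

lemma generic_basis:
 obtains S :: "('i => nat) set" and d h \<Delta> where "finite S" "S ~= {}" "Bindep S S.mon"
  "!!s. s \<in> S ==> S.mon s \<in> S.Rle d" "pol \<Delta>" "\<Delta> ~: PB"
  "!!f t. f \<in> S.Rle t ==> \<exists>b. (\<forall>s. b s \<in> T.Rle (t + h)) & pb \<Delta> * f - (\<Sum>s\<in>S. pb (b s) * S.mon s) \<in> I"
proof -
 obtain B0 where B0: "B0 > 0" and gen: "!!f t. f \<in> S.Rle t ==>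
  \<exists>b. (\<forall>e. b e \<in> T.Rle t) & f - (\<Sum>e | (\<Sum>i\<in>UNIV. e i) < B0. pb (b e) * S.mon e) \<in> I"
  by (rule finite_generation) blast
 let ?M = "{e :: 'i => nat. (\<Sum>i\<in>UNIV. e i) < B0}"
 have finM: "finite ?M" by (rule finite_subset[OF _ finite_degree(2)[of B0]]) auto
 let ?F = "{S. S \<subseteq> ?M & Bindep S S.mon}"
 have "finite ?F" using finM by simp
 moreover have "{} \<in> ?F" by (simp add: Bindep_def)
 ultimately obtain S where S: "S \<in> ?F" "!!S'. S' \<in> ?F ==> card S' <= card S"
  using ex_max_nat[of ?F card] by blast
 have SM: "S \<subseteq> ?M" and SB: "Bindep S S.mon" using S(1) by auto
 have finS: "finite S" using SM finM finite_subset by blast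
 have "\<exists>\<delta> c. pol \<delta> & \<delta> ~: PB & (\<forall>s. pol (c s)) & pb \<delta> * S.mon e - (\<Sum>s\<in>S. pb (c s) * S.mon s) \<in> I"
  if e: "e \<in> ?M" for e
 proof (cases "e \<in> S")
  case True
  have "pb 1 * S.mon e - (\<Sum>s\<in>S. pb (%_. if s = e then 1 else 0) * S.mon s) = 0"
  proof
   fix x
   have "(\<Sum>s\<in>S. (if s = e then 1 else 0) * S.mon s x) = (\<Sum>s\<in>S. if s = e then S.mon s x else 0)"
    by (intro sum.cong) auto
   then show "(pb 1 * S.mon e - (\<Sum>s\<in>S. pb (%_. if s = e then 1 else 0) * S.mon s)) x = 0 x"
    using finS True by (simp add: sum_fun_apply pb_ring)
  qed
  then have "pb 1 * S.mon e - (\<Sum>s\<in>S. pb (%_. if s = e then 1 else 0) * S.mon s) \<in> I"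
   using pidealD(2)[OF I_pideal] by (simp only:)
  then show ?thesis
   by (intro exI[of _ 1] exI[of _ "%s _. if s = e then 1 else 0"] conjI allI pol_1 pprimeD(2)[OF PB_prime] pol_const)
 next
  case False
  \<comment> \<open>Maximality of \<open>card S\<close> gives a relation, and its coefficient at
    \<open>e\<close> is not in \<open>PB\<close> because \<open>S\<close> alone is independent; this
    coefficient serves as the denominator of \<open>S.mon e\<close>.\<close>
  have "\<not> Bindep (insert e S) S.mon"
  proof
   assume "Bindep (insert e S) S.mon"
   then have "card (insert e S) <= card S" using S(2) e SM by blast
   then show False using False finS by simp
  qed
  then obtain b s0 where b: "\<forall>s\<in>insert e S. pol (b s)" "(\<Sum>s\<in>insert e S. pb (b s) * S.mon s) \<in> I"
   "s0 \<in> insert e S" "b s0 ~: PB" unfolding Bindep_def by blast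
  have sum: "(\<Sum>s\<in>insert e S. pb (b s) * S.mon s) = pb (b e) * S.mon e + (\<Sum>s\<in>S. pb (b s) * S.mon s)"
   by (rule sum.insert[OF finS False])
  have be: "b e ~: PB"
  proof
   assume "b e \<in> PB"
   then have "pb (b e) * S.mon e \<in> I" using pb_mem b(1) pidealD(5)[OF I_pideal _ S.pol_mon] by blast
   then have "(pb (b e) * S.mon e + (\<Sum>s\<in>S. pb (b s) * S.mon s)) - pb (b e) * S.mon e \<in> I"
    using b(2) unfolding sum by (intro pidealD(8)[OF I_pideal])
   then have "(\<Sum>s\<in>S. pb (b s) * S.mon s) \<in> I" by (simp only: add_diff_cancel_left')
   then have "\<forall>s\<in>S. b s \<in> PB" using SB b(1) unfolding Bindep_def by blast
   then show False using b(3,4) \<open>b e \<in> PB\<close> by blast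
  qed
  define c where "c s = (if s \<in> S then - b s else 0)" for s
  have "(\<Sum>s\<in>S. pb (c s) * S.mon s) = - (\<Sum>s\<in>S. pb (b s) * S.mon s)"
   by (simp add: c_def fun_eq_iff sum_fun_apply pb_ring sum_negf)
  then have "pb (b e) * S.mon e - (\<Sum>s\<in>S. pb (c s) * S.mon s) = (\<Sum>s\<in>insert e S. pb (b s) * S.mon s)"
   unfolding sum by (simp only: diff_minus_eq_add)
  then have "pb (b e) * S.mon e - (\<Sum>s\<in>S. pb (c s) * S.mon s) \<in> I" using b(2) by (simp only:)
  moreover have "pol (c s)" for s using b(1) by (auto simp: c_def pol_0 pol_uminus)
  ultimately show ?thesis using be b(1) by blast
 qed
 then have "\<forall>e\<in>?M. \<exists>\<delta> c. pol \<delta> & \<delta> ~: PB & (\<forall>s. pol (c s)) & pb \<delta> * S.mon e - (\<Sum>s\<in>S. pb (c s) * S.mon s) \<in> I"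
  by blast
 from bchoice[OF this] obtain \<delta> where "\<forall>e\<in>?M. \<exists>c. pol (\<delta> e) & \<delta> e ~: PB & (\<forall>s. pol (c s)) &
  pb (\<delta> e) * S.mon e - (\<Sum>s\<in>S. pb (c s) * S.mon s) \<in> I" by (elim exE)
 from bchoice[OF this] obtain c where c: "\<forall>e\<in>?M. pol (\<delta> e) & \<delta> e ~: PB & (\<forall>s. pol (c e s)) &
  pb (\<delta> e) * S.mon e - (\<Sum>s\<in>S. pb (c e s) * S.mon s) \<in> I" by (elim exE)
 define \<Delta> where "\<Delta> = (\<Prod>e\<in>?M. \<delta> e)"
 have p\<Delta>: "pol \<Delta>" unfolding \<Delta>_def using c by (intro pol_prod) blast
 have \<Delta>PB: "\<Delta> ~: PB"
  using pprime_prod[OF PB_prime finM, of \<delta>] c unfolding \<Delta>_def by blast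
 define C where "C e s = (\<Prod>e'\<in>?M - {e}. \<delta> e') * c e s" for e s
 have pC: "pol (C e s)" if "e \<in> ?M" for e s unfolding C_def using c that by (intro pol_mult pol_prod) blast+
 have CI: "pb \<Delta> * S.mon e - (\<Sum>s\<in>S. pb (C e s) * S.mon s) \<in> I" if e: "e \<in> ?M" for e
 proof -
  let ?r = "\<Prod>e'\<in>?M - {e}. \<delta> e'"
  have "\<Delta> = \<delta> e * ?r" unfolding \<Delta>_def by (rule prod.remove[OF finM e])
  then have \<Delta>x: "\<Delta> y = \<delta> e y * ?r y" for y by simp
  have "pb \<Delta> * S.mon e - (\<Sum>s\<in>S. pb (C e s) * S.mon s) =
    pb ?r * (pb (\<delta> e) * S.mon e - (\<Sum>s\<in>S. pb (c e s) * S.mon s))"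
  proof
   fix x
   show "(pb \<Delta> * S.mon e - (\<Sum>s\<in>S. pb (C e s) * S.mon s)) x =
    (pb ?r * (pb (\<delta> e) * S.mon e - (\<Sum>s\<in>S. pb (c e s) * S.mon s))) x"
    by (simp add: \<Delta>x sum_fun_apply pb_def C_def right_diff_distrib sum_distrib_left sum_distrib_right ac_simps)
  qed
  moreover have "pol (pb ?r)" using c by (intro pol_pb pol_prod) blast
  ultimately show ?thesis using pidealD(4)[OF I_pideal] c e by (simp only:)
 qed
 have "\<exists>h. \<forall>p\<in>?M \<times> S. C (fst p) (snd p) \<in> T.Rle h"
  by (rule bounded_degree) (use finM finS pC in auto)
 then obtain h where h: "!!e s. e \<in> ?M ==> s \<in> S ==> C e s \<in> T.Rle h" by fastforce
 have red: "\<exists>b. (\<forall>s. b s \<in> T.Rle (t + h)) & pb \<Delta> * f - (\<Sum>s\<in>S. pb (b s) * S.mon s) \<in> I"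
  if f: "f \<in> S.Rle t" for f t
 proof -
  obtain b where b: "\<forall>e. b e \<in> T.Rle t" "f - (\<Sum>e\<in>?M. pb (b e) * S.mon e) \<in> I" using gen[OF f] by blast
  define b' where "b' s = (if s \<in> S then \<Sum>e\<in>?M. b e * C e s else 0)" for s
  have "b' s \<in> T.Rle (t + h)" for s unfolding b'_def using fs.subspace_0[OF T.subspace_Rle] h b(1)
   by (auto intro!: fs.subspace_sum[OF T.subspace_Rle] T.Rle_mult)
  moreover have "pb \<Delta> * f - (\<Sum>s\<in>S. pb (b' s) * S.mon s) =
    pb \<Delta> * (f - (\<Sum>e\<in>?M. pb (b e) * S.mon e)) +
    (\<Sum>e\<in>?M. pb (b e) * (pb \<Delta> * S.mon e - (\<Sum>s\<in>S. pb (C e s) * S.mon s)))"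
  proof
   fix x
   have "(\<Sum>s\<in>S. (\<Sum>e\<in>?M. b e (lam x) * C e s (lam x)) * S.mon s x) =
    (\<Sum>e\<in>?M. b e (lam x) * (\<Sum>s\<in>S. C e s (lam x) * S.mon s x))"
    unfolding sum_distrib_right sum_distrib_left by (subst sum.swap) (simp only: mult.assoc)
   then show "(pb \<Delta> * f - (\<Sum>s\<in>S. pb (b' s) * S.mon s)) x =
    (pb \<Delta> * (f - (\<Sum>e\<in>?M. pb (b e) * S.mon e)) +
    (\<Sum>e\<in>?M. pb (b e) * (pb \<Delta> * S.mon e - (\<Sum>s\<in>S. pb (C e s) * S.mon s)))) x"
    by (simp add: sum_fun_apply pb_def b'_def right_diff_distrib sum_subtractf sum_distrib_left ac_simps)
  qed
  moreover have "pb \<Delta> * (f - (\<Sum>e\<in>?M. pb (b e) * S.mon e)) \<in> I"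
   by (rule pidealD(4)[OF I_pideal b(2) pol_pb[OF p\<Delta>]])
  moreover have "(\<Sum>e\<in>?M. pb (b e) * (pb \<Delta> * S.mon e - (\<Sum>s\<in>S. pb (C e s) * S.mon s))) \<in> I"
   using b(1) by (intro pideal_sum[OF I_pideal] pidealD(4)[OF I_pideal CI] pol_pb T.Rle_pol) auto
  ultimately have "pb \<Delta> * f - (\<Sum>s\<in>S. pb (b' s) * S.mon s) \<in> I" using pidealD(3)[OF I_pideal] by (simp only:)
  then show ?thesis using \<open>!!s. b' s \<in> T.Rle (t + h)\<close> by blast
 qed
 have "S ~= {}"
 proof
  assume S0: "S = {}"
  have "1 \<in> S.Rle 0" using S.const_Rle[of 1 0] by (simp only: one_fun_def)
  then obtain b where "pb \<Delta> * 1 - (\<Sum>s\<in>S. pb (b s) * S.mon s) \<in> I" using red by blast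
  then have "pb \<Delta> \<in> I" unfolding S0 by (simp only: sum.empty diff_zero mult_1_right)
  then show False using pb_mem[OF p\<Delta>] \<Delta>PB by blast
 qed
 moreover have "S.mon s \<in> S.Rle B0" if "s \<in> S" for s
  using that SM unfolding S.Rle_def by (intro fs.span_base) auto
 ultimately show ?thesis using that[OF finS _ SB _ p\<Delta> \<Delta>PB red] by blast
qed

text \<open>Multiplication by \<open>pb \<Delta>\<close> is injective on the coordinate ring of
  \<open>W\<close>, and its image on degree at most \<open>t\<close> is spanned by
  \<open>card S\<close> copies of a basis for the image variety.\<close>

lemma count_upper:
 assumes "finite S" "pol \<Delta>" "\<Delta> ~: PB"
  and red: "!!f. f \<in> S.Rle t ==> \<exists>b. (\<forall>s. b s \<in> T.Rle t') & pb \<Delta> * f - (\<Sum>s\<in>S. pb (b s) * a s) \<in> I"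
  and pa: "!!s. s \<in> S ==> pol (a s)"
 shows "S.Fn W t <= card S * T.Fn (lam ` W) t'"
proof -
 let ?V = "restr (lam ` W) ` T.Rle t'"
 have fV: "findim ?V" by (rule findim_image[OF T.findim_Rle flin_restr])
 obtain B where B: "finite B" "B \<subseteq> ?V" "?V \<subseteq> fs.span B" "card B = T.Fn (lam ` W) t'"
  using findim_basis[OF fV] unfolding T.Fn_def by metis
 define \<psi> where "\<psi> s u = (%x. if x \<in> W then u (lam x) * a s x else 0)" for s and u :: "'b => complex"
 have l\<psi>: "flin (\<psi> s)" for s by (rule flinI) (auto simp: \<psi>_def algebra_simps)
 have \<psi>r: "\<psi> s (restr (lam ` W) b) = restr W (pb b * a s)" for s b
  by (auto simp: \<psi>_def restr_def pb_def)
 let ?G = "\<Union>s\<in>S. \<psi> s ` B"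
 have "(%f. restr W (pb \<Delta> * f)) ` S.Rle t \<subseteq> fs.span ?G"
 proof
  fix v assume "v \<in> (%f. restr W (pb \<Delta> * f)) ` S.Rle t"
  then obtain f where f: "f \<in> S.Rle t" "v = restr W (pb \<Delta> * f)" by blast
  obtain b where b: "\<forall>s. b s \<in> T.Rle t'" "pb \<Delta> * f - (\<Sum>s\<in>S. pb (b s) * a s) \<in> I" using red[OF f(1)] by blast
  have "restr W (pb \<Delta> * f - (\<Sum>s\<in>S. pb (b s) * a s)) = 0"
   using b(2) restr_eq_0 pidealD(1)[OF I_pideal] by blast
  then have "v = restr W (\<Sum>s\<in>S. pb (b s) * a s)"
   unfolding f(2) flin_diff[OF flin_restr] by (simp only: right_minus_eq)
  also have "\<dots> = (\<Sum>s\<in>S. \<psi> s (restr (lam ` W) (b s)))" by (simp only: flin_sum[OF flin_restr] \<psi>r)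
  also have "\<dots> \<in> fs.span ?G"
  proof (rule fs.span_sum)
   fix s assume s: "s \<in> S"
   have "restr (lam ` W) (b s) \<in> fs.span B" using b(1) B(3) by blast
   then have "\<psi> s (restr (lam ` W) (b s)) \<in> fs.span (\<psi> s ` B)" using flin_image_span[OF l\<psi>, of s B] by blast
   moreover have "fs.span (\<psi> s ` B) \<subseteq> fs.span ?G" using s by (intro fs.span_mono) blast
   ultimately show "\<psi> s (restr (lam ` W) (b s)) \<in> fs.span ?G" by blast
  qed
  finally show "v \<in> fs.span ?G" .
 qed
 then have "fs.dim ((%f. restr W (pb \<Delta> * f)) ` S.Rle t) <= card ?G"
  by (rule fs.dim_le_card) (use assms(1) B(1) in simp)
 also have "card ?G <= (\<Sum>s\<in>S. card (\<psi> s ` B))" by (rule card_UN_le[OF assms(1)])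
 also have "\<dots> <= (\<Sum>s\<in>S. card B)" by (intro sum_mono card_image_le B(1))
 finally show ?thesis using S.dim_mult_restr[OF prime pol_pb[OF assms(2)]] pb_mem[OF assms(2)] assms(3) B(4) by simp
qed

lemma Fn_B_not_ndg: "\<exists>\<mu>. ndg (Suc \<mu>) (%t. int (T.Fn (lam ` W) t)) & \<not> ndg \<mu> (%t. int (T.Fn (lam ` W) t))"
proof -
 let ?f = "%t. int (T.Fn (lam ` W) t)"
 have "\<exists>M. dg M (T.H PB)" using T.good_H[OF T_hideal] unfolding good_def by blast
 then have ex: "\<exists>M. ndg M ?f" using T.Fn_ndg[OF PB_stable] by blast
 have "W ~= {}" using pprimeD(2)[OF prime] pol_1 by (auto simp: vanishing_ideal_def)
 then have n0: "\<not> ndg 0 ?f"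
 proof -
  assume "W ~= {}"
  then have "1 <= T.Fn (lam ` W) t" for t by (intro T.Fn_pos) blast
  then have "?f t ~= 0" for t by (metis not_one_le_zero of_nat_eq_0_iff)
  then show ?thesis by auto
 qed
 define M where "M = (LEAST M. ndg M ?f)"
 have M: "ndg M ?f" unfolding M_def using ex by (rule LeastI_ex)
 have "M ~= 0" using M n0 by metis
 then obtain \<mu> where \<mu>: "M = Suc \<mu>" by (cases M) auto
 have "\<not> ndg \<mu> ?f" using not_less_Least[of \<mu> "%M. ndg M ?f"] \<mu> unfolding M_def by simp
 then show ?thesis using M \<mu> by blast
qed

text \<open>Up to shifts of the degree, the affine Hilbert function of \<open>W\<close> lies between
  \<open>card S\<close> times that of the image on both sides (\<open>Bindep_count\<close>,
  \<open>count_upper\<close>). Shifts do not affect leading coefficients.\<close>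

lemma projection_coef:
 assumes S: "finite S" "S ~= {}" "Bindep S S.mon" "!!s. s \<in> S ==> S.mon s \<in> S.Rle d" "pol \<Delta>" "\<Delta> ~: PB"
  and red: "!!f t. f \<in> S.Rle t ==> \<exists>b. (\<forall>s. b s \<in> T.Rle (t + h)) & pb \<Delta> * f - (\<Sum>s\<in>S. pb (b s) * S.mon s) \<in> I"
  and m: "dg (Suc m) (S.H I)"
 shows "dg (Suc m) (T.H PB)"
  and "length ks = m ==> coef ks (S.H I) = int (card S) * coef ks (T.H PB)"
proof -
 let ?fB = "%t. int (T.Fn (lam ` W) t)" and ?fW = "%t. int (S.Fn W t)" and ?\<rho> = "int (card S)"
 have fW: "ndg (Suc (Suc m)) ?fW" using S.Fn_ndg[OF stab] m by blast
 have low: "?\<rho> * ?fB t <= ?fW (t + d)" for t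
  using Bindep_count[OF S(1,3,4), of t] by (metis of_nat_le_iff of_nat_mult)
 have up: "?fW t <= ?\<rho> * ?fB (t + h)" for t
  using count_upper[OF S(1,5,6) red S.pol_mon, of t] by (metis of_nat_le_iff of_nat_mult)
 have \<rho>1: "1 <= ?\<rho>" using S(1,2) by (simp add: Suc_leI card_gt_0_iff)
 have fW': "ndg (Suc (Suc m)) (%t. ?fW (t + d))" using fW ndg_shift[of "Suc (Suc m)" ?fW d] by blast
 obtain M where M: "ndg M ?fB" using Fn_B_not_ndg by blast
 have "0 <= ?fB t & ?fB t <= ?fW (t + d)" for t
 proof -
  have "1 * ?fB t <= ?\<rho> * ?fB t" using \<rho>1 by (intro mult_right_mono) auto
  then show ?thesis using low[of t] by linarith
 qed
 then have fB: "ndg (Suc (Suc m)) ?fB" using ndg_sandwich[OF M fW', of 0] by blast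
 then show dB: "dg (Suc m) (T.H PB)" using T.Fn_ndg[OF PB_stable] by blast
 \<comment> \<open>\<open>?p\<close> is the defect in the lower bound, and the upper bound shows
   that it is at most \<open>?q\<close>, a shift difference, which has one order less.\<close>
 let ?p = "%t. ?fW (t + d) - ?\<rho> * ?fB t" and ?q = "%t. ?\<rho> * (?fB (t + (d + h)) - ?fB t)"
 have "ndg (Suc m) ?p"
 proof (rule ndg_sandwich[of "Suc (Suc m)" _ _ ?q 0])
  show "ndg (Suc (Suc m)) ?p" by (rule ndg_diff[OF fW' ndg_cmult[OF fB]])
  show "ndg (Suc m) ?q" by (rule ndg_cmult[OF ndg_shift_diff[OF fB]])
  have "0 <= ?p t & ?p t <= ?q t" for t
   using low[of t] up[of "t + d"] by (simp add: right_diff_distrib add.assoc)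
  then show "\<forall>t\<ge>0. 0 <= ?p t & ?p t <= ?q t" by blast
 qed
 moreover have "nd ?p = (%t. S.H I (%_. t + d + 1) - ?\<rho> * T.H PB (%_. t + 1))"
  using S.Fn_Suc[OF stab] T.Fn_Suc[OF PB_stable] by (auto simp: nd_def algebra_simps)
 ultimately have "ndg m (%t. S.H I (%_. t + d + 1) - ?\<rho> * T.H PB (%_. t + 1))" by simp
 moreover have add: "(%_. t + d + 1) = (%_. t) + (%_. d + 1)" "(%_. t + 1) = (%_. t) + (%_. 1)"
  for t :: nat by auto
 ultimately have "ndg m (%t. S.H I ((%_. t) + (%_. d + 1)) - ?\<rho> * T.H PB ((%_. t) + (%_. 1)))"
  by (simp only: add)
 then have D: "dg m (%g. S.H I (g + (%_. d + 1)) - ?\<rho> * T.H PB (g + (%_. 1)))" by (simp only: dg_unit)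
 show "coef ks (S.H I) = ?\<rho> * coef ks (T.H PB)" if ks: "length ks = m"
 proof -
  let ?u = "%g. S.H I (g + (%_. d + 1)) - ?\<rho> * T.H PB (g + (%_. 1))" and ?v = "%g. ?\<rho> * T.H PB (g + (%_. 1))"
  have dB': "dg (Suc (length ks)) (%g. T.H PB (g + (%_. 1)))" using dB ks by (simp only: dg_shift)
  have "coef ks (%g. ?u g + ?v g) = coef ks ?u + coef ks ?v"
   by (rule coef_add) (use D dg_Suc dg_cmult[OF dB'] ks in blast)+
  moreover have "coef ks ?u = 0" by (rule coef_0) (use D ks in simp)
  moreover have "coef ks ?v = ?\<rho> * coef ks (T.H PB)" unfolding coef_cmult[OF dB'] coef_shift ..
  moreover have "(%g. ?u g + ?v g) = (%g. S.H I (g + (%_. d + 1)))" by auto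
  ultimately show ?thesis by (simp only: coef_shift)
 qed
qed

text \<open>If all powers of \<open>z\<close> up to \<open>card S\<close> were independent, the rank
  would be at least \<open>card S + 1\<close>. The two counts would then bound the Hilbert function
  of the image by a multiple of one of its own shift differences, which has smaller order.\<close>

lemma dependent_powers:
 assumes S: "finite S" "pol \<Delta>" "\<Delta> ~: PB"
  and red: "!!f t. f \<in> S.Rle t ==> \<exists>b. (\<forall>s. b s \<in> T.Rle (t + h)) & pb \<Delta> * f - (\<Sum>s\<in>S. pb (b s) * S.mon s) \<in> I"
  and z: "pol z"
 shows "\<exists>d b. (\<forall>k. pol (b k)) & (\<Sum>k\<le>d. pb (b k) * z ^ k) \<in> I & (\<exists>k\<le>d. b k ~: PB)"
proof (rule ccontr)
 assume no: "\<not> ?thesis"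
 let ?C = "{..card S}" and ?fB = "%t. int (T.Fn (lam ` W) t)" and ?\<rho> = "int (card S)"
 have ind: "Bindep ?C (%k. z ^ k)" unfolding Bindep_def
 proof (intro allI impI)
  fix b assume b: "(\<forall>s\<in>?C. pol (b s)) & (\<Sum>s\<in>?C. pb (b s) * z ^ s) \<in> I"
  let ?b = "%k. if k \<in> ?C then b k else 0"
  have "pol (?b k)" for k using b pol_0 by auto
  moreover have "(\<Sum>k\<le>card S. pb (?b k) * z ^ k) = (\<Sum>s\<in>?C. pb (b s) * z ^ s)" by (rule sum.cong) auto
  then have s: "(\<Sum>k\<le>card S. pb (?b k) * z ^ k) \<in> I" using b by (simp only:)
  ultimately have p: "\<forall>k. pol (?b k)" by blast
  have "\<forall>k\<le>card S. ?b k \<in> PB"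
  proof (rule ccontr)
   assume "\<not> ?thesis"
   then have "\<exists>k\<le>card S. ?b k ~: PB" by (simp only: not_all not_imp)
   with p s have "(\<forall>k. pol (?b k)) & (\<Sum>k\<le>card S. pb (?b k) * z ^ k) \<in> I & (\<exists>k\<le>card S. ?b k ~: PB)"
    by (intro conjI)
   then show False using no by (elim notE, intro exI)
  qed
  then show "\<forall>s\<in>?C. b s \<in> PB" by auto
 qed
 obtain d0 where d0: "z \<in> S.Rle d0" using S.pol_Rle[OF z] by blast
 have zp: "z ^ k \<in> S.Rle (k * d0)" for k
 proof (induction k)
  case 0
  then show ?case using S.const_Rle[of 1 0] by (simp only: power_0 one_fun_def mult_0)
 next
  case (Suc k)
  then show ?case using S.Rle_mult[OF d0 Suc] by (simp only: power_Suc mult_Suc)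
 qed
 define d where "d = card S * d0"
 have zd: "z ^ k \<in> S.Rle d" if "k \<in> ?C" for k
  using zp[of k] S.Rle_mono[of "k * d0" d] that by (auto simp: d_def)
 have low: "card ?C * T.Fn (lam ` W) t <= S.Fn W (t + d)" for t by (rule Bindep_count[OF _ ind zd]) auto
 have up: "S.Fn W (t + d) <= card S * T.Fn (lam ` W) (t + d + h)" for t
  using count_upper[OF S red S.pol_mon, of "t + d"] .
 have ineq: "0 <= ?fB t & ?fB t <= ?\<rho> * (?fB (t + (d + h)) - ?fB t)" for t
 proof -
  have "int (Suc (card S) * T.Fn (lam ` W) t) <= int (card S * T.Fn (lam ` W) (t + (d + h)))"
   unfolding of_nat_le_iff using order_trans[OF low up, of t] by (simp add: add.assoc)
  then show ?thesis by (simp add: algebra_simps)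
 qed
 obtain \<mu> where \<mu>: "ndg (Suc \<mu>) ?fB" "\<not> ndg \<mu> ?fB" using Fn_B_not_ndg by blast
 have "ndg \<mu> (%t. ?\<rho> * (?fB (t + (d + h)) - ?fB t))"
  by (rule ndg_cmult[OF ndg_shift_diff[OF \<mu>(1)]])
 then have "ndg \<mu> ?fB" using ndg_sandwich[OF \<mu>(1), of \<mu> _ 0] ineq by blast
 then show False using \<mu>(2) by blast
qed

section \<open>Relations of minimal degree and generic fibres\<close>

definition dep :: "('a => complex) => nat => bool" where
 "dep z d \<longleftrightarrow> (\<exists>b. (\<forall>k. pol (b k)) & (\<Sum>k\<le>d. pb (b k) * z ^ k) \<in> I & (\<exists>k\<le>d. b k ~: PB))"

lemma minimal_dependency:
 assumes "\<exists>d. dep z d" and z: "pol z"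
 obtains d b where "!!k. pol (b k)" "(\<Sum>k\<le>d. pb (b k) * z ^ k) \<in> I" "b d ~: PB" "d > 0"
  "!!d'. d' < d ==> \<not> dep z d'"
proof -
 define d where "d = (LEAST d. dep z d)"
 have "dep z d" unfolding d_def using assms(1) by (rule LeastI_ex)
 then obtain b k0 where b: "\<forall>k. pol (b k)" "(\<Sum>k\<le>d. pb (b k) * z ^ k) \<in> I" "k0 <= d" "b k0 ~: PB"
  unfolding dep_def by blast
 have min: "\<not> dep z d'" if "d' < d" for d' using that unfolding d_def by (rule not_less_Least)
 have d0: "d ~= 0"
 proof
  assume d0: "d = 0"
  then have "pb (b 0) \<in> I" using b(2) by (simp only: atMost_0 sum.insert finite.emptyI empty_iff simp_thms sum.empty power_0 mult_1_right add_0_right)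
  then show False using pb_mem[of "b 0"] b d0 by auto
 qed
 then obtain d' where d': "d = Suc d'" by (cases d) auto
 have "b d ~: PB"
 proof
  assume bd: "b d \<in> PB"
  have "pb (b d) * z ^ d \<in> I" using pb_mem[of "b d"] b(1) bd pidealD(5)[OF I_pideal _ pol_power[OF z]] by blast
  moreover have "(\<Sum>k\<le>d. pb (b k) * z ^ k) = (\<Sum>k\<le>d'. pb (b k) * z ^ k) + pb (b d) * z ^ d"
   unfolding d' by (rule sum.atMost_Suc)
  ultimately have "(\<Sum>k\<le>d'. pb (b k) * z ^ k) + pb (b d) * z ^ d - pb (b d) * z ^ d \<in> I"
   using b(2) pidealD(8)[OF I_pideal] by metis
  then have "(\<Sum>k\<le>d'. pb (b k) * z ^ k) \<in> I" by (simp only: add_diff_cancel_right')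
  moreover have "k0 ~= d" using bd b(4) by metis
  then have "k0 <= d'" using b(3) d' by simp
  ultimately have "dep z d'" unfolding dep_def using b(1,4) by blast
  then show False using min d' by simp
 qed
 then show ?thesis using that b(1,2) d0 min by blast
qed

text \<open>In characteristic 0 the derivative of a relation of minimal degree still has a leading
  coefficient outside \<open>PB\<close>; if it vanished modulo \<open>I\<close> it would be a
  shorter relation.\<close>

lemma separable_relation:
 assumes "\<exists>d. dep z d" and z: "pol z"
 shows "\<exists>d b. (\<forall>k. pol (b k)) & (\<Sum>k\<le>d. pb (b k) * z ^ k) \<in> I &
  (\<Sum>k<d. fsc (of_nat (Suc k)) (pb (b (Suc k)) * z ^ k)) ~: I"
proof -
 obtain d b where b: "!!k. pol (b k)" "(\<Sum>k\<le>d. pb (b k) * z ^ k) \<in> I" "b d ~: PB" "d > 0"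
  "!!d'. d' < d ==> \<not> dep z d'" by (rule minimal_dependency[OF assms]) blast
 obtain d' where d': "d = Suc d'" using b(4) by (cases d) auto
 have "(\<Sum>k<d. fsc (of_nat (Suc k)) (pb (b (Suc k)) * z ^ k)) ~: I"
 proof
  assume in_I: "(\<Sum>k<d. fsc (of_nat (Suc k)) (pb (b (Suc k)) * z ^ k)) \<in> I"
  have "(\<Sum>k<d. fsc (of_nat (Suc k)) (pb (b (Suc k)) * z ^ k)) =
    (\<Sum>k\<le>d'. pb (fsc (of_nat (Suc k)) (b (Suc k))) * z ^ k)" unfolding d' lessThan_Suc_atMost
   by (rule sum.cong[OF refl]) (simp add: pb_def fun_eq_iff mult.assoc)
  then have "(\<Sum>k\<le>d'. pb (fsc (of_nat (Suc k)) (b (Suc k))) * z ^ k) \<in> I" using in_I by (simp only:)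
  moreover have "fsc (of_nat (Suc d')) (b (Suc d')) ~: PB"
  proof
   assume "fsc (of_nat (Suc d')) (b (Suc d')) \<in> PB"
   then have "fsc (1 / of_nat (Suc d')) (fsc (of_nat (Suc d')) (b (Suc d'))) \<in> PB"
    by (rule pidealD(6)[OF PB_pideal])
   moreover have "fsc (1 / of_nat (Suc d')) (fsc (of_nat (Suc d')) (b (Suc d'))) = b d"
    unfolding fs.scale_scale d' by (simp del: of_nat_Suc)
   ultimately show False using b(3) by (simp only:)
  qed
  ultimately have "dep z d'" unfolding dep_def
   by (intro exI[of _ "%k. fsc (of_nat (Suc k)) (b (Suc k))"] conjI allI exI[of _ d'] pol_fsc b(1)) simp_all
  then show False using b(5) d' by blast
 qed
 then show ?thesis using b(1,2) by blast
qed

text \<open>The constant term of a minimal relation for \<open>q\<close> is a multiple of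
  \<open>q\<close> modulo \<open>I\<close>. It is outside \<open>PB\<close>, for otherwise
  \<open>q\<close> could be cancelled and the relation shortened. It acts as a norm: where
  \<open>r\<close> is nonzero on the image, \<open>q\<close> is nonzero on the fibre.\<close>

lemma norm_multiple:
 assumes "\<exists>d. dep q d" and q: "pol q" "q ~: I"
 shows "\<exists>r g. pol r & r ~: PB & pol g & q * g - pb r \<in> I"
proof -
 obtain d b where b: "!!k. pol (b k)" "(\<Sum>k\<le>d. pb (b k) * q ^ k) \<in> I" "b d ~: PB" "d > 0"
  "!!d'. d' < d ==> \<not> dep q d'" by (rule minimal_dependency[OF assms(1) q(1)]) blast
 obtain d' where d': "d = Suc d'" using b(4) by (cases d) auto
 define g where "g = (\<Sum>k\<le>d'. pb (b (Suc k)) * q ^ k)"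
 have pg: "pol g" unfolding g_def by (intro pol_sum pol_mult pol_pb b(1) pol_power q(1))
 have "(\<Sum>k\<le>d. pb (b k) * q ^ k) = pb (b 0) * q ^ 0 + (\<Sum>k\<le>d'. pb (b (Suc k)) * q ^ Suc k)"
  unfolding d' by (rule sum.atMost_Suc_shift)
 also have "(\<Sum>k\<le>d'. pb (b (Suc k)) * q ^ Suc k) = q * g"
  unfolding g_def sum_distrib_left by (rule sum.cong[OF refl]) (simp only: power_Suc mult.left_commute)
 finally have eq: "(\<Sum>k\<le>d. pb (b k) * q ^ k) = pb (b 0) + q * g" by (simp only: power_0 mult_1_right)
 have b0: "b 0 ~: PB"
 proof
  assume "b 0 \<in> PB"
  then have "pb (b 0) \<in> I" using pb_mem[OF b(1)] by blast
  then have "pb (b 0) + q * g - pb (b 0) \<in> I" using b(2) pidealD(8)[OF I_pideal] unfolding eq by blast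
  then have "q * g \<in> I" by (simp only: add_diff_cancel_left')
  then have "g \<in> I" using pprimeD(3)[OF prime q(1) pg] q(2) by blast
  then have "dep q d'" unfolding dep_def g_def
   by (intro exI[of _ "%k. b (Suc k)"] conjI allI exI[of _ d'] b(1)) (use b(3) d' in simp_all)
  then show False using b(5) d' by blast
 qed
 have "q * g - pb (- b 0) = pb (b 0) + q * g" unfolding pb_ring by (rule ext) simp
 then have "q * g - pb (- b 0) \<in> I" using b(2) unfolding eq by (simp only:)
 moreover have "- b 0 ~: PB" using pidealD(7)[OF PB_pideal, of "- b 0"] b0 by auto
 ultimately show ?thesis using pol_uminus[OF b(1)] pg by blast
qed

text \<open>\<open>S\<close> restricts to a basis of the functions on the fibre over
  \<open>u\<close>. It spans since \<Delta> is nonzero at \<open>u\<close>, which bounds the fibre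
  by \<open>card S\<close>. It is independent because the ideal \<open>?J\<close> of the
  scheme-theoretic fibre is radical and \<open>S\<close> is independent over the image, which gives
  the other inequality.\<close>

theorem generic_fibre:
 assumes S: "finite S" "Bindep S S.mon" "pol \<Delta>" "\<Delta> ~: PB"
  and red: "!!f t. f \<in> S.Rle t ==> \<exists>b. (\<forall>s. b s \<in> T.Rle (t + h)) & pb \<Delta> * f - (\<Sum>s\<in>S. pb (b s) * S.mon s) \<in> I"
 shows "\<exists>\<Theta>. pol \<Theta> & \<Theta> ~: PB & (\<forall>u\<in>zset PB. \<Theta> u ~= 0 -->
  finite {x\<in>W. lam x = u} & card {x\<in>W. lam x = u} = card S)"
proof -
 have dp: "\<exists>d. dep z d" if "pol z" for z unfolding dep_def using dependent_powers[OF S(1,3,4) red that] .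
 have "\<forall>i. \<exists>d b. (\<forall>k. pol (b k)) & (\<Sum>k\<le>d. pb (b k) * X i ^ k) \<in> I &
  (\<Sum>k<d. fsc (of_nat (Suc k)) (pb (b (Suc k)) * X i ^ k)) ~: I"
  by (intro allI separable_relation[OF dp[OF S.pol_X] S.pol_X])
 from choice[OF this] obtain d where "\<forall>i. \<exists>b. (\<forall>k. pol (b k)) & (\<Sum>k\<le>d i. pb (b k) * X i ^ k) \<in> I &
  (\<Sum>k<d i. fsc (of_nat (Suc k)) (pb (b (Suc k)) * X i ^ k)) ~: I" by (elim exE)
 from choice[OF this] obtain b where b': "\<forall>i. (\<forall>k. pol (b i k)) & (\<Sum>k\<le>d i. pb (b i k) * X i ^ k) \<in> I &
  (\<Sum>k<d i. fsc (of_nat (Suc k)) (pb (b i (Suc k)) * X i ^ k)) ~: I" by (elim exE)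
 then have b: "!!i k. pol (b i k)" "!!i. (\<Sum>k\<le>d i. pb (b i k) * X i ^ k) \<in> I"
  "!!i. (\<Sum>k<d i. fsc (of_nat (Suc k)) (pb (b i (Suc k)) * X i ^ k)) ~: I" by simp_all
 define q where "q i = (\<Sum>k<d i. fsc (of_nat (Suc k)) (pb (b i (Suc k)) * X i ^ k))" for i
 have pq: "pol (q i)" for i unfolding q_def by (intro pol_sum pol_fsc pol_mult pol_pb b(1) pol_power S.pol_X)
 have "\<exists>r g. pol r & r ~: PB & pol g & q i * g - pb r \<in> I" for i
  by (rule norm_multiple[OF dp[OF pq] pq]) (use b(3) q_def in simp)
 then obtain r g where r: "!!i. pol (r i)" "!!i. r i ~: PB" "!!i. q i * g i - pb (r i) \<in> I" by metis
 \<comment> \<open>\<open>q i\<close> is the derivative of the relation for \<open>X i\<close> and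
   \<open>r i\<close> its norm. Where \<Theta> is nonzero the denominator \<Delta> is invertible,
   and at every point of the fibre the relation for each coordinate has a simple root.\<close>
 define \<Theta> where "\<Theta> = \<Delta> * (\<Prod>i\<in>UNIV. r i)"
 have p\<Theta>: "pol \<Theta>" unfolding \<Theta>_def using S(3) r(1) by (intro pol_mult pol_prod)
 have "(\<Prod>i\<in>UNIV. r i) ~: PB" using pprime_prod[OF PB_prime finite, of UNIV r] r by blast
 then have \<Theta>PB: "\<Theta> ~: PB"
  unfolding \<Theta>_def using pprimeD(3)[OF PB_prime S(3)] S(4) pol_prod[of UNIV r] r(1) by blast
 have "finite {x\<in>W. lam x = u} & card {x\<in>W. lam x = u} = card S" if u: "u \<in> zset PB" "\<Theta> u ~= 0" for u
 proof -
  let ?\<Phi> = "{x\<in>W. lam x = u}"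
  have \<Delta>u: "\<Delta> u ~= 0" and ru: "r i u ~= 0" for i using u(2) by (auto simp: \<Theta>_def prod_fun_apply)
  obtain js :: "'j list" where js: "set js = UNIV" "distinct js"
   using finite_distinct_list[OF finite, of "UNIV :: 'j set"] by blast
  let ?y = "%j. pb (Y j) - (%_. Y j u)"
  let ?J = "adjoins I (map ?y js)"
  have py: "pol (?y j)" for j using pol_pbY by (intro pol_diff pol_const) (simp add: pb_def)
  have J: "pideal ?J" "I \<subseteq> ?J" "set (map ?y js) \<subseteq> ?J" "zset ?J = {x \<in> zset I. \<forall>a\<in>set (map ?y js). a x = 0}"
  proof -
   have pa: "pol a" if "a \<in> set (map ?y js)" for a using that py by auto
   show "pideal ?J" by (rule adjoins(1)[OF I_pideal]) (rule pa)
   show "I \<subseteq> ?J" by (rule adjoins(2)[OF I_pideal]) (rule pa)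
   show "set (map ?y js) \<subseteq> ?J" by (rule adjoins(3)[OF I_pideal]) (rule pa)
   show "zset ?J = {x \<in> zset I. \<forall>a\<in>set (map ?y js). a x = 0}" by (rule adjoins(4)[OF I_pideal]) (rule pa)
  qed
  have "(\<forall>j. Y j (lam x) = Y j u) \<longleftrightarrow> lam x = u" for x using T.X_inj[of "lam x" u] by auto
  then have zJ: "zset ?J = ?\<Phi>" unfolding J(4) closed using js(1) by (auto simp: pb_def)
  have evJ: "pb c - (%_. c u) \<in> ?J" if "pol c" for c
  proof -
   have "(%x. Y j (lam x) - Y j u) \<in> ?J" for j
   proof -
    have "?y j \<in> ?J" using J(3) js(1) by auto
    moreover have "?y j = (%x. Y j (lam x) - Y j u)" by (auto simp: pb_def)
    ultimately show ?thesis by (simp only:)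
   qed
   then have "(%x. c (lam x) - c u) \<in> ?J" by (rule T.evaluation_mod_ideal[OF J(1) _ pol_pbY that])
   moreover have "pb c - (%_. c u) = (%x. c (lam x) - c u)" by (auto simp: pb_def)
   ultimately show ?thesis by (simp only:)
  qed
  have span: "\<exists>c. \<forall>x\<in>?\<Phi>. f x = (\<Sum>s\<in>S. c s * S.mon s x)" if f: "pol f" for f
  proof -
   obtain t where "f \<in> S.Rle t" using S.pol_Rle[OF f] .
   from red[OF this] obtain \<beta> where \<beta>: "pb \<Delta> * f - (\<Sum>s\<in>S. pb (\<beta> s) * S.mon s) \<in> I" by (elim exE conjE)
   have "f x = (\<Sum>s\<in>S. (\<beta> s u / \<Delta> u) * S.mon s x)" if x: "x \<in> ?\<Phi>" for x
   proof -
    have "\<Delta> u * f x = (\<Sum>s\<in>S. \<beta> s u * S.mon s x)"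
     using vanD[OF \<beta>, of x] x by (simp add: sum_fun_apply pb_def)
    then have "f x = (\<Sum>s\<in>S. \<beta> s u * S.mon s x) / \<Delta> u" using \<Delta>u by (simp add: field_simps)
    then show ?thesis by (simp add: sum_divide_distrib)
   qed
   then show ?thesis by (intro exI[of _ "%s. \<beta> s u / \<Delta> u"] ballI)
  qed
  \<comment> \<open>With more points than elements of \<open>S\<close> the evaluations at the
    points, restricted to \<open>S\<close>, are dependent. By \<open>span\<close> the dependency
    holds for every polynomial, also for one that is nonzero only at \<open>x0\<close>.\<close>
  have le: "card C <= card S" if C: "finite C" "C \<subseteq> ?\<Phi>" for C
  proof (rule ccontr)
   assume neg: "\<not> card C <= card S"
   let ?v = "%x s. if s \<in> S then S.mon s x else 0"
   have "\<exists>\<alpha>. (\<exists>x\<in>C. \<alpha> x ~= 0) & (\<Sum>x\<in>C. fsc (\<alpha> x) (?v x)) = 0"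
    by (rule family_dependent[OF C(1) dim_supported_le(1)[OF S(1)]])
     (use dim_supported_le(2)[OF S(1)] neg in auto)
   then obtain \<alpha> x0 where \<alpha>: "x0 \<in> C" "\<alpha> x0 ~= 0" "(\<Sum>x\<in>C. fsc (\<alpha> x) (?v x)) = 0" by blast
   have \<alpha>s: "(\<Sum>x\<in>C. \<alpha> x * S.mon s x) = 0" if "s \<in> S" for s
    using fun_cong[OF \<alpha>(3), of s] that by (simp add: sum_fun_apply)
   obtain f where f: "pol f" "f x0 ~= 0" "\<forall>x\<in>C - {x0}. f x = 0"
    using S.separating_polynomial[of "C - {x0}" x0] C(1) by auto
   obtain c where c: "\<forall>x\<in>?\<Phi>. f x = (\<Sum>s\<in>S. c s * S.mon s x)" using span[OF f(1)] by blast
   have "(\<Sum>x\<in>C. \<alpha> x * f x) = (\<Sum>x\<in>C. \<alpha> x * (\<Sum>s\<in>S. c s * S.mon s x))"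
    using c C(2) by (intro sum.cong) auto
   also have "\<dots> = (\<Sum>s\<in>S. c s * (\<Sum>x\<in>C. \<alpha> x * S.mon s x))"
    unfolding sum_distrib_left by (subst sum.swap) (simp only: ac_simps)
   also have "\<dots> = 0" using \<alpha>s by simp
   finally have "(\<Sum>x\<in>C. \<alpha> x * f x) = 0" .
   moreover have "(\<Sum>x\<in>C. \<alpha> x * f x) = (\<Sum>x\<in>{x0}. \<alpha> x * f x)"
    using C(1) \<alpha>(1) f(3) by (intro sum.mono_neutral_right) auto
   ultimately show False using \<alpha>(2) f(2) by simp
  qed
  have fin: "finite ?\<Phi>"
  proof (rule ccontr)
   assume "infinite ?\<Phi>"
   from infinite_arbitrarily_large[OF this, of "Suc (card S)"]
   obtain C where "finite C & card C = Suc (card S) & C \<subseteq> ?\<Phi>" by (elim exE)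
   then show False using le[of C] by simp
  qed
  \<comment> \<open>A zero \<open>x\<close> of \<open>(?J : f)\<close> lies on the fibre. Dividing
    the relation of each coordinate by its simple root at \<open>x\<close> and multiplying the
    quotients gives \<open>G\<close>, nonzero at \<open>x\<close>, such that \<open>G\<close> times
    every \<open>X i - X i x\<close> is in \<open>?J\<close>. Then \<open>f\<close> is congruent to
    \<open>f x = 0\<close> modulo \<open>(?J : G)\<close>, so \<open>G\<close> is in
    \<open>(?J : f)\<close>, although \<open>G x\<close> is not 0.\<close>
  have radical: "f \<in> ?J" if f: "pol f" "!!x. x \<in> ?\<Phi> ==> f x = 0" for f
  proof (rule ccontr)
   assume nf: "f ~: ?J"
   let ?K = "colon ?J f"
   have K: "pideal ?K" by (rule pideal_colon[OF J(1)])
   have "1 ~: ?K"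
   proof
    assume "1 \<in> ?K"
    then have "f * 1 \<in> ?J" unfolding colon_def by blast
    then show False using nf unfolding mult_1_right by blast
   qed
   then have "1 ^ n ~: ?K" for n unfolding power_one .
   then obtain x where x: "x \<in> zset ?K" using S.nullstellensatz[OF K pol_1] by blast
   have x\<Phi>: "x \<in> ?\<Phi>" using x zset_antimono[OF colon_superset[OF J(1) f(1)]] zJ by blast
   have "\<exists>p. poly p (X i x) ~= 0 & (%y. poly p (X i y)) * (X i - (%_. X i x)) \<in> ?J" for i
   proof -
    define P where "P = (\<Sum>k\<le>d i. monom (b i k u) k)"
    have PJ: "(%y. poly P (X i y)) \<in> ?J"
    proof -
     have s1: "(\<Sum>k\<le>d i. pb (b i k) * X i ^ k) \<in> ?J" using b(2) J(2) by blast
     have s2: "(\<Sum>k\<le>d i. (pb (b i k) - (%_. b i k u)) * X i ^ k) \<in> ?J"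
      by (intro pideal_sum[OF J(1)] pidealD(5)[OF J(1) evJ[OF b(1)]] pol_power S.pol_X)
     note pidealD(8)[OF J(1) s1 s2]
     moreover have "(\<Sum>k\<le>d i. pb (b i k) * X i ^ k) - (\<Sum>k\<le>d i. (pb (b i k) - (%_. b i k u)) * X i ^ k) =
       (%y. poly P (X i y))"
     proof
      fix y
      show "((\<Sum>k\<le>d i. pb (b i k) * X i ^ k) - (\<Sum>k\<le>d i. (pb (b i k) - (%_. b i k u)) * X i ^ k)) y =
        poly P (X i y)"
       by (simp add: sum_fun_apply power_fun_apply P_def poly_sum poly_monom left_diff_distrib sum_subtractf)
     qed
     ultimately show ?thesis by (simp only:)
    qed
    have root: "poly P (X i x) = 0" using PJ x\<Phi> zJ unfolding zset_def by auto
    then obtain p where p: "P = [:- X i x, 1:] * p" by (metis dvdE poly_eq_0_iff_dvd)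
    have "poly (pderiv P) (X i x) = q i x"
    proof -
     have "pderiv (sum F A) = (\<Sum>k\<in>A. pderiv (F k))" for A and F :: "nat => complex poly"
      by (induction A rule: infinite_finite_induct) (simp_all add: pderiv_add)
     then have "pderiv P = (\<Sum>k\<le>d i. pderiv (monom (b i k u) k))" unfolding P_def .
     then have "poly (pderiv P) (X i x) = (\<Sum>k\<le>d i. of_nat k * b i k u * X i x ^ (k - 1))"
      by (simp add: poly_sum pderiv_monom poly_monom)
     also have "\<dots> = (\<Sum>k<d i. of_nat (Suc k) * b i (Suc k) u * X i x ^ k)"
      by (cases "d i") (simp_all add: sum.atMost_Suc_shift lessThan_Suc_atMost del: of_nat_Suc sum.atMost_Suc)
     also have "\<dots> = q i x"
      using x\<Phi> by (simp add: q_def sum_fun_apply pb_def power_fun_apply mult.assoc)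
     finally show ?thesis .
    qed
    moreover have "q i x ~= 0" using vanD[OF r(3)[of i], of x] x\<Phi> ru[of i] by (auto simp: pb_def)
    moreover have "poly (pderiv P) (X i x) = poly p (X i x)" unfolding p pderiv_mult by (simp add: pderiv_pCons)
    moreover have "(%y. poly p (X i y)) * (X i - (%_. X i x)) = (%y. poly P (X i y))"
     by (auto simp: p algebra_simps)
    ultimately have "poly p (X i x) ~= 0 & (%y. poly p (X i y)) * (X i - (%_. X i x)) \<in> ?J"
     using PJ by (simp only:) simp
    then show ?thesis by (rule exI)
   qed
   then have "\<forall>i. \<exists>p. poly p (X i x) ~= 0 & (%y. poly p (X i y)) * (X i - (%_. X i x)) \<in> ?J" by (rule allI)
   from choice[OF this] obtain p where "\<forall>i. poly (p i) (X i x) ~= 0 &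
    (%y. poly (p i) (X i y)) * (X i - (%_. X i x)) \<in> ?J" by (elim exE)
   then have p: "!!i. poly (p i) (X i x) ~= 0"
    "!!i. (%y. poly (p i) (X i y)) * (X i - (%_. X i x)) \<in> ?J" by blast+
   have pp: "pol (%y. poly c (X i y))" for c i
    by (induction c) (auto intro!: polynomial_fun.intros(2-) S.pol_X)
   define G where "G = (\<Prod>i\<in>UNIV. (%y. poly (p i) (X i y)))"
   have pG: "pol G" unfolding G_def by (intro pol_prod pp)
   have "(%y. X i y - X i x) \<in> colon ?J G" for i
   proof -
    have "G = (\<Prod>i\<in>UNIV - {i}. (%y. poly (p i) (X i y))) * (%y. poly (p i) (X i y))"
     unfolding G_def by (subst prod.remove[of UNIV i]) (simp_all only: finite UNIV_I mult.commute)
    then have "G * (X i - (%_. X i x)) =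
      (\<Prod>i\<in>UNIV - {i}. (%y. poly (p i) (X i y))) * ((%y. poly (p i) (X i y)) * (X i - (%_. X i x)))"
     by (simp only: mult.assoc)
    also have "\<dots> \<in> ?J" by (rule pidealD(4)[OF J(1) p(2)]) (intro pol_prod pp)
    finally have "X i - (%_. X i x) \<in> colon ?J G"
     unfolding colon_def using pol_diff[OF S.pol_X pol_const] by blast
    moreover have "X i - (%_. X i x) = (%y. X i y - X i x)" by auto
    ultimately show ?thesis by (simp only:)
   qed
   then have "(%y. f y - f x) \<in> colon ?J G"
    using S.evaluation_mod_ideal[OF pideal_colon[OF J(1)], where h = "%y. y" and f = f and u = x] S.pol_X f(1) by blast
   then have "f \<in> colon ?J G" using f(2)[OF x\<Phi>] by simp
   then have "G * f \<in> ?J" unfolding colon_def by blast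
   then have "f * G \<in> ?J" by (simp only: mult.commute)
   then have "G \<in> ?K" unfolding colon_def using pG by blast
   then have "G x = 0" using x unfolding zset_def by blast
   then show False using p(1) by (simp add: G_def prod_fun_apply)
  qed
  have ge: "card S <= card ?\<Phi>"
  proof (rule ccontr)
   assume neg: "\<not> card S <= card ?\<Phi>"
   let ?v = "%s x. if x \<in> ?\<Phi> then S.mon s x else 0"
   have "\<exists>\<alpha>. (\<exists>s\<in>S. \<alpha> s ~= 0) & (\<Sum>s\<in>S. fsc (\<alpha> s) (?v s)) = 0"
    by (rule family_dependent[OF S(1) dim_supported_le(1)[OF fin]])
     (use dim_supported_le(2)[OF fin] neg in auto)
   then obtain \<alpha> s0 where \<alpha>: "s0 \<in> S" "\<alpha> s0 ~= 0" "(\<Sum>s\<in>S. fsc (\<alpha> s) (?v s)) = 0" by blast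
   define f where "f = (\<Sum>s\<in>S. fsc (\<alpha> s) (S.mon s))"
   have pf: "pol f" unfolding f_def by (intro pol_sum pol_fsc S.pol_mon)
   have "f x = 0" if "x \<in> ?\<Phi>" for x
    using fun_cong[OF \<alpha>(3), of x] that by (simp add: f_def sum_fun_apply)
   then have "f \<in> ?J" by (rule radical[OF pf])
   then obtain w where w: "\<forall>j. pol (w j)" "f - (\<Sum>j\<in>set js. ?y j * w j) \<in> I"
    using adjoins_mem[OF _ js(2)] by blast
   have "\<exists>\<beta>. (\<forall>s. pol (\<beta> s)) & pb \<Delta> * w j - (\<Sum>s\<in>S. pb (\<beta> s) * S.mon s) \<in> I" for j
   proof -
    obtain t where "w j \<in> S.Rle t" using S.pol_Rle w(1) by blast
    then show ?thesis using red T.Rle_pol by meson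
   qed
   then obtain \<beta> where \<beta>: "!!j s. pol (\<beta> j s)" "!!j. pb \<Delta> * w j - (\<Sum>s\<in>S. pb (\<beta> j s) * S.mon s) \<in> I" by metis
   \<comment> \<open>Writing \<open>f\<close> through the generators \<open>?y j\<close> of the
     fibre ideal and multiplying by \<Delta> gives a relation over the image with these
     coefficients, so they lie in \<open>PB\<close>. At \<open>u\<close> the sum over
     \<open>j\<close> vanishes and \<open>\<alpha> s0 * \<Delta> u\<close> remains.\<close>
   define c where "c s = fsc (\<alpha> s) \<Delta> - (\<Sum>j\<in>set js. (Y j - (%_. Y j u)) * \<beta> j s)" for s
   have pc: "pol (c s)" for s
    unfolding c_def by (intro pol_diff pol_fsc S(3) pol_sum pol_mult T.pol_X pol_const \<beta>(1))
   have "(\<Sum>s\<in>S. pb (c s) * S.mon s) = pb \<Delta> * (f - (\<Sum>j\<in>set js. ?y j * w j)) +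
     (\<Sum>j\<in>set js. ?y j * (pb \<Delta> * w j - (\<Sum>s\<in>S. pb (\<beta> j s) * S.mon s)))"
   proof
    fix x
    let ?z = "%j. Y j (lam x) - Y j u"
    have "(\<Sum>s\<in>S. (\<Sum>j\<in>set js. ?z j * \<beta> j s (lam x)) * S.mon s x) =
     (\<Sum>j\<in>set js. ?z j * (\<Sum>s\<in>S. \<beta> j s (lam x) * S.mon s x))"
     unfolding sum_distrib_right sum_distrib_left by (subst sum.swap) (simp only: mult.assoc)
    moreover have "(\<Sum>s\<in>S. pb (c s) * S.mon s) x = (\<Sum>s\<in>S. \<alpha> s * \<Delta> (lam x) * S.mon s x) -
     (\<Sum>s\<in>S. (\<Sum>j\<in>set js. ?z j * \<beta> j s (lam x)) * S.mon s x)"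
     by (simp add: sum_fun_apply pb_def c_def left_diff_distrib[of "_ * _" _ "S.mon _ _"] sum_subtractf)
    moreover have "(\<Sum>s\<in>S. \<alpha> s * \<Delta> (lam x) * S.mon s x) = \<Delta> (lam x) * f x"
     by (simp add: f_def sum_fun_apply sum_distrib_left ac_simps)
    moreover have "(\<Sum>j\<in>set js. ?z j * (\<Delta> (lam x) * w j x - (\<Sum>s\<in>S. \<beta> j s (lam x) * S.mon s x))) =
     \<Delta> (lam x) * (\<Sum>j\<in>set js. ?z j * w j x) - (\<Sum>j\<in>set js. ?z j * (\<Sum>s\<in>S. \<beta> j s (lam x) * S.mon s x))"
     by (simp only: right_diff_distrib sum_subtractf sum_distrib_left ac_simps)
    ultimately show "(\<Sum>s\<in>S. pb (c s) * S.mon s) x = (pb \<Delta> * (f - (\<Sum>j\<in>set js. ?y j * w j)) +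
     (\<Sum>j\<in>set js. ?y j * (pb \<Delta> * w j - (\<Sum>s\<in>S. pb (\<beta> j s) * S.mon s)))) x"
     by (simp add: sum_fun_apply pb_def right_diff_distrib[of "\<Delta> (lam x)"])
   qed
   also have "\<dots> \<in> I" using pol_pb[OF S(3)] py w(2) \<beta>(2)
    by (intro pidealD(3)[OF I_pideal] pideal_sum[OF I_pideal] pidealD(4)[OF I_pideal])
   finally have "c s0 \<in> PB" using S(2) pc \<alpha>(1) unfolding Bindep_def by blast
   then have "c s0 u = 0" using u(1) unfolding zset_def by blast
   then have "\<alpha> s0 * \<Delta> u = 0" by (simp add: c_def sum_fun_apply)
   then show False using \<alpha>(2) \<Delta>u by simp
  qed
  show ?thesis using fin le[OF fin] ge by simp
 qed
 then show ?thesis using p\<Theta> \<Theta>PB by blast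
qed

theorem finite_projection:
 assumes "dg (Suc m) (S.H I)"
 obtains \<rho> \<Theta> where "dg (Suc m) (T.H PB)" "!!ks. length ks = m ==> coef ks (S.H I) = int \<rho> * coef ks (T.H PB)"
  "pol \<Theta>" "\<Theta> ~: PB"
  "!!u. u \<in> zset PB ==> \<Theta> u ~= 0 ==> finite {x\<in>W. lam x = u} & card {x\<in>W. lam x = u} = \<rho>"
proof -
 obtain S d h \<Delta> where S: "finite S" "S ~= {}" "Bindep S S.mon"
  "!!s. s \<in> S ==> S.mon s \<in> S.Rle d" "pol \<Delta>" "\<Delta> ~: PB"
  and red: "!!f t. f \<in> S.Rle t ==> \<exists>b. (\<forall>s. b s \<in> T.Rle (t + h)) & pb \<Delta> * f - (\<Sum>s\<in>S. pb (b s) * S.mon s) \<in> I"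
  by (rule generic_basis) blast
 note c = projection_coef[OF S red assms]
 obtain \<Theta> where "pol \<Theta>" "\<Theta> ~: PB" "\<forall>u\<in>zset PB. \<Theta> u ~= 0 -->
  finite {x\<in>W. lam x = u} & card {x\<in>W. lam x = u} = card S"
  using generic_fibre[OF S(1,3,5,6) red] by blast
 then show ?thesis using that[of "card S" \<Theta>] c by blast
qed

end

section \<open>Gradients\<close>

lemma bilin_commute: "bilin x y = bilin y x"
 by (simp add: bilin_def mult.commute)

lemma bilin_linear:
 "bilin (a + b) v = bilin a v + bilin b v" "bilin (c *s a) v = c * bilin a v" "bilin 0 v = 0"
 "bilin a (u + v) = bilin a u + bilin a v" "bilin a (c *s v) = c * bilin a v" "bilin a 0 = 0"
 "bilin (a - b) v = bilin a v - bilin b v"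
 by (simp_all add: bilin_def algebra_simps sum.distrib sum_distrib_left sum_subtractf)

lemma bilin_sum: "bilin (\<Sum>i\<in>A. f i) v = (\<Sum>i\<in>A. bilin (f i) v)"
 by (induction A rule: infinite_finite_induct) (simp_all add: bilin_linear)

lemma bilin_axis': "bilin x (axis i 1) = x $ i"
 using bilin_axis bilin_commute by metis

definition grad :: "('n::finite cvec => complex) => 'n cvec => 'n cvec" where
 "grad f x = (\<chi> i. deriv (%t. f (x + t *s axis i 1)) 0)"

lemma grad_eqI:
 assumes "!!v. ((%t. f (x + t *s v)) has_field_derivative bilin a v) (at 0)"
 shows "grad f x = a" using DERIV_imp_deriv[OF assms] by (simp add: grad_def vec_eq_iff bilin_axis')

lemma polynomial_gradient:
 fixes f :: "'n::finite cvec => complex"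
 assumes "pol f"
 shows has_derivative_grad: "((%t. f (x + t *s v)) has_field_derivative bilin (grad f x) v) (at 0)"
  and pol_grad: "pol (%x. grad f x $ i)"
proof -
 have "\<exists>g. (\<forall>i. pol (%x. g x $ i)) &
  (\<forall>x v. ((%t. f (x + t *s v)) has_field_derivative bilin (g x) v) (at 0))" using assms
 proof (induction rule: polynomial_fun.induct)
  case (coord f)
  then obtain i where i: "f = (%x. x $ i)" using V.coordinates_X by blast
  have "((%t. f (x + t *s v)) has_field_derivative bilin (axis i 1) v) (at 0)" for x v
   unfolding i bilin_axis by (auto intro!: derivative_eq_intros)
  then show ?case by (intro exI[of _ "%_. axis i 1"] conjI allI polynomial_fun.const)
 next
  case (const c)
  have "((%t. c) has_field_derivative bilin 0 v) (at 0)" for v :: "'n cvec"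
   unfolding bilin_linear by simp
  then show ?case by (intro exI[of _ "%_. 0"] conjI allI) (simp_all add: polynomial_fun.const)
 next
  case (add f h)
  obtain gf where gf: "\<forall>i. pol (%x. gf x $ i)"
   "\<forall>x v. ((%t. f (x + t *s v)) has_field_derivative bilin (gf x) v) (at 0)" using add.IH(1) by (elim exE conjE)
  obtain gh where gh: "\<forall>i. pol (%x. gh x $ i)"
   "\<forall>x v. ((%t. h (x + t *s v)) has_field_derivative bilin (gh x) v) (at 0)" using add.IH(2) by (elim exE conjE)
  have "((%t. f (x + t *s v) + h (x + t *s v)) has_field_derivative bilin (gf x + gh x) v) (at 0)" for x v
   unfolding bilin_linear using gf(2) gh(2) by (intro DERIV_add) simp_all
  moreover have "pol (%x. (gf x + gh x) $ i)" for i
   using polynomial_fun.add[of "%x. gf x $ i" "%x. gh x $ i"] gf(1) gh(1) by simp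
  ultimately show ?case by (intro exI[of _ "%x. gf x + gh x"] conjI allI)
 next
  case (mult f h)
  obtain gf where gf: "\<forall>i. pol (%x. gf x $ i)"
   "\<forall>x v. ((%t. f (x + t *s v)) has_field_derivative bilin (gf x) v) (at 0)" using mult.IH(1) by (elim exE conjE)
  obtain gh where gh: "\<forall>i. pol (%x. gh x $ i)"
   "\<forall>x v. ((%t. h (x + t *s v)) has_field_derivative bilin (gh x) v) (at 0)" using mult.IH(2) by (elim exE conjE)
  have "((%t. f (x + t *s v) * h (x + t *s v)) has_field_derivative bilin (h x *s gf x + f x *s gh x) v) (at 0)" for x v
   using DERIV_mult[OF gf(2)[rule_format, of x v] gh(2)[rule_format, of x v]] by (simp add: bilin_linear mult.commute)
  moreover have "pol (%x. (h x *s gf x + f x *s gh x) $ i)" for i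
   using gf(1) gh(1) mult.hyps by (simp, intro polynomial_fun.add polynomial_fun.mult) auto
  ultimately show ?case by (intro exI[of _ "%x. h x *s gf x + f x *s gh x"] conjI allI)
 qed
 then obtain g where g: "\<forall>i. pol (%x. g x $ i)"
  "\<forall>x v. ((%t. f (x + t *s v)) has_field_derivative bilin (g x) v) (at 0)" by (elim exE conjE)
 have "grad f x = g x" for x using grad_eqI g(2) by blast
 then show "((%t. f (x + t *s v)) has_field_derivative bilin (grad f x) v) (at 0)" "pol (%x. grad f x $ i)"
  using g by simp_all
qed

lemma grad_add: "pol f ==> pol g ==> grad (f + g) x = grad f x + grad g x"
 by (rule grad_eqI) (simp add: bilin_linear DERIV_add has_derivative_grad)

lemma grad_cmult: "pol f ==> grad (fsc c f) x = c *s grad f x"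
 by (rule grad_eqI) (simp add: bilin_linear DERIV_cmult has_derivative_grad)

lemma grad_0: "grad 0 x = 0"
 by (rule grad_eqI) (simp add: bilin_linear)

lemma grad_sum: "finite A ==> (!!i. i \<in> A ==> pol (f i)) ==> grad (\<Sum>i\<in>A. fsc (a i) (f i)) x = (\<Sum>i\<in>A. a i *s grad (f i) x)"
proof (induction A rule: finite_induct)
 case (insert i A)
 have "grad (\<Sum>i\<in>insert i A. fsc (a i) (f i)) x = grad (fsc (a i) (f i) + (\<Sum>i\<in>A. fsc (a i) (f i))) x"
  using insert.hyps by (simp only: sum.insert simp_thms)
 also have "\<dots> = grad (fsc (a i) (f i)) x + grad (\<Sum>i\<in>A. fsc (a i) (f i)) x"
  using insert.prems by (intro grad_add pol_fsc pol_sum) auto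
 also have "grad (fsc (a i) (f i)) x = a i *s grad (f i) x" by (rule grad_cmult) (use insert.prems in auto)
 also have "grad (\<Sum>i\<in>A. fsc (a i) (f i)) x = (\<Sum>i\<in>A. a i *s grad (f i) x)"
  by (rule insert.IH) (use insert.prems in auto)
 finally show ?case using insert.hyps by (simp only: sum.insert simp_thms)
qed (simp add: grad_0)

lemma grad_scale: "pol f ==> grad (%x. f (a *s x)) x = a *s grad f (a *s x)"
proof (rule grad_eqI)
 fix v assume "pol f"
 then show "((%t. f (a *s (x + t *s v))) has_field_derivative bilin (a *s grad f (a *s x)) v) (at 0)"
  using has_derivative_grad[of f "a *s x" "a *s v"] by (simp add: bilin_linear vector_add_ldistrib ac_simps)
qed

lemma tangent_space_iff:
 "v \<in> tangent_space A x \<longleftrightarrow> (\<forall>f\<in>\<I> A. bilin (grad f x) v = 0)"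
proof -
 have "deriv (%t. f (x + t *s v)) 0 = bilin (grad f x) v" if "f \<in> \<I> A" for f
  using DERIV_imp_deriv[OF has_derivative_grad] that by (auto simp: vanishing_ideal_def)
 then show ?thesis by (auto simp: tangent_space_def)
qed

text \<open>A frame consists of \<open>card C\<close> gradients, completed by unit vectors to a square matrix: this turns
 independence of the gradients into the non-vanishing of one polynomial.\<close>

definition frame :: "'n::finite set => ('n => 'n cvec => complex) => 'n cvec => complex ^ 'n ^ 'n" where
 "frame C F x = (\<chi> i. if i \<in> C then grad (F i) x else axis i 1)"

lemma det_iff_rows: "det (M :: complex ^ 'n ^ 'n::finite) ~= 0 \<longleftrightarrow>
  (\<forall>c. (\<Sum>i\<in>UNIV. c i *s M $ i) = 0 --> (\<forall>i. c i = 0))"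
 unfolding invertible_det_nz[symmetric] invertible_right_inverse matrix_right_invertible_independent_rows
 by (simp add: row_def)

lemma det_solve:
 assumes "det (M :: complex ^ 'n ^ 'n::finite) ~= 0"
 shows "\<exists>w. \<forall>i. bilin (M $ i) w = z i"
proof -
 obtain B where "M ** B = mat 1" using assms unfolding invertible_det_nz[symmetric] invertible_right_inverse by blast
 then have "M *v (B *v (\<chi> i. z i)) = (\<chi> i. z i)" by (simp add: matrix_vector_mul_assoc)
 moreover have "(M *v w) $ i = bilin (M $ i) w" for w i by (simp add: matrix_vector_mult_def bilin_def)
 ultimately have "\<forall>i. bilin (M $ i) (B *v (\<chi> i. z i)) = z i" by (metis vec_lambda_beta)
 then show ?thesis by blast
qed

lemma det_comb:
 assumes "det (M :: complex ^ 'n ^ 'n::finite) ~= 0"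
 shows "\<exists>a. z = (\<Sum>i\<in>UNIV. a i *s M $ i)"
proof -
 have "det (transpose M) ~= 0" using assms by (simp add: det_transpose)
 then obtain w where w: "\<forall>i. bilin (transpose M $ i) w = z $ i" using det_solve[of "transpose M" "%i. z $ i"] by blast
 have "z = (\<Sum>i\<in>UNIV. w $ i *s M $ i)"
  unfolding vec_eq_iff using w by (simp add: transpose_def bilin_def sum_component mult.commute)
 then show ?thesis by blast
qed

lemma pol_det_frame:
 assumes "!!i. i \<in> C ==> pol (F i)"
 shows "pol (%x. det (frame C F x))"
proof -
 have "pol (%x. frame C F x $ i $ j)" for i j
  using pol_grad[OF assms] polynomial_fun.const by (cases "i \<in> C") (auto simp: frame_def)
 then have "pol (\<Sum>p\<in>{p. p permutes UNIV}. fsc (of_int (sign p)) (\<Prod>i\<in>UNIV. (%x. frame C F x $ i $ p i)))"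
  by (intro pol_sum pol_fsc pol_prod)
 moreover have "(%x. det (frame C F x)) =
   (\<Sum>p\<in>{p. p permutes UNIV}. fsc (of_int (sign p)) (\<Prod>i\<in>UNIV. (%x. frame C F x $ i $ p i)))"
  by (rule ext) (simp add: det_def sum_fun_apply prod_fun_apply)
 ultimately show ?thesis by (simp only:)
qed

definition frame_kernel :: "'n::finite set => ('n => 'n cvec => complex) => 'n cvec => 'n cvec set" where
 "frame_kernel C F x = {v. \<forall>i\<in>C. bilin (grad (F i) x) v = 0}"

text \<open>An invertible frame is a linear change of coordinates that maps its kernel onto the
  coordinate subspace of \<open>- C\<close>.\<close>

lemma dim_frame_kernel:
 fixes x :: "'n::finite cvec"
 assumes "det (frame C F x) ~= 0"
 shows "vec.dim (frame_kernel C F x) = card (- C)"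
proof -
 let ?M = "frame C F x" and ?D = "{y :: 'n cvec. \<forall>i. i ~: - C --> y $ i = 0}"
 obtain B where B: "?M ** B = mat 1" "B ** ?M = mat 1"
  using assms unfolding invertible_det_nz[symmetric] invertible_def by blast
 have Mv: "(?M *v v) $ i = (if i \<in> C then bilin (grad (F i) x) v else v $ i)" for v i
 proof -
  have "(?M *v v) $ i = bilin (?M $ i) v" by (simp add: matrix_vector_mult_def bilin_def)
  then show ?thesis by (simp add: frame_def bilin_axis)
 qed
 have "(*v) B ` ?D \<subseteq> frame_kernel C F x"
 proof
  fix v assume "v \<in> (*v) B ` ?D"
  then obtain y where y: "y \<in> ?D" "v = B *v y" by blast
  have "?M *v v = y" unfolding y(2) by (simp add: matrix_vector_mul_assoc B(1))
  then have "\<forall>i\<in>C. bilin (grad (F i) x) v = y $ i" using Mv by metis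
  then show "v \<in> frame_kernel C F x" using y(1) by (simp add: frame_kernel_def)
 qed
 moreover have "frame_kernel C F x \<subseteq> (*v) B ` ?D"
 proof
  fix v assume "v \<in> frame_kernel C F x"
  then have "?M *v v \<in> ?D" using Mv by (auto simp: frame_kernel_def)
  moreover have "v = B *v (?M *v v)" by (simp add: matrix_vector_mul_assoc B(2))
  ultimately show "v \<in> (*v) B ` ?D" by blast
 qed
 ultimately have eq: "frame_kernel C F x = (*v) B ` ?D" by blast
 have "vec.dim (frame_kernel C F x) <= vec.dim ?D" unfolding eq
  by (rule vec.dim_image_le[OF matrix_vector_mul_linear_gen])
 moreover have "?D = (*v) ?M ` frame_kernel C F x"
  unfolding eq image_image by (simp add: matrix_vector_mul_assoc B(1))
 then have "vec.dim ?D <= vec.dim (frame_kernel C F x)"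
  using vec.dim_image_le[OF matrix_vector_mul_linear_gen, of ?M "frame_kernel C F x"] by simp
 ultimately show ?thesis using dim_substandard_cart[of "- C", where 'a = complex] by simp
qed

lemma subspace_frame_kernel: "vec.subspace (frame_kernel C F x)"
 by (simp add: vec.subspace_def frame_kernel_def bilin_linear)

lemma frame_kernel_perp:
 assumes "det (frame C F x) ~= 0" "!!v. v \<in> frame_kernel C F x ==> bilin y v = 0"
 shows "\<exists>a. y = (\<Sum>i\<in>C. a i *s grad (F i) x)"
proof -
 obtain a where a: "y = (\<Sum>i\<in>UNIV. a i *s frame C F x $ i)" using det_comb[OF assms(1)] by blast
 have "a j = 0" if j: "j ~: C" for j
 proof -
  obtain w where w: "\<forall>i. bilin (frame C F x $ i) w = (if i = j then 1 else 0)"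
   using det_solve[OF assms(1), of "%i. if i = j then 1 else 0"] by blast
  have "w \<in> frame_kernel C F x" unfolding frame_kernel_def
  proof (intro CollectI ballI)
   fix i assume "i \<in> C"
   then show "bilin (grad (F i) x) w = 0" using w[rule_format, of i] j by (auto simp: frame_def)
  qed
  then have "bilin y w = 0" by (rule assms(2))
  moreover have "bilin y w = (\<Sum>i\<in>UNIV. if i = j then a i else 0)"
   unfolding a bilin_sum by (rule sum.cong[OF refl]) (simp add: bilin_linear w)
  ultimately show ?thesis by simp
 qed
 then have "y = (\<Sum>i\<in>C. a i *s frame C F x $ i)" unfolding a by (intro sum.mono_neutral_right) auto
 also have "\<dots> = (\<Sum>i\<in>C. a i *s grad (F i) x)" by (rule sum.cong) (auto simp: frame_def)
 finally show ?thesis by blast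
qed

text \<open>Steinitz exchange: in a frame with as many gradients as possible, a gradient with a
  nonzero coefficient at a unit-vector row could replace that row. So all gradients are combinations
  of those in the frame.\<close>

lemma ex_frame:
 fixes A :: "'n::finite cvec set"
 obtains C F where "!!i. i \<in> C ==> F i \<in> \<I> A" "det (frame C F x) ~= 0"
  "tangent_space A x = frame_kernel C F x"
proof -
 let ?I = "\<I> A"
 let ?S = "{C. \<exists>F. (\<forall>i\<in>C. F i \<in> ?I) & det (frame C F x) ~= 0}"
 have "frame {} F x = mat 1" for F by (simp add: frame_def mat_def axis_def vec_eq_iff)
 then have "{} \<in> ?S" by simp
 then have "?S ~= {}" by blast
 from ex_max_nat[OF _ this, of card] obtain C where C: "C \<in> ?S" "!!C'. C' \<in> ?S ==> card C' <= card C"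
  using finite[of ?S] by blast
 then obtain F where F: "\<forall>i\<in>C. F i \<in> ?I" "det (frame C F x) ~= 0" by blast
 have "tangent_space A x = frame_kernel C F x"
 proof
  show "tangent_space A x \<subseteq> frame_kernel C F x" using F(1) by (auto simp: tangent_space_iff frame_kernel_def)
  show "frame_kernel C F x \<subseteq> tangent_space A x"
  proof
   fix v assume v: "v \<in> frame_kernel C F x"
   show "v \<in> tangent_space A x" unfolding tangent_space_iff
   proof
    fix f assume f: "f \<in> ?I"
    obtain a where a: "grad f x = (\<Sum>i\<in>UNIV. a i *s frame C F x $ i)" using det_comb[OF F(2)] by blast
    have "a i0 = 0" if i0: "i0 ~: C" for i0
    proof (rule ccontr)
     assume ai: "a i0 ~= 0"
     let ?C = "insert i0 C" and ?F = "F(i0 := f)"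
     have row: "frame ?C ?F x $ i = (if i = i0 then grad f x else frame C F x $ i)" for i
      by (auto simp: frame_def)
     have "det (frame ?C ?F x) ~= 0" unfolding det_iff_rows
     proof (rule allI, rule impI)
      fix c assume c: "(\<Sum>i\<in>UNIV. c i *s frame ?C ?F x $ i) = 0"
      have "(\<Sum>i\<in>UNIV. c i *s frame ?C ?F x $ i) =
        c i0 *s grad f x + (\<Sum>i\<in>UNIV - {i0}. c i *s frame C F x $ i)"
       by (subst sum.remove[of UNIV i0]) (simp_all add: row)
      also have "\<dots> = c i0 *s (\<Sum>i\<in>UNIV. a i *s frame C F x $ i) +
        (\<Sum>i\<in>UNIV. (if i = i0 then 0 else c i) *s frame C F x $ i)"
       unfolding a by (intro arg_cong2[where f = "(+)"] refl sum.mono_neutral_cong_left) auto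
      also have "\<dots> = (\<Sum>i\<in>UNIV. (c i0 * a i + (if i = i0 then 0 else c i)) *s frame C F x $ i)"
       by (simp add: vec_eq_iff sum_component sum_distrib_left sum.distrib algebra_simps)
      finally have "(\<Sum>i\<in>UNIV. (c i0 * a i + (if i = i0 then 0 else c i)) *s frame C F x $ i) = 0"
       using c by simp
      then have z: "\<forall>i. c i0 * a i + (if i = i0 then 0 else c i) = 0"
       using F(2)[unfolded det_iff_rows, rule_format, of "%i. c i0 * a i + (if i = i0 then 0 else c i)"] by blast
      then have "c i0 = 0" using ai z[rule_format, of i0] by simp
      then show "\<forall>i. c i = 0" using z by (metis add_0 mult_zero_left)
     qed
     moreover have "\<forall>i\<in>?C. ?F i \<in> ?I" using F(1) f by simp
     ultimately have "card ?C <= card C" by (intro C(2)) blast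
     then show False using i0 by simp
    qed
    then have "grad f x = (\<Sum>i\<in>C. a i *s frame C F x $ i)"
     unfolding a by (intro sum.mono_neutral_right) auto
    then have "bilin (grad f x) v = (\<Sum>i\<in>C. a i * bilin (frame C F x $ i) v)"
     by (simp add: bilin_sum bilin_linear)
    also have "\<dots> = 0" using v by (intro sum.neutral) (auto simp: frame_def frame_kernel_def)
    finally show "bilin (grad f x) v = 0" .
   qed
  qed
 qed
 then show ?thesis using that F by blast
qed

lemma comb_grad:
 fixes A :: "'n::finite cvec set" and C :: "'n set"
 assumes "!!i. i \<in> C ==> F i \<in> \<I> A"
 shows "\<exists>f\<in>\<I> A. (\<Sum>i\<in>C. a i *s grad (F i) x) = grad f x"
proof -
 have "(\<Sum>i\<in>C. fsc (a i) (F i)) \<in> \<I> A"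
  by (intro pideal_sum[OF vanishing_ideal_pideal] pidealD(6)[OF vanishing_ideal_pideal] assms)
 moreover have "pol (F i)" if "i \<in> C" for i using assms[OF that] by (simp add: vanishing_ideal_def)
 then have "grad (\<Sum>i\<in>C. fsc (a i) (F i)) x = (\<Sum>i\<in>C. a i *s grad (F i) x)" by (intro grad_sum finite) auto
 ultimately show ?thesis by (intro bexI[of _ "\<Sum>i\<in>C. fsc (a i) (F i)"]) simp_all
qed

text \<open>A combination of gradients at \<open>x\<close> is the gradient of one polynomial of the
  ideal. Hence each normal vector extends to the polynomial section \<open>grad f\<close> over all
  of \<open>A\<close>.\<close>

lemma normal_space_eq: "normal_space A x = (%f. grad f x) ` \<I> A"
proof
 obtain C F where CF: "!!i. i \<in> C ==> F i \<in> \<I> A" "det (frame C F x) ~= 0"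
  "tangent_space A x = frame_kernel C F x" by (rule ex_frame[of A x]) blast
 show "normal_space A x \<subseteq> (%f. grad f x) ` \<I> A"
 proof
  fix y assume "y \<in> normal_space A x"
  then have "bilin y v = 0" if "v \<in> frame_kernel C F x" for v using that CF(3) by (simp add: normal_space_def)
  from frame_kernel_perp[OF CF(2) this] obtain a where "y = (\<Sum>i\<in>C. a i *s grad (F i) x)" by blast
  then show "y \<in> (%f. grad f x) ` \<I> A" using comb_grad[of C F A a x] CF(1) by auto
 qed
 show "(%f. grad f x) ` \<I> A \<subseteq> normal_space A x"
  by (auto simp: normal_space_def tangent_space_iff)
qed

section \<open>The relative conormal cone\<close>

definition pcoord :: "'n::finite + 'n => 'n cvec2 => complex" where
 "pcoord s p = (case s of Inl i => fst p $ i | Inr i => snd p $ i)"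

lemma pcoord_simps: "pcoord (Inl i) = (%p. fst p $ i)" "pcoord (Inr i) = (%p. snd p $ i)"
 by (auto simp: pcoord_def)

lemma pcoord_coordinates:
 "coordinates = range (pcoord :: 'n::finite + 'n => _)"
 "\<exists>x. \<forall>s :: 'n + 'n. pcoord s x = v s"
 "(!!s :: 'n + 'n. pcoord s x = pcoord s y) ==> x = y"
proof -
 have "range (pcoord :: 'n + 'n => _) = range (%i. pcoord (Inl i)) \<union> range (%i. pcoord (Inr i))"
  by (subst UNIV_sum) (simp only: image_Un image_image)
 then show "coordinates = range (pcoord :: 'n::finite + 'n => _)"
  by (auto simp: pcoord_simps coordinates_prod_def coordinates_vec_def coordinates_complex_def)
 show "\<exists>x. \<forall>s :: 'n + 'n. pcoord s x = v s"
  by (intro exI[of _ "(\<chi> i. v (Inl i), \<chi> i. v (Inr i))"]) (simp add: pcoord_def split: sum.split)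
 assume *: "!!s :: 'n + 'n. pcoord s x = pcoord s y"
 show "x = y" using *[of "Inl _"] *[of "Inr _"] by (simp add: prod_eq_iff vec_eq_iff pcoord_simps)
qed

interpretation VV: affine_coords "pcoord :: 'n::finite + 'n => _"
 by unfold_locales (rule pcoord_coordinates, assumption?)+

lemma VV_sc: "VV.sc s p = (s () *s fst p, s () *s snd p)" for p :: "'n::finite cvec2"
proof (rule VV.X_inj)
 fix k :: "'n + 'n"
 show "pcoord k (VV.sc s p) = pcoord k (s () *s fst p, s () *s snd p)"
  unfolding VV.X_sc by (cases k) (simp_all add: pcoord_simps)
qed

interpretation pfst: affine_map "pcoord :: 'n::finite + 'n => _" "%(i::'n) (x :: 'n cvec). x $ i" fst "Suc 0"
proof unfold_locales
 fix j :: 'n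
 show "(%x :: 'n cvec2. fst x $ j) \<in> VV.Rle (Suc 0)"
  using VV.X_Rle[of "Inl j :: 'n + 'n"] by (simp only: pcoord_simps)
qed

lemma VV_pol_comp:
 fixes h :: "'b::affine_space => 'n::finite cvec2"
 assumes "!!i. pol (%x. fst (h x) $ i)" "!!i. pol (%x. snd (h x) $ i)" "pol f"
 shows "pol (%x. f (h x))"
proof (rule VV.pol_comp[OF _ assms(3)])
 fix k :: "'n + 'n"
 show "pol (%x. pcoord k (h x))" by (cases k) (simp_all add: pcoord_simps assms)
qed

lemma VV_mon: "VV.mon e p = V.mon (%i. e (Inl i)) (fst p) * (\<Prod>i\<in>UNIV. snd p $ i ^ e (Inr i))"
 for p :: "'n::finite cvec2" unfolding VV.mon_def V.mon_def UNIV_Plus_UNIV[symmetric]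
 by (subst prod.Plus) (simp_all add: pcoord_simps comp_def)

lemma pol_complex_poly: "pol (p :: complex => complex) ==> \<exists>P. p = poly P"
proof (induction rule: polynomial_fun.induct)
 case (coord f)
 then have "f = poly [:0, 1:]" by (auto simp: coordinates_complex_def)
 then show ?case by blast
next
 case (const c)
 have "(%_. c) = poly [:c:]" by auto
 then show ?case by blast
next
 case (add f g)
 then obtain P Q where "f = poly P" "g = poly Q" by blast
 then have "(%x. f x + g x) = poly (P + Q)" by auto
 then show ?case by blast
next
 case (mult f g)
 then obtain P Q where "f = poly P" "g = poly Q" by blast
 then have "(%x. f x * g x) = poly (P * Q)" by auto
 then show ?case by blast
qed

lemma pprime_witness:
 assumes "pprime (\<I> B)" "pol f" "pol g" "f ~: \<I> B" "g ~: \<I> B"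
 shows "f * g ~: \<I> B" "\<exists>x\<in>B. f x ~= 0 & g x ~= 0"
proof -
 show n: "f * g ~: \<I> B" using pprimeD(3)[OF assms(1-3)] assms(4,5) by blast
 have "pol (f * g)" by (rule pol_mult[OF assms(2,3)])
 then show "\<exists>x\<in>B. f x ~= 0 & g x ~= 0" using n by (auto simp: vanishing_ideal_def)
qed

lemma generic_vanishing:
 assumes "pprime (\<I> B)" "pol D" "D ~: \<I> B" "pol f" "!!x. x \<in> B ==> D x ~= 0 ==> f x = 0"
 shows "f \<in> \<I> B" using pprime_witness(2)[OF assms(1,2,4,3)] assms(5) by blast

lemma common_degree:
 fixes f :: "'c::finite => _"
 assumes "affine_coords X" "!!i. pol (f i)"
 shows "\<exists>\<kappa>. \<forall>i. f i \<in> affine_coords.Rle X \<kappa>"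
proof -
 interpret affine_coords X by (rule assms(1))
 have "\<exists>t. f i \<in> Rle t" for i using pol_Rle[OF assms(2)] by blast
 then obtain t where t: "!!i. f i \<in> Rle (t i)" by metis
 have "f i \<in> Rle (\<Sum>i\<in>UNIV. t i)" for i
 proof (rule subsetD[OF Rle_mono t])
  show "t i <= (\<Sum>i\<in>UNIV. t i)" by (rule member_le_sum) auto
 qed
 then show ?thesis by blast
qed

text \<open>The part of lowest order of a relation \<open>\<Sum> h\<^sub>\<beta> F\<^sup>\<beta> = 0\<close> along a line through \<open>x\<close>.\<close>

lemma normal_expansion:
 fixes x :: "'n::finite cvec" and k t :: nat
 assumes F: "!!i. i \<in> C ==> F i \<in> \<I> A" and x: "x \<in> A" "det (frame C F x) ~= 0"
  and h: "!!\<beta>. \<beta> \<in> Pi\<^sub>E C (%_. {..t}) ==> pol (h \<beta>)"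
  and rel: "!!y. (\<Sum>\<beta>\<in>Pi\<^sub>E C (%_. {..t}). h \<beta> y * (\<Prod>i\<in>C. F i y ^ \<beta> i)) = 0"
  and low: "!!\<beta> y. \<beta> \<in> Pi\<^sub>E C (%_. {..t}) ==> (\<Sum>i\<in>C. \<beta> i) < k ==> h \<beta> y = 0"
  and \<beta>: "\<beta> \<in> Pi\<^sub>E C (%_. {..t})" "(\<Sum>i\<in>C. \<beta> i) = k"
 shows "h \<beta> x = 0"
proof -
 let ?B = "Pi\<^sub>E C (%_. {..t})" and ?deg = "%\<beta> :: 'n => nat. \<Sum>i\<in>C. \<beta> i"
 \<comment> \<open>The power of \<tau> that remains after division by \<tau> to the
   \<open>k\<close>. At \<tau> = 0 it selects the exponents of total degree exactly
   \<open>k\<close>; smaller ones drop out by \<open>low\<close>.\<close>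
 let ?e = "%\<beta> \<tau> :: complex. if ?deg \<beta> < k then 0 else \<tau> ^ (?deg \<beta> - k)"
 have "(\<Sum>\<beta>\<in>?B. (h \<beta> x * ?e \<beta> 0) * (\<Prod>i\<in>C. z i ^ \<beta> i)) = 0" for z
 proof -
  obtain w where w: "\<forall>i. bilin (frame C F x $ i) w = z i" using det_solve[OF x(2)] by blast
  let ?y = "%\<tau>. x + \<tau> *s w"
  let ?\<phi> = "%\<tau>. \<Sum>\<beta>\<in>?B. (h \<beta> (?y \<tau>) * ?e \<beta> \<tau>) * (\<Prod>i\<in>C. (F i (?y \<tau>) / \<tau>) ^ \<beta> i)"
  have lim_h: "((%\<tau>. h \<beta> (?y \<tau>)) \<longlongrightarrow> h \<beta> x) (at 0)" if "\<beta> \<in> ?B" for \<beta>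
   using DERIV_isCont[OF has_derivative_grad[OF h[OF that], of x w]] by (simp add: isCont_def)
  have lim_F: "((%\<tau>. F i (?y \<tau>) / \<tau>) \<longlongrightarrow> z i) (at 0)" if i: "i \<in> C" for i
  proof -
   have "pol (F i)" "F i x = 0" using F[OF i] x(1) by (auto simp: vanishing_ideal_def)
   moreover have "bilin (grad (F i) x) w = z i" using w[rule_format, of i] i by (simp add: frame_def)
   ultimately show ?thesis using has_derivative_grad[of "F i" x w] by (simp add: DERIV_def)
  qed
  have lim_e: "(?e \<beta> \<longlongrightarrow> ?e \<beta> 0) (at 0)" for \<beta> by (cases "?deg \<beta> < k") (auto intro!: tendsto_intros)
  have lim: "(?\<phi> \<longlongrightarrow> (\<Sum>\<beta>\<in>?B. (h \<beta> x * ?e \<beta> 0) * (\<Prod>i\<in>C. z i ^ \<beta> i))) (at 0)"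
   by (intro tendsto_sum tendsto_mult tendsto_prod tendsto_power lim_h lim_F lim_e)
  have "?\<phi> \<tau> = 0" if \<tau>: "\<tau> ~= 0" for \<tau>
  proof -
   have "\<tau> ^ k * ((h \<beta> (?y \<tau>) * ?e \<beta> \<tau>) * (\<Prod>i\<in>C. (F i (?y \<tau>) / \<tau>) ^ \<beta> i)) =
     h \<beta> (?y \<tau>) * (\<Prod>i\<in>C. F i (?y \<tau>) ^ \<beta> i)" if b: "\<beta> \<in> ?B" for \<beta>
   proof (cases "?deg \<beta> < k")
    case True
    then show ?thesis using low[OF b] by simp
   next
    case False
    then have e1: "\<tau> ^ k * \<tau> ^ (?deg \<beta> - k) = \<tau> ^ ?deg \<beta>" by (simp add: power_add[symmetric])
    have e2: "(\<Prod>i\<in>C. (F i (?y \<tau>) / \<tau>) ^ \<beta> i) = (\<Prod>i\<in>C. F i (?y \<tau>) ^ \<beta> i) / \<tau> ^ ?deg \<beta>"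
     by (simp add: power_divide prod_dividef power_sum)
    have "\<tau> ^ k * ((h \<beta> (?y \<tau>) * ?e \<beta> \<tau>) * (\<Prod>i\<in>C. (F i (?y \<tau>) / \<tau>) ^ \<beta> i)) =
      h \<beta> (?y \<tau>) * ((\<tau> ^ k * \<tau> ^ (?deg \<beta> - k)) * (\<Prod>i\<in>C. (F i (?y \<tau>) / \<tau>) ^ \<beta> i))"
     using False by (simp add: ac_simps)
    also have "\<dots> = h \<beta> (?y \<tau>) * (\<Prod>i\<in>C. F i (?y \<tau>) ^ \<beta> i)"
     unfolding e1 e2 using \<tau> by simp
    finally show ?thesis .
   qed
   then have "\<tau> ^ k * ?\<phi> \<tau> = (\<Sum>\<beta>\<in>?B. h \<beta> (?y \<tau>) * (\<Prod>i\<in>C. F i (?y \<tau>) ^ \<beta> i))"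
    unfolding sum_distrib_left by (rule sum.cong[OF refl])
   then show ?thesis using rel[of "?y \<tau>"] \<tau> by simp
  qed
  then have "\<forall>\<^sub>F \<tau> in at 0. 0 = ?\<phi> \<tau>" by (auto simp: eventually_at_filter)
  then have "(?\<phi> \<longlongrightarrow> 0) (at 0)" by (rule Lim_transform_eventually[OF tendsto_const])
  with at_neq_bot lim show ?thesis by (rule tendsto_unique)
 qed
 then have "h \<beta> x * ?e \<beta> 0 = 0" using \<beta>(1) by (intro box_identity[where C = C and t = t and c = "%\<beta>. h \<beta> x * ?e \<beta> 0"]) simp_all
 then show ?thesis using \<beta>(2) by simp
qed

text \<open>The products of powers of the \<open>F i\<close> with a basis modulo
  \<open>\<I> A\<close> are independent as polynomials: at general points of \<open>A\<close> the
  gradients are independent, so the part of lowest order of a relation would relate the basis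
  elements on \<open>A\<close>. The left side counts these products, the right side bounds the
  number of polynomials of their degree.\<close>

lemma rank_count:
 fixes A :: "'n::finite cvec set" and C :: "'n set"
 assumes prime: "pprime (\<I> A)"
  and F: "!!i. i \<in> C ==> F i \<in> \<I> A" "!!i. i \<in> C ==> F i \<in> V.Rle \<kappa>"
  and x0: "x0 \<in> A" "det (frame C F x0) ~= 0"
 shows "(t + 1) ^ card C * V.Fn A t <= (t + card C * (t * \<kappa>) + 1) ^ CARD('n)"
proof -
 let ?D = "%x. det (frame C F x)" and ?X = "Pi\<^sub>E C (%_. {..t})"
 have pF: "pol (F i)" if "i \<in> C" for i using F(1)[OF that] by (simp add: vanishing_ideal_def)
 have D: "pol ?D" "?D ~: \<I> A" using pol_det_frame[OF pF] x0 by (auto simp: vanishing_ideal_def)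
 obtain Bs where Bs: "finite Bs" "Bs \<subseteq> V.Rle t" "card Bs = V.Fn A t"
  "!!\<alpha>. (\<Sum>b\<in>Bs. fsc (\<alpha> b) b) \<in> \<I> A ==> \<forall>b\<in>Bs. \<alpha> b = 0" by (rule V.basis_lift[of t A]) blast
 have fX: "finite ?X" by (intro finite_PiE) auto
 let ?g = "%p. snd p * (\<Prod>i\<in>C. F i ^ fst p i)"
 have "card (?X \<times> Bs) <= V.Fn (UNIV :: 'n cvec set) (t + (\<Sum>i\<in>C. t * \<kappa>))"
 proof (rule V.family_count[of _ ?g])
  show "finite (?X \<times> Bs)" using fX Bs(1) by simp
  fix p assume p: "p \<in> ?X \<times> Bs"
  have "F i ^ fst p i \<in> V.Rle (t * \<kappa>)" if i: "i \<in> C" for i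
  proof (rule subsetD[OF V.Rle_mono V.Rle_power[OF F(2)[OF i]]])
   show "fst p i * \<kappa> <= t * \<kappa>" using p i by (auto simp: PiE_iff)
  qed
  then show "?g p \<in> V.Rle (t + (\<Sum>i\<in>C. t * \<kappa>))"
   using p Bs(2) by (intro V.Rle_mult V.Rle_prod) auto
 next
  fix \<alpha> assume z: "(\<Sum>p\<in>?X \<times> Bs. fsc (\<alpha> p) (?g p)) \<in> \<I> UNIV"
  define h where "h \<beta> = (\<Sum>b\<in>Bs. fsc (\<alpha> (\<beta>, b)) b)" for \<beta>
  have ph: "pol (h \<beta>)" for \<beta> unfolding h_def using Bs(2) V.Rle_pol by (intro pol_sum pol_fsc) blast
  have rel: "(\<Sum>\<beta>\<in>?X. h \<beta> y * (\<Prod>i\<in>C. F i y ^ \<beta> i)) = 0" for y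
  proof -
   have "(\<Sum>\<beta>\<in>?X. h \<beta> y * (\<Prod>i\<in>C. F i y ^ \<beta> i)) = (\<Sum>p\<in>?X \<times> Bs. fsc (\<alpha> p) (?g p)) y"
    by (simp add: h_def sum_fun_apply prod_fun_apply power_fun_apply sum_distrib_right
     sum.cartesian_product case_prod_beta' mult.assoc)
   then show ?thesis using vanD[OF z, of y] by simp
  qed
  show "\<forall>p\<in>?X \<times> Bs. \<alpha> p = 0"
  proof (rule ccontr)
   assume "\<not> ?thesis"
   then obtain \<beta>0 b0 where 0: "\<beta>0 \<in> ?X" "b0 \<in> Bs" "\<alpha> (\<beta>0, b0) ~= 0" by auto
   \<comment> \<open>\<open>k\<close> is the lowest order in which a nonzero coefficient occurs;
     \<open>normal_expansion\<close> then makes the coefficient polynomial \<open>h \<beta>\<close>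
     vanish on \<open>A\<close>.\<close>
   let ?Q = "%k. \<exists>\<beta>\<in>?X. \<exists>b\<in>Bs. \<alpha> (\<beta>, b) ~= 0 & (\<Sum>i\<in>C. \<beta> i) = k"
   define k where "k = (LEAST k. ?Q k)"
   have "?Q k" unfolding k_def by (rule LeastI_ex) (use 0 in blast)
   then obtain \<beta> b where \<beta>: "\<beta> \<in> ?X" "b \<in> Bs" "\<alpha> (\<beta>, b) ~= 0" "(\<Sum>i\<in>C. \<beta> i) = k" by blast
   have low: "h \<beta> y = 0" if b: "\<beta> \<in> ?X" "(\<Sum>i\<in>C. \<beta> i) < k" for \<beta> y
   proof -
    have "\<not> ?Q (\<Sum>i\<in>C. \<beta> i)" using b(2) unfolding k_def by (rule not_less_Least)
    then have "\<alpha> (\<beta>, b) = 0" if "b \<in> Bs" for b using b(1) that by blast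
    then show ?thesis by (simp add: h_def sum_fun_apply)
   qed
   have "h \<beta> \<in> \<I> A"
   proof (rule generic_vanishing[OF prime D ph])
    fix x assume x: "x \<in> A" "?D x ~= 0"
    show "h \<beta> x = 0" by (rule normal_expansion[OF F(1) x ph rel low \<beta>(1,4)])
   qed
   then show False using Bs(4)[of "%b. \<alpha> (\<beta>, b)"] \<beta>(2,3) unfolding h_def by blast
  qed
 qed
 also have "\<dots> <= (t + (\<Sum>i\<in>C. t * \<kappa>) + 1) ^ CARD('n)" by (rule V.Fn_box)
 finally show ?thesis using Bs(3) by (simp add: card_cartesian_product card_box)
qed

text \<open>Equivalently, tangent spaces have at least the dimension of the variety. The chain
  forces growth of order \<open>Suc n\<close> on \<open>A\<close>, each gradient adds one order by
  \<open>rank_count\<close>, and the ambient space permits only \<open>CARD('n)\<close>.\<close>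

lemma rank_bound:
 fixes A :: "'n::finite cvec set" and C :: "'n set"
 assumes chain: "is_chain {C. closedin zariski C & irreducible_in zariski C} (Suc n) c" "c (Suc n) = A"
  and prime: "pprime (\<I> A)"
  and F: "!!i. i \<in> C ==> F i \<in> \<I> A"
  and x0: "x0 \<in> A" "det (frame C F x0) ~= 0"
 shows "card C + Suc n <= CARD('n)"
proof -
 have "pol (if i \<in> C then F i else 0)" for i using F by (auto simp: vanishing_ideal_def pol_0)
 from common_degree[OF V.affine_coords_axioms, of "%i. if i \<in> C then F i else 0", OF this]
 obtain \<kappa> where \<kappa>: "\<forall>i. (if i \<in> C then F i else 0) \<in> V.Rle \<kappa>" by (elim exE)
 have F\<kappa>: "F i \<in> V.Rle \<kappa>" if "i \<in> C" for i using \<kappa>[rule_format, of i] that by simp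
 obtain h where h: "h > 0" "!!t. t >= Suc n ==> t ^ Suc n <= Suc n ^ Suc n * V.Fn A (t * h)"
  using V.chain_lower_bound[OF chain(1)] chain(2) by blast
 show ?thesis
 proof (rule power_growth_compare)
  fix t assume t: "t >= Suc n"
  let ?T = "t * h"
  have tT: "t <= ?T" using h(1) by simp
  have "t ^ (card C + Suc n) = t ^ card C * t ^ Suc n" by (rule power_add)
  also have "\<dots> <= (?T + 1) ^ card C * (Suc n ^ Suc n * V.Fn A ?T)"
   using h t by (intro mult_mono power_mono h(2)) (use tT t in linarith)+
  also have "\<dots> = Suc n ^ Suc n * ((?T + 1) ^ card C * V.Fn A ?T)" by (simp only: ac_simps)
  also have "\<dots> <= Suc n ^ Suc n * (?T + card C * (?T * \<kappa>) + 1) ^ CARD('n)"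
   by (intro mult_left_mono rank_count[OF prime F F\<kappa> x0]) auto
  also have "\<dots> <= Suc n ^ Suc n * (t * (h + card C * h * \<kappa> + 1)) ^ CARD('n)"
   using t by (intro mult_left_mono power_mono) (auto simp: algebra_simps)
  also have "\<dots> = (Suc n ^ Suc n * (h + card C * h * \<kappa> + 1) ^ CARD('n)) * t ^ CARD('n)"
   by (simp only: power_mult_distrib ac_simps)
  finally show "t ^ (card C + Suc n) <= (Suc n ^ Suc n * (h + card C * h * \<kappa> + 1) ^ CARD('n)) * t ^ CARD('n)" .
 qed
qed

lemma Fn_cylinder:
 fixes B :: "'n::finite cvec set" and C :: "'n set"
 shows "VV.Fn (B \<times> {a. \<forall>i. i ~: C --> a $ i = 0}) s <= (s + 1) ^ card C * V.Fn B s"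
proof -
 let ?Y = "B \<times> {a :: 'n cvec. \<forall>i. i ~: C --> a $ i = 0}" and ?X = "Pi\<^sub>E C (%_. {..s})"
 obtain Bs where Bs: "finite Bs" "Bs \<subseteq> V.Rle s" "card Bs = V.Fn B s"
  "!!f. f \<in> V.Rle s ==> \<exists>\<alpha>. f - (\<Sum>b\<in>Bs. fsc (\<alpha> b) b) \<in> \<I> B" by (rule V.basis_lift[of s B]) blast
 have fX: "finite ?X" by (intro finite_PiE) auto
 define g where "g \<beta> b = restr ?Y (%p. b (fst p) * (\<Prod>i\<in>C. snd p $ i ^ \<beta> i))" for \<beta> b
 let ?G = "(%p. g (fst p) (snd p)) ` (?X \<times> Bs)"
 have "restr ?Y ` VV.Rle s \<subseteq> fs.span ?G" unfolding VV.Rle_def flin_image_span[OF flin_restr]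
 proof (rule fs.span_minimal[OF _ fs.subspace_span], rule subsetI)
  fix u assume "u \<in> restr ?Y ` VV.mon ` {e. (\<Sum>i\<in>UNIV. e i) <= s}"
  then obtain e :: "'n + 'n => nat" where e: "u = restr ?Y (VV.mon e)" "(\<Sum>i\<in>UNIV. e i) <= s" by blast
  have "(\<Sum>i\<in>UNIV. e i) = (\<Sum>i\<in>UNIV. e (Inl i)) + (\<Sum>i\<in>UNIV. e (Inr i))"
   unfolding UNIV_Plus_UNIV[symmetric] by (subst sum.Plus) (simp_all add: comp_def)
  then have le: "(\<Sum>i\<in>UNIV. e (Inl i)) <= s" "(\<Sum>i\<in>UNIV. e (Inr i)) <= s" using e(2) by auto
  show "u \<in> fs.span ?G"
  proof (cases "\<exists>i. i ~: C & e (Inr i) ~= 0")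
   case True
   then obtain i where i: "i ~: C" "e (Inr i) ~= 0" by blast
   have "u p = 0" for p
   proof (cases "p \<in> ?Y")
    case True
    then have "snd p $ i ^ e (Inr i) = 0" using i by auto
    then have "(\<Prod>i\<in>UNIV. snd p $ i ^ e (Inr i)) = 0" by (intro prod_zero) auto
    then show ?thesis unfolding e(1) by (simp add: restr_def VV_mon)
   qed (simp add: e(1) restr_def)
   then have "u = 0" by (simp add: fun_eq_iff)
   then show ?thesis by (simp only: fs.span_zero)
  next
   case False
   let ?\<beta> = "restrict (%i. e (Inr i)) C"
   have "e (Inr i) <= (\<Sum>i\<in>UNIV. e (Inr i))" for i by (rule member_le_sum) auto
   then have \<beta>: "?\<beta> \<in> ?X" using le(2) order_trans by (auto intro: order_trans)
   have prod: "(\<Prod>i\<in>UNIV. y $ i ^ e (Inr i)) = (\<Prod>i\<in>C. y $ i ^ ?\<beta> i)" for y :: "'n cvec"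
    by (rule prod.mono_neutral_cong_right) (use False in auto)
   have "V.mon (%i. e (Inl i)) \<in> V.Rle s" unfolding V.Rle_def using le(1) by (intro fs.span_base) blast
   from Bs(4)[OF this] obtain \<alpha> where \<alpha>: "V.mon (%i. e (Inl i)) - (\<Sum>b\<in>Bs. fsc (\<alpha> b) b) \<in> \<I> B"
    by (elim exE)
   have "u = (\<Sum>b\<in>Bs. fsc (\<alpha> b) (g ?\<beta> b))"
   proof
    fix p
    show "u p = (\<Sum>b\<in>Bs. fsc (\<alpha> b) (g ?\<beta> b)) p"
    proof (cases "p \<in> ?Y")
     case True
     then have "V.mon (%i. e (Inl i)) (fst p) = (\<Sum>b\<in>Bs. \<alpha> b * b (fst p))"
      using vanD[OF \<alpha>, of "fst p"] by (auto simp: sum_fun_apply)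
     then show ?thesis using True
      by (simp add: e(1) restr_def VV_mon prod g_def sum_fun_apply sum_distrib_right mult.assoc del: mem_Times_iff)
    qed (simp add: e(1) restr_def g_def sum_fun_apply del: mem_Times_iff)
   qed
   moreover have "g ?\<beta> b \<in> ?G" if "b \<in> Bs" for b
    using imageI[of "(?\<beta>, b)" "?X \<times> Bs" "%p. g (fst p) (snd p)"] \<beta> that by simp
   ultimately show ?thesis by (simp only:) (intro fs.span_sum fs.span_scale fs.span_base)
  qed
 qed
 then have "VV.Fn ?Y s <= card ?G" unfolding VV.Fn_def by (rule fs.dim_le_card) (use fX Bs(1) in simp)
 also have "\<dots> <= card (?X \<times> Bs)" by (intro card_image_le) (use fX Bs(1) in simp)
 finally show ?thesis using Bs(3) by (simp add: card_cartesian_product card_box)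
qed

text \<open>\<open>A\<close> and \<open>B\<close> stand for the affine cones over \<open>X\<close>
  and \<open>Z\<close>, hence \<open>Suc n\<close> and \<open>Suc d\<close>. Dimensions appear in
  the form each use requires: chains for lower bounds on growth, \<open>krull_dim\<close> for the
  smooth locus, the Hilbert function for upper bounds.\<close>

locale relative_conormal =
 fixes A B :: "'n::finite cvec set" and n d :: nat
 assumes chainA: "\<exists>c. is_chain {C. closedin zariski C & irreducible_in zariski C} (Suc n) c & c (Suc n) = A"
  and primeA: "pprime (\<I> A)" and stableA: "V.stable (\<I> A)"
  and dimA: "krull_dim zariski A = enat (Suc n)"
  and chainB: "\<exists>c. is_chain {C. closedin zariski C & irreducible_in zariski C} (Suc d) c & c (Suc d) = B"
  and primeB: "pprime (\<I> B)" and stableB: "V.stable (\<I> B)"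
  and dimB: "dg (Suc d) (V.H (\<I> B))"
  and sub: "B \<subseteq> A" and coneB: "x \<in> B ==> a ~= 0 ==> a *s x \<in> B"
  and smooth: "smooth_locus A \<inter> B ~= {}"
begin

definition S :: "'n cvec2 set" where
 "S = {(x, y). x \<in> smooth_locus A \<inter> B & y \<in> normal_space A x}"

lemma smooth_iff: "x \<in> smooth_locus A \<longleftrightarrow> x \<in> A & vec.dim (tangent_space A x) = Suc n"
 by (simp add: smooth_locus_def dimA)

lemma card_compl: "card (- C) = CARD('n) - card C" for C :: "'n set"
 by (simp add: Compl_eq_Diff_UNIV card_Diff_subset)

lemma frame_rank:
 assumes "!!i. i \<in> C ==> F i \<in> \<I> A" "x \<in> A" "det (frame C F x) ~= 0"
 shows "card C + Suc n <= CARD('n)"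
proof -
 obtain c where c: "is_chain {C. closedin zariski C & irreducible_in zariski C} (Suc n) c" "c (Suc n) = A"
  using chainA by blast
 show ?thesis by (rule rank_bound[OF c primeA assms])
qed

lemma smooth_frame:
 assumes "x \<in> smooth_locus A"
 obtains C F where "!!i. i \<in> C ==> F i \<in> \<I> A" "det (frame C F x) ~= 0" "card C + Suc n = CARD('n)"
proof -
 obtain C F where CF: "!!i. i \<in> C ==> F i \<in> \<I> A" "det (frame C F x) ~= 0"
  "tangent_space A x = frame_kernel C F x" by (rule ex_frame[of A x]) blast
 have "card C <= CARD('n)" by (rule card_mono) auto
 then have "card C + Suc n = CARD('n)"
  using assms dim_frame_kernel[OF CF(2)] unfolding smooth_iff CF(3) card_compl by linarith
 then show ?thesis using that CF by blast
qed

text \<open>No frame has more gradients than this one, by \<open>rank_bound\<close>, so the tangent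
  space is exactly its kernel: the point is smooth and the frame spans all normal vectors.\<close>

lemma frame_smooth:
 assumes F: "!!i. i \<in> C ==> F i \<in> \<I> A" and x: "x \<in> A" "det (frame C F x) ~= 0"
  and C: "card C + Suc n = CARD('n)"
 shows "x \<in> smooth_locus A" "f \<in> \<I> A ==> \<exists>a. grad f x = (\<Sum>i\<in>C. a i *s grad (F i) x)"
proof -
 obtain C' F' where CF: "!!i. i \<in> C' ==> F' i \<in> \<I> A" "det (frame C' F' x) ~= 0"
  "tangent_space A x = frame_kernel C' F' x" by (rule ex_frame[of A x]) blast
 have "card C' + Suc n <= CARD('n)" by (rule frame_rank[OF CF(1) x(1) CF(2)])
 then have ge: "Suc n <= vec.dim (tangent_space A x)"
  unfolding CF(3) dim_frame_kernel[OF CF(2)] card_compl by linarith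
 have k: "vec.dim (frame_kernel C F x) = Suc n" unfolding dim_frame_kernel[OF x(2)] card_compl using C by linarith
 have "tangent_space A x \<subseteq> frame_kernel C F x" using F by (auto simp: tangent_space_iff frame_kernel_def)
 then have eq: "tangent_space A x = frame_kernel C F x"
  using ge k unfolding CF(3) by (intro vec.subspace_dim_equal subspace_frame_kernel) simp_all
 show "x \<in> smooth_locus A" unfolding smooth_iff eq k using x(1) by simp
 assume "f \<in> \<I> A"
 then have "bilin (grad f x) v = 0" if "v \<in> frame_kernel C F x" for v
  using that unfolding eq[symmetric] tangent_space_iff by blast
 then show "\<exists>a. grad f x = (\<Sum>i\<in>C. a i *s grad (F i) x)" by (rule frame_kernel_perp[OF x(2)])
qed

lemma S_iff: "(x, y) \<in> S \<longleftrightarrow> x \<in> smooth_locus A & x \<in> B & (\<exists>f\<in>\<I> A. y = grad f x)"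
 by (auto simp: S_def normal_space_eq)

lemma pol_vanishing: "f \<in> \<I> W ==> pol f"
 by (simp add: vanishing_ideal_def)

lemma det_frame_not_vanishing:
 assumes "!!i. i \<in> C ==> F i \<in> \<I> A" "x \<in> B" "det (frame C F x) ~= 0"
 shows "pol (%x. det (frame C F x))" "(%x. det (frame C F x)) ~: \<I> B"
 using pol_det_frame[of C F] assms by (auto simp: vanishing_ideal_def)

lemma pol_section: "pol f ==> g \<in> \<I> A ==> pol (%x. f (x, grad g x))"
 by (rule VV_pol_comp) (simp_all add: V.pol_X pol_grad pol_vanishing)

text \<open>Each point of \<open>S\<close> extends to a section \<open>(x, grad f x)\<close> over an
  open part of \<open>B\<close>. Points at which the two given polynomials are nonzero thus yield
  two sections over one common smooth \<open>x\<close>; on the line joining them inside the normal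
  space a product of nonzero polynomials is nonzero.\<close>

lemma S_prime: "pprime (\<I> S)"
 unfolding pprime_def
proof (intro conjI allI impI vanishing_ideal_pideal)
 obtain x0 where "x0 \<in> smooth_locus A" "x0 \<in> B" using smooth by blast
 then have "(x0, grad 0 x0) \<in> S" using pidealD(2)[OF vanishing_ideal_pideal, of A] S_iff by blast
 then show "1 ~: \<I> S" using vanD[of 1 S] by fastforce
 fix f g assume fg: "pol f & pol g & f * g \<in> \<I> S"
 show "f \<in> \<I> S \<or> g \<in> \<I> S"
 proof (rule ccontr)
  assume neg: "\<not> ?thesis"
  then obtain p1 p2 where p: "p1 \<in> S" "f p1 ~= 0" "p2 \<in> S" "g p2 ~= 0" using fg by (auto simp: vanishing_ideal_def)
  obtain x1 f1 where 1: "p1 = (x1, grad f1 x1)" "x1 \<in> smooth_locus A" "x1 \<in> B" "f1 \<in> \<I> A"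
   using p(1) S_iff by (cases p1) auto
  obtain x2 f2 where 2: "p2 = (x2, grad f2 x2)" "x2 \<in> B" "f2 \<in> \<I> A" using p(3) S_iff by (cases p2) auto
  obtain C F where CF: "!!i. i \<in> C ==> F i \<in> \<I> A" "det (frame C F x1) ~= 0" "card C + Suc n = CARD('n)"
   by (rule smooth_frame[OF 1(2)]) blast
  note D = det_frame_not_vanishing[OF CF(1) 1(3) CF(2)]
  let ?f = "%x. f (x, grad f1 x)" and ?g = "%x. g (x, grad f2 x)"
  have pf: "pol ?f" "pol ?g" using fg 1(4) 2(3) by (auto intro: pol_section)
  have nf: "?f ~: \<I> B" "?g ~: \<I> B" using p(2,4) 1 2 vanD[of ?f B x1] vanD[of ?g B x2] by auto
  obtain x where x: "x \<in> B" "?f x ~= 0" "?g x ~= 0" "det (frame C F x) ~= 0"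
   using pprime_witness(2)[OF primeB pf(1) pol_mult[OF pf(2) D(1)] nf(1)
    pprime_witness(1)[OF primeB pf(2) D(1) nf(2) D(2)]] by auto
  have xA: "x \<in> A" using x(1) sub by blast
  have sm: "x \<in> smooth_locus A" by (rule frame_smooth(1)[OF CF(1) xA x(4) CF(3)])
  let ?y = "%t. grad f1 x + t *s (grad f2 x - grad f1 x)"
  have yS: "(x, ?y t) \<in> S" for t
  proof -
   have "f1 + fsc t (f2 - f1) \<in> \<I> A" using 1(4) 2(3) by (intro pidealD(3,6,8)[OF vanishing_ideal_pideal])
   moreover have "f2 - f1 = f2 + fsc (-1) f1" by (rule ext) simp
   then have "grad (f1 + fsc t (f2 - f1)) x = ?y t"
    using 1(4) 2(3) by (simp only: grad_add grad_cmult pol_add pol_fsc pol_vanishing) (simp add: vector_smult_lneg)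
   ultimately show ?thesis unfolding S_iff using sm x(1) by metis
  qed
  have "pol (%t. h (x, ?y t))" if "pol h" for h
  proof (rule VV_pol_comp[OF _ _ that])
   fix i
   show "pol (%t. fst (x, ?y t) $ i)" using polynomial_fun.const by simp
   have "pol (%t :: complex. t)" by (rule polynomial_fun.coord) (simp add: coordinates_complex_def)
   then have "pol (%t. grad f1 x $ i + (t * grad f2 x $ i + t * (- grad f1 x $ i)))"
    by (intro polynomial_fun.add polynomial_fun.mult polynomial_fun.const)
   then show "pol (%t. snd (x, ?y t) $ i)" by (simp add: right_diff_distrib)
  qed
  then obtain P Q where PQ: "(%t. f (x, ?y t)) = poly P" "(%t. g (x, ?y t)) = poly Q"
   using pol_complex_poly fg by metis
  have "poly (P * Q) t = 0" for t
  proof -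
   have "f (x, ?y t) * g (x, ?y t) = 0" using fg vanD[OF _ yS[of t], of "f * g"] by simp
   then show ?thesis using fun_cong[OF PQ(1), of t] fun_cong[OF PQ(2), of t] by simp
  qed
  then have "P * Q = 0" using poly_all_0_iff_0 by blast
  moreover have "poly P 0 ~= 0" using fun_cong[OF PQ(1), of 0] x(2) by simp
  moreover have "poly Q 1 ~= 0" using fun_cong[OF PQ(2), of 1] x(3) by simp
  ultimately show False by auto
 qed
qed

lemma tangent_space_scale:
 assumes "a ~= 0"
 shows "tangent_space A (a *s x) = tangent_space A x"
proof -
 have le: "tangent_space A x \<subseteq> tangent_space A (a *s x)" if a: "a ~= 0" for a x
 proof
  fix v assume v: "v \<in> tangent_space A x"
  show "v \<in> tangent_space A (a *s x)" unfolding tangent_space_iff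
  proof
   fix f assume f: "f \<in> \<I> A"
   have "(%x. f (a *s x)) \<in> \<I> A" using V.stableD[OF stableA f, of "%_. a"] a by (simp add: V_sc)
   then have "bilin (grad (%x. f (a *s x)) x) v = 0" using v unfolding tangent_space_iff by blast
   then show "bilin (grad f (a *s x)) v = 0" using a by (simp add: grad_scale[OF pol_vanishing[OF f]] bilin_linear)
  qed
 qed
 show ?thesis using le[OF assms, of x] le[of "inverse a" "a *s x"] assms by auto
qed

lemma S_scale:
 assumes "(x, y) \<in> S" "a ~= 0"
 shows "(a *s x, b *s y) \<in> S"
proof -
 have "a *s x \<in> B" using coneB assms by (simp add: S_def)
 then show ?thesis using assms sub by (auto simp: S_def smooth_iff normal_space_def tangent_space_scale bilin_linear)
qed

lemma S_stable: "VV.stable (\<I> S)"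
 by (rule VV.stable_vanishing_ideal) (use S_scale in \<open>auto simp: VV_sc\<close>)

text \<open>Where the frame is invertible, \<phi> maps \<open>B\<close> times the coordinate space
  of \<open>C\<close> onto the normal vectors. A polynomial that vanishes on the image vanishes
  along every section over a dense part of \<open>B\<close>, hence on \<open>S\<close>; the orders
  \<open>Suc d\<close> and \<open>card C\<close> add up.\<close>

lemma S_upper: "\<exists>K. \<forall>t. VV.Fn S t <= K * (t + 1) ^ (Suc d + (CARD('n) - Suc n))"
proof -
 obtain x1 where x1: "x1 \<in> smooth_locus A" "x1 \<in> B" using smooth by blast
 obtain C F where CF: "!!i. i \<in> C ==> F i \<in> \<I> A" "det (frame C F x1) ~= 0" "card C + Suc n = CARD('n)"
  by (rule smooth_frame[OF x1(1)]) blast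
 note D = det_frame_not_vanishing[OF CF(1) x1(2) CF(2)]
 define \<phi> where "\<phi> p = (fst p, \<Sum>i\<in>C. (snd p $ i) *s grad (F i) (fst p))" for p :: "'n cvec2"
 have pp: "pol (%p. pcoord k (\<phi> p))" for k
 proof (cases k)
  case (Inl i)
  then show ?thesis using VV.pol_X[of "Inl i :: 'n + 'n"] by (simp add: \<phi>_def pcoord_simps)
 next
  case (Inr j)
  have "pol (\<Sum>i\<in>C. (%p. pcoord (Inr i) p) * (%p. grad (F i) (fst p) $ j))"
   using pfst.pol_map[OF pol_grad[OF pol_vanishing[OF CF(1)]]] VV.pol_X by (intro pol_sum pol_mult) simp_all
  moreover have "(%p. pcoord k (\<phi> p)) = (\<Sum>i\<in>C. (%p. pcoord (Inr i) p) * (%p. grad (F i) (fst p) $ j))"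
   by (rule ext) (simp add: Inr \<phi>_def pcoord_simps sum_component sum_fun_apply)
  ultimately show ?thesis by (simp only:)
 qed
 from common_degree[OF VV.affine_coords_axioms, of "%k p. pcoord k (\<phi> p)", OF pp]
 obtain \<kappa> where \<kappa>: "\<forall>k. (%p. pcoord k (\<phi> p)) \<in> VV.Rle \<kappa>" by (elim exE)
 interpret \<phi>: affine_map pcoord pcoord \<phi> \<kappa> by unfold_locales (rule \<kappa>[rule_format])
 let ?Y = "B \<times> {a. \<forall>i. i ~: C --> a $ i = 0}"
 have "\<I> (\<phi> ` ?Y) \<subseteq> \<I> S"
 proof
  fix f assume f: "f \<in> \<I> (\<phi> ` ?Y)"
  have "f (x, y) = 0" if xy: "(x, y) \<in> S" for x y
  proof -
   obtain g where g: "g \<in> \<I> A" "y = grad g x" "x \<in> B" using xy unfolding S_iff by blast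
   have "(%x. f (x, grad g x)) \<in> \<I> B"
   proof (rule generic_vanishing[OF primeB D pol_section[OF pol_vanishing[OF f] g(1)]])
    fix z assume z: "z \<in> B" "det (frame C F z) ~= 0"
    have "z \<in> A" using z(1) sub by blast
    from frame_smooth(2)[OF CF(1) this z(2) CF(3) g(1)]
    obtain a where a: "grad g z = (\<Sum>i\<in>C. a i *s grad (F i) z)" by blast
    have "(z, grad g z) = \<phi> (z, \<chi> i. if i \<in> C then a i else 0)" by (simp add: \<phi>_def a)
    moreover have "(z, \<chi> i. if i \<in> C then a i else 0) \<in> ?Y" using z(1) by simp
    ultimately have "(z, grad g z) \<in> \<phi> ` ?Y" by blast
    then show "f (z, grad g z) = 0" using vanD[OF f] by blast
   qed
   then show ?thesis using g vanD by fastforce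
  qed
  then show "f \<in> \<I> S" using f by (auto simp: vanishing_ideal_def)
 qed
 then have "VV.Fn S t <= VV.Fn (\<phi> ` ?Y) t" for t by (rule VV.Fn_ideal_mono)
 then have "VV.Fn S t <= VV.Fn ?Y (t * \<kappa>)" for t using \<phi>.Fn_image[of ?Y t] order_trans by blast
 then have 1: "VV.Fn S t <= (t * \<kappa> + 1) ^ card C * V.Fn B (t * \<kappa>)" for t
  using Fn_cylinder[of B C "t * \<kappa>"] order_trans by blast
 obtain K where K: "!!t. V.Fn B t <= K * (t + 1) ^ Suc d" using V.Fn_upper_bound[OF stableB dimB] by blast
 let ?m = "Suc d + (CARD('n) - Suc n)"
 have m: "?m = card C + Suc d" using CF(3) by linarith
 have "VV.Fn S t <= (K * (\<kappa> + 1) ^ ?m) * (t + 1) ^ ?m" for t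
 proof -
  have "VV.Fn S t <= (t * \<kappa> + 1) ^ card C * (K * (t * \<kappa> + 1) ^ Suc d)"
   using 1[of t] K[of "t * \<kappa>"] by (meson mult_le_mono2 order_trans)
  also have "\<dots> = K * (t * \<kappa> + 1) ^ ?m" unfolding m power_add by (simp only: ac_simps)
  also have "\<dots> <= K * ((\<kappa> + 1) * (t + 1)) ^ ?m" by (intro mult_left_mono power_mono) (auto simp: algebra_simps)
  finally show ?thesis by (simp only: power_mult_distrib mult.assoc)
 qed
 then show ?thesis by blast
qed

text \<open>Frame rows outside \<open>C\<close> are unit vectors, so where the frame is invertible
  the \<open>C\<close>-coordinates of normal vectors are arbitrary. Monomials in these coordinates,
  with coefficients independent on \<open>B\<close>, are therefore independent on
  \<open>S\<close>.\<close>

lemma S_lower: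
 obtains r where "r + Suc n = CARD('n)" "!!t. (t + 1) ^ r * V.Fn B t <= VV.Fn S (t + r * t)"
proof -
 obtain x1 where x1: "x1 \<in> smooth_locus A" "x1 \<in> B" using smooth by blast
 obtain C F where CF: "!!i. i \<in> C ==> F i \<in> \<I> A" "det (frame C F x1) ~= 0" "card C + Suc n = CARD('n)"
  by (rule smooth_frame[OF x1(1)]) blast
 note D = det_frame_not_vanishing[OF CF(1) x1(2) CF(2)]
 have "(t + 1) ^ card C * V.Fn B t <= VV.Fn S (t + card C * t)" for t
 proof -
  let ?X = "Pi\<^sub>E C (%_. {..t})"
  obtain Bs where Bs: "finite Bs" "Bs \<subseteq> V.Rle t" "card Bs = V.Fn B t"
   "!!\<alpha>. (\<Sum>b\<in>Bs. fsc (\<alpha> b) b) \<in> \<I> B ==> \<forall>b\<in>Bs. \<alpha> b = 0" by (rule V.basis_lift[of t B]) blast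
  have fX: "finite ?X" by (intro finite_PiE) auto
  let ?g = "%p. (%q. snd p (fst q)) * (\<Prod>i\<in>C. pcoord (Inr i) ^ fst p i)"
  have "card (?X \<times> Bs) <= VV.Fn S (t + (\<Sum>i\<in>C. t))"
  proof (rule VV.family_count[of _ ?g])
   show "finite (?X \<times> Bs)" using fX Bs(1) by simp
   fix p assume p: "p \<in> ?X \<times> Bs"
   have "pcoord (Inr i) ^ fst p i \<in> VV.Rle t" if i: "i \<in> C" for i
   proof (rule subsetD[OF VV.Rle_mono VV.Rle_power[OF VV.X_Rle]])
    show "fst p i * Suc 0 <= t" using p i by (auto simp: PiE_iff)
   qed
   moreover have "(%q. snd p (fst q)) \<in> VV.Rle t" using pfst.comp_Rle[of "snd p" t] p Bs(2) by auto
   ultimately show "?g p \<in> VV.Rle (t + (\<Sum>i\<in>C. t))" by (intro VV.Rle_mult VV.Rle_prod) auto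
  next
   fix \<alpha> assume z: "(\<Sum>p\<in>?X \<times> Bs. fsc (\<alpha> p) (?g p)) \<in> \<I> S"
   define h where "h \<beta> = (\<Sum>b\<in>Bs. fsc (\<alpha> (\<beta>, b)) b)" for \<beta>
   have ph: "pol (h \<beta>)" for \<beta> unfolding h_def using Bs(2) V.Rle_pol by (intro pol_sum pol_fsc) blast
   have rel: "(\<Sum>\<beta>\<in>?X. h \<beta> x * (\<Prod>i\<in>C. y $ i ^ \<beta> i)) = 0" if "(x, y) \<in> S" for x y
   proof -
    have "(\<Sum>\<beta>\<in>?X. h \<beta> x * (\<Prod>i\<in>C. y $ i ^ \<beta> i)) = (\<Sum>p\<in>?X \<times> Bs. fsc (\<alpha> p) (?g p)) (x, y)"
     by (simp add: h_def sum_fun_apply prod_fun_apply power_fun_apply sum_distrib_right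
      sum.cartesian_product case_prod_beta' mult.assoc pcoord_simps)
    then show ?thesis using vanD[OF z that] by simp
   qed
   have "h \<beta> \<in> \<I> B" if \<beta>: "\<beta> \<in> ?X" for \<beta>
   proof (rule generic_vanishing[OF primeB D ph])
    fix x assume x: "x \<in> B" "det (frame C F x) ~= 0"
    have xA: "x \<in> A" using x(1) sub by blast
    have sm: "x \<in> smooth_locus A" by (rule frame_smooth(1)[OF CF(1) xA x(2) CF(3)])
    have "(\<Sum>\<beta>\<in>?X. h \<beta> x * (\<Prod>i\<in>C. z i ^ \<beta> i)) = 0" for z
    proof -
     obtain a where a: "(\<chi> i. z i) = (\<Sum>i\<in>UNIV. a i *s frame C F x $ i)" using det_comb[OF x(2)] by blast
     let ?y = "\<Sum>i\<in>C. a i *s grad (F i) x"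
     have "\<exists>f\<in>\<I> A. ?y = grad f x" by (rule comb_grad[OF CF(1)])
     then have "(x, ?y) \<in> S" unfolding S_iff using sm x(1) by blast
     moreover have "?y $ k = z k" if k: "k \<in> C" for k
     proof -
      have "z k = (\<Sum>i\<in>UNIV. a i * (frame C F x $ i $ k))"
       using arg_cong[OF a, of "%v. v $ k"] by (simp add: sum_component)
      also have "\<dots> = (\<Sum>i\<in>C. a i * (grad (F i) x $ k))"
       by (rule sum.mono_neutral_cong_right) (use k in \<open>auto simp: frame_def axis_def\<close>)
      finally show ?thesis by (simp add: sum_component)
     qed
     ultimately show ?thesis using rel[of x ?y] by simp
    qed
    then show "h \<beta> x = 0" using \<beta> by (intro box_identity[where C = C and t = t and c = "%\<beta>. h \<beta> x"]) simp_all
   qed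
   then have "\<forall>b\<in>Bs. \<alpha> (\<beta>, b) = 0" if "\<beta> \<in> ?X" for \<beta>
    using Bs(4)[of "%b. \<alpha> (\<beta>, b)"] that unfolding h_def by blast
   then show "\<forall>p\<in>?X \<times> Bs. \<alpha> p = 0" by auto
  qed
  then show ?thesis using Bs(3) by (simp add: card_cartesian_product card_box)
 qed
 then show ?thesis using that CF(3) by blast
qed

text \<open>\<open>Suc d\<close> counts the base and \<open>CARD('n) - Suc n\<close> the normal
  directions. The a priori degree \<open>M\<close> from \<open>good_H\<close> makes the growth bound
  of \<open>S_upper\<close> into a bound on the degree.\<close>

theorem S_dim:
 shows "dg (Suc d + (CARD('n) - Suc n)) (VV.H (\<I> S))"
  and "dg m (VV.H (\<I> S)) ==> Suc d + (CARD('n) - Suc n) <= m"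
proof -
 have hS: "VV.hideal (\<I> S)" using S_stable vanishing_ideal_pideal by (simp add: VV.hideal_def)
 let ?m = "Suc d + (CARD('n) - Suc n)"
 obtain M where "dg M (VV.H (\<I> S))" using VV.good_H[OF hS] unfolding good_def by blast
 then have M: "ndg (Suc M) (%t. int (VV.Fn S t))" using VV.Fn_ndg[OF S_stable] by blast
 obtain K where K: "!!t. VV.Fn S t <= K * (t + 1) ^ ?m" using S_upper by blast
 have "ndg (Suc ?m) (%t. int (VV.Fn S t))"
 proof (rule ndg_bounded[OF M])
  show "int (VV.Fn S t) <= int K * int (t + 1) ^ ?m" for t
   using K[of t] by (metis of_nat_le_iff of_nat_mult of_nat_power)
 qed simp
 then show "dg ?m (VV.H (\<I> S))" using VV.Fn_ndg[OF S_stable] by blast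
 assume "dg m (VV.H (\<I> S))"
 then obtain K where K: "!!t. VV.Fn S t <= K * (t + 1) ^ m" using VV.Fn_upper_bound[OF S_stable] by blast
 obtain c where c: "is_chain {C. closedin zariski C & irreducible_in zariski C} (Suc d) c" "c (Suc d) = B"
  using chainB by blast
 obtain h where h: "h > 0" "!!t. t >= Suc d ==> t ^ Suc d <= Suc d ^ Suc d * V.Fn B (t * h)"
  using V.chain_lower_bound[OF c(1)] c(2) by blast
 obtain r where r: "r + Suc n = CARD('n)" "!!t. (t + 1) ^ r * V.Fn B t <= VV.Fn S (t + r * t)" by (rule S_lower) blast
 have rm: "?m = r + Suc d" using r(1) by linarith
 show "?m <= m" unfolding rm
 proof (rule power_growth_compare)
  fix t assume t: "t >= Suc d"
  let ?T = "t * h"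
  have tT: "t <= ?T" using h(1) by simp
  have "t ^ (r + Suc d) = t ^ r * t ^ Suc d" by (rule power_add)
  also have "\<dots> <= (?T + 1) ^ r * (Suc d ^ Suc d * V.Fn B ?T)"
   using h t by (intro mult_mono power_mono h(2)) (use tT t in linarith)+
  also have "\<dots> = Suc d ^ Suc d * ((?T + 1) ^ r * V.Fn B ?T)" by (simp only: ac_simps)
  also have "\<dots> <= Suc d ^ Suc d * (K * (?T + r * ?T + 1) ^ m)"
   by (intro mult_left_mono order_trans[OF r(2) K]) auto
  also have "\<dots> <= Suc d ^ Suc d * (K * (t * (h + r * h + 1)) ^ m)"
   using t by (intro mult_left_mono power_mono) (auto simp: algebra_simps)
  also have "\<dots> = (Suc d ^ Suc d * K * (h + r * h + 1) ^ m) * t ^ m"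
   by (simp only: power_mult_distrib ac_simps)
  finally show "t ^ (r + Suc d) <= (Suc d ^ Suc d * K * (h + r * h + 1) ^ m) * t ^ m" .
 qed
qed

end

section \<open>From bigraded to total Hilbert functions\<close>

text \<open>Bidegrees are functions on \<open>bool\<close>, with \<open>True\<close> for the first
  factor, to match the weight \<open>isl\<close> on the coordinates.\<close>

definition pr :: "nat => nat => bool => nat" where
 "pr a b = (%k. if k then a else b)"

definition conv :: "((bool => nat) => int) => nat => int" where
 "conv G t = (\<Sum>a\<le>t. G (pr a (t - a)))"

text \<open>Contrary to \<open>dg\<close>, the differences vanish everywhere and not only for large arguments.\<close>

primrec edg :: "nat => ((bool => nat) => int) => bool" where
 "edg 0 f \<longleftrightarrow> (\<forall>g. f g = 0)"
| "edg (Suc m) f \<longleftrightarrow> (\<forall>k. edg m (fdiff k f))"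

lemma pr_upd: "(pr a b)(True := Suc (pr a b True)) = pr (Suc a) b" "(pr a b)(False := Suc (pr a b False)) = pr a (Suc b)"
 by (auto simp: pr_def)

lemma pr_cases: "g = pr (g True) (g False)"
 by (rule ext) (simp add: pr_def)

lemma fdiff_pr: "fdiff True G (pr a b) = G (pr (Suc a) b) - G (pr a b)" "fdiff False G (pr a b) = G (pr a (Suc b)) - G (pr a b)"
 unfolding fdiff_def pr_upd by simp_all

lemma edg_dg: "edg m f ==> dg m f"
 by (induction m arbitrary: f) (auto simp: evc_def)

lemma edg_Suc: "edg m f ==> edg (Suc m) f"
 by (induction m arbitrary: f) (auto simp: fdiff_def)

lemma edg_mono: "edg m f ==> m <= n ==> edg n f"
 by (induction n) (auto simp: le_Suc_eq simp del: edg.simps(2) dest: edg_Suc)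

lemma edg_shift: "edg m f ==> edg m (%g. f (g + h))"
 by (induction m arbitrary: f) (simp_all add: fdiff_shift)

lemma dg_edg: "dg m f ==> \<exists>c. edg m (%g. f (g + (%_. c)))"
proof (induction m arbitrary: f)
 case 0
 then obtain c where "\<forall>g. (\<forall>k. c <= g k) --> f g = 0" by (auto simp: evc_def)
 then have "edg 0 (%g. f (g + (%_. c)))" by simp
 then show ?case by blast
next
 case (Suc m)
 have "\<exists>c. edg m (%g. fdiff k f (g + (%_. c)))" for k by (rule Suc.IH) (use Suc.prems in simp)
 then obtain c where c: "!!k. edg m (%g. fdiff k f (g + (%_. c k)))" by metis
 let ?c = "c True + c False"
 have "edg m (%g. fdiff k f (g + (%_. ?c)))" for k
 proof -
  have "edg m (%g. fdiff k f ((g + (%_. c (\<not> k))) + (%_. c k)))" by (rule edg_shift[OF c])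
  moreover have "(g + (%_. c (\<not> k))) + (%_. c k) = g + (%_. ?c)" for g :: "bool => nat"
   by (cases k) (simp_all add: fun_eq_iff)
  ultimately show ?thesis by (simp only:)
 qed
 then have "edg (Suc m) (%g. f (g + (%_. ?c)))" by (simp add: fdiff_shift)
 then show ?case by blast
qed

abbreviation U :: "(nat => int) => (unit => nat) => int" where
 "U f \<equiv> (%g. f (g ()))"

lemma fdiff_U: "fdiff () (U f) = U (nd f)"
 by (auto simp: fdiff_def nd_def)

lemma coef_U_Suc: "coef (replicate (Suc k) ()) (U f) = coef (replicate k ()) (U (nd f))"
 by (simp add: coef_Cons fdiff_U)

lemma coef_U_shift: "coef (replicate k ()) (U (%t. f (t + h))) = coef (replicate k ()) (U f)"
 using coef_shift[of "replicate k ()" "U f" "%_. h"] by simp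

lemma coef_U_0: "ndg k f ==> coef (replicate k ()) (U f) = 0"
 by (rule coef_0) (simp add: ndg_dg)

lemma coef_U_add: "ndg (Suc k) f ==> ndg (Suc k) g ==>
  coef (replicate k ()) (U (%t. f t + g t)) = coef (replicate k ()) (U f) + coef (replicate k ()) (U g)"
 using coef_add[of "replicate k ()" "U f" "U g"] by (simp add: ndg_dg del: dg.simps ndg.simps)

lemma ndg_slice: "edg m G ==> ndg m (%t. G (pr a t))" "edg m G ==> ndg m (%t. G (pr t b))"
proof -
 show "edg m G ==> ndg m (%t. G (pr a t))"
 proof (induction m arbitrary: G)
  case (Suc m)
  have "nd (%t. G (pr a t)) = (%t. fdiff False G (pr a t))" by (rule ext) (simp only: nd_def fdiff_pr)
  then show ?case using Suc by simp
 qed simp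
 show "edg m G ==> ndg m (%t. G (pr t b))"
 proof (induction m arbitrary: G)
  case (Suc m)
  have "nd (%t. G (pr t b)) = (%t. fdiff True G (pr t b))" by (rule ext) (simp only: nd_def fdiff_pr)
  then show ?case using Suc by simp
 qed simp
qed

lemma coef_slice: "edg (Suc k) G ==> coef (replicate k ()) (U (%t. G (pr 0 t))) = coef (replicate k False) G"
proof (induction k arbitrary: G)
 case 0
 have const: "G (pr a b) = G (pr 0 b)" for a b
 proof (induction a)
  case (Suc a)
  have "fdiff True G (pr a b) = 0" using 0 by simp
  then show ?case using Suc unfolding fdiff_pr by simp
 qed simp
 have "dg (Suc 0) G" by (rule edg_dg[OF 0])
 then have "evc G (coef [] G)" using coef_evc[of "[]" G] by simp
 then obtain c where c: "!!g. (\<forall>k. c <= g k) ==> G g = coef [] G" by (auto simp: evc_def)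
 have "evc (U (%t. G (pr 0 t))) (coef [] G)" unfolding evc_def
 proof (intro exI[of _ c] allI impI)
  fix g :: "unit => nat" assume g: "\<forall>k. c <= g k"
  have "G (pr 0 (g ())) = G (pr c (g ()))" using const[of c "g ()"] by simp
  also have "\<dots> = coef [] G" by (rule c) (use g in \<open>simp add: pr_def\<close>)
  finally show "G (pr 0 (g ())) = coef [] G" .
 qed
 then have "coef [] (U (%t. G (pr 0 t))) = coef [] G" using coef_eqI[of "[]" "U (%t. G (pr 0 t))"] by simp
 then show ?case by simp
next
 case (Suc k)
 have "nd (%t. G (pr 0 t)) = (%t. fdiff False G (pr 0 t))" by (rule ext) (simp only: nd_def fdiff_pr)
 with coef_U_Suc[of k "%t. G (pr 0 t)"]
 have "coef (replicate (Suc k) ()) (U (%t. G (pr 0 t))) = coef (replicate k ()) (U (%t. fdiff False G (pr 0 t)))"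
  by (simp only:)
 also have "\<dots> = coef (replicate k False) (fdiff False G)" by (rule Suc.IH) (use Suc.prems in simp)
 finally show ?case by (simp add: coef_Cons)
qed

lemma nd_conv: "nd (conv G) = (%t. G (pr 0 (t + 1)) + conv (fdiff True G) t)"
proof
 fix t
 have "conv G (Suc t) = G (pr 0 (t + 1)) + (\<Sum>a\<le>t. G (pr (Suc a) (t - a)))"
  unfolding conv_def by (subst sum.atMost_Suc_shift) simp
 then show "nd (conv G) t = G (pr 0 (t + 1)) + conv (fdiff True G) t"
  unfolding nd_def conv_def fdiff_pr sum_subtractf by simp
qed

text \<open>By \<open>nd_conv\<close> a difference of the sum over bidegrees is a boundary slice
  plus the sum for \<open>fdiff True G\<close>. The slice contributes the coefficient without
  differences in the first variable; iteration brings in those with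
  \<open>i = 1, 2, ...\<close>.\<close>

lemma conv_exact:
 assumes "edg (Suc m) G"
 shows "ndg (Suc (Suc m)) (conv G) &
  coef (replicate (Suc m) ()) (U (conv G)) = (\<Sum>i\<le>m. coef (replicate i True @ replicate (m - i) False) G)"
 using assms
proof (induction m arbitrary: G)
 case 0
 have "conv (fdiff True G) = (%_. 0)" using 0 by (simp add: conv_def fun_eq_iff)
 then have nd: "nd (conv G) = (%t. G (pr 0 (t + 1)))" unfolding nd_conv by simp
 have sl: "ndg (Suc 0) (%t. G (pr 0 (t + 1)))"
  using ndg_slice(1)[OF 0, of 0] ndg_shift[of "Suc 0" "%t. G (pr 0 t)" 1] by blast
 have "coef (replicate (Suc 0) ()) (U (conv G)) = coef (replicate 0 ()) (U (%t. G (pr 0 (t + 1))))"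
  unfolding coef_U_Suc nd ..
 also have "\<dots> = coef (replicate 0 ()) (U (%t. G (pr 0 t)))" by (rule coef_U_shift)
 also have "\<dots> = coef (replicate 0 False) G" by (rule coef_slice[OF 0])
 finally show ?case using sl nd by simp
next
 case (Suc m)
 let ?s = "%t. G (pr 0 (t + 1))"
 have e: "edg (Suc m) (fdiff True G)" using Suc.prems by simp
 note IH = Suc.IH[OF e]
 have sl: "ndg (Suc (Suc m)) ?s"
  using ndg_slice(1)[OF Suc.prems, of 0] ndg_shift[of "Suc (Suc m)" "%t. G (pr 0 t)" 1] by blast
 have "ndg (Suc (Suc m)) (nd (conv G))" unfolding nd_conv by (rule ndg_add[OF sl conjunct1[OF IH]])
 then have 1: "ndg (Suc (Suc (Suc m))) (conv G)" by simp
 have "coef (replicate (Suc (Suc m)) ()) (U (conv G)) =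
   coef (replicate (Suc m) ()) (U (%t. ?s t + conv (fdiff True G) t))"
  unfolding coef_U_Suc[of "Suc m"] nd_conv ..
 also have "\<dots> = coef (replicate (Suc m) ()) (U ?s) + coef (replicate (Suc m) ()) (U (conv (fdiff True G)))"
  by (rule coef_U_add[OF sl conjunct1[OF IH]])
 also have "coef (replicate (Suc m) ()) (U ?s) = coef (replicate (Suc m) ()) (U (%t. G (pr 0 t)))" by (rule coef_U_shift)
 also have "\<dots> = coef (replicate (Suc m) False) G" by (rule coef_slice[OF Suc.prems])
 also have "coef (replicate (Suc m) ()) (U (conv (fdiff True G))) =
   (\<Sum>i\<le>m. coef (replicate (Suc i) True @ replicate (Suc m - Suc i) False) G)"
  using conjunct2[OF IH] by (simp add: coef_Cons)
 also have "coef (replicate (Suc m) False) G + (\<Sum>i\<le>m. coef (replicate (Suc i) True @ replicate (Suc m - Suc i) False) G) =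
   (\<Sum>i\<le>Suc m. coef (replicate i True @ replicate (Suc m - i) False) G)"
  by (subst sum.atMost_Suc_shift) simp
 finally show ?case using 1 by blast
qed

lemma coef_swap: "coef (False # replicate i True @ xs) f = coef (replicate i True @ False # xs) f"
proof (induction i arbitrary: f)
 case (Suc i)
 have "coef (False # replicate (Suc i) True @ xs) f = coef (replicate i True @ xs) (fdiff False (fdiff True f))"
  by (simp add: coef_Cons fdiff_commute)
 also have "\<dots> = coef (False # replicate i True @ xs) (fdiff True f)" by (simp add: coef_Cons)
 also have "\<dots> = coef (replicate (Suc i) True @ False # xs) f" unfolding Suc.IH by (simp add: coef_Cons)
 finally show ?case .
qed simp

lemma coef_sort: "\<exists>i\<le>length ks. coef ks f = coef (replicate i True @ replicate (length ks - i) False) f"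
proof (induction ks arbitrary: f)
 case (Cons k ks)
 obtain i where i: "i <= length ks" "coef ks (fdiff k f) = coef (replicate i True @ replicate (length ks - i) False) (fdiff k f)"
  using Cons.IH by blast
 show ?case
 proof (cases k)
  case True
  then have "coef (k # ks) f = coef (replicate (Suc i) True @ replicate (length (k # ks) - Suc i) False) f"
   using i by (simp add: coef_Cons)
  then show ?thesis using i(1) by (intro exI[of _ "Suc i"]) auto
 next
  case False
  have "coef (k # ks) f = coef (False # replicate i True @ replicate (length ks - i) False) f"
   using i(2) False by (simp add: coef_Cons)
  also have "\<dots> = coef (replicate i True @ replicate (length (k # ks) - i) False) f"
   unfolding coef_swap using i(1) by (simp add: Suc_diff_le)
  finally show ?thesis using i(1) by (intro exI[of _ i]) auto
 qed
qed simp

lemma mono_pr: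
 assumes "!!g k. G g <= G (g(k := Suc (g k)))" "a <= a'" "b <= b'"
 shows "(G (pr a b) :: int) <= G (pr a' b')"
proof -
 have 1: "G (pr a b) <= G (pr (a + i) b)" for i
 proof (induction i)
  case (Suc i)
  then show ?case using assms(1)[of "pr (a + i) b" True] unfolding pr_upd by simp
 qed simp
 have 2: "G (pr a' b) <= G (pr a' (b + i))" for i
 proof (induction i)
  case (Suc i)
  then show ?case using assms(1)[of "pr a' (b + i)" False] unfolding pr_upd by simp
 qed simp
 show ?thesis using 1[of "a' - a"] 2[of "b' - b"] assms(2,3) by simp
qed

text \<open>By monotonicity a value near an axis is dominated by \<open>s + 1\<close> values on one
  antidiagonal of total degree \<open>a + 2 * s\<close>. The order \<open>Suc m\<close> of the total
  sum thus leaves only order \<open>m\<close> for a strip of fixed width.\<close>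

lemma strip_bound:
 assumes mono: "!!g k. G g <= G (g(k := Suc (g k)))" and nonneg: "!!g. 0 <= G g"
  and K: "!!t. conv G t <= int K * int (t + 1) ^ Suc m"
 shows "G (pr a s) <= int (K * (a + 2) ^ Suc m) * int (s + 1) ^ m" "G (pr s a) <= int (K * (a + 2) ^ Suc m) * int (s + 1) ^ m"
proof -
 have "x <= int (K * (a + 2) ^ Suc m) * int (s + 1) ^ m"
  if x: "int (s + 1) * x <= conv G (a + 2 * s)" for x
 proof -
  have "int (s + 1) * x <= int K * int (a + 2 * s + 1) ^ Suc m" using x K order_trans by blast
  also have "\<dots> <= int K * (int (a + 2) * int (s + 1)) ^ Suc m"
   by (intro mult_left_mono power_mono) (auto simp: algebra_simps)
  also have "\<dots> = int (s + 1) * (int (K * (a + 2) ^ Suc m) * int (s + 1) ^ m)"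
   unfolding power_mult_distrib by (simp only: of_nat_mult of_nat_power power_Suc ac_simps)
  finally show ?thesis by (rule mult_left_le_imp_le) simp
 qed
 moreover have "int (s + 1) * G (pr a s) <= conv G (a + 2 * s)"
 proof -
  have "int (s + 1) * G (pr a s) = (\<Sum>j\<in>{a..a + s}. G (pr a s))" by simp
  also have "\<dots> <= (\<Sum>j\<in>{a..a + s}. G (pr j (a + 2 * s - j)))" by (intro sum_mono mono_pr[of G, OF mono]) auto
  also have "\<dots> <= conv G (a + 2 * s)" unfolding conv_def by (intro sum_mono2 nonneg) auto
  finally show ?thesis .
 qed
 moreover have "int (s + 1) * G (pr s a) <= conv G (a + 2 * s)"
 proof -
  have "int (s + 1) * G (pr s a) = (\<Sum>j\<in>{s..2 * s}. G (pr s a))" by simp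
  also have "\<dots> <= (\<Sum>j\<in>{s..2 * s}. G (pr j (a + 2 * s - j)))" by (intro sum_mono mono_pr[of G, OF mono]) auto
  also have "\<dots> <= conv G (a + 2 * s)" unfolding conv_def by (intro sum_mono2 nonneg) auto
  finally show ?thesis .
 qed
 ultimately show "G (pr a s) <= int (K * (a + 2) ^ Suc m) * int (s + 1) ^ m"
  "G (pr s a) <= int (K * (a + 2) ^ Suc m) * int (s + 1) ^ m" by blast+
qed

text \<open>\<open>conv_exact\<close> applies only to the shifted function \<open>?G\<close>, which
  is polynomial on the whole quadrant. The difference to the true sum consists of strips along the
  axes and has smaller order by \<open>strip_bound\<close>.\<close>

theorem total_coefficient:
 assumes mono: "!!g k. G g <= G (g(k := Suc (g k)))" and nonneg: "!!g. 0 <= G g"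
  and tot: "ndg (Suc (Suc m)) (conv G)"
  and G: "dg (Suc m') G" "\<not> dg m' G" "!!ks. length ks = m' ==> 0 <= coef ks G"
 shows "m' <= m"
  and "coef (replicate (Suc m) ()) (U (conv G)) = (\<Sum>i\<le>m. coef (replicate i True @ replicate (m - i) False) G)"
proof -
 obtain c where c: "edg (Suc m') (%g. G (g + (%_. c)))" using dg_edg[OF G(1)] by blast
 let ?G = "%g. G (g + (%_. c))" and ?T = "%t. t + 2 * c"
 \<comment> \<open>In total degree \<open>t + 2 * c\<close> the shifted quadrant accounts for first
   degrees from \<open>c\<close> to \<open>t + c\<close>; \<open>?e\<close> collects the remaining
   \<open>2 * c\<close> bidegrees, which have an entry below \<open>c\<close>.\<close>
 let ?e = "%t. conv G (?T t) - conv ?G t" and ?A = "%t. {..?T t} - {c..t + c}"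
 have pr_add: "pr a b + (%_. c) = pr (a + c) (b + c)" for a b by (rule ext) (simp add: pr_def)
 have e_eq: "?e t = (\<Sum>a\<in>?A t. G (pr a (?T t - a)))" for t
 proof -
  have "conv ?G t = (\<Sum>a\<le>t. G (pr (a + c) (?T t - (a + c))))" unfolding conv_def pr_add
  proof (intro sum.cong refl)
   fix a assume "a \<in> {..t}"
   then have "t - a + c = ?T t - (a + c)" by simp
   then show "G (pr (a + c) (t - a + c)) = G (pr (a + c) (?T t - (a + c)))" by (simp only:)
  qed
  also have "\<dots> = (\<Sum>a\<in>{c..t + c}. G (pr a (?T t - a)))"
   by (rule sum.reindex_bij_witness[of _ "%a. a - c" "%a. a + c"]) auto
  finally have q: "conv ?G t = (\<Sum>a\<in>{c..t + c}. G (pr a (?T t - a)))" .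
  show ?thesis unfolding q unfolding conv_def by (subst sum_diff) auto
 qed
 obtain K where "!!t. \<bar>conv G t\<bar> <= int K * int (t + 1) ^ Suc m" using ndg_growth[OF tot] by blast
 then have K: "conv G t <= int K * int (t + 1) ^ Suc m" for t using abs_le_D1 by blast
 note strip = strip_bound[of G, OF mono nonneg K]
 \<comment> \<open>Valid for all strips at once: the distance from the axis is at most
   \<open>c\<close>, and \<open>s <= t + 2 * c\<close> gives
   \<open>s + 1 <= (2 * c + 1) * (t + 1)\<close>.\<close>
 define K1 where "K1 = K * (c + 2) ^ Suc m * (2 * c + 1) ^ m"
 have term_le: "G (pr a (?T t - a)) <= int K1 * int (t + 1) ^ m" if a: "a \<in> ?A t" for a t
 proof -
  have bound: "int (K * (x + 2) ^ Suc m) * int (s + 1) ^ m <= int K1 * int (t + 1) ^ m" if "x <= c" "s <= ?T t" for x s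
  proof -
   have "K * (x + 2) ^ Suc m * (s + 1) ^ m <= K * (c + 2) ^ Suc m * ((2 * c + 1) * (t + 1)) ^ m"
    using that by (intro mult_mono power_mono) (auto simp: algebra_simps)
   then have "K * (x + 2) ^ Suc m * (s + 1) ^ m <= K1 * (t + 1) ^ m"
    unfolding K1_def power_mult_distrib by (simp only: mult.assoc)
   then have "int (K * (x + 2) ^ Suc m * (s + 1) ^ m) <= int (K1 * (t + 1) ^ m)" by (simp only: of_nat_le_iff)
   then show ?thesis by (simp only: of_nat_mult of_nat_power)
  qed
  show ?thesis
  proof (cases "a <= c")
   case True
   then show ?thesis using strip(1)[of a "?T t - a"] bound[of a "?T t - a"] by fastforce
  next
   case False
   let ?b = "?T t - a"
   have "?b <= c" "a <= ?T t" using a False by auto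
   then show ?thesis using strip(2)[of a ?b] bound[of ?b a] by fastforce
  qed
 qed
 have cardA: "card (?A t) = 2 * c" for t by (subst card_Diff_subset) auto
 have q: "ndg (Suc (Suc m')) (conv ?G)" using conv_exact[OF c] by blast
 have tot': "ndg (Suc (Suc m)) (%t. conv G (?T t))" using tot ndg_shift[of "Suc (Suc m)" "conv G" "2 * c"] by blast
 let ?M = "max (Suc (Suc m)) (Suc (Suc m'))"
 have e: "ndg (Suc m) ?e"
 proof (rule ndg_bounded)
  show "ndg ?M ?e" by (intro ndg_diff ndg_mono[OF tot'] ndg_mono[OF q]) auto
  show "0 <= ?e t" for t unfolding e_eq by (intro sum_nonneg nonneg)
  have "?e t <= (\<Sum>a\<in>?A t. int K1 * int (t + 1) ^ m)" for t unfolding e_eq by (intro sum_mono term_le)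
  then show "?e t <= int (2 * c * K1) * int (t + 1) ^ m" for t by (simp add: cardA mult.assoc)
 qed
 have shift: "coef ks ?G = coef ks G" for ks by (rule coef_shift)
 \<comment> \<open>Otherwise the sum of the coefficients of order \<open>m'\<close> would be 0.
   Being nonnegative they would all vanish, also for the other orders of differences by
   \<open>coef_sort\<close>, and the degree of \<open>G\<close> would be smaller.\<close>
 show m': "m' <= m"
 proof (rule ccontr)
  assume "\<not> m' <= m"
  then have le: "Suc m <= m'" by simp
  have "ndg (Suc (Suc m)) (%t. conv G (?T t) - ?e t)" by (rule ndg_diff[OF tot' ndg_mono[OF e]]) simp
  then have "ndg (Suc (Suc m)) (conv ?G)" by simp
  then have "ndg (Suc m') (conv ?G)" by (rule ndg_mono) (use le in simp)
  then have "coef (replicate (Suc m') ()) (U (conv ?G)) = 0" by (rule coef_U_0)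
  then have "(\<Sum>i\<le>m'. coef (replicate i True @ replicate (m' - i) False) G) = 0"
   using conjunct2[OF conv_exact[OF c]] unfolding shift by simp
  then have z: "coef (replicate i True @ replicate (m' - i) False) G = 0" if "i <= m'" for i
   using that G(3) by (subst (asm) sum_nonneg_eq_0_iff) auto
  have "coef ks G = 0" if "length ks = m'" for ks using coef_sort[of ks G] z that by auto
  then have "dg m' G" using dg_coef_0[OF G(1)] by blast
  then show False using G(2) by blast
 qed
 have c': "edg (Suc m) ?G" by (rule edg_mono[OF c]) (use m' in simp)
 have "coef (replicate (Suc m) ()) (U (conv G)) = coef (replicate (Suc m) ()) (U (%t. conv G (?T t)))"
  by (rule coef_U_shift[symmetric])
 also have "\<dots> = coef (replicate (Suc m) ()) (U (%t. conv ?G t + ?e t))" by simp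
 also have "\<dots> = coef (replicate (Suc m) ()) (U (conv ?G)) + coef (replicate (Suc m) ()) (U ?e)"
  by (rule coef_U_add[OF conjunct1[OF conv_exact[OF c']] ndg_mono[OF e]]) simp
 also have "coef (replicate (Suc m) ()) (U ?e) = 0" by (rule coef_U_0[OF e])
 finally show "coef (replicate (Suc m) ()) (U (conv G)) = (\<Sum>i\<le>m. coef (replicate i True @ replicate (m - i) False) G)"
  unfolding conjunct2[OF conv_exact[OF c']] shift by (simp only: add_0_right)
qed

lemma fdiffs_append: "fdiffs (xs @ ys) f = fdiffs ys (fdiffs xs f)"
 by (induction xs arbitrary: f) simp_all

text \<open>With the second degree fixed, \<open>G\<close> is of order \<open>d\<close> in the
  first, so more than \<open>d\<close> differences in the first direction annihilate it
  eventually.\<close>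

lemma coef_vanish:
 assumes G: "dg (Suc m) G" and nonneg: "!!g. 0 <= G g"
  and K: "!!b. \<exists>K::nat. \<forall>a. G (pr a b) <= int K * int (a + 1) ^ d" and i: "d < i" "i + j = m"
 shows "coef (replicate i True @ replicate j False) G = 0"
proof -
 obtain c where c: "edg (Suc m) (%g. G (g + (%_. c)))" using dg_edg[OF G] by blast
 let ?G = "%g. G (g + (%_. c))"
 \<comment> \<open>The threshold in \<open>a\<close> may depend on \<open>b\<close>. This is
   preserved by differences in the second direction, and one fixed large \<open>b\<close> suffices
   to read off the coefficient.\<close>
 let ?P = "%F :: (bool => nat) => int. \<forall>b. \<exists>a0. \<forall>a\<ge>a0. F (pr a b) = 0"
 have pr_add: "pr a b + (%_. c) = pr (a + c) (b + c)" for a b by (rule ext) (simp add: pr_def)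
 have pow: "fdiffs (replicate k True) F (pr a b) = (nd ^^ k) (%t. F (pr t b)) a" for k F a b
 proof (induction k arbitrary: F)
  case (Suc k)
  have "(%t. fdiff True F (pr t b)) = nd (%t. F (pr t b))" by (rule ext) (simp only: nd_def fdiff_pr)
  then show ?case using Suc.IH[of "fdiff True F"] by (simp add: funpow_swap1)
 qed simp
 have "?P (fdiffs (replicate i True) ?G)"
 proof
  fix b
  obtain K where K: "!!a. G (pr a (b + c)) <= int K * int (a + 1) ^ d" using K[of "b + c"] by blast
  have "ndg (Suc d) (%t. ?G (pr t b))"
  proof (rule ndg_bounded[OF ndg_slice(2)[OF c]])
   show "0 <= ?G (pr t b)" for t by (rule nonneg)
   show "?G (pr t b) <= int (K * (c + 1) ^ d) * int (t + 1) ^ d" for t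
   proof -
    have "?G (pr t b) <= int K * int (t + c + 1) ^ d" unfolding pr_add by (rule K)
    also have "\<dots> <= int K * (int (c + 1) * int (t + 1)) ^ d"
     by (intro mult_left_mono power_mono) (auto simp: algebra_simps)
    finally show ?thesis by (simp add: power_mult_distrib mult.assoc)
   qed
  qed
  then have "ndg i (%t. ?G (pr t b))" by (rule ndg_mono) (use i in simp)
  from ndg_evc_0[OF this] show "\<exists>a0. \<forall>a\<ge>a0. fdiffs (replicate i True) ?G (pr a b) = 0" unfolding pow .
 qed
 moreover have "?P (fdiffs (replicate k False) F)" if "?P F" for k F using that
 proof (induction k arbitrary: F)
  case (Suc k)
  have "?P (fdiff False F)"
  proof
   fix b
   obtain a0 where a0: "\<forall>a\<ge>a0. F (pr a b) = 0" using Suc.prems by blast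
   obtain a1 where a1: "\<forall>a\<ge>a1. F (pr a (Suc b)) = 0" using Suc.prems by blast
   show "\<exists>a0. \<forall>a\<ge>a0. fdiff False F (pr a b) = 0"
    unfolding fdiff_pr using a0 a1 by (intro exI[of _ "max a0 a1"]) simp
  qed
  then show ?case using Suc.IH by simp
 qed simp
 ultimately have z: "?P (fdiffs (replicate i True @ replicate j False) ?G)" unfolding fdiffs_append by blast
 have "dg (Suc (length (replicate i True @ replicate j False))) ?G" using edg_dg[OF c] i(2) by simp
 from coef_evc[OF this] obtain c1 where c1: "!!g. (\<forall>k. c1 <= g k) ==>
  fdiffs (replicate i True @ replicate j False) ?G g = coef (replicate i True @ replicate j False) ?G" by (auto simp: evc_def)
 obtain a0 where a0: "\<forall>a\<ge>a0. fdiffs (replicate i True @ replicate j False) ?G (pr a c1) = 0" using z by blast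
 have "coef (replicate i True @ replicate j False) ?G = 0"
  using c1[of "pr (max a0 c1) c1"] a0 by (simp add: pr_def[of "max a0 c1" c1, THEN fun_cong])
 then show ?thesis unfolding coef_shift .
qed

section \<open>Bigraded pieces of the coordinate ring of the product\<close>

interpretation G2: graded_coords "pcoord :: 'n::finite + 'n => _" isl
 by unfold_locales (rule pcoord_coordinates, assumption?)+

lemma G2_sc: "G2.sc s p = (s True *s fst p, s False *s snd p)" for p :: "'n::finite cvec2"
proof (rule G2.X_inj)
 fix k :: "'n + 'n"
 show "pcoord k (G2.sc s p) = pcoord k (s True *s fst p, s False *s snd p)"
  unfolding G2.X_sc by (cases k) (simp_all add: pcoord_simps)
qed

lemma all_bool: "(\<forall>k. P k) \<longleftrightarrow> P True & P False"
 by (metis (full_types))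

interpretation PP: multiprojective "pcoord :: 'n::finite + 'n => _" isl PP_dom "map_prod point point"
 "%k. if k then hyperplane_fst else hyperplane_snd"
proof
 show "PP_dom = {x :: 'n cvec2. \<forall>k. \<exists>i. isl i = k & pcoord i x ~= 0}"
  unfolding all_bool split_sum_ex by (auto simp: PP_dom_def pcoord_simps vec_eq_iff)
 fix x y :: "'n cvec2" assume "x \<in> PP_dom" "y \<in> PP_dom"
 then have ne: "fst x ~= 0" "snd x ~= 0" "fst y ~= 0" "snd y ~= 0" by (auto simp: PP_dom_def)
 have "map_prod point point x = map_prod point point y \<longleftrightarrow> point (fst x) = point (fst y) & point (snd x) = point (snd y)"
  by (simp add: prod_eq_iff)
 also have "\<dots> \<longleftrightarrow> (\<exists>c. c ~= 0 & fst y = c *s fst x) & (\<exists>c. c ~= 0 & snd y = c *s snd x)"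
  using point_eq_iff[OF ne(1,3)] point_eq_iff[OF ne(2,4)] by simp
 also have "\<dots> \<longleftrightarrow> (\<exists>s. (\<forall>k. s k ~= 0) & y = G2.sc s x)"
 proof
  assume "(\<exists>c. c ~= 0 & fst y = c *s fst x) & (\<exists>c. c ~= 0 & snd y = c *s snd x)"
  then obtain c c' where "c ~= 0" "fst y = c *s fst x" "c' ~= 0" "snd y = c' *s snd x" by blast
  then show "\<exists>s. (\<forall>k. s k ~= 0) & y = G2.sc s x"
   by (intro exI[of _ "%k. if k then c else c'"]) (simp add: G2_sc prod_eq_iff)
 next
  assume "\<exists>s. (\<forall>k. s k ~= 0) & y = G2.sc s x"
  then show "(\<exists>c. c ~= 0 & fst y = c *s fst x) & (\<exists>c. c ~= 0 & snd y = c *s snd x)"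
   by (auto simp: G2_sc)
 qed
 finally show "map_prod point point x = map_prod point point y \<longleftrightarrow> (\<exists>s. (\<forall>k. s k ~= 0) & y = G2.sc s x)" .
next
 show "map_prod point point ` PP_dom = (UNIV :: ('n pspace \<times> 'n pspace) set)"
 proof (rule UNIV_eq_I[symmetric])
  fix p :: "'n pspace \<times> 'n pspace"
  obtain x y where "x ~= 0" "fst p = point x" "y ~= 0" "snd p = point y" using point_surj by metis
  then show "p \<in> map_prod point point ` PP_dom" by (intro image_eqI[of _ _ "(x, y)"]) (auto simp: PP_dom_def prod_eq_iff)
 qed
next
 fix l :: "'n cvec2 => complex" and k
 assume l: "l \<in> (if k then hyperplane_fst else hyperplane_snd)"
 have X: "(\<Sum>i\<in>UNIV. fsc (a $ i) (pcoord (\<iota> i))) \<in> G2.R (G2.eg k)" if "!!i. isl (\<iota> i) = k"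
  for a :: "'n cvec" and \<iota> :: "'n => 'n + 'n"
 proof (intro fs.subspace_sum[OF G2.subspace_R] fs.subspace_scale[OF G2.subspace_R])
  show "pcoord (\<iota> i) \<in> G2.R (G2.eg k)" for i using G2.X_R[of "\<iota> i"] that by simp
 qed
 show "l \<in> G2.R (G2.eg k)"
 proof (cases k)
  case True
  then obtain a where "l = (%p. bilin a (fst p))" using l by (auto simp: hyperplane_fst_def)
  also have "\<dots> = (\<Sum>i\<in>UNIV. fsc (a $ i) (pcoord (Inl i)))"
   by (rule ext) (simp add: bilin_def sum_fun_apply pcoord_simps)
  finally show ?thesis using X[of Inl a] True by simp
 next
  case False
  then obtain a where "l = (%p. bilin a (snd p))" using l by (auto simp: hyperplane_snd_def)
  also have "\<dots> = (\<Sum>i\<in>UNIV. fsc (a $ i) (pcoord (Inr i)))"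
   by (rule ext) (simp add: bilin_def sum_fun_apply pcoord_simps)
  finally show ?thesis using X[of Inr a] False by simp
 qed
next
 fix i :: "'n + 'n"
 show "pcoord i \<in> (if isl i then hyperplane_fst else hyperplane_snd)"
 proof (cases i)
  case (Inl j)
  then have "pcoord i = (%p. bilin (axis j 1) (fst p))" by (simp add: pcoord_simps bilin_axis)
  then show ?thesis using Inl by (auto simp: hyperplane_fst_def)
 next
  case (Inr j)
  then have "pcoord i = (%p. bilin (axis j 1) (snd p))" by (simp add: pcoord_simps bilin_axis)
  then show ?thesis using Inr by (auto simp: hyperplane_snd_def)
 qed
qed

lemma bidegree_sum:
 fixes e :: "'n::finite + 'n => nat"
 shows "(\<Sum>i\<in>UNIV. e i) = G2.mdeg e True + G2.mdeg e False"
proof -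
 have "(\<Sum>i\<in>UNIV. e i) = (\<Sum>i\<in>{i. isl i = True} \<union> {i. isl i = False}. e i)" by (rule sum.cong) auto
 also have "\<dots> = (\<Sum>i\<in>{i. isl i = True}. e i) + (\<Sum>i\<in>{i. isl i = False}. e i)"
  by (rule sum.union_disjoint) auto
 finally show ?thesis by (simp only: G2.mdeg_def)
qed

lemma bigraded_R: "a <= t ==> G2.R (pr a (t - a)) \<subseteq> VV.R (%_. t)"
 unfolding G2.R_def VV.R_def
proof (intro fs.span_mono image_mono subsetI)
 fix e :: "'n::finite + 'n => nat" assume "a <= t" and e: "e \<in> {e. G2.mdeg e = pr a (t - a)}"
 have "G2.mdeg e True = a" "G2.mdeg e False = t - a" using e by (simp_all add: pr_def)
 then show "e \<in> {e. VV.mdeg e = (%_. t)}" using \<open>a <= t\<close> by (simp add: VV.mdeg_unit bidegree_sum)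
qed

lemma bigraded_decomp:
 assumes "f \<in> VV.R (%_. t)"
 shows "\<exists>F. (\<forall>a. F a \<in> G2.R (pr a (t - a))) & f = (\<Sum>a<Suc t. F a)"
 using assms unfolding VV.R_def
proof (induction rule: fs.span_induct_alt)
 case base
 have "0 = (\<Sum>a<Suc t. (%_. 0) a)" by simp
 then show ?case using fs.subspace_0[OF G2.subspace_R] by (intro exI[of _ "%_. 0"] conjI allI)
next
 case (step c u v)
 then obtain e where e: "u = VV.mon e" "VV.mdeg e = (%_. t)" by blast
 obtain F where F: "\<forall>a. F a \<in> G2.R (pr a (t - a))" "v = (\<Sum>a<Suc t. F a)" using step.IH by (elim exE conjE)
 let ?a = "G2.mdeg e True"
 have t: "?a + G2.mdeg e False = t" using e(2) bidegree_sum[of e] by (simp add: VV.mdeg_unit fun_eq_iff)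
 have "G2.mdeg e = pr ?a (t - ?a)" using t by (subst pr_cases) (auto simp: pr_def fun_eq_iff)
 then have u: "u \<in> G2.R (pr ?a (t - ?a))" using G2.mon_R[of e] unfolding e(1) by simp
 define F' where "F' a = (if a = ?a then fsc c u + F a else F a)" for a
 have "F' a \<in> G2.R (pr a (t - a))" for a
 proof (cases "a = ?a")
  case True
  have "fsc c u + F ?a \<in> G2.R (pr ?a (t - ?a))"
   using F(1) by (intro fs.subspace_add[OF G2.subspace_R] fs.subspace_scale[OF G2.subspace_R] u) blast
  then show ?thesis unfolding F'_def True by (simp only: if_True simp_thms)
 qed (use F(1) in \<open>simp add: F'_def\<close>)
 moreover have "(\<Sum>a<Suc t. F' a) = fsc c u + v"
 proof -
  have "(\<Sum>a<Suc t. F' a) = (\<Sum>a<Suc t. (if a = ?a then fsc c u else 0) + F a)"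
   by (rule sum.cong[OF refl]) (simp only: F'_def split: if_split, simp)
  also have "\<dots> = (\<Sum>a<Suc t. if a = ?a then fsc c u else 0) + v" unfolding F(2) by (rule sum.distrib)
  also have "(\<Sum>a<Suc t. if a = ?a then fsc c u else 0) = fsc c u"
   using t by (subst sum.delta) (simp_all only: finite_lessThan lessThan_iff, simp)
  finally show ?thesis .
 qed
 ultimately show ?case by (intro exI[of _ F'] conjI allI) simp_all
qed

lemma bigraded_components:
 fixes F :: "nat => 'n::finite cvec2 => complex"
 assumes "fs.subspace V" "G2.stable V" "(\<Sum>a<s. F a) \<in> V" "!!a. a < s ==> F a \<in> G2.R (pr a (t - a))" "a < s"
 shows "F a \<in> V"
proof -
 let ?p = "%a. pr a (t - a)"
 have pT: "?p a True = a" for a by (simp add: pr_def)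
 have inj: "inj_on ?p {..<s}" by (rule inj_onI) (metis pT)
 have "(\<Sum>g\<in>?p ` {..<s}. F (g True)) = (\<Sum>a<s. F a)" unfolding sum.reindex[OF inj] comp_def pT ..
 then have "(\<Sum>g\<in>?p ` {..<s}. F (g True)) \<in> V" using assms(3) by (simp only:)
 then have "F (?p a True) \<in> V"
  by (rule G2.stable_component[OF assms(1,2), of "?p ` {..<s}" "%g. F (g True)", rotated 2])
   (use assms(4,5) pT in auto)
 then show ?thesis unfolding pT .
qed

text \<open>The sum of the first \<open>s\<close> bihomogeneous pieces of \<open>J\<close> in total
  degree \<open>t\<close>, built recursively so that dimensions add one piece at a time. For
  \<open>s > Suc t\<close> the truncated \<open>t - s\<close> would leave total degree
  \<open>t\<close>, hence the bound in the dimension formula.\<close>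

primrec bisum :: "('n::finite cvec2 => complex) set => nat => nat =>
  ('n cvec2 => complex) set" where
 "bisum J t 0 = {0}"
| "bisum J t (Suc s) = {u + v | u v. u \<in> bisum J t s & v \<in> J \<inter> G2.R (pr s (t - s))}"

lemma bisum:
 fixes J :: "('n::finite cvec2 => complex) set"
 assumes J: "pideal J"
 shows "fs.subspace (bisum J t s)"
  and "u \<in> bisum J t s \<longleftrightarrow> (\<exists>F. (\<forall>a. F a \<in> J \<inter> G2.R (pr a (t - a))) & u = (\<Sum>a<s. F a))"
  and "s <= Suc t ==> fs.dim (bisum J t s) = (\<Sum>a<s. fs.dim (J \<inter> G2.R (pr a (t - a))))"
proof -
 have sJ: "fs.subspace (J \<inter> G2.R g)" for g using pideal_subspace[OF J] G2.subspace_R by (rule fs.subspace_inter)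
 have z: "0 \<in> J \<inter> G2.R g" for g using fs.subspace_0[OF sJ] .
 show sub: "fs.subspace (bisum J t s)" for s
 proof (induction s)
  case 0
  show ?case unfolding bisum.simps by (rule fs.subspace_single_0)
 next
  case (Suc s)
  show ?case unfolding bisum.simps by (rule fs.subspace_sums[OF Suc.IH sJ])
 qed
 show iff: "u \<in> bisum J t s \<longleftrightarrow> (\<exists>F. (\<forall>a. F a \<in> J \<inter> G2.R (pr a (t - a))) & u = (\<Sum>a<s. F a))" for u s
 proof (induction s arbitrary: u)
  case 0
  then show ?case using z by (auto simp del: Int_iff intro!: exI[of _ "%_. 0"])
 next
  case (Suc s)
  show ?case
  proof
   assume "u \<in> bisum J t (Suc s)"
   then obtain u' v where uv: "u = u' + v" "u' \<in> bisum J t s" "v \<in> J \<inter> G2.R (pr s (t - s))"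
    unfolding bisum.simps mem_Collect_eq by (elim exE conjE)
   from uv(2)[unfolded Suc.IH] obtain F where F: "\<forall>a. F a \<in> J \<inter> G2.R (pr a (t - a))" "u' = (\<Sum>a<s. F a)"
    by (elim exE conjE)
   have "(\<Sum>a<Suc s. (F(s := v)) a) = (\<Sum>a<s. F a) + v"
    unfolding sum.lessThan_Suc by (rule arg_cong2[where f = "(+)"]) (auto intro: sum.cong)
   then have "u = (\<Sum>a<Suc s. (F(s := v)) a)" using uv(1) F(2) by (simp only:)
   moreover have "\<forall>a. (F(s := v)) a \<in> J \<inter> G2.R (pr a (t - a))" using F(1) uv(3) by (simp del: Int_iff)
   ultimately show "\<exists>F. (\<forall>a. F a \<in> J \<inter> G2.R (pr a (t - a))) & u = (\<Sum>a<Suc s. F a)"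
    by (intro exI[of _ "F(s := v)"] conjI)
  next
   assume "\<exists>F. (\<forall>a. F a \<in> J \<inter> G2.R (pr a (t - a))) & u = (\<Sum>a<Suc s. F a)"
   then obtain F where F: "\<forall>a. F a \<in> J \<inter> G2.R (pr a (t - a))" "u = (\<Sum>a<Suc s. F a)" by (elim exE conjE)
   have "(\<Sum>a<s. F a) \<in> bisum J t s" unfolding Suc.IH using F(1) by (intro exI[of _ F] conjI refl)
   then show "u \<in> bisum J t (Suc s)" unfolding bisum.simps F(2) sum.lessThan_Suc using F(1) by blast
  qed
 qed
 have le: "bisum J t s \<subseteq> VV.R (%_. t)" if s: "s <= Suc t" for s
 proof
  fix u assume "u \<in> bisum J t s"
  then obtain F where F: "\<forall>a. F a \<in> J \<inter> G2.R (pr a (t - a))" "u = (\<Sum>a<s. F a)" unfolding iff by (elim exE conjE)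
  have "F a \<in> VV.R (%_. t)" if "a < s" for a
  proof (rule subsetD[OF bigraded_R])
   show "a <= t" using that s by simp
   show "F a \<in> G2.R (pr a (t - a))" using F(1) by blast
  qed
  then show "u \<in> VV.R (%_. t)" unfolding F(2) by (intro fs.subspace_sum[OF VV.subspace_R]) simp
 qed
 show "s <= Suc t ==> fs.dim (bisum J t s) = (\<Sum>a<s. fs.dim (J \<inter> G2.R (pr a (t - a))))"
 proof (induction s)
  case 0
  have "findim (bisum J t 0)" by (rule findim_subset[OF VV.findim_R le]) simp
  then have "fs.dim (bisum J t 0) = 0" using fs_dim_0_iff[of "bisum J t 0"] unfolding bisum.simps by blast
  then show ?case unfolding lessThan_0 sum.empty .
 next
  case (Suc s)
  let ?B = "J \<inter> G2.R (pr s (t - s))"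
  have "bisum J t s \<inter> ?B \<subseteq> {0}"
  proof
   fix u assume u: "u \<in> bisum J t s \<inter> ?B"
   then have "u \<in> bisum J t s" by blast
   then obtain F where F: "\<forall>a. F a \<in> J \<inter> G2.R (pr a (t - a))" "u = (\<Sum>a<s. F a)" unfolding iff by (elim exE conjE)
   define F' where "F' a = (if a = s then - u else F a)" for a
   have "(\<Sum>a<Suc s. F' a) = (\<Sum>a<s. F a) + - u"
    unfolding sum.lessThan_Suc by (rule arg_cong2[where f = "(+)"]) (auto simp: F'_def intro: sum.cong)
   then have "(\<Sum>a<Suc s. F' a) = 0" unfolding F(2) by (simp only: right_minus)
   then have "(\<Sum>a<Suc s. F' a) \<in> {0}" by blast
   moreover have "F' a \<in> G2.R (pr a (t - a))" if "a < Suc s" for a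
    unfolding F'_def using F(1) u fs.subspace_neg[OF G2.subspace_R] by auto
   moreover have "G2.stable {0}" by (simp add: G2.stable_def zero_fun_def)
   ultimately have "F' s \<in> {0}" by (intro bigraded_components[where V = "{0}" and s = "Suc s" and F = F' and t = t]) (simp_all add: fs.subspace_single_0)
   then have "- u = 0" by (simp only: F'_def if_True simp_thms singleton_iff)
   then show "u \<in> {0}" by (simp only: neg_equal_0_iff_equal singleton_iff)
  qed
  then have d: "fs.dim (bisum J t (Suc s)) = fs.dim (bisum J t s) + fs.dim ?B" unfolding bisum.simps
   by (intro dim_direct_sum sub sJ findim_subset[OF VV.findim_R le] findim_subset[OF G2.findim_R]) (use Suc.prems in auto)
  have "fs.dim (bisum J t s) = (\<Sum>a<s. fs.dim (J \<inter> G2.R (pr a (t - a))))"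
   by (rule Suc.IH) (use Suc.prems in simp)
  then show ?case unfolding d sum.lessThan_Suc by (simp only:)
 qed
qed

lemma total_dim:
 fixes J :: "('n::finite cvec2 => complex) set"
 assumes J: "pideal J" "G2.stable J"
 shows "fs.dim (J \<inter> VV.R (%_. t)) = (\<Sum>a\<le>t. fs.dim (J \<inter> G2.R (pr a (t - a))))"
proof -
 have "J \<inter> VV.R (%_. t) = bisum J t (Suc t)"
 proof (rule Set.set_eqI, rule iffI)
  fix f assume f: "f \<in> J \<inter> VV.R (%_. t)"
  then have "f \<in> VV.R (%_. t)" by blast
  from bigraded_decomp[OF this] obtain F where F: "\<forall>a. F a \<in> G2.R (pr a (t - a))" "f = (\<Sum>a<Suc t. F a)"
   by (elim exE conjE)
  have sJ: "(\<Sum>a<Suc t. F a) \<in> J" using f unfolding F(2)[symmetric] by blast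
  have FJ: "F a \<in> J" if "a < Suc t" for a
   by (rule bigraded_components[OF pideal_subspace[OF J(1)] J(2) sJ _ that]) (use F(1) in blast)
  define F' where "F' a = (if a < Suc t then F a else 0)" for a
  have "F' a \<in> J \<inter> G2.R (pr a (t - a))" for a
   unfolding F'_def using FJ F(1) pidealD(2)[OF J(1)] fs.subspace_0[OF G2.subspace_R] by auto
  moreover have "f = (\<Sum>a<Suc t. F' a)" unfolding F(2) by (rule sum.cong) (auto simp: F'_def)
  ultimately show "f \<in> bisum J t (Suc t)" unfolding bisum(2)[OF J(1)] by (intro exI[of _ F'] conjI allI)
 next
  fix f assume "f \<in> bisum J t (Suc t)"
  then obtain F where F: "\<forall>a. F a \<in> J \<inter> G2.R (pr a (t - a))" "f = (\<Sum>a<Suc t. F a)"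
   unfolding bisum(2)[OF J(1)] by (elim exE conjE)
  have "F a \<in> J \<inter> VV.R (%_. t)" if "a \<in> {..<Suc t}" for a
   using bigraded_R[of a t] F(1) that by (auto simp: less_Suc_eq_le)
  then show "f \<in> J \<inter> VV.R (%_. t)"
   unfolding F(2) by (intro fs.subspace_sum[OF fs.subspace_inter[OF pideal_subspace[OF J(1)] VV.subspace_R]])
 qed
 then show ?thesis using bisum(3)[OF J(1), of "Suc t" t] by (simp add: lessThan_Suc_atMost)
qed

lemma H_total:
 fixes J :: "('n::finite cvec2 => complex) set"
 assumes J: "pideal J" "G2.stable J"
 shows "VV.H J (%_. t) = conv (G2.H J) t"
proof -
 have pI: "pideal (Collect pol :: ('n cvec2 => complex) set)"
  unfolding pideal_def by (auto intro: pol_0 pol_add pol_mult)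
 have "G2.stable (Collect pol)" by (auto simp: G2.stable_def intro: G2.pol_sc)
 note d = total_dim[OF pI this, of t]
 have "Collect pol \<inter> VV.R g = (VV.R g :: ('n cvec2 => complex) set)" for g
  using VV.R_pol by blast
 moreover have "Collect pol \<inter> G2.R g = (G2.R g :: ('n cvec2 => complex) set)" for g
  using G2.R_pol by blast
 ultimately have "fs.dim (VV.R (%_. t) :: ('n cvec2 => complex) set) =
   (\<Sum>a\<le>t. fs.dim (G2.R (pr a (t - a)) :: ('n cvec2 => complex) set))"
  using d by (simp only:)
 then show ?thesis unfolding VV.H_def conv_def G2.H_def total_dim[OF J] by (simp add: sum_subtractf)
qed

text \<open>The difference in direction \<open>k\<close> is again a Hilbert function, hence
  nonnegative.\<close>

lemma H_prime_mono:
 assumes "G2.hideal P" "pprime P" "G2.relevant P"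
 shows "G2.H P g <= G2.H P (g(k := Suc (g k)))"
proof -
 obtain i where i: "isl i = k" "pcoord i ~: P" using assms(3) unfolding G2.relevant_def by blast
 have "fdiff k (G2.H P) = (%g. G2.H (adjoin P (pcoord i)) (g + G2.eg k))"
  by (rule G2.fdiff_H_prime[OF assms(1,2) _ i(2)]) (use G2.X_R[of i] i(1) in simp)
 then have "0 <= fdiff k (G2.H P) g" using G2.H_nonneg by simp
 then show ?thesis by (simp add: fdiff_def)
qed

section \<open>The conormal variety and the ED correspondence\<close>

lemma zset_vanishing_ideal: "\<I> (zset (\<I> S)) = \<I> S"
proof
 show "\<I> (zset (\<I> S)) \<subseteq> \<I> S" by (rule vanishing_ideal_antimono[OF subset_zset_vanishing])
 show "\<I> S \<subseteq> \<I> (zset (\<I> S))" by (auto simp: vanishing_ideal_def zset_def)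
qed

text \<open>Two nonempty open subsets of the irreducible data locus meet, so the cardinality in the
  definite description is unique.\<close>

lemma ED_degree_eqI:
 assumes fin: "!!u. u \<in> ED_data_locus X Z ==> \<Theta> u ~= 0 ==>
   finite {x. (x, u) \<in> ED_corr X Z} & card {x. (x, u) \<in> ED_corr X Z} = \<rho>"
  and \<Theta>: "pol \<Theta>" "\<Theta> ~: \<I> (ED_data_locus X Z)"
  and prime: "pprime (\<I> (ED_data_locus X Z))"
 shows "ED_degree X Z = \<rho>" unfolding ED_degree_def
proof (rule the_equality)
 let ?D = "ED_data_locus X Z"
 have "openin zariski {u. \<Theta> u ~= 0}"
  unfolding openin_zariski using \<Theta>(1) by (intro exI[of _ "{\<Theta>}"]) auto
 moreover have "{u. \<Theta> u ~= 0} \<inter> ?D ~= {}" using \<Theta> by (auto simp: vanishing_ideal_def)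
 ultimately show "\<exists>U. openin zariski U & U \<inter> ?D ~= {} & (\<forall>u\<in>U \<inter> ?D.
   finite {x. (x, u) \<in> ED_corr X Z} & card {x. (x, u) \<in> ED_corr X Z} = \<rho>)"
  using fin by (intro exI[of _ "{u. \<Theta> u ~= 0}"] conjI ballI) auto
 fix k assume "\<exists>U. openin zariski U & U \<inter> ?D ~= {} & (\<forall>u\<in>U \<inter> ?D.
   finite {x. (x, u) \<in> ED_corr X Z} & card {x. (x, u) \<in> ED_corr X Z} = k)"
 then obtain U where U: "openin zariski U" "U \<inter> ?D ~= {}"
  "!!u. u \<in> U ==> u \<in> ?D ==> card {x. (x, u) \<in> ED_corr X Z} = k" by blast
 obtain F where F: "F \<subseteq> Collect pol" "U = {x. \<exists>f\<in>F. f x ~= 0}" using U(1) unfolding openin_zariski by blast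
 obtain u f where f: "u \<in> ?D" "f \<in> F" "f u ~= 0" using U(2) F(2) by blast
 have "pol f" "f ~: \<I> ?D" using f F(1) by (auto simp: vanishing_ideal_def)
 from pprime_witness(2)[OF prime \<Theta>(1) this(1) \<Theta>(2) this(2)]
 obtain v where v: "v \<in> ?D" "\<Theta> v ~= 0" "f v ~= 0" by blast
 then have "v \<in> U" using F(2) f(2) by blast
 then show "k = \<rho>" using U(3)[OF _ v(1)] fin[OF v(1,2)] by simp
qed

lemma projective_degree_cone:
 fixes PB :: "('n::finite cvec => complex) set"
 assumes PB: "V.hideal PB" "pprime PB" "V.relevant PB" and m: "dg (Suc m) (V.H PB)" "\<not> dg m (V.H PB)"
 shows "int (projective_degree (projectivization (zset PB))) = coef (replicate m ()) (V.H PB)"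
proof -
 let ?Y = "projectivization (zset PB)"
 have "zset PB - {0} = P_dom \<inter> zset PB" by (auto simp: P_dom_def)
 then have Y: "?Y = P.Vp PB" unfolding projectivization_def P.Vp_def by (rule arg_cong)
 have IW: "P.IW ?Y = PB" unfolding Y by (rule P.IW_Vp[OF PB])
 have cl: "closedin zariski_P ?Y" unfolding Y by (rule P.closed_Vp[OF PB(1)])
 have irr: "irreducible_in zariski_P ?Y" using P.irreducible_iff_prime[OF cl] PB(2) unfolding IW by blast
 have "krull_dim zariski_P ?Y = enat m" by (rule P.krull_dim_T[OF cl irr]) (use m IW in simp_all)
 then have "projective_degree ?Y = (THE k. intersection_number P_dom point (replicate m hyperplane_P) ?Y k)"
  by (simp add: projective_degree_def)
 moreover have "map (%_. hyperplane_P) (replicate m ()) = replicate m (hyperplane_P :: ('n cvec => complex) set)"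
  by (simp add: map_replicate_const)
 ultimately show ?thesis using P.the_intersection_number[OF cl irr, of "replicate m ()"] m(1) unfolding IW by simp
qed

section \<open>Multidegrees of the conormal variety\<close>

context relative_conormal
begin

lemma S_scale': "p \<in> S ==> (!!k. s k ~= 0) ==> G2.sc s p \<in> S"
 using S_scale[of "fst p" "snd p" "s True" "s False"] by (simp add: G2_sc)

lemma G2_hideal: "G2.hideal (\<I> S)"
 unfolding G2.hideal_def by (intro conjI vanishing_ideal_pideal G2.stable_vanishing_ideal S_scale')

text \<open>For fixed degree \<open>b\<close> in \<open>y\<close>, functions of bidegree
  \<open>(a, b)\<close> on \<open>S\<close> are combinations of finitely many monomials in
  \<open>y\<close> whose coefficients are forms of degree \<open>a\<close> on \<open>B\<close>.
  Their number is of order \<open>d\<close> in \<open>a\<close>, which removes the multidegrees with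
  \<open>i > d\<close>.\<close>

lemma dim_B_bound: "\<exists>K::nat. \<forall>a. G2.H (\<I> S) (pr a b) <= int K * int (a + 1) ^ d"
proof -
 let ?E = "{e :: 'n => nat. (\<Sum>i\<in>UNIV. e i) = b}"
 have finE: "finite ?E" by (rule finite_subset[OF _ finite_degree(2)[of b]]) auto
 have bound: "G2.H (\<I> S) (pr a b) <= int (card ?E) * V.H (\<I> B) (%_. a)" for a
 proof -
  let ?V = "restr B ` V.R (%_. a)"
  obtain Bs where Bs: "finite Bs" "?V \<subseteq> fs.span Bs" "card Bs = fs.dim ?V"
   using findim_basis[OF findim_image[OF V.findim_R flin_restr], of B "%_. a"] by metis
  define \<psi> where "\<psi> e u = (%p. if p \<in> S then u (fst p) * (\<Prod>i\<in>UNIV. snd p $ i ^ e i) else 0)"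
   for e :: "'n => nat" and u :: "'n cvec => complex"
  have l\<psi>: "flin (\<psi> e)" for e by (rule flinI) (auto simp: \<psi>_def algebra_simps)
  let ?G = "\<Union>e\<in>?E. \<psi> e ` Bs"
  have "restr S ` G2.R (pr a b) \<subseteq> fs.span ?G" unfolding G2.R_def flin_image_span[OF flin_restr]
  proof (rule fs.span_minimal[OF _ fs.subspace_span], rule subsetI)
   fix u assume "u \<in> restr S ` G2.mon ` {e. G2.mdeg e = pr a b}"
   then obtain e :: "'n + 'n => nat" where e: "u = restr S (VV.mon e)" "G2.mdeg e = pr a b" by blast
   have "G2.mdeg e True = (\<Sum>i\<in>UNIV. e (Inl i))"
    unfolding G2.mdeg_def by (rule sum.reindex_bij_witness[of _ Inl projl]) auto
   moreover have "G2.mdeg e False = (\<Sum>i\<in>UNIV. e (Inr i))"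
    unfolding G2.mdeg_def by (rule sum.reindex_bij_witness[of _ Inr projr]) auto
   ultimately have deg: "(\<Sum>i\<in>UNIV. e (Inl i)) = a" "(\<Sum>i\<in>UNIV. e (Inr i)) = b" using e(2) by (simp_all add: pr_def)
   let ?e1 = "%i. e (Inl i)" and ?e2 = "%i. e (Inr i)"
   have "V.mon ?e1 \<in> V.R (%_. a)" using V.mon_R[of ?e1] deg(1) by (simp add: V.mdeg_unit)
   then have "restr B (V.mon ?e1) \<in> fs.span Bs" using Bs(2) by blast
   then have "\<psi> ?e2 (restr B (V.mon ?e1)) \<in> fs.span (\<psi> ?e2 ` Bs)" using flin_image_span[OF l\<psi>, of ?e2 Bs] by blast
   moreover have "fs.span (\<psi> ?e2 ` Bs) \<subseteq> fs.span ?G" using deg(2) by (intro fs.span_mono) blast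
   moreover have "u = \<psi> ?e2 (restr B (V.mon ?e1))"
   proof
    fix p
    have "fst p \<in> B" if "p \<in> S" using that by (auto simp: S_def)
    then show "u p = \<psi> ?e2 (restr B (V.mon ?e1)) p" by (simp add: e(1) restr_def \<psi>_def VV_mon)
   qed
   ultimately show "u \<in> fs.span ?G" by blast
  qed
  then have "fs.dim (restr S ` G2.R (pr a b)) <= card ?G" by (rule fs.dim_le_card) (use finE Bs(1) in simp)
  also have "\<dots> <= (\<Sum>e\<in>?E. card (\<psi> e ` Bs))" by (rule card_UN_le[OF finE])
  also have "\<dots> <= (\<Sum>e\<in>?E. card Bs)" by (intro sum_mono card_image_le Bs(1))
  also have "\<dots> = card ?E * fs.dim ?V" using Bs(3) by simp
  finally have "int (fs.dim (restr S ` G2.R (pr a b))) <= int (card ?E) * int (fs.dim ?V)"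
   unfolding of_nat_mult[symmetric] of_nat_le_iff .
  moreover have "G2.H (\<I> S) (pr a b) = int (fs.dim (restr S ` G2.R (pr a b)))"
   by (rule G2.H_eq_dim_image[OF flin_restr]) (use restr_eq_0 G2.R_pol in blast)
  ultimately show ?thesis unfolding V.H_vanishing by simp
 qed
 obtain K where K: "!!a. \<bar>V.H (\<I> B) (%_. a)\<bar> <= int K * int (a + 1) ^ d"
  using ndg_growth[of d "%a. V.H (\<I> B) (%_. a)"] dimB unfolding dg_unit by blast
 have "G2.H (\<I> S) (pr a b) <= int (card ?E * K) * int (a + 1) ^ d" for a
 proof -
  have "int (card ?E) * V.H (\<I> B) (%_. a) <= int (card ?E) * (int K * int (a + 1) ^ d)"
   using K[of a] by (intro mult_left_mono) auto
  then show ?thesis using bound[of a] by (simp add: mult.assoc)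
 qed
 then show ?thesis by blast
qed

end

locale ED_conormal = relative_conormal +
 assumes nonzero: "\<exists>x\<in>smooth_locus A \<inter> B. x ~= 0" and proper_sub: "Suc n < CARD('a)"
begin

text \<open>\<open>proper_sub\<close> makes the frame at a smooth point nonempty, and a row of an
  invertible frame is a nonzero normal vector.\<close>

lemma coord_not_vanishing: "\<exists>i. pcoord (Inl i) ~: \<I> S" "\<exists>i. pcoord (Inr i) ~: \<I> S"
proof -
 obtain x where x: "x \<in> smooth_locus A" "x \<in> B" "x ~= 0" using nonzero by blast
 obtain C F where CF: "!!i. i \<in> C ==> F i \<in> \<I> A" "det (frame C F x) ~= 0" "card C + Suc n = CARD('a)"
  by (rule smooth_frame[OF x(1)]) blast
 have "C ~= {}" using CF(3) proper_sub by auto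
 then obtain j where j: "j \<in> C" by blast
 have "grad (F j) x ~= 0"
 proof
  assume z: "grad (F j) x = 0"
  have "(\<Sum>i\<in>UNIV. (if i = j then 1 else 0) *s frame C F x $ i) = 0"
   by (rule sum.neutral) (use z j in \<open>auto simp: frame_def\<close>)
  then have "(if j = j then 1 else 0 :: complex) = 0"
   using CF(2)[unfolded det_iff_rows, rule_format, of "%i. if i = j then 1 else 0" j] by blast
  then show False by simp
 qed
 then obtain i where i: "grad (F j) x $ i ~= 0" by (auto simp: vec_eq_iff)
 have S: "(x, grad (F j) x) \<in> S" unfolding S_iff using x CF(1)[OF j] by blast
 then show "\<exists>i. pcoord (Inr i) ~: \<I> S"
  using i vanD[OF _ S, of "pcoord (Inr i)"] by (intro exI[of _ i]) (auto simp: pcoord_simps)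
 obtain i' where "x $ i' ~= 0" using x(3) by (auto simp: vec_eq_iff)
 then show "\<exists>i. pcoord (Inl i) ~: \<I> S"
  using vanD[OF _ S, of "pcoord (Inl i')"] by (intro exI[of _ i']) (auto simp: pcoord_simps)
qed

lemma S_relevant: "G2.relevant (\<I> S)"
 unfolding G2.relevant_def all_bool split_sum_ex using coord_not_vanishing by simp

abbreviation "W \<equiv> zariski_PP closure_of (map_prod point point ` (S \<inter> PP_dom))"

text \<open>Discarding the points of \<open>S\<close> with \<open>x = 0\<close> or
  \<open>y = 0\<close> keeps the vanishing ideal, since on the irreducible \<open>S\<close> some
  coordinate of either kind is not identically 0. So the bihomogeneous ideal of \<open>W\<close> is
  that of the cone \<open>S\<close>.\<close>

lemma W_facts: "PP.IW W = \<I> S" "W = map_prod point point ` (PP_dom \<inter> zset (\<I> S))"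
 "closedin zariski_PP W" "irreducible_in zariski_PP W"
proof -
 let ?S = "S \<inter> PP_dom"
 have "\<I> ?S \<subseteq> \<I> S"
 proof
  fix f assume f: "f \<in> \<I> ?S"
  obtain i j where ij: "pcoord (Inl i) ~: \<I> S" "pcoord (Inr j) ~: \<I> S"
   using coord_not_vanishing by blast
  have pf: "pol f" using f by (simp add: vanishing_ideal_def)
  show "f \<in> \<I> S"
  proof (rule generic_vanishing[OF S_prime pol_mult[OF VV.pol_X VV.pol_X] pprime_witness(1)[OF S_prime VV.pol_X VV.pol_X ij] pf])
   fix p assume p: "p \<in> S" "(pcoord (Inl i) * pcoord (Inr j)) p ~= 0"
   then have "fst p ~= 0" "snd p ~= 0" by (auto simp: pcoord_simps)
   then have "p \<in> PP_dom" by (cases p) (simp add: PP_dom_def)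
   then show "f p = 0" using f p(1) vanD by blast
  qed
 qed
 then have eq: "\<I> ?S = \<I> S" using vanishing_ideal_antimono[of ?S S] by blast
 have sc: "G2.sc s p \<in> ?S" if "p \<in> ?S" "!!k. s k ~= 0" for p s
  using S_scale'[of p s] PP.D_sc[of p s] that by blast
 have c: "W = PP.Vp (\<I> ?S)" "PP.IW W = \<I> ?S" using PP.closure_of_image[of ?S] sc by blast+
 show IW: "PP.IW W = \<I> S" using c(2) unfolding eq .
 show "W = map_prod point point ` (PP_dom \<inter> zset (\<I> S))" using c(1) unfolding eq PP.Vp_def .
 show cl: "closedin zariski_PP W" by (rule closedin_closure_of)
 show "irreducible_in zariski_PP W" using PP.irreducible_iff_prime[OF cl] S_prime unfolding IW by blast
qed

abbreviation "Hilb \<equiv> G2.H (\<I> S)"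

text \<open>\<open>m\<close> is the dimension of the conormal variety. Its two cone directions give
  \<open>S\<close> dimension \<open>m + 2\<close>, and the Hilbert function of \<open>S\<close> in
  the total grading has order one less, so that \<open>Suc m\<close> differences extract its leading
  coefficient.\<close>

theorem multidegrees:
 assumes m: "Suc (Suc m) = Suc d + (CARD('a) - Suc n)"
 shows "coef (replicate (Suc m) ()) (VV.H (\<I> S)) = (\<Sum>i\<le>d. int (bidegree i (m - i) W))"
proof -
 obtain m' where m': "dg (Suc m') Hilb" "\<not> dg m' Hilb"
  using PP.ex_dim[OF W_facts(3,4)] unfolding W_facts(1) by blast
 have L: "coef ks Hilb = int (THE k. intersection_number PP_dom (map_prod point point)
   (map (%k. if k then hyperplane_fst else hyperplane_snd) ks) W k)" if "dg (Suc (length ks)) Hilb" for ks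
  using PP.the_intersection_number[OF W_facts(3,4), of ks] that unfolding W_facts(1) by simp
 have HVV: "VV.H (\<I> S) (%_. t) = conv Hilb t" for t
  by (rule H_total[OF vanishing_ideal_pideal G2.hidealD(2)[OF G2_hideal]])
 then have H: "VV.H (\<I> S) = U (conv Hilb)" 
 proof -
  have "VV.H (\<I> S) g = conv Hilb (g ())" for g
  proof -
   have "g = (%_. g ())" by (rule ext) simp
   then show ?thesis using HVV[of "g ()"] by simp
  qed
  then show ?thesis by (rule ext)
 qed
 have tot: "ndg (Suc (Suc m)) (conv Hilb)" using S_dim(1) unfolding m[symmetric] dg_unit HVV .
 have c: "0 <= coef ks Hilb" if "length ks = m'" for ks using L[of ks] m'(1) that by simp
 have mono: "Hilb g <= Hilb (g(k := Suc (g k)))" for g k by (rule H_prime_mono[OF G2_hideal S_prime S_relevant])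
 note tc = total_coefficient[of Hilb, OF mono G2.H_nonneg tot m' c]
 have dm: "dg (Suc m) Hilb" by (rule dg_mono[OF m'(1)]) (use tc(1) in simp)
 have dle: "d <= m" using m proper_sub by linarith
 have "coef (replicate (Suc m) ()) (VV.H (\<I> S)) = (\<Sum>i\<le>m. coef (replicate i True @ replicate (m - i) False) Hilb)"
  unfolding H by (rule tc(2))
 also have "\<dots> = (\<Sum>i\<le>d. coef (replicate i True @ replicate (m - i) False) Hilb)"
 proof (rule sum.mono_neutral_right)
  show "\<forall>i\<in>{..m} - {..d}. coef (replicate i True @ replicate (m - i) False) Hilb = 0"
  proof
   fix i assume i: "i \<in> {..m} - {..d}"
   show "coef (replicate i True @ replicate (m - i) False) Hilb = 0"
    by (rule coef_vanish[OF dm G2.H_nonneg dim_B_bound]) (use i in auto)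
  qed
 qed (use dle in auto)
 also have "\<dots> = (\<Sum>i\<le>d. int (bidegree i (m - i) W))"
 proof (rule sum.cong[OF refl])
  fix i assume i: "i \<in> {..d}"
  have len: "length (replicate i True @ replicate (m - i) False) = m" using i dle by simp
  show "coef (replicate i True @ replicate (m - i) False) Hilb = int (bidegree i (m - i) W)"
   using L[of "replicate i True @ replicate (m - i) False"] dm unfolding len
   by (simp add: bidegree_def map_replicate_const)
 qed
 finally show ?thesis .
qed

text \<open>The closure of \<open>S\<close> is projected by \<open>(x, y) \<mapsto> x + y\<close>.
  Its leading coefficient is \<open>\<rho>\<close> times that of the image; the image has the data
  locus as closure, and \<open>\<rho>\<close> is the size of a general fibre, which is a fibre of
  the ED correspondence.\<close>

theorem degree_of_sum_map:
 fixes X Z :: "'a pspace set"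
 assumes m: "Suc (Suc m) = Suc d + (CARD('a) - Suc n)"
  and AB: "A = affine_cone X" "B = affine_cone Z"
  and disjoint: "W \<inter> range (%p. (p, p)) = {}"
 shows "int (ED_degree X Z * projective_degree (projectivization (ED_data_locus X Z))) =
  coef (replicate (Suc m) ()) (VV.H (\<I> S))"
proof -
 let ?I = "\<I> S" and ?lam = "%p :: 'a cvec2. fst p + snd p"
 let ?W = "zset ?I"
 have IW: "\<I> ?W = ?I" by (rule zset_vanishing_ideal)
 \<comment> \<open>A nonzero \<open>(x, y)\<close> with \<open>x + y = 0\<close> has both entries
   nonzero and proportional, so its class is a point of \<open>W\<close> on the diagonal.\<close>
 have proper: "p = 0" if p: "p \<in> ?W" "?lam p = 0" for p
 proof (rule ccontr)
  assume ne: "p ~= 0"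
  have y: "snd p = (-1) *s fst p" using p(2) by (simp add: add_eq_0_iff vector_smult_lneg)
  then have x: "fst p ~= 0" using ne by (auto simp: prod_eq_iff)
  then have y0: "snd p ~= 0" using p(2) by auto
  have "p \<in> PP_dom" using x y0 by (cases p) (simp add: PP_dom_def)
  then have "map_prod point point p \<in> W" using p(1) W_facts(2) by blast
  moreover have "point (fst p) = point (snd p)" using point_eq_iff[OF x y0] y by (metis neg_equal_0_iff_equal one_neq_zero)
  ultimately have "(point (fst p), point (fst p)) \<in> W" by (simp add: map_prod_def case_prod_beta)
  then show False using disjoint by blast
 qed
 interpret FP: finite_projection pcoord "%(i::'a) (x :: 'a cvec). x $ i" ?lam ?W
 proof unfold_locales
  fix j :: 'a
  have "pcoord (Inl j) + pcoord (Inr j) \<in> VV.R (VV.eg ())"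
   using VV.X_R[of "Inl j"] VV.X_R[of "Inr j"] by (intro fs.subspace_add[OF VV.subspace_R])
  moreover have "pcoord (Inl j) + pcoord (Inr j) = (%x. ?lam x $ j)" by (rule ext) (simp add: pcoord_simps)
  ultimately show "(%x. ?lam x $ j) \<in> VV.R (VV.eg ())" by (simp only:)
  show "pprime (\<I> ?W)" unfolding IW by (rule S_prime)
  show "VV.stable (\<I> ?W)" unfolding IW by (rule S_stable)
  show "zset (\<I> ?W) = ?W" unfolding IW ..
  fix p and i :: "'a + 'a" assume p: "p \<in> ?W" "!!j. ?lam p $ j = 0"
  then have "p = 0" by (intro proper) (simp_all add: vec_eq_iff)
  then show "pcoord i p = 0" by (cases i) (simp_all add: pcoord_simps)
 qed
 let ?PB = "\<I> (?lam ` ?W)"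
 have dS: "dg (Suc (Suc m)) (VV.H (\<I> ?W))" unfolding IW m by (rule S_dim(1))
 obtain \<rho> \<Theta> where \<rho>: "dg (Suc (Suc m)) (V.H ?PB)"
  "!!ks. length ks = Suc m ==> coef ks (VV.H (\<I> ?W)) = int \<rho> * coef ks (V.H ?PB)"
  and \<Theta>: "pol \<Theta>" "\<Theta> ~: ?PB"
  "!!u. u \<in> zset ?PB ==> \<Theta> u ~= 0 ==> finite {p\<in>?W. ?lam p = u} & card {p\<in>?W. ?lam p = u} = \<rho>"
  by (rule FP.finite_projection[OF dS]) blast
 have coefS: "coef ks (VV.H ?I) = int \<rho> * coef ks (V.H ?PB)" if "length ks = Suc m" for ks
  using \<rho>(2)[OF that] unfolding IW .
 \<comment> \<open>\<open>?\<sigma>\<close> and \<open>?\<tau>\<close> are mutually inverse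
   polynomial maps, so they carry the closure of \<open>S\<close> onto the closure that defines the
   ED correspondence.\<close>
 let ?\<sigma> = "%p :: 'a cvec2. (fst p, ?lam p)"
 let ?\<tau> = "%p :: 'a cvec2. (fst p, snd p - fst p)"
 have coordp: "pol (%p :: 'a cvec2. fst p $ i)" "pol (%p :: 'a cvec2. snd p $ i)" for i :: 'a
  using VV.pol_X[of "Inl i :: 'a + 'a"] VV.pol_X[of "Inr i :: 'a + 'a"] by (simp_all only: pcoord_simps)
 have p\<sigma>: "pol (%p. f (?\<sigma> p))" if "pol f" for f
  by (rule VV_pol_comp[OF _ _ that]) (use coordp polynomial_fun.add[OF coordp] in simp_all)
 have p\<tau>: "pol (%p. f (?\<tau> p))" if "pol f" for f
 proof (rule VV_pol_comp[OF _ _ that])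
  fix i
  show "pol (%p. fst (?\<tau> p) $ i)" using coordp by simp
  have "pol ((%p :: 'a cvec2. snd p $ i) - (%p. fst p $ i))" by (intro pol_diff coordp)
  then show "pol (%p. snd (?\<tau> p) $ i)" by (simp add: fun_diff_def)
 qed
 have corr: "(x, u) \<in> ED_corr X Z \<longleftrightarrow> (x, u - x) \<in> ?W" for x u
 proof -
  have "{(x, u). x \<in> smooth_locus (affine_cone X) \<inter> affine_cone Z & u - x \<in> normal_space (affine_cone X) x} = ?\<sigma> ` S"
   unfolding AB[symmetric]
  proof (rule Set.set_eqI, clarify)
   fix x u
   have "(x, u) \<in> ?\<sigma> ` S \<longleftrightarrow> (x, u - x) \<in> S"
   proof
    assume "(x, u - x) \<in> S"
    then show "(x, u) \<in> ?\<sigma> ` S" by (intro image_eqI[of _ _ "(x, u - x)"]) simp_all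
   qed auto
   then show "(x, u) \<in> {(x, u). x \<in> smooth_locus A \<inter> B & u - x \<in> normal_space A x} \<longleftrightarrow> (x, u) \<in> ?\<sigma> ` S"
    by (simp add: S_def)
  qed
  then have E: "ED_corr X Z = zset (\<I> (?\<sigma> ` S))" unfolding ED_corr_def zariski_closure by (simp only:)
  show ?thesis
  proof
   assume a: "(x, u) \<in> ED_corr X Z"
   have "f (x, u - x) = 0" if f: "f \<in> ?I" for f
   proof -
    have "pol f" using f by (simp add: vanishing_ideal_def)
    then have "(%p. f (?\<tau> p)) \<in> \<I> (?\<sigma> ` S)"
     using p\<tau>[of f] vanD[OF f] by (auto simp: vanishing_ideal_def)
    then show ?thesis using a unfolding E zset_def by fastforce
   qed
   then show "(x, u - x) \<in> ?W" by (simp add: zset_def)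
  next
   assume a: "(x, u - x) \<in> ?W"
   have "f (x, u) = 0" if f: "f \<in> \<I> (?\<sigma> ` S)" for f
   proof -
    have "pol f" using f by (simp add: vanishing_ideal_def)
    then have "(%p. f (?\<sigma> p)) \<in> ?I"
     using p\<sigma>[of f] vanD[OF f] by (auto simp: vanishing_ideal_def)
    then show ?thesis using a unfolding zset_def by fastforce
   qed
   then show "(x, u) \<in> ED_corr X Z" unfolding E by (simp add: zset_def)
  qed
 qed
 have "snd ` ED_corr X Z = ?lam ` ?W"
 proof
  show "snd ` ED_corr X Z \<subseteq> ?lam ` ?W"
  proof
   fix u assume "u \<in> snd ` ED_corr X Z"
   then obtain x where "(x, u) \<in> ED_corr X Z" by force
   then have "(x, u - x) \<in> ?W" unfolding corr .
   then show "u \<in> ?lam ` ?W" by (intro image_eqI[of _ _ "(x, u - x)"]) simp_all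
  qed
  show "?lam ` ?W \<subseteq> snd ` ED_corr X Z"
  proof
   fix u assume "u \<in> ?lam ` ?W"
   then obtain x y where "(x, y) \<in> ?W" "u = x + y" by force
   then have "(x, u) \<in> ED_corr X Z" unfolding corr by simp
   then show "u \<in> snd ` ED_corr X Z" by force
  qed
 qed
 then have DL: "ED_data_locus X Z = zset ?PB" unfolding ED_data_locus_def zariski_closure by (simp only:)
 have IDL: "\<I> (ED_data_locus X Z) = ?PB" unfolding DL by (rule zset_vanishing_ideal)
 have ED: "ED_degree X Z = \<rho>"
 proof (rule ED_degree_eqI[OF _ \<Theta>(1)])
  show "\<Theta> ~: \<I> (ED_data_locus X Z)" "pprime (\<I> (ED_data_locus X Z))"
   unfolding IDL using \<Theta>(2) FP.PB_prime by blast+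
  fix u assume u: "u \<in> ED_data_locus X Z" "\<Theta> u ~= 0"
  have bij: "bij_betw fst {p\<in>?W. ?lam p = u} {x. (x, u) \<in> ED_corr X Z}"
   by (rule bij_betw_byWitness[where f' = "%x. (x, u - x)"]) (auto simp: corr)
  show "finite {x. (x, u) \<in> ED_corr X Z} & card {x. (x, u) \<in> ED_corr X Z} = \<rho>"
   using \<Theta>(3)[OF u[unfolded DL]] bij_betw_finite[OF bij] bij_betw_same_card[OF bij] by simp
 qed
 \<comment> \<open>The image has the full dimension of \<open>S\<close>: otherwise all leading
   coefficients of \<open>S\<close>, being multiples of those of the image, would vanish, against
   \<open>S_dim\<close>. The exact dimension is required because \<open>projective_degree\<close>
   cuts by \<open>krull_dim\<close> many hyperplanes.\<close>
 have notdg: "\<not> dg (Suc m) (V.H ?PB)"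
 proof
  assume d: "dg (Suc m) (V.H ?PB)"
  have "coef ks (VV.H ?I) = 0" if "length ks = Suc m" for ks
   using coefS[OF that] coef_0[of ks "V.H ?PB"] d that by simp
  then have "dg (Suc m) (VV.H ?I)" using dg_coef_0[of "Suc m" "VV.H ?I"] S_dim(1) unfolding m by blast
  from S_dim(2)[OF this] show False unfolding m[symmetric] by simp
 qed
 have rel: "V.relevant ?PB" unfolding V.relevant_def
 proof
  fix k :: unit
  obtain i where "pcoord (Inl i) ~: ?I" using coord_not_vanishing by blast
  then obtain p where p: "p \<in> S" "fst p $ i ~= 0" using VV.pol_X[of "Inl i"] by (auto simp: vanishing_ideal_def pcoord_simps)
  have pW: "p \<in> ?W" using p(1) subset_zset_vanishing by blast
  have "p ~= 0" using p(2) by auto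
  then have "?lam p ~= 0" using proper[OF pW] by blast
  then obtain j where "?lam p $ j ~= 0" by (auto simp: vec_eq_iff)
  then have "(%x. x $ j) ~: ?PB" using pW by (auto simp: vanishing_ideal_def)
  then show "\<exists>j. () = k & (%x. x $ j) ~: ?PB" by auto
 qed
 have "int (projective_degree (projectivization (ED_data_locus X Z))) = coef (replicate (Suc m) ()) (V.H ?PB)"
  unfolding DL by (rule projective_degree_cone[OF FP.T_hideal FP.PB_prime rel \<rho>(1) notdg])
 then show ?thesis unfolding ED using coefS[of "replicate (Suc m) ()"] by simp
qed

end

theorem theorem1p5:
 fixes X Z :: "'n::finite pspace set" and N n d :: nat
 assumes "CARD('n) = N + 1"
  and "projective_variety X" and "krull_dim zariski_P X = enat n" and "n < N"
  and "projective_variety Z" and "Z \<subseteq> X" and "krull_dim zariski_P Z = enat d"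
  and "ED_regular X Z"
  and "conormal X Z \<inter> range (\<lambda>p. (p, p)) = {}"
 shows "ED_degree X Z * projective_degree (projectivization (ED_data_locus X Z)) =
  (\<Sum>i=0..d. relative_polar_degree i X Z)"
proof -
 have X: "closedin zariski_P X" "irreducible_in zariski_P X" and Z: "closedin zariski_P Z" "irreducible_in zariski_P Z"
  using assms(2,5) by (simp_all add: projective_variety_def)
 have ne: "X ~= {}" "Z ~= {}" using X(2) Z(2) unfolding irreducible_in_def by blast+
 note vX = vanishing_ideal_cone[OF ne(1)] and vZ = vanishing_ideal_cone[OF ne(2)]
 \<comment> \<open>ED regularity provides a smooth point of the cone over \<open>X\<close> that lies
   over \<open>Z\<close>; being non-isotropic, it is not the origin.\<close>
 obtain z where z: "z \<in> affine_cone Z" "z ~: singular_locus (affine_cone X)" "quadric_form z ~= 0"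
  using assms(8) unfolding ED_regular_def by blast
 have sub: "affine_cone Z \<subseteq> affine_cone X" using assms(6) cone_subset_iff by blast
 have z': "z \<in> smooth_locus (affine_cone X)" using z(1,2) sub unfolding singular_locus_def by blast
 have z0: "z ~= 0" using z(3) by (auto simp: quadric_form_def bilin_linear)
 interpret ED_conormal "affine_cone X" "affine_cone Z" n d
 proof unfold_locales
  show "pprime (\<I> (affine_cone X))" by (rule irreducible_cone(1)[OF X])
  show "pprime (\<I> (affine_cone Z))" by (rule irreducible_cone(1)[OF Z])
  show "V.stable (\<I> (affine_cone X))" "V.stable (\<I> (affine_cone Z))"
   unfolding vX vZ by (rule V.hidealD(2)[OF P.hideal_IW])+
  show "krull_dim zariski (affine_cone X) = enat (Suc n)" by (rule krull_dim_affine_cone[OF X assms(3)])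
  show "dg (Suc d) (V.H (\<I> (affine_cone Z)))" unfolding vZ by (rule P.dim_iff(1)[OF Z assms(7)])
  show "smooth_locus (affine_cone X) \<inter> affine_cone Z ~= {}" using z(1) z' by blast
  show "\<exists>x\<in>smooth_locus (affine_cone X) \<inter> affine_cone Z. x ~= 0" using z(1) z' z0 by blast
  show "Suc n < CARD('n)" using assms(1,4) by simp
  fix x :: "'n cvec" and a :: complex assume "x \<in> affine_cone Z" "a ~= 0"
  then show "a *s x \<in> affine_cone Z" using point_eq_iff[of x "a *s x"] by (auto simp: affine_cone_def)
 qed (use cone_chain[OF X assms(3)] cone_chain[OF Z assms(7)] sub in blast)+
 have con: "conormal X Z = W"
 proof -
  have "{(point x, point y) | x y. x \<in> (smooth_locus (affine_cone X) \<inter> affine_cone Z) - {0} &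
    y \<in> normal_space (affine_cone X) x - {0}} = map_prod point point ` (S \<inter> PP_dom)"
   by (force simp: S_def PP_dom_def)
  then show ?thesis unfolding conormal_def by (rule arg_cong)
 qed
 \<comment> \<open>The dimension of the conormal variety; the subtraction is exact because
   \<open>n < N\<close>.\<close>
 let ?m = "N - 1 - n + d"
 have m: "Suc (Suc ?m) = Suc d + (CARD('n) - Suc n)" using assms(1,4) by simp
 have "int (ED_degree X Z * projective_degree (projectivization (ED_data_locus X Z))) =
   (\<Sum>i\<le>d. int (bidegree i (?m - i) W))"
  unfolding degree_of_sum_map[OF m refl refl assms(9)[unfolded con]] by (rule multidegrees[OF m])
 also have "\<dots> = int (\<Sum>i=0..d. relative_polar_degree i X Z)"
  unfolding relative_polar_degree_def con using assms(1,3,7) by (simp add: atLeast0AtMost)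
 finally show ?thesis by (simp only: of_nat_eq_iff)
qed

end
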